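(* Let $m,Q\ge1$ be integers, $U\subset\mathbb R^m$ open, and let $f\in W^1_2(U,\mathcal Q_Q(\ell_2))$ be squeeze and squash stationary. Then: (1) for every $a\in U$, $$\lim_{r\to0}\frac1{r^{m-2}}\int_{B(a,r)}|Df|^2=0;$$ (2) in case $U=B(0,1)$, $f$ is VMO in the following sense: there is a function $\omega:[0,\tfrac12]\to[0,\infty)$ with $\lim_{r\to0}\omega(r)=0$ such that for every $a\in B(0,\tfrac12)$ and every $r\in(0,\tfrac12]$, $$\frac1{\mathcal L^m(B(a,r))}\int_{B(a,r)}\mathcal G^2(f,\overline f_{a,r})\le\omega(r),$$ where $\overline f_{a,r}\in\mathcal Q_Q(\ell_2)$ is a mean of $f$ in $B(a,r)$.
   Context: $\ell_2$ is the separable infinite-dimensional Hilbert space. $\mathcal Q_Q(\ell_2)$ is the space of unordered $Q$-tuples $u=\oplus_{i=1}^Q[[u_i]]$ of elements of $\ell_2$, with metric $\mathcal G(u,v)=\min_{\sigma\in S_Q}\big(\sum_i\|u_i-v_{\sigma(i)}\|^2\big)^{1/2}$, and $|u|=\mathcal G(u,Q[[0]])$. $W^1_2(U,\mathcal Q_Q(\ell_2))$ is the set of measurable $f:U\to\mathcal Q_Q(\ell_2)$ with $\int_U|f|^2<\infty$ for which there is $g\in L^2(U)$ such that for every $T$ the function $\mathcal G(f(\cdot),T)$ is weakly differentiable with $|\nabla\mathcal G(f,T)|\le g$ a.e. Such $f$ is approximately differentiable a.e.: for a.e. $a$, writing $f(a)=\oplus_i[[f_i(a)]]$, there are linear maps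 $Df_i(a):\mathbb R^m\to\ell_2$, with $Df_i(a)=Df_j(a)$ if $f_i(a)=f_j(a)$, such that the approximate limit as $x\to a$ of $\mathcal G\big(f(x),\oplus_i[[f_i(a)+Df_i(a)(x-a)]]\big)/\|x-a\|$ is $0$. Put $Df=\oplus_i[[Df_i]]$ and $|Df|=\big(\sum_i\|Df_i\|_{HS}^2\big)^{1/2}$ (Hilbert–Schmidt norms). $f$ is squeeze stationary in $U$ if for every $X\in C^\infty_c(U,\mathbb R^m)$, with $\Phi_t(x)=x+tX(x)$ (a diffeomorphism of $U$ for small $|t|$), one has $\frac{d}{dt}\big|_{t=0}\int_U|D(f\circ\Phi_t)|^2=0$. $f$ is squash stationary in $U$ if for every $C^1$ map $Y:U\times\ell_2\to\ell_2$ such that $\{x\in U:Y(x,\cdot)\ne0\}$ is relatively compact in $U$, one has $\frac{d}{dt}\big|_{t=0}\int_U|D(Y\Box f)_t|^2=0$, where $(Y\Box f)_t(x)=\oplus_{i=1}^Q[[f_i(x)+tY(x,f_i(x))]]$. A mean of $f$ in a ball $B(a,r)$ is a point $P\in\mathcal Q_Q(\ell_2)$ for which the Poincaré inequality $\int_{B(a,r)}\mathcal G(f,P)^2\le C_P\,r^2\int_{B(a,r)}|Df|^2$ holds, where $C_P=C_P(m,Q)$ is a fixed constant for which such points always exist. *)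

theory Defs
  imports "HOL-Analysis.Analysis" "HOL-Combinatorics.Permutations"
begin

section \<open>Unordered \<open>Q\<close>-tuples\<close>

definition QQ :: "nat \<Rightarrow> 'h multiset set" where
  "QQ Q = {u. size u = Q}"

text \<open>
  The minimum also ranges over all enumerations of the two multisets, so that no enumeration has
  to be chosen. It is taken over a finite nonempty set, and is meaningful when
  \<open>size u = size v\<close>.
\<close>

definition Gdist :: "'h::real_normed_vector multiset \<Rightarrow> 'h multiset \<Rightarrow> real" where
  "Gdist u v = Min {sqrt (\<Sum>i<size u. (norm (xs ! i - ys ! \<sigma> i))\<^sup>2) | xs ys \<sigma>.
     mset xs = u \<and> mset ys = v \<and> \<sigma> permutes {..<size u}}"

section \<open>Smooth functions and weak gradients\<close>

fun Ck_on :: "nat \<Rightarrow> 'a::real_normed_vector set \<Rightarrow> ('a \<Rightarrow> 'b::real_normed_vector) \<Rightarrow> bool" where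
  "Ck_on 0 S \<phi> \<longleftrightarrow> continuous_on S \<phi>"
| "Ck_on (Suc k) S \<phi> \<longleftrightarrow> (\<forall>x\<in>S. \<phi> differentiable (at x)) \<and>
     (\<forall>v. Ck_on k S (\<lambda>x. frechet_derivative \<phi> (at x) v))"

text \<open>
  Compactly supported smooth functions on \<open>U\<close> are represented by their extension by zero.
\<close>

definition test_functions ::
    "(real ^ 'm) set \<Rightarrow> (real ^ 'm \<Rightarrow> 'b::real_normed_vector) set" where
  "test_functions U = {\<phi>. (\<forall>k. Ck_on k UNIV \<phi>) \<and>
     compact (closure {x. \<phi> x \<noteq> 0}) \<and> closure {x. \<phi> x \<noteq> 0} \<subseteq> U}"

definition locally_integrable ::
    "(real ^ 'm) set \<Rightarrow> (real ^ 'm \<Rightarrow> 'b::{banach, second_countable_topology}) \<Rightarrow> bool" where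
  "locally_integrable U h \<longleftrightarrow> (\<forall>K. compact K \<and> K \<subseteq> U \<longrightarrow> set_integrable lebesgue K h)"

definition has_weak_gradient ::
    "(real ^ 'm) set \<Rightarrow> (real ^ 'm \<Rightarrow> real) \<Rightarrow> (real ^ 'm \<Rightarrow> real ^ 'm) \<Rightarrow> bool" where
  "has_weak_gradient U h w \<longleftrightarrow> locally_integrable U h \<and> locally_integrable U w \<and>
     (\<forall>\<phi>\<in>test_functions U. \<forall>i.
        (LINT x:U|lebesgue. h x * frechet_derivative \<phi> (at x) (axis i 1)) =
        - (LINT x:U|lebesgue. w x $ i * \<phi> x))"

section \<open>The Sobolev space\<close>

definition W12 :: "(real ^ 'm) set \<Rightarrow> nat \<Rightarrow> (real ^ 'm \<Rightarrow> 'h::real_normed_vector multiset) set" where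
  "W12 U Q = {f.
     f \<in> measurable (lebesgue_on U) (sigma (QQ Q) {V. Metric_space.mopen (QQ Q) Gdist V}) \<and>
     set_integrable lebesgue U (\<lambda>x. (Gdist (f x) (replicate_mset Q 0))\<^sup>2) \<and>
     (\<exists>g :: real ^ 'm \<Rightarrow> real.
        set_borel_measurable lebesgue U g \<and> set_integrable lebesgue U (\<lambda>x. (g x)\<^sup>2) \<and>
        (\<forall>T\<in>QQ Q. \<exists>w. has_weak_gradient U (\<lambda>x. Gdist (f x) T) w \<and>
           (AE x in lebesgue_on U. norm (w x) \<le> g x)))}"

section \<open>Approximate differentials\<close>

text \<open>
  Approximate limits are defined through the outer measure, so that the exceptional sets need not
  be assumed measurable.
\<close>

definition ap_lim :: "(real ^ 'm \<Rightarrow> real) \<Rightarrow> real ^ 'm \<Rightarrow> real \<Rightarrow> bool" where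
  "ap_lim h a l \<longleftrightarrow> (\<forall>\<epsilon>>0.
     ((\<lambda>r. outer_measure_of lebesgue {x \<in> ball a r. \<epsilon> \<le> \<bar>h x - l\<bar>} / emeasure lebesgue (ball a r))
        \<longlongrightarrow> 0) (at_right 0))"

text \<open>
  A member \<open>(v, L)\<close> of the multiset \<open>M\<close> is a pair \<open>(f\<^sub>i(a), Df\<^sub>i(a))\<close>. Such an \<open>M\<close> is unique when it
  exists, so the definite description below is legitimate; where none exists (a null set, for
  Sobolev maps) its value is unspecified.
\<close>

definition has_ap_differential ::
    "(real ^ 'm \<Rightarrow> 'h::real_normed_vector multiset) \<Rightarrow> real ^ 'm \<Rightarrow>
     ('h \<times> ((real ^ 'm) \<Rightarrow>\<^sub>L 'h)) multiset \<Rightarrow> bool" where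
  "has_ap_differential f a M \<longleftrightarrow>
     image_mset fst M = f a \<and>
     (\<forall>p\<in>#M. \<forall>q\<in>#M. fst p = fst q \<longrightarrow> snd p = snd q) \<and>
     ap_lim (\<lambda>x. Gdist (f x) (image_mset (\<lambda>(v, L). v + blinfun_apply L (x - a)) M) / norm (x - a)) a 0"

definition ap_differential ::
    "(real ^ 'm \<Rightarrow> 'h::real_normed_vector multiset) \<Rightarrow> real ^ 'm \<Rightarrow>
     ('h \<times> ((real ^ 'm) \<Rightarrow>\<^sub>L 'h)) multiset" where
  "ap_differential f a = (THE M. has_ap_differential f a M)"

definition HS_norm :: "((real ^ 'm) \<Rightarrow>\<^sub>L 'h::real_normed_vector) \<Rightarrow> real" where
  "HS_norm L = sqrt (\<Sum>i\<in>UNIV. (norm (blinfun_apply L (axis i 1)))\<^sup>2)"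

definition norm_D :: "(real ^ 'm \<Rightarrow> 'h::real_normed_vector multiset) \<Rightarrow> real ^ 'm \<Rightarrow> real" where
  "norm_D f a = sqrt (\<Sum>(v, L)\<in>#ap_differential f a. (HS_norm L)\<^sup>2)"

definition energy :: "(real ^ 'm) set \<Rightarrow> (real ^ 'm \<Rightarrow> 'h::real_normed_vector multiset) \<Rightarrow> real" where
  "energy U f = (LINT x:U|lebesgue. (norm_D f x)\<^sup>2)"

section \<open>Stationarity\<close>

text \<open>
  Finiteness of the energies for small parameters is part of the requirement that the derivative
  at \<open>0\<close> exists; it must be stated separately because a divergent integral has value \<open>0\<close> in HOL.
\<close>

definition critical_family ::
    "(real ^ 'm) set \<Rightarrow> (real \<Rightarrow> real ^ 'm \<Rightarrow> 'h::real_normed_vector multiset) \<Rightarrow> bool" where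
  "critical_family U F \<longleftrightarrow>
     (\<forall>\<^sub>F t in nhds 0. set_integrable lebesgue U (\<lambda>x. (norm_D (F t) x)\<^sup>2)) \<and>
     ((\<lambda>t. energy U (F t)) has_real_derivative 0) (at 0)"

definition squeeze_stationary ::
    "(real ^ 'm) set \<Rightarrow> (real ^ 'm \<Rightarrow> 'h::real_normed_vector multiset) \<Rightarrow> bool" where
  "squeeze_stationary U f \<longleftrightarrow>
     (\<forall>X :: real ^ 'm \<Rightarrow> real ^ 'm. X \<in> test_functions U \<longrightarrow>
        critical_family U (\<lambda>t x. f (x + t *\<^sub>R X x)))"

definition C1_on ::
    "'a::real_normed_vector set \<Rightarrow> ('a \<Rightarrow> 'b::real_normed_vector) \<Rightarrow> bool" where
  "C1_on S Y \<longleftrightarrow> (\<exists>Y' :: 'a \<Rightarrow> ('a \<Rightarrow>\<^sub>L 'b).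
     (\<forall>z\<in>S. (Y has_derivative blinfun_apply (Y' z)) (at z)) \<and> continuous_on S Y')"

definition squash_stationary ::
    "(real ^ 'm) set \<Rightarrow> (real ^ 'm \<Rightarrow> 'h::real_normed_vector multiset) \<Rightarrow> bool" where
  "squash_stationary U f \<longleftrightarrow>
     (\<forall>Y :: (real ^ 'm) \<times> 'h \<Rightarrow> 'h.
        C1_on (U \<times> UNIV) Y \<and>
        compact (closure {x \<in> U. \<exists>y. Y (x, y) \<noteq> 0}) \<and>
        closure {x \<in> U. \<exists>y. Y (x, y) \<noteq> 0} \<subseteq> U \<longrightarrow>
        critical_family U (\<lambda>t x. image_mset (\<lambda>y. y + t *\<^sub>R Y (x, y)) (f x)))"

section \<open>Means\<close>

definition is_mean ::
    "real \<Rightarrow> nat \<Rightarrow> (real ^ 'm \<Rightarrow> 'h::real_normed_vector multiset) \<Rightarrow> real ^ 'm \<Rightarrow> real \<Rightarrow>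
     'h multiset \<Rightarrow> bool" where
  "is_mean C Q f a r P \<longleftrightarrow> P \<in> QQ Q \<and>
     (LINT x:ball a r|lebesgue. (Gdist (f x) P)\<^sup>2) \<le> C * r\<^sup>2 * energy (ball a r) f"

text \<open>
  \<open>C\<close> is an admissible value of \<open>C\<^sub>P(m, Q)\<close>. The first argument only fixes the dimension and the
  Hilbert space.
\<close>

definition poincare_constant ::
    "(real ^ 'm \<Rightarrow> 'h::real_normed_vector multiset) itself \<Rightarrow> nat \<Rightarrow> real \<Rightarrow> bool" where
  "poincare_constant _ Q C \<longleftrightarrow>
     (\<forall>(a :: real ^ 'm) r (h :: real ^ 'm \<Rightarrow> 'h multiset).
        0 < r \<and> h \<in> W12 (ball a r) Q \<longrightarrow> (\<exists>P. is_mean C Q h a r P))"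

end

theory Submission
  imports Defs
begin

text \<open>
  Let \<open>u = Gdist f 0\<close> and \<open>m\<close> the dimension. Scaling the values of \<open>f\<close> by \<open>1 + t \<phi>\<close>, a squash
  variation, gives the weak identity \<open>\<Delta> u\<^sup>2 = 2 |Df|\<^sup>2\<close>. Hence the average \<open>A r\<close> of \<open>u\<^sup>2\<close> against a
  smooth radial bump of radius \<open>r\<close> around a point is nondecreasing in \<open>r\<close>, with derivative
  \<open>r / r ^ m\<close> times a smoothed energy. Since \<open>A\<close> is bounded below, \<open>A (2 * r) - A r\<close> tends to 0, which
  is the first claim. The squeeze variation along a radial field makes the scaled smoothed energy monotone in
  \<open>r\<close>. It is also continuous in the centre, so that by Dini's argument it tends to 0 uniformly on
  compact sets, and the defining inequality of a mean yields the second claim.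

  The first variations can be computed because \<open>f\<close> is approximately differentiable almost everywhere.
  At a Lebesgue point of the countably many weak gradients of \<open>Gdist f T\<close>, \<open>T\<close> in a dense set, these
  functions have approximate differentials; near the tuple \<open>f a\<close> they determine the inner products of
  the increments of the branches of \<open>f\<close> with every direction, so that the branches expand weakly,
  and the bound on the norms makes the expansion strong.
\<close>

section \<open>Approximate limits as a filter\<close>

text \<open>\<open>norm_D\<close> is given by a definite description, with no measurability and no
  formula attached. Each varied energy is therefore computed by exhibiting an approximate
  differential of the varied map almost everywhere and using its uniqueness; integrability of the
  density itself comes from stationarity with the zero field. Two obstacles shape the
  differentiability proof. Branches that agree at \<open>a\<close> might separate nearby; this is
  excluded at density points of the sets where the number of distinct values is constant. And the
  increment has to be bounded uniformly over all \<open>T\<close>, while a Lebesgue point of one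
  gradient says nothing about the others; hence Lebesgue points are also taken for the suprema of
  all gradients in fixed directions. The squeeze variation enters as an inequality only: a radial
  stretch multiplies \<open>|Df|\<^sup>2\<close> by at most
  \<open>(1 + t * bump a r x)\<^sup>2\<close>, and comparing energies for \<open>t > 0\<close> is
  enough for monotonicity. The profile \<open>exp (- 1 / s)\<close> is used because its quotients by
  powers of \<open>s\<close> are closed under differentiation up to linear combinations.\<close>

lemma outer_measure_of_Un_le:
  assumes "A \<subseteq> space M" "B \<subseteq> space M"
  shows "outer_measure_of M (A \<union> B) \<le> outer_measure_of M A + outer_measure_of M B"
proof -
  obtain E where E: "E \<in> sets M" "A \<subseteq> E" "outer_measure_of M A = emeasure M E"
    using outer_measure_of_attain[OF assms(1)] by blast
  obtain F where F: "F \<in> sets M" "B \<subseteq> F" "outer_measure_of M B = emeasure M F"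
    using outer_measure_of_attain[OF assms(2)] by blast
  have "outer_measure_of M (A \<union> B) \<le> outer_measure_of M (E \<union> F)"
    using E F by (intro outer_measure_of_mono) auto
  also have "\<dots> = emeasure M (E \<union> F)"
    using E F by (simp add: outer_measure_of_eq)
  also have "\<dots> \<le> emeasure M E + emeasure M F"
    using E F by (intro emeasure_subadditive) auto
  finally show ?thesis using E F by simp
qed

lemma emeasure_lebesgue_ball_pos:
  fixes a :: "'a::euclidean_space"
  assumes "0 < r"
  shows "0 < emeasure lebesgue (ball a r)" "emeasure lebesgue (ball a r) < \<infinity>"
proof -
  have "emeasure lborel (ball a r) \<noteq> 0"
    using assms emeasure_lborel_ball_finite[of a r]
    by (metis content_ball_pos measure_def enn2real_0 less_irrefl)
  then show "0 < emeasure lebesgue (ball a r)" by (simp add: zero_less_iff_neq_zero)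
  show "emeasure lebesgue (ball a r) < \<infinity>"
    using emeasure_lborel_ball_finite[of a r] by simp
qed

lemma emeasure_lebesgue_ball_scale:
  fixes a b :: "'a::euclidean_space"
  assumes "0 \<le> r" "0 \<le> c"
  shows "emeasure lebesgue (ball b (c * r)) = ennreal (c ^ DIM('a)) * emeasure lebesgue (ball a r)"
  using assms by (simp add: emeasure_ball power_mult_distrib ennreal_mult' ennreal_mult'' ac_simps)

text \<open>The filter of sets of full density at \<open>a\<close>. Outer measure makes it a filter
  on arbitrary sets, so approximate statements can be combined like any other eventual
  statements.\<close>

definition ap_at :: "'a::euclidean_space \<Rightarrow> 'a filter" where
  "ap_at a = Abs_filter (\<lambda>P. ((\<lambda>r. outer_measure_of lebesgue {x \<in> ball a r. \<not> P x} /
      emeasure lebesgue (ball a r)) \<longlongrightarrow> 0) (at_right 0))"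

lemma tendsto_0_ennrealI:
  fixes f :: "'a \<Rightarrow> ennreal"
  assumes "(g \<longlongrightarrow> 0) F" "\<forall>\<^sub>F x in F. f x \<le> g x"
  shows "(f \<longlongrightarrow> 0) F"
  by (rule tendsto_sandwich[of "\<lambda>_. 0", OF _ assms(2) _ assms(1)]) auto

lemma eventually_ap_at:
  "eventually P (ap_at a) \<longleftrightarrow> ((\<lambda>r. outer_measure_of lebesgue {x \<in> ball a r. \<not> P x} /
      emeasure lebesgue (ball a r)) \<longlongrightarrow> 0) (at_right 0)"
  unfolding ap_at_def
proof (rule eventually_Abs_filter, rule is_filter.intro)
  show "((\<lambda>r. outer_measure_of lebesgue {x \<in> ball a r. \<not> True} /
      emeasure lebesgue (ball a r)) \<longlongrightarrow> 0) (at_right 0)"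
    by simp
next
  fix P R :: "'a \<Rightarrow> bool"
  assume P: "((\<lambda>r. outer_measure_of lebesgue {x \<in> ball a r. \<not> P x} /
      emeasure lebesgue (ball a r)) \<longlongrightarrow> 0) (at_right 0)"
    and R: "((\<lambda>r. outer_measure_of lebesgue {x \<in> ball a r. \<not> R x} /
      emeasure lebesgue (ball a r)) \<longlongrightarrow> 0) (at_right 0)"
  have "outer_measure_of lebesgue {x \<in> ball a r. \<not> (P x \<and> R x)} / emeasure lebesgue (ball a r)
    \<le> outer_measure_of lebesgue {x \<in> ball a r. \<not> P x} / emeasure lebesgue (ball a r)
      + outer_measure_of lebesgue {x \<in> ball a r. \<not> R x} / emeasure lebesgue (ball a r)" for r
  proof -
    have "{x \<in> ball a r. \<not> (P x \<and> R x)} = {x \<in> ball a r. \<not> P x} \<union> {x \<in> ball a r. \<not> R x}"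
      by auto
    then show ?thesis
      using outer_measure_of_Un_le[of "{x \<in> ball a r. \<not> P x}" lebesgue "{x \<in> ball a r. \<not> R x}"]
      by (simp add: add_divide_distrib_ennreal[symmetric] divide_right_mono_ennreal)
  qed
  then show "((\<lambda>r. outer_measure_of lebesgue {x \<in> ball a r. \<not> (P x \<and> R x)} /
      emeasure lebesgue (ball a r)) \<longlongrightarrow> 0) (at_right 0)"
    by (intro tendsto_0_ennrealI[OF tendsto_add_zero[OF P R]]) simp
next
  fix P R :: "'a \<Rightarrow> bool"
  assume imp: "\<forall>x. P x \<longrightarrow> R x"
    and P: "((\<lambda>r. outer_measure_of lebesgue {x \<in> ball a r. \<not> P x} /
      emeasure lebesgue (ball a r)) \<longlongrightarrow> 0) (at_right 0)"
  show "((\<lambda>r. outer_measure_of lebesgue {x \<in> ball a r. \<not> R x} /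
      emeasure lebesgue (ball a r)) \<longlongrightarrow> 0) (at_right 0)"
    using imp
    by (intro tendsto_0_ennrealI[OF P] always_eventually allI divide_right_mono_ennreal
        outer_measure_of_mono) auto
qed

lemma ap_lim_iff: "ap_lim h a l \<longleftrightarrow> (h \<longlongrightarrow> l) (ap_at a)"
  by (simp add: ap_lim_def tendsto_iff eventually_ap_at dist_real_def not_less)

text \<open>Covering the exceptional points by a measurable set of small relative measure is the
  form in which Chebyshev and Fubini arguments deliver full density.\<close>

lemma eventually_ap_atI:
  assumes "\<And>\<epsilon>. 0 < \<epsilon> \<Longrightarrow> \<forall>\<^sub>F r in at_right 0. \<exists>E\<in>sets lebesgue. {x \<in> ball a r. \<not> P x} \<subseteq> E \<and>
    emeasure lebesgue E \<le> ennreal \<epsilon> * emeasure lebesgue (ball a r)"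
  shows "eventually P (ap_at a)"
  unfolding eventually_ap_at
proof (rule tendsto_0_ennrealI)
  let ?h = "\<lambda>r. outer_measure_of lebesgue {x \<in> ball a r. \<not> P x} / emeasure lebesgue (ball a r)"
  have "\<forall>\<^sub>F r in at_right 0. ?h r \<le> ennreal \<epsilon>" if "0 < \<epsilon>" for \<epsilon>
    using assms[OF that] eventually_at_right_less[of 0]
  proof eventually_elim
    case (elim r)
    then obtain E where E: "E \<in> sets lebesgue" "{x \<in> ball a r. \<not> P x} \<subseteq> E"
      "emeasure lebesgue E \<le> ennreal \<epsilon> * emeasure lebesgue (ball a r)" by blast
    have "outer_measure_of lebesgue {x \<in> ball a r. \<not> P x} \<le> emeasure lebesgue E"
      using outer_measure_of_mono[OF E(2), of lebesgue] E(1) by simp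
    with E(3) have "outer_measure_of lebesgue {x \<in> ball a r. \<not> P x}
      \<le> ennreal \<epsilon> * emeasure lebesgue (ball a r)" by simp
    then show ?case
      using emeasure_lebesgue_ball_pos[of r a] elim
      by (simp add: divide_le_posI_ennreal mult.commute)
  qed
  then have *: "\<forall>\<^sub>F r in at_right 0. ?h r \<le> ennreal \<epsilon>" if "0 < \<epsilon>" for \<epsilon> using that by blast
  show "(?h \<longlongrightarrow> 0) (at_right 0)"
  proof (rule order_tendstoI)
    fix y :: ennreal assume "0 < y"
    then obtain \<epsilon> where "0 < \<epsilon>" "ennreal \<epsilon> < y"
      by (metis ennreal_less_zero_iff dense ennreal_cases ennreal_less_top order.strict_trans infinity_ennreal_def
          less_top_ennreal)
    with *[of \<epsilon>] show "\<forall>\<^sub>F r in at_right 0. ?h r < y"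
      by (auto elim!: eventually_mono)
  qed simp
qed simp

lemma eventually_ap_atE:
  assumes "eventually P (ap_at a)" "0 < \<epsilon>"
  shows "\<forall>\<^sub>F r in at_right 0. \<exists>E\<in>sets lebesgue. {x \<in> ball a r. \<not> P x} \<subseteq> E \<and>
    emeasure lebesgue E \<le> ennreal \<epsilon> * emeasure lebesgue (ball a r)"
proof -
  have "\<forall>\<^sub>F r in at_right 0. outer_measure_of lebesgue {x \<in> ball a r. \<not> P x} /
      emeasure lebesgue (ball a r) < ennreal \<epsilon>"
    using assms(1)[unfolded eventually_ap_at] by (rule order_tendstoD) (use assms(2) in simp)
  then show ?thesis using eventually_at_right_less[of 0]
  proof eventually_elim
    case (elim r)
    obtain E where E: "E \<in> sets lebesgue" "{x \<in> ball a r. \<not> P x} \<subseteq> E"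
      "outer_measure_of lebesgue {x \<in> ball a r. \<not> P x} = emeasure lebesgue E"
      using outer_measure_of_attain[of "{x \<in> ball a r. \<not> P x}" lebesgue] by auto
    moreover have "emeasure lebesgue E \<le> ennreal \<epsilon> * emeasure lebesgue (ball a r)"
      using elim emeasure_lebesgue_ball_pos[of r a] unfolding E(3)
      by (simp add: divide_less_ennreal less_imp_le)
    ultimately show ?case by blast
  qed
qed

lemma ap_at_le_at: "ap_at a \<le> at a"
proof (rule filter_leI)
  fix P assume "eventually P (at a)"
  then obtain d where d: "0 < d" "\<And>x. x \<noteq> a \<Longrightarrow> dist x a < d \<Longrightarrow> P x"
    unfolding eventually_at by blast
  show "eventually P (ap_at a)"
  proof (rule eventually_ap_atI)
    fix \<epsilon> :: real assume "0 < \<epsilon>"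
    have "\<forall>\<^sub>F r in at_right 0. r < d"
      using d(1) by (rule eventually_at_right_real[THEN eventually_mono]) auto
    then show "\<forall>\<^sub>F r in at_right 0. \<exists>E\<in>sets lebesgue. {x \<in> ball a r. \<not> P x} \<subseteq> E \<and>
      emeasure lebesgue E \<le> ennreal \<epsilon> * emeasure lebesgue (ball a r)"
    proof eventually_elim
      case (elim r)
      have "{x \<in> ball a r. \<not> P x} \<subseteq> {a}"
        using d(2) elim by (force simp: dist_commute)
      then show ?case by (intro bexI[of _ "{a}"]) auto
    qed
  qed
qed

lemma eventually_ap_at_AE:
  fixes a :: "'a::euclidean_space"
  assumes "AE x in lebesgue. x \<in> ball a d \<longrightarrow> P x" "0 < d"
  shows "eventually P (ap_at a)"
proof -
  obtain N where N: "N \<in> null_sets lebesgue" "{x. \<not> (x \<in> ball a d \<longrightarrow> P x)} \<subseteq> N"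
    using assms(1) unfolding eventually_ae_filter by auto
  show ?thesis
  proof (rule eventually_ap_atI)
    fix \<epsilon> :: real assume "0 < \<epsilon>"
    have "\<forall>\<^sub>F r in at_right 0. r < d"
      using assms(2) by (rule eventually_at_right_real[THEN eventually_mono]) auto
    then show "\<forall>\<^sub>F r in at_right 0. \<exists>E\<in>sets lebesgue. {x \<in> ball a r. \<not> P x} \<subseteq> E \<and>
      emeasure lebesgue E \<le> ennreal \<epsilon> * emeasure lebesgue (ball a r)"
    proof eventually_elim
      case (elim r)
      then show ?case using N by (intro bexI[of _ N]) auto
    qed
  qed
qed

text \<open>The ball of radius \<open>\<epsilon> * t\<close> about \<open>a + t *\<^sub>R v\<close>
  fills a fixed proportion of a ball about \<open>a\<close>, so an exceptional set of density 0
  cannot swallow it. This is how an approximate statement about \<open>x - a\<close> reaches every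
  direction \<open>v\<close>.\<close>

lemma ap_at_cone:
  fixes a v :: "'a::euclidean_space"
  assumes "eventually P (ap_at a)" "0 < \<epsilon>"
  shows "\<exists>x t. 0 < t \<and> norm (x - a - t *\<^sub>R v) < \<epsilon> * t \<and> P x"
proof -
  define c where "c = \<epsilon> / (norm v + \<epsilon>)"
  have c: "0 < c" using assms(2) by (auto simp: c_def intro!: divide_pos_pos add_nonneg_pos)
  have "0 < c ^ DIM('a) / 2" using c by simp
  from eventually_conj[OF eventually_ap_atE[OF assms(1) this] eventually_at_right_less[of 0]]
  obtain r where r: "0 < r" and "\<exists>E\<in>sets lebesgue. {x \<in> ball a r. \<not> P x} \<subseteq> E \<and>
      emeasure lebesgue E \<le> ennreal (c ^ DIM('a) / 2) * emeasure lebesgue (ball a r)"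
    using eventually_happens' trivial_limit_at_right_real by (smt (verit))
  then obtain E where E: "E \<in> sets lebesgue" "{x \<in> ball a r. \<not> P x} \<subseteq> E"
    "emeasure lebesgue E \<le> ennreal (c ^ DIM('a) / 2) * emeasure lebesgue (ball a r)" by blast
  \<comment> \<open>With this \<open>t\<close> the small ball just fits into \<open>ball a r\<close>
    and its radius \<open>\<epsilon> * t\<close> equals \<open>c * r\<close>; its share of the
    volume is \<open>c ^ DIM('a)\<close>, twice what \<open>E\<close> may have.\<close>
  define t where "t = r / (norm v + \<epsilon>)"
  have t: "0 < t" using r assms(2) by (auto simp: t_def intro!: divide_pos_pos add_nonneg_pos)
  have rt: "r = t * (norm v + \<epsilon>)" using assms(2) add_nonneg_pos[OF norm_ge_zero[of v] assms(2)] by (simp add: t_def)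
  have ct: "\<epsilon> * t = c * r" by (simp add: c_def t_def)
  have sub: "ball (a + t *\<^sub>R v) (\<epsilon> * t) \<subseteq> ball a r"
  proof
    fix x assume "x \<in> ball (a + t *\<^sub>R v) (\<epsilon> * t)"
    then have "norm (x - a - t *\<^sub>R v) < \<epsilon> * t" by (simp add: dist_norm norm_minus_commute algebra_simps)
    moreover have "norm (x - a) \<le> norm (x - a - t *\<^sub>R v) + norm (t *\<^sub>R v)"
      using norm_triangle_ineq[of "x - a - t *\<^sub>R v" "t *\<^sub>R v"] by simp
    ultimately show "x \<in> ball a r" using t by (simp add: dist_norm norm_minus_commute rt algebra_simps)
  qed
  have "\<not> ball (a + t *\<^sub>R v) (\<epsilon> * t) \<subseteq> E"
  proof
    assume "ball (a + t *\<^sub>R v) (\<epsilon> * t) \<subseteq> E"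
    then have "emeasure lebesgue (ball (a + t *\<^sub>R v) (c * r)) \<le> emeasure lebesgue E"
      using E(1) ct by (intro emeasure_mono) auto
    also note E(3)
    finally have "ennreal (c ^ DIM('a)) * emeasure lebesgue (ball a r)
      \<le> ennreal (c ^ DIM('a) / 2) * emeasure lebesgue (ball a r)"
      using emeasure_lebesgue_ball_scale[of r c "a + t *\<^sub>R v" a] r c by simp
    moreover have "ennreal (c ^ DIM('a) / 2) < ennreal (c ^ DIM('a))"
      using c by (intro ennreal_lessI) auto
    ultimately show False
      using emeasure_lebesgue_ball_pos[OF r, of a]
      by (metis ennreal_mult_strict_right_mono leD infinity_ennreal_def)
  qed
  then obtain x where "x \<in> ball (a + t *\<^sub>R v) (\<epsilon> * t)" "x \<notin> E" by blast
  then have "P x" "norm (x - a - t *\<^sub>R v) < \<epsilon> * t"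
    using sub E(2) by (force simp: dist_norm norm_minus_commute algebra_simps)+
  with t show ?thesis by blast
qed

lemma ap_at_neq_bot: "ap_at (a::'a::euclidean_space) \<noteq> bot"
  using ap_at_cone[of "\<lambda>_. False" a 1 0] by (auto simp: trivial_limit_def)

text \<open>If \<open>F\<close> were positive at \<open>v\<close>, it would be positive on an open
  cone around \<open>v\<close>, and \<open>ap_at_cone\<close> finds a point of the full-density set
  in that cone. Positive homogeneity suffices, so \<open>F\<close> may contain norms.\<close>

lemma homogeneous_ap_at_le_0:
  fixes F :: "'a::euclidean_space \<Rightarrow> real"
  assumes hom: "\<And>t z. 0 < t \<Longrightarrow> F (t *\<^sub>R z) = t * F z" and cont: "isCont F v"
    and ev: "\<forall>\<^sub>F x in ap_at a. F (x - a) \<le> 0"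
  shows "F v \<le> 0"
proof (rule ccontr)
  assume "\<not> F v \<le> 0"
  then have "\<forall>\<^sub>F y in nhds v. 0 < F y"
    using cont by (intro order_tendstoD(1)[of F "F v"]) (auto simp: isCont_def tendsto_at_iff_tendsto_nhds)
  then obtain \<epsilon> where \<epsilon>: "0 < \<epsilon>" "\<And>y. dist y v < \<epsilon> \<Longrightarrow> 0 < F y"
    by (auto simp: eventually_nhds_metric)
  obtain x t where x: "0 < t" "norm (x - a - t *\<^sub>R v) < \<epsilon> * t" "F (x - a) \<le> 0"
    using ap_at_cone[OF ev \<epsilon>(1)] by blast
  define y where "y = (1/t) *\<^sub>R (x - a)"
  have xy: "x - a = t *\<^sub>R y" using x(1) by (simp add: y_def)
  have "x - a - t *\<^sub>R v = t *\<^sub>R (y - v)" by (simp add: xy scaleR_diff_right)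
  then have "t * norm (y - v) < t * \<epsilon>" using x(1,2) by (simp add: mult.commute)
  then have "0 < F y" using x(1) by (intro \<epsilon>(2)) (simp add: dist_norm)
  moreover have "t * F y \<le> 0" using x(3) hom[OF x(1)] by (simp add: xy)
  ultimately show False using x(1) by (simp add: mult_le_0_iff)
qed

lemma linear_bound_ap_at:
  fixes A :: "'a::euclidean_space \<Rightarrow> 'b::real_normed_vector"
  assumes A: "linear A" and bd: "\<forall>\<^sub>F x in ap_at a. norm (A (x - a)) \<le> c * norm (x - a)"
  shows "norm (A v) \<le> c * norm v"
proof -
  have "norm (A v) - c * norm v \<le> 0"
  proof (rule homogeneous_ap_at_le_0[where F = "\<lambda>z. norm (A z) - c * norm z" and a = a])
    show "isCont (\<lambda>z. norm (A z) - c * norm z) v"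
      by (intro continuous_intros linear_continuous_at linear_conv_bounded_linear[THEN iffD1] A)
    show "norm (A (t *\<^sub>R z)) - c * norm (t *\<^sub>R z) = t * (norm (A z) - c * norm z)" if "0 < t" for t z
      using that by (simp add: linear_cmul[OF A] right_diff_distrib)
    show "\<forall>\<^sub>F x in ap_at a. norm (A (x - a)) - c * norm (x - a) \<le> 0"
      using bd by eventually_elim simp
  qed
  then show ?thesis by simp
qed

lemma ap_at_AE_neq: "\<forall>\<^sub>F x in ap_at a. x \<noteq> a"
  using ap_at_le_at[of a] by (auto simp: le_filter_def eventually_at_filter)

section \<open>Lebesgue points\<close>

lemma ball_in_borel[measurable]: "ball a r \<in> sets borel"
  by simp

lemma nn_integral_lborel_affine:
  fixes F :: "'a::euclidean_space \<Rightarrow> ennreal"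
  assumes [measurable]: "F \<in> borel_measurable borel" and c: "c \<noteq> 0"
  shows "(\<integral>\<^sup>+x. F x \<partial>lborel) = ennreal (\<bar>c\<bar> ^ DIM('a)) * (\<integral>\<^sup>+x. F (t + c *\<^sub>R x) \<partial>lborel)"
proof -
  have "(\<integral>\<^sup>+x. F x \<partial>lborel) =
    (\<integral>\<^sup>+x. F x \<partial>density (distr lborel borel (\<lambda>x. t + c *\<^sub>R x)) (\<lambda>_. \<bar>c\<bar> ^ DIM('a)))"
    using lborel_affine[OF c, of t] by simp
  also have "\<dots> = (\<integral>\<^sup>+x. ennreal (\<bar>c\<bar> ^ DIM('a)) * F (t + c *\<^sub>R x) \<partial>lborel)"
    by (simp add: nn_integral_density nn_integral_distr)
  also have "\<dots> = ennreal (\<bar>c\<bar> ^ DIM('a)) * (\<integral>\<^sup>+x. F (t + c *\<^sub>R x) \<partial>lborel)"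
    by (rule nn_integral_cmult) simp
  finally show ?thesis .
qed

lemma AE_lborel_locallyI:
  fixes V :: "'a::euclidean_space set"
  assumes "\<And>a. a \<in> V \<Longrightarrow> \<exists>r>0. AE x in lborel. x \<in> ball a r \<longrightarrow> P x"
  shows "AE x in lborel. x \<in> V \<longrightarrow> P x"
proof -
  obtain r where r: "\<And>a. a \<in> V \<Longrightarrow> 0 < r a" "\<And>a. a \<in> V \<Longrightarrow> AE x in lborel. x \<in> ball a (r a) \<longrightarrow> P x"
    using assms by metis
  obtain F' where F': "F' \<subseteq> (\<lambda>a. ball a (r a)) ` V" "countable F'" "\<Union>F' = (\<Union>a\<in>V. ball a (r a))"
    using Lindelof[of "(\<lambda>a. ball a (r a)) ` V"] by auto
  have "AE x in lborel. \<forall>B\<in>F'. x \<in> B \<longrightarrow> P x"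
    using F'(1,2) r(2) by (subst AE_ball_countable) auto
  then show ?thesis
  proof eventually_elim
    case (elim x)
    then show ?case using F'(3) r(1) by (metis UN_I UnionE centre_in_ball)
  qed
qed

definition lebesgue_point :: "('a::euclidean_space \<Rightarrow> 'b::real_normed_vector) \<Rightarrow> 'a \<Rightarrow> bool" where
  "lebesgue_point f a \<longleftrightarrow> (\<forall>\<epsilon>>0. \<forall>\<^sub>F r in at_right 0.
     (\<integral>\<^sup>+x. ennreal (norm (f x - f a)) * indicator (ball a r) x \<partial>lborel)
       \<le> ennreal \<epsilon> * emeasure lborel (ball a r))"

text \<open>The measure with density \<open>g\<close> gives \<open>A\<close> mass 0, so
  \<open>A\<close> lies in an open set of tiny mass. The bad points are finely covered by balls
  inside this open set whose mass exceeds \<open>\<epsilon>\<close> times their volume; a disjoint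
  Vitali subfamily covers almost all bad points and has small volume.\<close>

lemma AE_zero_density:
  fixes g :: "'a::euclidean_space \<Rightarrow> ennreal"
  assumes g[measurable]: "g \<in> borel_measurable borel" and fin: "(\<integral>\<^sup>+x. g x \<partial>lborel) < \<infinity>"
    and A[measurable]: "A \<in> sets borel" and g0: "\<And>x. x \<in> A \<Longrightarrow> g x = 0" and \<epsilon>: "0 < \<epsilon>"
  shows "AE a in lborel. a \<in> A \<longrightarrow> (\<forall>\<^sub>F r in at_right 0.
     (\<integral>\<^sup>+x. g x * indicator (ball a r) x \<partial>lborel) \<le> ennreal \<epsilon> * emeasure lborel (ball a r))"
proof -
  define M where "M = density lborel g"
  have setsM[simp]: "sets M = sets borel" by (simp add: M_def)
  have eM: "emeasure M B = (\<integral>\<^sup>+x. g x * indicator B x \<partial>lborel)" if "B \<in> sets borel" for B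
    using that by (simp add: M_def emeasure_density)
  have finM: "emeasure M (space M) \<noteq> \<infinity>" using fin by (simp add: M_def emeasure_density)
  have MA: "emeasure M A = 0"
  proof -
    have "emeasure M A = (\<integral>\<^sup>+x. 0 \<partial>(lborel :: 'a measure))"
      unfolding eM[OF A] by (intro nn_integral_cong) (auto simp: g0 indicator_def)
    then show ?thesis by simp
  qed
  define S where "S = {a \<in> A. \<not> (\<forall>\<^sub>F r in at_right 0.
     emeasure M (ball a r) \<le> ennreal \<epsilon> * emeasure lborel (ball a r))}"
  have "negligible S"
    unfolding negligible_outer_le
  proof (intro allI impI)
    fix e :: real assume e: "0 < e"
    \<comment> \<open>Mass below \<open>\<epsilon> * e\<close> forces the disjoint balls selected
      later to have total volume at most \<open>e\<close>.\<close>
    have "(INF U\<in>{U. A \<subseteq> U \<and> open U}. emeasure M U) < ennreal (\<epsilon> * e)"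
      using outer_regular[OF setsM finM A] MA e \<epsilon> by simp
    then obtain G where G: "A \<subseteq> G" "open G" "emeasure M G < ennreal (\<epsilon> * e)"
      by (auto simp: INF_less_iff)
    define K where "K = {(x, r). 0 < r \<and> ball x r \<subseteq> G \<and>
        ennreal \<epsilon> * emeasure lborel (ball x r) < emeasure M (ball x r)}"
    have cov: "\<exists>i. i \<in> K \<and> x \<in> ball (fst i) (snd i) \<and> snd i < d" if x: "x \<in> S" and d: "0 < d" for x d
    proof -
      from x have "x \<in> G" using G by (auto simp: S_def)
      then obtain d' where d': "0 < d'" "ball x d' \<subseteq> G" using G(2) open_contains_ball by blast
      have "\<exists>\<^sub>F r in at_right 0. \<not> emeasure M (ball x r) \<le> ennreal \<epsilon> * emeasure lborel (ball x r)"
        using x unfolding S_def frequently_def by simp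
      moreover have "\<forall>\<^sub>F r in at_right (0::real). 0 < r \<and> r < min d d'"
        using d d' eventually_at_right_real[of 0 "min d d'"] by simp
      ultimately have "\<exists>\<^sub>F r in at_right 0. \<not> emeasure M (ball x r) \<le> ennreal \<epsilon> * emeasure lborel (ball x r)
         \<and> (0 < r \<and> r < min d d')"
        by (rule frequently_eventually_frequently)
      then obtain r where "\<not> emeasure M (ball x r) \<le> ennreal \<epsilon> * emeasure lborel (ball x r)"
         "0 < r" "r < min d d'" by (auto dest: frequently_ex)
      then show ?thesis
        using d' by (intro exI[of _ "(x, r)"]) (auto simp: K_def not_le)
    qed
    obtain C where C: "countable C" "C \<subseteq> K"
      "pairwise (\<lambda>i j. disjnt (ball (fst i) (snd i)) (ball (fst j) (snd j))) C"
      "negligible (S - (\<Union>i\<in>C. ball (fst i) (snd i)))"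
      using Vitali_covering_theorem_balls[of S K fst snd, OF cov] by blast
    define W where "W = (\<Union>i\<in>C. ball (fst i) (snd i))"
    have disj: "disjoint_family_on (\<lambda>i. ball (fst i) (snd i)) C"
      using C(3) by (auto simp: pairwise_def disjoint_family_on_def disjnt_def)
    have oW: "open W" unfolding W_def by auto
    have "ennreal \<epsilon> * emeasure lborel W
      = ennreal \<epsilon> * (\<integral>\<^sup>+i. emeasure lborel (ball (fst i) (snd i)) \<partial>count_space C)"
      unfolding W_def using C(1) disj by (subst emeasure_UN_countable) auto
    also have "\<dots> = (\<integral>\<^sup>+i. ennreal \<epsilon> * emeasure lborel (ball (fst i) (snd i)) \<partial>count_space C)"
      by (simp add: nn_integral_cmult)
    also have "\<dots> \<le> (\<integral>\<^sup>+i. emeasure M (ball (fst i) (snd i)) \<partial>count_space C)"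
      using C(2) by (intro nn_integral_mono) (auto simp: K_def)
    also have "\<dots> = emeasure M W"
      unfolding W_def using C(1) disj by (subst emeasure_UN_countable) auto
    also have "\<dots> \<le> emeasure M G"
      using C(2) G(2) by (intro emeasure_mono) (fastforce simp: W_def K_def)+
    also have "\<dots> \<le> ennreal \<epsilon> * ennreal e" using G(3) e \<epsilon> by (simp add: ennreal_mult)
    finally have W: "emeasure lborel W \<le> ennreal e"
      using \<epsilon> by (subst (asm) ennreal_mult_le_mult_iff) auto
    then have Wl: "W \<in> lmeasurable"
      using oW by (intro fmeasurableI) (auto simp: le_less_trans)
    have "measure lebesgue W \<le> e"
      using W e oW by (simp add: measure_def enn2real_leI)
    moreover have "measure lebesgue (W \<union> (S - W)) = measure lebesgue W"
    proof (rule measure_Un_null_set)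
      show "S - W \<in> null_sets lebesgue"
        using C(4) unfolding W_def[symmetric] by (simp only: negligible_iff_null_sets)
    qed (use Wl in \<open>auto simp: fmeasurableD\<close>)
    moreover have "W \<union> (S - W) \<in> lmeasurable"
      using C(4) unfolding W_def[symmetric] by (intro fmeasurable.Un Wl negligible_imp_measurable)
    ultimately show "\<exists>T. S \<subseteq> T \<and> T \<in> lmeasurable \<and> measure lebesgue T \<le> e"
      by (intro exI[of _ "W \<union> (S - W)"]) auto
  qed
  then have "AE a in lebesgue. a \<notin> S"
    by (intro AE_not_in) (simp add: negligible_iff_null_sets)
  then have "AE a in lborel. a \<notin> S" by (simp add: AE_completion_iff)
  then show ?thesis by eventually_elim (auto simp: S_def eM)
qed

text \<open>On \<open>A q n\<close> the function is within \<open>1 / real (Suc n)\<close> of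
  \<open>q\<close>, and by \<open>AE_zero_density\<close> what happens off \<open>A q n\<close> is
  negligible at almost every point of \<open>A q n\<close>. Countably many \<open>q\<close> from a
  dense set reach every value, which treats scalar and vector-valued functions alike.\<close>

lemma AE_lebesgue_point_ball:
  fixes f :: "'a::euclidean_space \<Rightarrow> 'b::{real_normed_vector, second_countable_topology}"
  assumes f[measurable]: "f \<in> borel_measurable borel"
    and fin: "(\<integral>\<^sup>+x. ennreal (norm (f x)) * indicator (ball a0 r0) x \<partial>lborel) < \<infinity>"
  shows "AE a in lborel. a \<in> ball a0 r0 \<longrightarrow> lebesgue_point f a"
proof -
  obtain D :: "'b set" where D: "countable D" "\<And>X. open X \<Longrightarrow> X \<noteq> {} \<Longrightarrow> \<exists>d\<in>D. d \<in> X"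
    using countable_dense_exists[where ?'a='b] by metis
  define A where "A q n = {x. norm (f x - q) \<le> 1 / real (Suc n)}" for q n
  have A[measurable]: "A q n \<in> sets borel" for q n
    unfolding A_def by measurable
  define g where "g q n x = ennreal (norm (f x - q)) * indicator (ball a0 r0 - A q n) x" for q n x
  have g[measurable]: "g q n \<in> borel_measurable borel" for q n
    unfolding g_def by (intro borel_measurable_times_ennreal borel_measurable_indicator sets.Diff A) simp_all
  have gfin: "(\<integral>\<^sup>+x. g q n x \<partial>lborel) < \<infinity>" for q n
  proof -
    have "(\<integral>\<^sup>+x. g q n x \<partial>lborel) \<le> (\<integral>\<^sup>+x. ennreal (norm (f x)) * indicator (ball a0 r0) x
        + ennreal (norm q) * indicator (ball a0 r0) x \<partial>lborel)"
      by (intro nn_integral_mono)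
         (auto simp: g_def indicator_def ennreal_plus[symmetric] norm_triangle_ineq4 simp del: ennreal_plus)
    also have "\<dots> = (\<integral>\<^sup>+x. ennreal (norm (f x)) * indicator (ball a0 r0) x \<partial>lborel)
        + ennreal (norm q) * emeasure lborel (ball a0 r0)"
      by (subst nn_integral_add) (auto simp: nn_integral_cmult_indicator)
    also have "\<dots> < \<infinity>"
      using fin emeasure_lborel_ball_finite[of a0 r0] by (simp add: ennreal_mult_less_top)
    finally show ?thesis .
  qed
  have "AE a in lborel. \<forall>q\<in>D. \<forall>n. a \<in> A q n \<longrightarrow> (\<forall>\<^sub>F r in at_right 0.
     (\<integral>\<^sup>+x. g q n x * indicator (ball a r) x \<partial>lborel) \<le> ennreal (1 / real (Suc n)) * emeasure lborel (ball a r))"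
    using D(1) by (subst AE_ball_countable, simp, subst AE_all_countable)
      (intro ballI allI AE_zero_density g gfin A, auto simp: g_def)
  then show ?thesis
  proof eventually_elim
    case (elim a)
    show ?case unfolding lebesgue_point_def
    proof (intro impI allI)
      fix \<epsilon> :: real assume a: "a \<in> ball a0 r0" and \<epsilon>: "0 < \<epsilon>"
      obtain n where n: "3 / \<epsilon> < real (Suc n)"
        using reals_Archimedean2 by (metis less_SucI of_nat_less_iff order.strict_trans lessI)
      define \<eta> where "\<eta> = 1 / real (Suc n)"
      have \<eta>: "0 < \<eta>" "3 * \<eta> \<le> \<epsilon>" using n \<epsilon> by (auto simp: \<eta>_def field_simps)
      obtain q where q: "q \<in> D" "norm (f a - q) < \<eta>"
        using D(2)[of "ball (f a) \<eta>"] \<eta>(1) by (auto simp: dist_norm)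
      have aA: "a \<in> A q n" using q(2) by (simp add: A_def \<eta>_def)
      obtain d where d: "0 < d" "ball a d \<subseteq> ball a0 r0"
        using a open_contains_ball[of "ball a0 r0"] by blast
      have "\<forall>\<^sub>F r in at_right (0::real). 0 < r \<and> r < d"
        using d eventually_at_right_real[of 0 d] by simp
      moreover have "\<forall>\<^sub>F r in at_right 0.
        (\<integral>\<^sup>+x. g q n x * indicator (ball a r) x \<partial>lborel) \<le> ennreal \<eta> * emeasure lborel (ball a r)"
        using elim q(1) aA by (auto simp: \<eta>_def)
      ultimately show "\<forall>\<^sub>F r in at_right 0.
        (\<integral>\<^sup>+x. ennreal (norm (f x - f a)) * indicator (ball a r) x \<partial>lborel)
       \<le> ennreal \<epsilon> * emeasure lborel (ball a r)"
      proof eventually_elim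
        case (elim r)
        have le: "ennreal (norm (f x - f a)) * indicator (ball a r) x
          \<le> g q n x * indicator (ball a r) x + ennreal (2 * \<eta>) * indicator (ball a r) x" for x
        proof (cases "x \<in> ball a r")
          case True
          then have "x \<in> ball a d" using elim by auto
          then have xb: "x \<in> ball a0 r0" using d by blast
          have tr: "norm (f x - f a) \<le> norm (f x - q) + \<eta>"
            using norm_triangle_ineq[of "f x - q" "q - f a"] q(2) by (simp add: norm_minus_commute)
          show ?thesis
          proof (cases "x \<in> A q n")
            case True
            then have "norm (f x - f a) \<le> 2 * \<eta>" using tr by (simp add: A_def \<eta>_def)
            then show ?thesis using \<open>x \<in> ball a r\<close> by (simp add: ennreal_leI add_increasing)
          next
            case False
            have "ennreal (norm (f x - f a)) \<le> ennreal (norm (f x - q) + 2 * \<eta>)"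
              using tr \<eta>(1) by (intro ennreal_leI) simp
            then show ?thesis using \<open>x \<in> ball a r\<close> xb False \<eta>(1) by (simp add: g_def)
          qed
        qed simp
        have "(\<integral>\<^sup>+x. ennreal (norm (f x - f a)) * indicator (ball a r) x \<partial>lborel)
          \<le> (\<integral>\<^sup>+x. g q n x * indicator (ball a r) x + ennreal (2 * \<eta>) * indicator (ball a r) x \<partial>lborel)"
          by (intro nn_integral_mono le)
        also have "\<dots> = (\<integral>\<^sup>+x. g q n x * indicator (ball a r) x \<partial>lborel)
            + ennreal (2 * \<eta>) * emeasure lborel (ball a r)"
          by (subst nn_integral_add) (auto simp: nn_integral_cmult_indicator)
        also have "\<dots> \<le> ennreal \<eta> * emeasure lborel (ball a r) + ennreal (2 * \<eta>) * emeasure lborel (ball a r)"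
          using elim by (intro add_right_mono)
        also have "\<dots> = ennreal (3 * \<eta>) * emeasure lborel (ball a r)"
          using \<eta>(1) by (simp add: distrib_right[symmetric] ennreal_plus[symmetric] del: ennreal_plus)
        also have "\<dots> \<le> ennreal \<epsilon> * emeasure lborel (ball a r)"
          using \<eta>(2) by (intro mult_right_mono ennreal_leI) auto
        finally show ?case .
      qed
    qed
  qed
qed

theorem AE_lebesgue_point:
  fixes f :: "'a::euclidean_space \<Rightarrow> 'b::{real_normed_vector, second_countable_topology}"
  assumes f: "f \<in> borel_measurable borel"
    and fin: "\<And>a. a \<in> V \<Longrightarrow> \<exists>r>0. (\<integral>\<^sup>+x. ennreal (norm (f x)) * indicator (ball a r) x \<partial>lborel) < \<infinity>"
  shows "AE a in lborel. a \<in> V \<longrightarrow> lebesgue_point f a"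
  using AE_lborel_locallyI[of V "lebesgue_point f"] AE_lebesgue_point_ball[OF f] fin by meson

text \<open>By Fubini, the segment averages integrated over \<open>ball a r\<close> are averages
  over the shrunken balls \<open>ball a (s * r)\<close>: the powers of \<open>s\<close> from the
  Jacobian and from the volume cancel. Chebyshev's inequality then leaves few exceptional end points
  \<open>x\<close>.\<close>

lemma lebesgue_point_segment:
  fixes f :: "'a::euclidean_space \<Rightarrow> 'b::{real_normed_vector, second_countable_topology}"
  assumes f[measurable]: "f \<in> borel_measurable borel" and a: "lebesgue_point f a" and \<epsilon>: "0 < \<epsilon>"
  shows "\<forall>\<^sub>F x in ap_at a. (\<integral>\<^sup>+s. ennreal (norm (f (a + s *\<^sub>R (x - a)) - f a)) * indicator {0..1} s \<partial>lborel)
    \<le> ennreal \<epsilon>"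
proof (rule eventually_ap_atI)
  fix \<delta> :: real assume \<delta>: "0 < \<delta>"
  define K where "K x = (\<integral>\<^sup>+s. ennreal (norm (f (a + s *\<^sub>R (x - a)) - f a)) * indicator {0..1} s \<partial>lborel)" for x
  have K[measurable]: "K \<in> borel_measurable borel"
    unfolding K_def by measurable
  have "\<forall>\<^sub>F r in at_right 0. (\<integral>\<^sup>+x. ennreal (norm (f x - f a)) * indicator (ball a r) x \<partial>lborel)
       \<le> ennreal (\<epsilon> * \<delta>) * emeasure lborel (ball a r)"
    using a \<epsilon> \<delta> unfolding lebesgue_point_def by (meson mult_pos_pos)
  then obtain d where d: "0 < d" "\<And>r. 0 < r \<Longrightarrow> r < d \<Longrightarrow>
      (\<integral>\<^sup>+x. ennreal (norm (f x - f a)) * indicator (ball a r) x \<partial>lborel)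
       \<le> ennreal (\<epsilon> * \<delta>) * emeasure lborel (ball a r)"
    unfolding eventually_at_right[OF zero_less_one] by blast
  have "\<forall>\<^sub>F r in at_right (0::real). 0 < r \<and> r < d"
    using d eventually_at_right_real[of 0 d] by simp
  then show "\<forall>\<^sub>F r in at_right 0. \<exists>E\<in>sets lebesgue.
     {x \<in> ball a r. \<not> (\<integral>\<^sup>+s. ennreal (norm (f (a + s *\<^sub>R (x - a)) - f a)) * indicator {0..1} s \<partial>lborel)
       \<le> ennreal \<epsilon>} \<subseteq> E \<and> emeasure lebesgue E \<le> ennreal \<delta> * emeasure lebesgue (ball a r)"
  proof eventually_elim
    case (elim r)
    define E where "E = {x \<in> ball a r. ennreal \<epsilon> < K x}"
    have E[measurable]: "E \<in> sets borel" unfolding E_def by measurable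
    have inner: "(\<integral>\<^sup>+x. ennreal (norm (f (a + s *\<^sub>R (x - a)) - f a)) * indicator (ball a r) x \<partial>lborel)
       \<le> ennreal (\<epsilon> * \<delta>) * emeasure lborel (ball a r)" if s: "0 < s" "s \<le> 1" for s
    proof -
      let ?J = "\<integral>\<^sup>+x. ennreal (norm (f (a + s *\<^sub>R (x - a)) - f a)) * indicator (ball a r) x \<partial>lborel"
      have sr: "0 < s * r" "s * r < d" using s elim by (auto simp: mult_le_cancel_right1 intro: le_less_trans[of "s * r" r])
      have mem: "(a - s *\<^sub>R a) + s *\<^sub>R x \<in> ball a (s * r) \<longleftrightarrow> x \<in> ball a r" for x
      proof -
        have "dist a ((a - s *\<^sub>R a) + s *\<^sub>R x) = norm (s *\<^sub>R (a - x))"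
          by (simp add: dist_norm algebra_simps)
        then show ?thesis using s by (simp add: dist_norm)
      qed
      have "ennreal (s ^ DIM('a)) * ?J
        = ennreal (\<bar>s\<bar> ^ DIM('a)) * (\<integral>\<^sup>+x. ennreal (norm (f ((a - s *\<^sub>R a) + s *\<^sub>R x) - f a)) *
            indicator (ball a (s * r)) ((a - s *\<^sub>R a) + s *\<^sub>R x) \<partial>lborel)"
      proof -
        have "?J = (\<integral>\<^sup>+x. ennreal (norm (f ((a - s *\<^sub>R a) + s *\<^sub>R x) - f a)) *
            indicator (ball a (s * r)) ((a - s *\<^sub>R a) + s *\<^sub>R x) \<partial>lborel)"
          using mem by (intro nn_integral_cong) (simp add: indicator_def algebra_simps)
        then show ?thesis using s by simp
      qed
      also have "\<dots> = (\<integral>\<^sup>+x. ennreal (norm (f x - f a)) * indicator (ball a (s * r)) x \<partial>lborel)"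
        using s by (intro nn_integral_lborel_affine[symmetric] borel_measurable_times_ennreal borel_measurable_indicator) simp_all
      also have "\<dots> \<le> ennreal (\<epsilon> * \<delta>) * emeasure lborel (ball a (s * r))"
        using d(2)[OF sr] .
      also have "emeasure lborel (ball a (s * r)) = ennreal (s ^ DIM('a)) * emeasure lborel (ball a r)"
        using emeasure_lebesgue_ball_scale[of r s a a] s elim by simp
      finally have "ennreal (s ^ DIM('a)) * ?J
         \<le> ennreal (s ^ DIM('a)) * (ennreal (\<epsilon> * \<delta>) * emeasure lborel (ball a r))"
        by (simp add: ac_simps)
      then show ?thesis using s by (subst (asm) ennreal_mult_le_mult_iff) auto
    qed
    have "ennreal \<epsilon> * emeasure lborel E = (\<integral>\<^sup>+x. ennreal \<epsilon> * indicator E x \<partial>lborel)"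
      by (simp add: nn_integral_cmult_indicator)
    also have "\<dots> \<le> (\<integral>\<^sup>+x. K x * indicator (ball a r) x \<partial>lborel)"
      by (intro nn_integral_mono) (auto simp: E_def indicator_def)
    also have "\<dots> = (\<integral>\<^sup>+x. (\<integral>\<^sup>+s. ennreal (norm (f (a + s *\<^sub>R (x - a)) - f a)) * indicator {0..1} s * indicator (ball a r) x \<partial>lborel) \<partial>lborel)"
      unfolding K_def by (simp add: nn_integral_multc)
    also have "\<dots> = (\<integral>\<^sup>+s. (\<integral>\<^sup>+x. ennreal (norm (f (a + s *\<^sub>R (x - a)) - f a)) * indicator {0..1} s * indicator (ball a r) x \<partial>lborel) \<partial>lborel)"
      by (rule lborel_pair.Fubini') measurable
    also have "\<dots> = (\<integral>\<^sup>+s. (\<integral>\<^sup>+x. ennreal (norm (f (a + s *\<^sub>R (x - a)) - f a)) * indicator (ball a r) x \<partial>lborel) * indicator {0..1} s \<partial>lborel)"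
      by (intro nn_integral_cong) (subst nn_integral_multc[symmetric], measurable, simp add: ac_simps)
    also have "\<dots> \<le> (\<integral>\<^sup>+s. ennreal (\<epsilon> * \<delta>) * emeasure lborel (ball a r) * indicator {0..(1::real)} s \<partial>lborel)"
    proof (intro nn_integral_mono_AE)
      show "AE s in lborel. (\<integral>\<^sup>+x. ennreal (norm (f (a + s *\<^sub>R (x - a)) - f a)) * indicator (ball a r) x \<partial>lborel) * indicator {0..1} s
        \<le> ennreal (\<epsilon> * \<delta>) * emeasure lborel (ball a r) * indicator {0..(1::real)} s"
        using AE_lborel_singleton[of "0::real"]
      proof eventually_elim
        case (elim s)
        then show ?case using inner[of s] by (auto simp: indicator_def)
      qed
    qed
    also have "\<dots> = ennreal \<epsilon> * (ennreal \<delta> * emeasure lborel (ball a r))"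
      using \<epsilon> \<delta> by (subst nn_integral_cmult_indicator) (auto simp: ennreal_mult ac_simps)
    finally have "emeasure lborel E \<le> ennreal \<delta> * emeasure lborel (ball a r)"
      using \<epsilon> by (subst (asm) ennreal_mult_le_mult_iff) auto
    then show ?case
      unfolding K_def[symmetric] by (intro bexI[of _ E]) (auto simp: E_def[symmetric] not_le, auto simp: E_def)
  qed
qed

section \<open>Smooth bump functions\<close>

text \<open>The quotients by \<open>s ^ j\<close> make the span of the family closed under
  differentiation (\<open>DERIV_flat\<close>), so smoothness follows by one induction for all
  \<open>j\<close> at once.\<close>

definition flat :: "nat \<Rightarrow> real \<Rightarrow> real" where
  "flat j s = (if 0 < s then exp (- 1 / s) / s ^ j else 0)"

lemma power_div_fact_le_exp:
  fixes x :: real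
  assumes "0 \<le> x"
  shows "x ^ n / fact n \<le> exp x"
proof -
  have "(\<lambda>n. x ^ n / fact n) sums exp x"
    using exp_converges[of x] by (simp add: divide_inverse mult.commute)
  moreover have "x ^ n / fact n = (\<Sum>i\<in>{n}. x ^ i / fact i)" by simp
  ultimately show ?thesis
    using assms sum_le_suminf[of "\<lambda>n. x ^ n / fact n" "{n}"]
    by (simp add: sums_iff)
qed

lemma flat_nonneg [simp]: "0 \<le> flat j s"
  by (simp add: flat_def)

text \<open>One term of the exponential series at \<open>1 / s\<close>, of degree
  \<open>j + n\<close>, beats the pole of order \<open>j\<close> and leaves \<open>n\<close> powers
  of \<open>s\<close> to spare: \<open>n = 2\<close> gives differentiability at 0,
  \<open>n = 0\<close> the uniform bound.\<close>

lemma flat_le_power: "flat j s \<le> fact (j + n) * \<bar>s\<bar> ^ n"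
proof (cases "0 < s")
  case True
  have "(1 / s) ^ (j + n) / fact (j + n) \<le> exp (1 / s)"
    using True by (intro power_div_fact_le_exp) simp
  then have "exp (- 1 / s) \<le> fact (j + n) * s ^ (j + n)"
    using True by (simp add: exp_minus field_simps power_one_over)
  then show ?thesis using True by (simp add: flat_def power_add field_simps)
qed (simp add: flat_def)

lemma flat_le_fact: "flat j s \<le> fact j"
  using flat_le_power[of j s 0] by simp

lemma flat_0_le_1: "flat 0 s \<le> 1"
  using flat_le_fact[of 0 s] by simp

lemma flat_0_mono: "s \<le> t \<Longrightarrow> flat 0 s \<le> flat 0 t"
  by (auto simp: flat_def frac_le)

lemma flat_pos: "0 < s \<Longrightarrow> 0 < flat j s"
  by (simp add: flat_def)

lemma flat_eq_0: "s \<le> 0 \<Longrightarrow> flat j s = 0"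
  by (simp add: flat_def)

lemma DERIV_flat:
  "(flat j has_real_derivative (flat (j + 2) s - real j * flat (j + 1) s)) (at s)"
proof -
  consider "0 < s" | "s < 0" | "s = 0" by linarith
  then show ?thesis
  proof cases
    case 1
    have "((\<lambda>s. exp (- 1 / s) / s ^ j) has_real_derivative
        (flat (j + 2) s - real j * flat (j + 1) s)) (at s)"
    proof -
      have "((\<lambda>s. exp (- 1 / s) / s ^ j) has_real_derivative
          ((exp (- 1 / s) * (1 / s\<^sup>2)) * s ^ j - exp (- 1 / s) * (real j * s ^ (j - 1))) / (s ^ j * s ^ j)) (at s)"
        using 1 by (auto intro!: derivative_eq_intros simp: power2_eq_square)
      also have "((exp (- 1 / s) * (1 / s\<^sup>2)) * s ^ j - exp (- 1 / s) * (real j * s ^ (j - 1))) / (s ^ j * s ^ j)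
        = flat (j + 2) s - real j * flat (j + 1) s"
        using 1 by (cases j) (simp_all add: flat_def field_simps power2_eq_square)
      finally show ?thesis .
    qed
    moreover have "\<forall>\<^sub>F t in nhds s. flat j t = exp (- 1 / t) / t ^ j"
      using 1 by (auto simp: flat_def intro!: eventually_mono[OF eventually_nhds_in_open[of "{0<..}"]])
    ultimately show ?thesis by (subst DERIV_cong_ev) auto
  next
    case 2
    have "((\<lambda>_. 0) has_real_derivative 0) (at s)" by simp
    moreover have "\<forall>\<^sub>F t in nhds s. flat j t = 0"
      using 2 by (auto simp: flat_def intro!: eventually_mono[OF eventually_nhds_in_open[of "{..<0}"]])
    ultimately show ?thesis using 2 by (subst DERIV_cong_ev) (auto simp: flat_def)
  next
    case 3
    have "((\<lambda>h. flat j h / h) \<longlongrightarrow> 0) (at 0)"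
    proof (rule Lim_null_comparison)
      have "norm (flat j h / h) \<le> fact (j + 2) * \<bar>h\<bar>" if "h \<noteq> 0" for h
      proof -
        have "flat j h \<le> (fact (j + 2) * \<bar>h\<bar>) * \<bar>h\<bar>"
          using flat_le_power[of j h 2] unfolding power2_eq_square mult.assoc .
        then show ?thesis using that by (simp only: norm_divide real_norm_def abs_of_nonneg[OF flat_nonneg]) (simp add: pos_divide_le_eq)
      qed
      then show "\<forall>\<^sub>F h in at 0. norm (flat j h / h) \<le> fact (j + 2) * \<bar>h\<bar>"
        by (simp add: eventually_at_filter)
      show "((\<lambda>h. fact (j + 2) * \<bar>h\<bar>) \<longlongrightarrow> 0) (at (0::real))"
        by (auto intro!: tendsto_eq_intros)
    qed
    then show ?thesis using 3 by (simp add: has_field_derivative_iff flat_def)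
  qed
qed

lemma continuous_on_flat [continuous_intros]:
  "continuous_on S f \<Longrightarrow> continuous_on S (\<lambda>x. flat j (f x))"
  using continuous_on_compose2[of UNIV "flat j" S f] DERIV_flat[THEN DERIV_isCont]
  by (auto simp: continuous_on_eq_continuous_at)

lemma flat_measurable [measurable]: "flat j \<in> borel_measurable borel"
  by (intro borel_measurable_continuous_onI continuous_intros)

lemma has_derivative_flat [derivative_intros]:
  assumes "(f has_derivative f') (at x within S)"
  shows "((\<lambda>x. flat j (f x)) has_derivative
    (\<lambda>h. (flat (j + 2) (f x) - real j * flat (j + 1) (f x)) * f' h)) (at x within S)"
  using has_derivative_compose[OF assms DERIV_flat[of j "f x", THEN has_field_derivative_imp_has_derivative]]
  by (simp add: mult.commute)

lemma Ck_on_SucI: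
  assumes "\<And>x. (f has_derivative f' x) (at x)" "\<And>v. Ck_on k UNIV (\<lambda>x. f' x v)"
  shows "Ck_on (Suc k) UNIV f"
  using assms frechet_derivative_at[OF assms(1)] by (auto simp: differentiable_def)

lemma Ck_on_SucD:
  assumes "Ck_on (Suc k) UNIV f"
  shows "(f has_derivative frechet_derivative f (at x)) (at x)"
    "Ck_on k UNIV (\<lambda>x. frechet_derivative f (at x) v)"
  using assms by (auto simp: frechet_derivative_works)

lemma Ck_on_Suc_imp: "Ck_on (Suc k) UNIV f \<Longrightarrow> Ck_on k UNIV f"
proof (induction k arbitrary: f)
  case 0
  then have "\<And>x. isCont f x"
    using differentiable_imp_continuous_within[of f _ UNIV] by (auto simp: continuous_at_imp_continuous_within)
  then show ?case by (simp add: continuous_at_imp_continuous_on)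
qed simp

lemma Ck_on_const: "Ck_on k UNIV (\<lambda>x. c)"
proof (induction k arbitrary: c)
  case (Suc k)
  then show ?case by (intro Ck_on_SucI[where f' = "\<lambda>_ _. 0"]) auto
qed simp

lemma Ck_on_add: "Ck_on k UNIV f \<Longrightarrow> Ck_on k UNIV g \<Longrightarrow> Ck_on k UNIV (\<lambda>x. f x + g x)"
proof (induction k arbitrary: f g)
  case (Suc k)
  show ?case
    by (rule Ck_on_SucI[OF has_derivative_add[OF Ck_on_SucD(1)[OF Suc.prems(1)] Ck_on_SucD(1)[OF Suc.prems(2)]]])
       (rule Suc.IH[OF Ck_on_SucD(2)[OF Suc.prems(1)] Ck_on_SucD(2)[OF Suc.prems(2)]])
qed (auto intro: continuous_on_add)

lemma Ck_on_bilinear: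
  assumes "bounded_bilinear pr"
  shows "Ck_on k UNIV f \<Longrightarrow> Ck_on k UNIV g \<Longrightarrow> Ck_on k UNIV (\<lambda>x. pr (f x) (g x))"
proof (induction k arbitrary: f g)
  case 0
  then show ?case by (simp add: bounded_bilinear.continuous_on[OF assms])
next
  case (Suc k)
  note D = Ck_on_SucD[OF Suc.prems(1)] Ck_on_SucD[OF Suc.prems(2)]
  show ?case
    by (rule Ck_on_SucI[OF bounded_bilinear.FDERIV[OF assms D(1) D(3)]])
       (rule Ck_on_add[OF Suc.IH[OF Ck_on_Suc_imp[OF Suc.prems(1)] D(4)]
          Suc.IH[OF D(2) Ck_on_Suc_imp[OF Suc.prems(2)]]])
qed

lemma Ck_on_affine:
  assumes "bounded_linear f"
  shows "Ck_on k UNIV (\<lambda>x. f x + c)"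
proof (cases k)
  case 0
  then show ?thesis by (simp add: continuous_on_add bounded_linear.continuous_on[OF assms])
next
  case (Suc k)
  show ?thesis unfolding Suc
    by (rule Ck_on_SucI[where f' = "\<lambda>x. f"])
       (auto intro!: Ck_on_const derivative_eq_intros bounded_linear_imp_has_derivative[OF assms])
qed

section \<open>Radial bumps and their gradients\<close>

definition height :: "'a::real_inner \<Rightarrow> real \<Rightarrow> 'a \<Rightarrow> real" where
  "height a r x = 1 - (norm (x - a))\<^sup>2 / r\<^sup>2"

lemma has_derivative_height [derivative_intros]:
  "((height a r) has_derivative (\<lambda>v. - (2 / r\<^sup>2) * ((x - a) \<bullet> v))) (at x within S)"
proof -
  have "((\<lambda>x. 1 - c * ((x - a) \<bullet> (x - a))) has_derivative
      (\<lambda>v. - (2 * c) * ((x - a) \<bullet> v))) (at x within S)" for c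
    by (auto intro!: derivative_eq_intros simp: inner_commute)
  from this[of "1 / r\<^sup>2"] show ?thesis by (simp add: height_def[abs_def] power2_norm_eq_inner)
qed

lemma continuous_on_height [continuous_intros]: "continuous_on S (height a r)"
  by (rule has_derivative_continuous_on[OF has_derivative_height])

lemma height_measurable [measurable]: "height (a::'a::euclidean_space) r \<in> borel_measurable borel"
  by (intro borel_measurable_continuous_onI continuous_intros)

lemma height_pos_iff: "0 < r \<Longrightarrow> 0 < height a r x \<longleftrightarrow> x \<in> ball a r"
proof -
  assume r: "0 < r"
  have "0 < height a r x \<longleftrightarrow> (norm (x - a))\<^sup>2 < r\<^sup>2"
    using r by (simp add: height_def)
  also have "\<dots> \<longleftrightarrow> norm (x - a) < r"
    using r abs_le_square_iff[of r "norm (x - a)"] by (simp add: linorder_not_le[symmetric] del: linorder_not_le)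
  finally show ?thesis by (simp add: dist_norm norm_minus_commute)
qed

lemma Ck_on_flat_height: "Ck_on k UNIV (\<lambda>x. flat j (height a r x))"
proof (induction k arbitrary: j)
  case 0
  show ?case by (auto intro!: continuous_intros)
next
  case (Suc k)
  have "Ck_on k UNIV (\<lambda>x. (flat (j + 2) (height a r x) + (- real j) * flat (j + 1) (height a r x))
     * ((- (2 / r\<^sup>2) * (x \<bullet> v)) + (2 / r\<^sup>2) * (a \<bullet> v)))" for v
    by (rule Ck_on_bilinear[OF bounded_bilinear_mult Ck_on_add[OF Suc.IH
          Ck_on_bilinear[OF bounded_bilinear_mult Ck_on_const Suc.IH]] Ck_on_affine])
       (rule bounded_linear_const_mult[OF bounded_linear_inner_left])
  moreover have "(flat (j + 2) (height a r x) + (- real j) * flat (j + 1) (height a r x))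
     * ((- (2 / r\<^sup>2) * (x \<bullet> v)) + (2 / r\<^sup>2) * (a \<bullet> v)) =
     (flat (j + 2) (height a r x) - real j * flat (j + 1) (height a r x))
     * (- (2 / r\<^sup>2) * ((x - a) \<bullet> v))" for x v
    by (simp only: inner_diff_left) algebra
  ultimately have "Ck_on k UNIV (\<lambda>x. (flat (j + 2) (height a r x) - real j * flat (j + 1) (height a r x))
     * (- (2 / r\<^sup>2) * ((x - a) \<bullet> v)))" for v
    by (simp only:)
  then show ?case by (rule Ck_on_SucI[OF has_derivative_flat[OF has_derivative_height]])
qed

definition bump :: "'a::real_inner \<Rightarrow> real \<Rightarrow> 'a \<Rightarrow> real" where
  "bump a r x = flat 0 (height a r x)"

text \<open>\<open>flat 2\<close> is the derivative of \<open>flat 0\<close>, and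
  \<open>- (2 / r\<^sup>2) *\<^sub>R (x - a)\<close> is the gradient of
  \<open>height a r\<close>.\<close>

definition grad_bump :: "'a::real_inner \<Rightarrow> real \<Rightarrow> 'a \<Rightarrow> 'a" where
  "grad_bump a r x = (- (2 / r\<^sup>2) * flat 2 (height a r x)) *\<^sub>R (x - a)"

lemma has_derivative_bump [derivative_intros]:
  "(bump a r has_derivative (\<lambda>v. grad_bump a r x \<bullet> v)) (at x within S)"
proof -
  have eq: "(\<lambda>h. (flat (0 + 2) (height a r x) - real 0 * flat (0 + 1) (height a r x)) *
      (- (2 / r\<^sup>2) * ((x - a) \<bullet> h))) = (\<lambda>v. grad_bump a r x \<bullet> v)"
    by (auto simp: grad_bump_def numeral_2_eq_2)
  show ?thesis
    using has_derivative_flat[OF has_derivative_height, of 0 a r x S] unfolding eq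
    unfolding bump_def[abs_def] .
qed

lemma frechet_derivative_bump: "frechet_derivative (bump a r) (at x) v = grad_bump a r x \<bullet> v"
  using frechet_derivative_at[OF has_derivative_bump] by metis

lemma bump_translate: "bump a r (x - v) = bump (a + v) r x"
  by (simp add: bump_def height_def algebra_simps)

lemma bump_nonneg [simp]: "0 \<le> bump a r x" and bump_le_1: "bump a r x \<le> 1"
  by (simp_all add: bump_def flat_0_le_1)

lemma bump_eq_0: "0 < r \<Longrightarrow> x \<notin> ball a r \<Longrightarrow> bump a r x = 0"
  using height_pos_iff[of r a x] by (simp add: bump_def flat_eq_0)

lemma grad_bump_eq_0: "0 < r \<Longrightarrow> x \<notin> ball a r \<Longrightarrow> grad_bump a r x = 0"
  using height_pos_iff[of r a x] by (simp add: grad_bump_def flat_eq_0)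

lemma bump_le_indicator: "0 < r \<Longrightarrow> bump a r x \<le> indicator (ball a r) x"
  using bump_eq_0[of r x a] bump_le_1[of a r x] by (auto simp: indicator_def)

lemma bump_lower: "0 < r \<Longrightarrow> flat 0 (3 / 4) * indicator (ball a (r / 2)) x \<le> bump a r x"
proof (cases "x \<in> ball a (r / 2)")
  case True
  assume r: "0 < r"
  have "(norm (x - a))\<^sup>2 \<le> (r / 2)\<^sup>2"
    using True by (intro power_mono) (auto simp: dist_norm norm_minus_commute)
  \<comment> \<open>At half the radius the height is \<open>1 - 1 / 4\<close>.\<close>
  then have "3 / 4 \<le> height a r x"
    using r by (simp add: height_def field_simps power2_eq_square)
  then show ?thesis using True flat_0_mono by (simp add: bump_def)
qed simp

lemma norm_grad_bump_le: "0 < r \<Longrightarrow> norm (grad_bump a r x) \<le> 4 / r"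
proof (cases "x \<in> ball a r")
  case True
  assume r: "0 < r"
  have "norm (grad_bump a r x) = (2 / r\<^sup>2) * flat 2 (height a r x) * norm (x - a)"
    by (simp add: grad_bump_def)
  also have "\<dots> \<le> (2 / r\<^sup>2) * 2 * r"
    using True r flat_le_fact[of 2 "height a r x"]
    by (intro mult_mono) (auto simp: dist_norm norm_minus_commute fact_2)
  also have "\<dots> = 4 / r" using r by (simp add: power2_eq_square)
  finally show ?thesis .
qed (simp add: grad_bump_eq_0)

lemma continuous_on_bump [continuous_intros]: "continuous_on S (bump a r)"
  by (rule has_derivative_continuous_on[OF has_derivative_bump])

lemma continuous_on_grad_bump [continuous_intros]: "continuous_on S (grad_bump a r)"
  unfolding grad_bump_def[abs_def] by (intro continuous_intros)

lemma bump_measurable [measurable]: "bump (a::'a::euclidean_space) r \<in> borel_measurable borel"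
  by (intro borel_measurable_continuous_onI continuous_intros)

lemma grad_bump_measurable [measurable]: "grad_bump (a::'a::euclidean_space) r \<in> borel_measurable borel"
  by (intro borel_measurable_continuous_onI continuous_intros)

lemma test_functionsI:
  assumes "\<And>k. Ck_on k UNIV \<phi>" "\<And>x. x \<notin> cball a r \<Longrightarrow> \<phi> x = 0" "cball a r \<subseteq> U"
  shows "\<phi> \<in> test_functions U"
proof -
  have "closure {x. \<phi> x \<noteq> 0} \<subseteq> cball a r"
    using assms(2) by (intro closure_minimal subsetI) (blast, simp)
  then show ?thesis
    using assms(1,3) by (auto simp: test_functions_def compact_eq_bounded_closed intro: bounded_subset)
qed

lemma bump_test_function:
  assumes "0 < r" "cball a r \<subseteq> U"
  shows "bump a r \<in> test_functions U"
proof (rule test_functionsI[OF _ _ assms(2)])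
  show "Ck_on k UNIV (bump a r)" for k
    using Ck_on_flat_height unfolding bump_def[abs_def] .
qed (use assms(1) in \<open>auto simp: bump_eq_0\<close>)

lemma radial_field_test_function:
  "0 < r \<Longrightarrow> cball a r \<subseteq> U \<Longrightarrow> (\<lambda>x. bump a r x *\<^sub>R (x - a)) \<in> test_functions U"
proof (rule test_functionsI[where a = a and r = r])
  fix k
  have "Ck_on k UNIV (\<lambda>x. x + (- a))" by (intro Ck_on_affine bounded_linear_ident)
  then show "Ck_on k UNIV (\<lambda>x. bump a r x *\<^sub>R (x - a))"
    using Ck_on_bilinear[OF bounded_bilinear_scaleR Ck_on_flat_height[of k 0 a r]]
    by (simp add: bump_def[abs_def])
qed (auto simp: bump_eq_0)

section \<open>Sobolev functions along segments\<close>

lemma lborel_shift: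
  fixes f :: "'a::euclidean_space \<Rightarrow> 'b::{banach, second_countable_topology}"
  assumes [measurable]: "f \<in> borel_measurable borel"
  shows integral_lborel_shift: "(LINT x|lborel. f (c + x)) = (LINT x|lborel. f x)"
    and integrable_lborel_shift: "integrable lborel (\<lambda>x. f (c + x)) \<longleftrightarrow> integrable lborel f"
proof -
  have "(LINT x|lborel. f (c + x)) = (LINT x|distr lborel borel ((+) c). f x)"
    by (subst integral_distr) auto
  then show "(LINT x|lborel. f (c + x)) = (LINT x|lborel. f x)" by (simp add: lborel_distr_plus)
  have "integrable lborel (\<lambda>x. f (c + x)) \<longleftrightarrow> integrable (distr lborel borel ((+) c)) f"
    by (subst integrable_distr_eq) auto
  then show "integrable lborel (\<lambda>x. f (c + x)) \<longleftrightarrow> integrable lborel f" by (simp add: lborel_distr_plus)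
qed

lemma integrable_bounded_mult:
  fixes f g :: "'a \<Rightarrow> real"
  assumes f: "integrable M f" and [measurable]: "g \<in> borel_measurable M" and bd: "\<And>x. \<bar>g x\<bar> \<le> C"
  shows "integrable M (\<lambda>x. f x * g x)"
proof (rule Bochner_Integration.integrable_bound)
  show "integrable M (\<lambda>x. C * f x)" using f by simp
  show "(\<lambda>x. f x * g x) \<in> borel_measurable M"
    using borel_measurable_integrable[OF f] by measurable
  show "AE x in M. norm (f x * g x) \<le> norm (C * f x)"
  proof (rule AE_I2)
    fix x
    have "\<bar>f x\<bar> * \<bar>g x\<bar> \<le> \<bar>f x\<bar> * \<bar>C\<bar>" using bd[of x] by (intro mult_left_mono) auto
    then show "norm (f x * g x) \<le> norm (C * f x)" by (simp add: abs_mult mult.commute)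
  qed
qed

lemma integrable_segment:
  fixes g :: "'a::euclidean_space \<Rightarrow> real"
  assumes g: "integrable lborel g"
  shows "integrable (lborel \<Otimes>\<^sub>M lborel) (\<lambda>(s::real, x). g (x + s *\<^sub>R z) * indicator {0..1} s)"
proof (rule lborel_pair.Fubini_integrable)
  have [measurable]: "g \<in> borel_measurable borel" using g by simp
  show "(\<lambda>(s::real, x). g (x + s *\<^sub>R z) * indicator {0..1} s) \<in> borel_measurable (lborel \<Otimes>\<^sub>M lborel)"
    by measurable
  have sh: "integrable lborel (\<lambda>x. g (x + s *\<^sub>R z))" for s
    using integrable_lborel_shift[of g "s *\<^sub>R z"] g by (simp add: add.commute)
  then show "AE s in lborel. integrable lborel (\<lambda>y. case (s, y) of (s::real, x) \<Rightarrow> g (x + s *\<^sub>R z) * indicator {0..1} s)"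
    by simp
  have "(LINT x|lborel. norm (g (x + s *\<^sub>R z) * indicator {0..1} s)) = (LINT x|lborel. \<bar>g x\<bar>) * indicator {0..1} s" for s :: real
    using integral_lborel_shift[of "\<lambda>x. \<bar>g x\<bar>" "s *\<^sub>R z"] by (simp add: add.commute abs_mult)
  then show "integrable lborel (\<lambda>s::real. LINT y|lborel. norm (case (s, y) of (s::real, x) \<Rightarrow> g (x + s *\<^sub>R z) * indicator {0..1} s))"
    by simp
qed

text \<open>Bumps alone serve as test functions: translates of bumps are bumps, which the segment
  formula exploits, and bumps determine an integrable function almost everywhere
  (\<open>fundamental_lemma_bump\<close>).\<close>

definition weak_test :: "'a::euclidean_space set \<Rightarrow> ('a \<Rightarrow> real) \<Rightarrow> ('a \<Rightarrow> 'a) \<Rightarrow> bool" where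
  "weak_test V H W \<longleftrightarrow> (\<forall>a r v. 0 < r \<longrightarrow> cball a r \<subseteq> V \<longrightarrow>
     (LINT x|lborel. H x * (grad_bump a r x \<bullet> v)) = - (LINT x|lborel. (W x \<bullet> v) * bump a r x))"

lemma bump_diff_eq_integral:
  fixes a z :: "'a::euclidean_space"
  shows "bump (a + z) r x - bump a r x
    = (LINT s|lborel. - (grad_bump (a + s *\<^sub>R z) r x \<bullet> z) * indicator {0..1} s)"
proof -
  have gr: "grad_bump a r (x - s *\<^sub>R z) = grad_bump (a + s *\<^sub>R z) r x" for s
    by (simp add: grad_bump_def height_def algebra_simps)
  have "(LINT s|lborel. - (grad_bump a r (x - s *\<^sub>R z) \<bullet> z) * indicator {0..1} s)
    = bump a r (x - 1 *\<^sub>R z) - bump a r (x - 0 *\<^sub>R z)"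
  proof (rule integral_FTC_Icc_real[where F = "\<lambda>s. bump a r (x - s *\<^sub>R z)"])
    fix s :: real
    have "((\<lambda>s. bump a r (x - s *\<^sub>R z)) has_derivative
        (\<lambda>h. grad_bump a r (x - s *\<^sub>R z) \<bullet> (- (h *\<^sub>R z)))) (at s)"
      by (rule has_derivative_compose[OF _ has_derivative_bump])
         (auto intro!: derivative_eq_intros)
    moreover have "(\<lambda>h. grad_bump a r (x - s *\<^sub>R z) \<bullet> (- (h *\<^sub>R z))) = (*) (- (grad_bump a r (x - s *\<^sub>R z) \<bullet> z))"
      by (auto simp: fun_eq_iff)
    ultimately show "((\<lambda>s. bump a r (x - s *\<^sub>R z)) has_real_derivative - (grad_bump a r (x - s *\<^sub>R z) \<bullet> z)) (at s)"
      by (simp add: has_field_derivative_def)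
    have "isCont (\<lambda>s. grad_bump a r (x - s *\<^sub>R z)) s"
    proof (rule isCont_o2[where f = "\<lambda>s. x - s *\<^sub>R z" and g = "grad_bump a r"])
      show "isCont (grad_bump a r) (x - s *\<^sub>R z)"
        using continuous_on_grad_bump[of UNIV a r] by (simp add: continuous_on_eq_continuous_at)
    qed (intro continuous_intros)
    then show "isCont (\<lambda>s. - (grad_bump a r (x - s *\<^sub>R z) \<bullet> z)) s"
      by (intro isCont_minus isCont_inner) simp_all
  qed simp
  then show ?thesis by (simp add: gr bump_translate)
qed

text \<open>At a Lebesgue point with \<open>F a \<noteq> 0\<close>, integrating against a small bump
  gives \<open>F a\<close> times the mass of the bump up to an error that is small relative to the
  volume of the ball, and the mass of the bump is comparable to that volume.\<close>

lemma fundamental_lemma_bump: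
  fixes F :: "'a::euclidean_space \<Rightarrow> real"
  assumes F: "integrable lborel F" and V: "open V"
    and 0: "\<And>a r. 0 < r \<Longrightarrow> cball a r \<subseteq> V \<Longrightarrow> (LINT x|lborel. F x * bump a r x) = 0"
  shows "AE x in lborel. x \<in> V \<longrightarrow> F x = 0"
proof -
  have [measurable]: "F \<in> borel_measurable borel" using F by simp
  have "AE a in lborel. a \<in> V \<longrightarrow> lebesgue_point F a"
  proof (rule AE_lebesgue_point)
    fix a assume "a \<in> V"
    have "(\<integral>\<^sup>+x. ennreal (norm (F x)) * indicator (ball a 1) x \<partial>lborel) \<le> (\<integral>\<^sup>+x. ennreal (norm (F x)) \<partial>lborel)"
      by (intro nn_integral_mono) (auto simp: indicator_def)
    also have "\<dots> < \<infinity>" using F unfolding integrable_iff_bounded by simp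
    finally show "\<exists>r>0. (\<integral>\<^sup>+x. ennreal (norm (F x)) * indicator (ball a r) x \<partial>lborel) < \<infinity>"
      by (intro exI[of _ 1]) auto
  qed simp
  then show ?thesis
  proof eventually_elim
    case (elim a)
    show ?case
    proof (intro impI, rule ccontr)
      assume aV: "a \<in> V" and Fa: "F a \<noteq> 0"
      \<comment> \<open>A lower bound for the mean of a bump over its ball: it is at least
        \<open>flat 0 (3 / 4)\<close> on the ball of half the radius, which has the share
        \<open>1 / 2 ^ DIM('a)\<close> of the volume.\<close>
      define c where "c = flat 0 (3 / 4) / 2 ^ DIM('a)"
      have c: "0 < c" by (simp add: c_def flat_pos)
      define \<epsilon> where "\<epsilon> = \<bar>F a\<bar> * c / 2"
      have \<epsilon>: "0 < \<epsilon>" using c Fa by (simp add: \<epsilon>_def)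
      obtain d where d: "0 < d" "cball a d \<subseteq> V" using V aV open_contains_cball by blast
      have "\<forall>\<^sub>F r in at_right (0::real). 0 < r \<and> r < d"
        using d eventually_at_right_real[of 0 d] by simp
      moreover have "\<forall>\<^sub>F r in at_right 0. (\<integral>\<^sup>+x. ennreal (norm (F x - F a)) * indicator (ball a r) x \<partial>lborel)
         \<le> ennreal \<epsilon> * emeasure lborel (ball a r)"
        using elim aV \<epsilon> by (simp add: lebesgue_point_def)
      ultimately obtain r where r: "0 < r" "r < d"
        and L: "(\<integral>\<^sup>+x. ennreal (norm (F x - F a)) * indicator (ball a r) x \<partial>lborel)
         \<le> ennreal \<epsilon> * emeasure lborel (ball a r)"
        using eventually_happens'[OF trivial_limit_at_right_real eventually_conj] by blast
      let ?B = "measure lborel (ball a r)"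
      have Bpos: "0 < ?B" using content_ball_pos[OF r(1), of a] .
      have eB: "emeasure lborel (ball a r) = ennreal ?B"
        using emeasure_lborel_ball_finite[of a r] by (simp add: emeasure_eq_ennreal_measure)
      have iB: "integrable lborel (indicator (ball b \<rho>) :: 'a \<Rightarrow> real)" for b \<rho>
        using emeasure_lborel_ball_finite[of b \<rho>] by (simp add: integrable_indicator_iff)
      have ibump: "integrable lborel (bump a r)"
        by (rule Bochner_Integration.integrable_bound[OF iB[of a r]])
           (use bump_le_indicator[OF r(1)] in auto)
      have iF: "integrable lborel (\<lambda>x. \<bar>F x - F a\<bar> * indicator (ball a r) x)"
      proof -
        have "integrable lborel (\<lambda>x. F x * indicator (ball a r) x - F a * indicator (ball a r) x)"
        proof (intro Bochner_Integration.integrable_diff integrable_mult_right iB)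
          show "integrable lborel (\<lambda>x. F x * indicator (ball a r) x)"
            using F by (rule integrable_bounded_mult[where C=1]) (simp_all add: indicator_def)
        qed
        then have "integrable lborel (\<lambda>x. \<bar>F x * indicator (ball a r) x - F a * indicator (ball a r) x\<bar>)"
          by (rule integrable_abs)
        then show ?thesis
          by (rule Bochner_Integration.integrable_cong[THEN iffD1, rotated -1]) (auto simp: indicator_def)
      qed
      have "ennreal (LINT x|lborel. \<bar>F x - F a\<bar> * indicator (ball a r) x)
        = (\<integral>\<^sup>+x. ennreal (norm (F x - F a)) * indicator (ball a r) x \<partial>lborel)"
        by (subst nn_integral_eq_integral[OF iF, symmetric])
           (auto simp: ennreal_mult ennreal_indicator)
      also have "\<dots> \<le> ennreal (\<epsilon> * ?B)" using L \<epsilon> by (simp add: eB ennreal_mult)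
      finally have small: "(LINT x|lborel. \<bar>F x - F a\<bar> * indicator (ball a r) x) \<le> \<epsilon> * ?B"
        using \<epsilon> Bpos by (subst (asm) ennreal_le_iff) (auto intro: mult_nonneg_nonneg)
      have big: "c * ?B \<le> (LINT x|lborel. bump a r x)"
      proof -
        have "c * ?B = flat 0 (3 / 4) * measure lborel (ball a (r / 2))"
          using r by (simp add: c_def content_ball power_divide)
        also have "\<dots> = (LINT x|lborel. flat 0 (3 / 4) * indicator (ball a (r / 2)) x)"
          by simp
        also have "\<dots> \<le> (LINT x|lborel. bump a r x)"
          using iB by (intro integral_mono ibump bump_lower[OF r(1)]) auto
        finally show ?thesis .
      qed
      have iFb: "integrable lborel (\<lambda>x. F x * bump a r x)"
        using F by (intro integrable_bounded_mult[where C=1]) (auto simp: bump_le_1)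
      have "F a * (LINT x|lborel. bump a r x)
        = - ((LINT x|lborel. F x * bump a r x) - F a * (LINT x|lborel. bump a r x))"
        using 0[of r a] r d by (auto simp: subset_iff)
      also have "(LINT x|lborel. F x * bump a r x) - F a * (LINT x|lborel. bump a r x)
        = (LINT x|lborel. F x * bump a r x - F a * bump a r x)"
        using iFb ibump by simp
      finally have "\<bar>F a * (LINT x|lborel. bump a r x)\<bar> = \<bar>LINT x|lborel. F x * bump a r x - F a * bump a r x\<bar>"
        by simp
      then have "\<bar>F a\<bar> * (LINT x|lborel. bump a r x) = \<bar>LINT x|lborel. F x * bump a r x - F a * bump a r x\<bar>"
        by (simp add: abs_mult)
      also have "\<dots> \<le> (LINT x|lborel. \<bar>F x * bump a r x - F a * bump a r x\<bar>)"
        by (rule integral_abs_bound)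
      also have "\<dots> \<le> (LINT x|lborel. \<bar>F x - F a\<bar> * indicator (ball a r) x)"
      proof (intro integral_mono)
        show "integrable lborel (\<lambda>x. \<bar>F x * bump a r x - F a * bump a r x\<bar>)"
          using iFb ibump by simp
        fix x
        have "\<bar>F x * bump a r x - F a * bump a r x\<bar> = \<bar>F x - F a\<bar> * bump a r x"
          by (simp add: left_diff_distrib[symmetric] abs_mult)
        also have "\<dots> \<le> \<bar>F x - F a\<bar> * indicator (ball a r) x"
          using bump_le_indicator[OF r(1)] by (intro mult_left_mono) auto
        finally show "\<bar>F x * bump a r x - F a * bump a r x\<bar> \<le> \<bar>F x - F a\<bar> * indicator (ball a r) x" .
      qed (use iF in auto)
      also note small
      finally have "\<bar>F a\<bar> * (c * ?B) \<le> \<epsilon> * ?B"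
        using mult_left_mono[OF big, of "\<bar>F a\<bar>"] by simp
      then have "\<bar>F a\<bar> * c \<le> \<epsilon>" using Bpos by simp
      then show False using c Fa by (simp add: \<epsilon>_def)
    qed
  qed
qed

locale weak_gradient =
  fixes V :: "'a::euclidean_space set" and H :: "'a \<Rightarrow> real" and W :: "'a \<Rightarrow> 'a"
  assumes H: "integrable lborel H" and W: "integrable lborel W" and test: "weak_test V H W"
begin

lemma [measurable]: "H \<in> borel_measurable borel" "W \<in> borel_measurable borel"
  using H W by auto

lemma integrable_W_inner: "integrable lborel (\<lambda>x. W x \<bullet> z)"
  using W by simp

text \<open>The translation by \<open>z\<close> is moved onto the bump, the difference of the two
  bumps is the integral of a gradient over the segment of centres, and for each intermediate centre
  the weak gradient identity applies. Shifting back gives the fundamental theorem of calculus in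
  weak form.\<close>

lemma integral_segment_bump:
  assumes "0 < r" and cb: "\<And>s. 0 \<le> s \<Longrightarrow> s \<le> 1 \<Longrightarrow> cball (a + s *\<^sub>R z) r \<subseteq> V"
  shows "(LINT x|lborel. (H (x + z) - H x) * bump a r x)
    = (LINT x|lborel. (LINT s|lborel. (W (x + s *\<^sub>R z) \<bullet> z) * indicator {0..1} s) * bump a r x)"
proof -
  have iHz: "integrable lborel (\<lambda>x. H (x + z))"
    using integrable_lborel_shift[of H z] H by (simp add: add.commute)
  have ib: "integrable lborel (\<lambda>x. g x * bump b r x)" if "integrable lborel g" for b g
    using that by (intro integrable_bounded_mult[where C=1]) (auto simp: bump_le_1)
  have "(LINT x|lborel. (H (x + z) - H x) * bump a r x)
    = (LINT x|lborel. H (z + x) * bump (a + z) r (z + x)) - (LINT x|lborel. H x * bump a r x)"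
  proof -
    have "bump (a + z) r (z + x) = bump a r x" for x
      using bump_translate[of a r "z + x" z] by simp
    then show ?thesis using ib[OF iHz] ib[OF H] by (simp add: left_diff_distrib add.commute)
  qed
  also have "\<dots> = (LINT x|lborel. H x * (bump (a + z) r x - bump a r x))"
    using integral_lborel_shift[of "\<lambda>x. H x * bump (a + z) r x" z] ib[OF H]
    by (simp add: right_diff_distrib)
  also have "\<dots> = (LINT x|lborel. (LINT s|lborel. (H x * indicator {0..1} s) * - (grad_bump (a + s *\<^sub>R z) r x \<bullet> z)))"
    unfolding bump_diff_eq_integral
    by (subst integral_mult_right_zero[symmetric]) (simp add: ac_simps)
  also have "\<dots> = (LINT s|lborel. (LINT x|lborel. (H x * indicator {0..1} s) * - (grad_bump (a + s *\<^sub>R z) r x \<bullet> z)))"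
  proof (rule lborel_pair.Fubini_integral)
    have 1: "integrable (lborel \<Otimes>\<^sub>M lborel) (\<lambda>(s::real, x). H x * indicator {0..1} s)"
      using integrable_segment[OF H, of 0] by simp
    have gb: "(\<lambda>(s::real, x). grad_bump (a + s *\<^sub>R z) r x) \<in> borel_measurable (lborel \<Otimes>\<^sub>M lborel)"
      unfolding grad_bump_def height_def by measurable
    have "integrable (lborel \<Otimes>\<^sub>M lborel) (\<lambda>p. (case p of (s::real, x) \<Rightarrow> H x * indicator {0..1} s) *
       - ((case p of (s::real, x) \<Rightarrow> grad_bump (a + s *\<^sub>R z) r x) \<bullet> z))"
    proof (rule integrable_bounded_mult[OF 1, where C="4 / r * norm z"])
      show "(\<lambda>p. - ((case p of (s::real, x) \<Rightarrow> grad_bump (a + s *\<^sub>R z) r x) \<bullet> z)) \<in> borel_measurable (lborel \<Otimes>\<^sub>M lborel)"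
        using gb by measurable
      fix p :: "real \<times> 'a"
      obtain s x where p: "p = (s, x)" by force
      have "\<bar>grad_bump (a + s *\<^sub>R z) r x \<bullet> z\<bar> \<le> norm (grad_bump (a + s *\<^sub>R z) r x) * norm z"
        by (rule Cauchy_Schwarz_ineq2)
      also have "\<dots> \<le> 4 / r * norm z"
        using norm_grad_bump_le[OF assms(1)] by (intro mult_right_mono) auto
      finally show "\<bar>- ((case p of (s::real, x) \<Rightarrow> grad_bump (a + s *\<^sub>R z) r x) \<bullet> z)\<bar> \<le> 4 / r * norm z"
        by (simp add: p)
    qed
    then show "integrable (lborel \<Otimes>\<^sub>M lborel) (\<lambda>(s, x). H x * indicator {0..1} s * - (grad_bump (a + s *\<^sub>R z) r x \<bullet> z))"
      by (simp add: case_prod_beta')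
  qed
  also have "\<dots> = (LINT s|lborel. (LINT x|lborel. (W (x + s *\<^sub>R z) \<bullet> z) * indicator {0..1} s * bump a r x))"
  proof (rule Bochner_Integration.integral_cong[OF refl])
    fix s :: real
    show "(LINT x|lborel. H x * indicator {0..1} s * - (grad_bump (a + s *\<^sub>R z) r x \<bullet> z))
      = (LINT x|lborel. (W (x + s *\<^sub>R z) \<bullet> z) * indicator {0..1} s * bump a r x)"
    proof (cases "0 \<le> s \<and> s \<le> 1")
      case True
      have "(LINT x|lborel. (W (x + s *\<^sub>R z) \<bullet> z) * bump a r x)
        = (LINT x|lborel. (W (s *\<^sub>R z + x) \<bullet> z) * bump (a + s *\<^sub>R z) r (s *\<^sub>R z + x))"
        using bump_translate[of a r "s *\<^sub>R z + x" "s *\<^sub>R z" for x] by (simp add: add.commute)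
      also have "\<dots> = (LINT x|lborel. (W x \<bullet> z) * bump (a + s *\<^sub>R z) r x)"
        by (rule integral_lborel_shift[of "\<lambda>x. (W x \<bullet> z) * bump (a + s *\<^sub>R z) r x"]) measurable
      also have "\<dots> = - (LINT x|lborel. H x * (grad_bump (a + s *\<^sub>R z) r x \<bullet> z))"
        using test assms(1) cb[of s] True unfolding weak_test_def by (metis add.inverse_inverse)
      finally show ?thesis using True by simp
    qed simp
  qed
  also have "\<dots> = (LINT x|lborel. (LINT s|lborel. (W (x + s *\<^sub>R z) \<bullet> z) * indicator {0..1} s * bump a r x))"
  proof (rule lborel_pair.Fubini_integral[symmetric])
    have "integrable (lborel \<Otimes>\<^sub>M lborel) (\<lambda>p. (case p of (s::real, x) \<Rightarrow> (W (x + s *\<^sub>R z) \<bullet> z) * indicator {0..1} s) * bump a r (snd p))"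
      by (rule integrable_bounded_mult[OF integrable_segment[OF integrable_W_inner], where C=1]) (auto simp: bump_le_1)
    then show "integrable (lborel \<Otimes>\<^sub>M lborel) (\<lambda>(s::real, x). (W (x + s *\<^sub>R z) \<bullet> z) * indicator {0..1} s * bump a r x)"
      by (simp add: case_prod_beta')
  qed
  finally show ?thesis by simp
qed

lemma segment_formula:
  assumes V': "open V'" and sub: "\<And>x s. x \<in> V' \<Longrightarrow> 0 \<le> s \<Longrightarrow> s \<le> 1 \<Longrightarrow> x + s *\<^sub>R z \<in> V"
  shows "AE x in lborel. x \<in> V' \<longrightarrow>
    H (x + z) - H x = (LINT s|lborel. (W (x + s *\<^sub>R z) \<bullet> z) * indicator {0..1} s)"
proof -
  define F where "F x = (H (x + z) - H x) - (LINT s|lborel. (W (x + s *\<^sub>R z) \<bullet> z) * indicator {0..1} s)" for x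
  have i1: "integrable lborel (\<lambda>x. H (x + z) - H x)"
    using integrable_lborel_shift[of H z] H by (simp add: add.commute)
  have i2: "integrable lborel (\<lambda>x. LINT s|lborel. (W (x + s *\<^sub>R z) \<bullet> z) * indicator {0..1} s)"
    using lborel_pair.integrable_snd[OF integrable_segment[OF integrable_W_inner]] .
  have "AE x in lborel. x \<in> V' \<longrightarrow> F x = 0"
  proof (rule fundamental_lemma_bump[OF _ V'])
    show "integrable lborel F" unfolding F_def using i1 i2 by simp
    fix a r assume r: "0 < r" and ar: "cball a r \<subseteq> V'"
    have cb: "cball (a + s *\<^sub>R z) r \<subseteq> V" if "0 \<le> s" "s \<le> 1" for s
    proof
      fix y assume "y \<in> cball (a + s *\<^sub>R z) r"
      then have "y - s *\<^sub>R z \<in> V'" using ar by (auto simp: dist_norm algebra_simps subset_iff)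
      from sub[OF this that] show "y \<in> V" by simp
    qed
    have ib: "integrable lborel (\<lambda>x. g x * bump a r x)" if "integrable lborel g" for g
      using that by (intro integrable_bounded_mult[where C=1]) (auto simp: bump_le_1)
    show "(LINT x|lborel. F x * bump a r x) = 0"
      unfolding F_def using integral_segment_bump[OF r cb] ib[OF i1] ib[OF i2]
      by (simp add: left_diff_distrib)
  qed
  then show ?thesis by eventually_elim (auto simp: F_def)
qed

text \<open>The exceptional set of \<open>segment_formula\<close> depends on \<open>z\<close>.
  Exchanging the two quantifiers by Fubini yields base points \<open>x\<close> that are good for
  almost every \<open>z\<close>, as is required to fix the point of differentiation.\<close>

lemma segment_formula_pairs:
  assumes V': "open V'" and sub: "\<And>x. x \<in> V' \<Longrightarrow> ball x \<rho> \<subseteq> V"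
  shows "AE x in lborel. AE z in lborel. x \<in> V' \<longrightarrow> norm z < \<rho> \<longrightarrow>
    H (x + z) - H x = (LINT s|lborel. (W (x + s *\<^sub>R z) \<bullet> z) * indicator {0..1} s)"
proof (subst lborel_pair.AE_commute)
  have [measurable]: "V' \<in> sets borel" using V' by simp
  show "{p \<in> space (lborel \<Otimes>\<^sub>M lborel). fst p \<in> V' \<longrightarrow> norm (snd p) < \<rho> \<longrightarrow>
     H (fst p + snd p) - H (fst p) = (LINT s|lborel. (W (fst p + s *\<^sub>R snd p) \<bullet> snd p) * indicator {0..1} s)}
    \<in> sets (lborel \<Otimes>\<^sub>M lborel)"
    by measurable
  show "AE z in lborel. AE x in lborel. x \<in> V' \<longrightarrow> norm z < \<rho> \<longrightarrow>
    H (x + z) - H x = (LINT s|lborel. (W (x + s *\<^sub>R z) \<bullet> z) * indicator {0..1} s)"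
  proof (rule AE_I2)
    fix z :: 'a
    show "AE x in lborel. x \<in> V' \<longrightarrow> norm z < \<rho> \<longrightarrow>
      H (x + z) - H x = (LINT s|lborel. (W (x + s *\<^sub>R z) \<bullet> z) * indicator {0..1} s)"
    proof (cases "norm z < \<rho>")
      case True
      have mem: "x + s *\<^sub>R z \<in> V" if "x \<in> V'" "0 \<le> s" "s \<le> 1" for x s
      proof -
        have "norm (s *\<^sub>R z) \<le> norm z" using that by (simp add: mult_left_le_one_le)
        then have "x + s *\<^sub>R z \<in> ball x \<rho>" using True by (simp add: dist_norm)
        then show ?thesis using sub[OF that(1)] by blast
      qed
      have "AE x in lborel. x \<in> V' \<longrightarrow>
        H (x + z) - H x = (LINT s|lborel. (W (x + s *\<^sub>R z) \<bullet> z) * indicator {0..1} s)"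
        by (rule segment_formula[OF V']) (rule mem)
      then show ?thesis by eventually_elim auto
    qed simp
  qed
qed

end

text \<open>The triangle below the diagonal carries half of the double integral. This takes the
  place of differentiating the square of a primitive of \<open>g\<close>, which is merely absolutely
  continuous.\<close>

lemma integral_triangle_square:
  fixes g :: "real \<Rightarrow> real"
  assumes g: "integrable lborel g"
  shows "2 * (LINT s|lborel. (LINT t|lborel. g t * indicator {..s} t) * g s) = (LINT t|lborel. g t)\<^sup>2"
proof -
  have [measurable]: "g \<in> borel_measurable borel" using g by simp
  have ii: "integrable (lborel \<Otimes>\<^sub>M lborel) (\<lambda>(t, s). g t * g s)"
  proof (rule lborel_pair.Fubini_integrable)
    show "integrable lborel (\<lambda>t. LINT s|lborel. norm (case (t, s) of (t, s) \<Rightarrow> g t * g s))"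
      using g by (simp add: abs_mult)
  qed (use g in auto)
  have i1: "integrable (lborel \<Otimes>\<^sub>M lborel) (\<lambda>(t, s). g t * g s * indicator {..s} t)"
    using integrable_bounded_mult[OF ii, of "\<lambda>(t, s). indicator {..s} t" 1]
    by (simp add: case_prod_beta' indicator_def)
  have i2: "integrable (lborel \<Otimes>\<^sub>M lborel) (\<lambda>(t, s). g t * g s * indicator {s..} t)"
    using integrable_bounded_mult[OF ii, of "\<lambda>(t, s). indicator {s..} t" 1]
    by (simp add: case_prod_beta' indicator_def)
  let ?I = "LINT s|lborel. (LINT t|lborel. g t * g s * indicator {..s} t)"
  have I: "(LINT s|lborel. (LINT t|lborel. g t * indicator {..s} t) * g s) = ?I"
    by (intro Bochner_Integration.integral_cong refl)
       (simp add: integral_mult_left_zero[symmetric] ac_simps)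
  have "?I = (LINT t|lborel. (LINT s|lborel. g t * g s * indicator {..s} t))"
    by (rule lborel_pair.Fubini_integral[OF i1])
  also have "\<dots> = (LINT s|lborel. (LINT t|lborel. g t * g s * indicator {s..} t))"
    by (simp add: indicator_def mult.commute)
  finally have I': "?I = (LINT s|lborel. (LINT t|lborel. g t * g s * indicator {s..} t))" .
  have "?I + ?I = (LINT s|lborel. (LINT t|lborel. g t * g s * indicator {..s} t) +
     (LINT t|lborel. g t * g s * indicator {s..} t))"
    using I' lborel_pair.integrable_snd[OF i1] lborel_pair.integrable_snd[OF i2] by simp
  also have "\<dots> = (LINT s|lborel. (LINT t|lborel. g t) * g s)"
  proof (rule Bochner_Integration.integral_cong[OF refl])
    fix s
    have j: "integrable lborel (\<lambda>t. g t * g s * indicator {..s} t)" "integrable lborel (\<lambda>t. g t * g s * indicator {s..} t)"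
      using integrable_bounded_mult[of lborel "\<lambda>t. g t * g s" "indicator {..s}" 1]
        integrable_bounded_mult[of lborel "\<lambda>t. g t * g s" "indicator {s..}" 1] g
      by (auto simp: indicator_def)
    have "(LINT t|lborel. g t * g s * indicator {..s} t) + (LINT t|lborel. g t * g s * indicator {s..} t)
      = (LINT t|lborel. g t * g s * indicator {..s} t + g t * g s * indicator {s..} t)"
      using j by simp
    also have "\<dots> = (LINT t|lborel. g t * g s)"
    proof (rule integral_cong_AE)
      show "AE t in lborel. g t * g s * indicator {..s} t + g t * g s * indicator {s..} t = g t * g s"
        using AE_lborel_singleton[of s] by eventually_elim (auto simp: indicator_def)
    qed auto
    also have "\<dots> = (LINT t|lborel. g t) * g s" by simp
    finally show "(LINT t|lborel. g t * g s * indicator {..s} t) + (LINT t|lborel. g t * g s * indicator {s..} t)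
       = (LINT t|lborel. g t) * g s" .
  qed
  finally show ?thesis using I by (simp add: power2_eq_square)
qed

section \<open>The chain rule for the square of a Sobolev function\<close>

locale weak_gradient_L2 = weak_gradient +
  assumes H2: "integrable lborel (\<lambda>x. (H x)\<^sup>2)" and W2: "integrable lborel (\<lambda>x. (norm (W x))\<^sup>2)"
begin

lemma integrable_HW: "integrable lborel (\<lambda>x. H x * (W x \<bullet> z))"
proof (rule Bochner_Integration.integrable_bound)
  show "integrable lborel (\<lambda>x. (H x)\<^sup>2 + (norm z)\<^sup>2 * (norm (W x))\<^sup>2)" using H2 W2 by simp
  show "AE x in lborel. norm (H x * (W x \<bullet> z)) \<le> norm ((H x)\<^sup>2 + (norm z)\<^sup>2 * (norm (W x))\<^sup>2)"
  proof (rule AE_I2)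
    fix x
    have "norm (H x * (W x \<bullet> z)) \<le> \<bar>H x\<bar> * (norm z * norm (W x))"
      using Cauchy_Schwarz_ineq2[of "W x" z] by (simp add: abs_mult mult_left_mono mult.commute)
    also have "2 * (\<bar>H x\<bar> * (norm z * norm (W x))) \<le> \<bar>H x\<bar>\<^sup>2 + (norm z * norm (W x))\<^sup>2"
      using sum_squares_bound[of "\<bar>H x\<bar>" "norm z * norm (W x)"] by simp
    finally show "norm (H x * (W x \<bullet> z)) \<le> norm ((H x)\<^sup>2 + (norm z)\<^sup>2 * (norm (W x))\<^sup>2)"
      by (simp add: power_mult_distrib)
  qed
qed measurable

text \<open>On almost every segment \<open>H\<close> equals \<open>H x\<close> plus the primitive
  \<open>G\<close> of an integrable \<open>g\<close>. The integral of
  \<open>2 * (H x + G s) * g s\<close> is then evaluated by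
  \<open>integral_triangle_square\<close>.\<close>

lemma square_segment_formula:
  assumes V': "open V'" and sub: "\<And>x s. x \<in> V' \<Longrightarrow> 0 \<le> s \<Longrightarrow> s \<le> 1 \<Longrightarrow> x + s *\<^sub>R z \<in> V"
  shows "AE x in lborel. x \<in> V' \<longrightarrow> (H (x + z))\<^sup>2 - (H x)\<^sup>2
    = (LINT s|lborel. 2 * (H (x + s *\<^sub>R z) * (W (x + s *\<^sub>R z) \<bullet> z)) * indicator {0..1} s)"
proof -
  have [measurable]: "V' \<in> sets borel" using V' by simp
  \<comment> \<open>\<open>segment_formula\<close> is applied to every shorter vector
    \<open>s *\<^sub>R z\<close>; Fubini then gives the primitive at almost every \<open>s\<close>
    of almost every segment.\<close>
  have "AE s in lborel. AE x in lborel. x \<in> V' \<longrightarrow> s \<in> {0<..(1::real)} \<longrightarrow>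
    H (x + s *\<^sub>R z) - H x = (LINT t|lborel. (W (x + t *\<^sub>R s *\<^sub>R z) \<bullet> (s *\<^sub>R z)) * indicator {0..1} t)"
  proof (rule AE_I2)
    fix s :: real
    show "AE x in lborel. x \<in> V' \<longrightarrow> s \<in> {0<..(1::real)} \<longrightarrow>
      H (x + s *\<^sub>R z) - H x = (LINT t|lborel. (W (x + t *\<^sub>R s *\<^sub>R z) \<bullet> (s *\<^sub>R z)) * indicator {0..1} t)"
    proof (cases "s \<in> {0<..1}")
      case True
      have mem: "x + t *\<^sub>R s *\<^sub>R z \<in> V" if "x \<in> V'" "0 \<le> t" "t \<le> 1" for x t
        using sub[of x "t * s"] that True by (simp add: mult_le_one)
      have "AE x in lborel. x \<in> V' \<longrightarrow> H (x + s *\<^sub>R z) - H x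
        = (LINT t|lborel. (W (x + t *\<^sub>R s *\<^sub>R z) \<bullet> (s *\<^sub>R z)) * indicator {0..1} t)"
        by (rule segment_formula[OF V']) (rule mem)
      then show ?thesis by eventually_elim auto
    qed (intro AE_I2, auto)
  qed
  then have pairs: "AE x in lborel. AE s in lborel. x \<in> V' \<longrightarrow> s \<in> {0<..(1::real)} \<longrightarrow>
    H (x + s *\<^sub>R z) - H x = (LINT t|lborel. (W (x + t *\<^sub>R s *\<^sub>R z) \<bullet> (s *\<^sub>R z)) * indicator {0..1} t)"
  proof (subst lborel_pair.AE_commute)
    show "{p \<in> space (lborel \<Otimes>\<^sub>M lborel). fst p \<in> V' \<longrightarrow> snd p \<in> {0<..(1::real)} \<longrightarrow>
      H (fst p + snd p *\<^sub>R z) - H (fst p) =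
      (LINT t|lborel. (W (fst p + t *\<^sub>R snd p *\<^sub>R z) \<bullet> (snd p *\<^sub>R z)) * indicator {0..1} t)} \<in> sets (lborel \<Otimes>\<^sub>M lborel)"
      by measurable
  qed
  have int: "AE x in lborel. integrable lborel (\<lambda>s. (W (x + s *\<^sub>R z) \<bullet> z) * indicator {0..1} s)"
    using lborel_pair.AE_integrable_snd[OF integrable_segment[OF integrable_W_inner]] .
  have "AE x in lborel. x \<in> V' \<longrightarrow>
    H (x + z) - H x = (LINT s|lborel. (W (x + s *\<^sub>R z) \<bullet> z) * indicator {0..1} s)"
    by (rule segment_formula[OF V']) (rule sub)
  with pairs int show ?thesis
  proof eventually_elim
    case (elim x)
    show ?case
    proof
      assume x: "x \<in> V'"
      define g where "g s = (W (x + s *\<^sub>R z) \<bullet> z) * indicator {0..1} s" for s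
      have g: "integrable lborel g" using elim(2) unfolding g_def .
      then have [measurable]: "g \<in> borel_measurable borel" by simp
      define G where "G s = (LINT t|lborel. g t * indicator {..s} t)" for s
      have Gs: "(LINT t|lborel. (W (x + t *\<^sub>R s *\<^sub>R z) \<bullet> (s *\<^sub>R z)) * indicator {0..1} t) = G s" if s: "0 < s" "s \<le> 1" for s
      proof -
        have "G s = \<bar>s\<bar> *\<^sub>R (LINT t|lborel. g (0 + s * t) * indicator {..s} (0 + s * t))"
          unfolding G_def using s by (intro lborel_integral_real_affine) auto
        also have "\<dots> = (LINT t|lborel. s * (g (s * t) * indicator {..s} (s * t)))"
          using s by simp
        also have "\<dots> = (LINT t|lborel. (W (x + t *\<^sub>R s *\<^sub>R z) \<bullet> (s *\<^sub>R z)) * indicator {0..1} t)"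
          using s by (intro Bochner_Integration.integral_cong refl)
            (auto simp: g_def indicator_def ac_simps zero_le_mult_iff mult_le_one)
        finally show ?thesis ..
      qed
      have Hs: "AE s in lborel. s \<in> {0<..1} \<longrightarrow> H (x + s *\<^sub>R z) = H x + G s"
        using elim(1) by eventually_elim (use x Gs in \<open>auto simp: algebra_simps\<close>)
      have H1: "H (x + z) = H x + (LINT t|lborel. g t)" using elim(3) x by (simp add: g_def)
      have Gbd: "\<bar>G s\<bar> \<le> (LINT t|lborel. \<bar>g t\<bar>)" for s
      proof -
        have "\<bar>G s\<bar> \<le> (LINT t|lborel. \<bar>g t * indicator {..s} t\<bar>)"
          unfolding G_def by (rule integral_abs_bound)
        also have "\<dots> \<le> (LINT t|lborel. \<bar>g t\<bar>)"
          using g by (intro integral_mono integrable_abs integrable_bounded_mult[where C=1])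
            (auto simp: indicator_def)
        finally show ?thesis .
      qed
      have [measurable]: "G \<in> borel_measurable borel"
        unfolding G_def indicator_def atMost_iff by measurable
      have iG: "integrable lborel (\<lambda>s. g s * G s)"
        using g Gbd by (intro integrable_bounded_mult) auto
      have "(LINT s|lborel. 2 * (H (x + s *\<^sub>R z) * (W (x + s *\<^sub>R z) \<bullet> z)) * indicator {0..1} s)
        = (LINT s|lborel. 2 * H x * g s + 2 * (G s * g s))"
      proof (rule integral_cong_AE)
        show "AE s in lborel. 2 * (H (x + s *\<^sub>R z) * (W (x + s *\<^sub>R z) \<bullet> z)) * indicator {0..1} s
          = 2 * H x * g s + 2 * (G s * g s)"
          using Hs AE_lborel_singleton[of "0::real"]
          by eventually_elim (auto simp: g_def indicator_def algebra_simps)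
      qed auto
      also have "\<dots> = 2 * H x * (LINT s|lborel. g s) + 2 * (LINT s|lborel. G s * g s)"
        using g iG by (simp add: mult.commute)
      also have "2 * (LINT s|lborel. G s * g s) = (LINT s|lborel. g s)\<^sup>2"
        unfolding G_def by (rule integral_triangle_square[OF g])
      finally show "(H (x + z))\<^sup>2 - (H x)\<^sup>2
        = (LINT s|lborel. 2 * (H (x + s *\<^sub>R z) * (W (x + s *\<^sub>R z) \<bullet> z)) * indicator {0..1} s)"
        unfolding H1 by (simp add: power2_eq_square algebra_simps)
    qed
  qed
qed

lemma weak_gradient_square:
  assumes V': "open V'" and \<rho>: "0 < \<rho>" and sub: "\<And>x. x \<in> V' \<Longrightarrow> ball x \<rho> \<subseteq> V"
    and D: "\<And>x. (\<psi> has_derivative (\<lambda>v. g x \<bullet> v)) (at x)" and gC: "\<And>x. norm (g x) \<le> C"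
    and g[measurable]: "g \<in> borel_measurable borel"
    and \<psi>C: "\<And>x. \<bar>\<psi> x\<bar> \<le> C" and supp: "\<And>x. x \<notin> V' \<Longrightarrow> \<psi> x = 0"
  shows "(LINT x|lborel. (H x)\<^sup>2 * (g x \<bullet> v)) = - 2 * (LINT x|lborel. H x * (W x \<bullet> v) * \<psi> x)"
proof -
  have cont: "continuous_on UNIV \<psi>"
    by (rule has_derivative_continuous_on[OF has_derivative_at_withinI[OF D]])
  have [measurable]: "\<psi> \<in> borel_measurable borel"
    using cont by (rule borel_measurable_continuous_onI)
  have lip: "\<bar>\<psi> y - \<psi> x\<bar> \<le> C * norm (y - x)" for x y
  proof -
    have "norm (\<psi> y - \<psi> x) \<le> C * norm (y - x)"
    proof (rule differentiable_bound[of UNIV])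
      show "(\<psi> has_derivative (\<lambda>v. g x \<bullet> v)) (at x within UNIV)" for x using D by simp
      show "onorm (\<lambda>v. g x \<bullet> v) \<le> C" for x
      proof (rule onorm_le)
        fix v
        have "norm (g x \<bullet> v) \<le> norm (g x) * norm v" by (simp add: Cauchy_Schwarz_ineq2)
        also have "\<dots> \<le> C * norm v" using gC by (intro mult_right_mono) auto
        finally show "norm (g x \<bullet> v) \<le> C * norm v" .
      qed
    qed auto
    then show ?thesis by simp
  qed
  have C0: "0 \<le> C" using \<psi>C abs_ge_zero order_trans by blast
  \<comment> \<open>Step lengths tending to 0, so short that segments starting in \<open>V'\<close>
    stay in \<open>V\<close>; the \<open>+ 1\<close> covers \<open>v = 0\<close>.\<close>
  define \<tau> where "\<tau> n = \<rho> / (norm v + 1) / real (Suc n)" for n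
  have \<tau>: "0 < \<tau> n" "norm (\<tau> n *\<^sub>R v) < \<rho>" for n
  proof -
    show "0 < \<tau> n" using \<rho> unfolding \<tau>_def by (intro divide_pos_pos add_nonneg_pos) auto
    have "\<tau> n \<le> \<rho> / (norm v + 1)"
    proof -
      define b where "b = \<rho> / (norm v + 1)"
      have "0 \<le> b" using \<rho> by (auto simp: b_def intro!: divide_nonneg_nonneg)
      then show ?thesis unfolding \<tau>_def b_def[symmetric] by (simp add: pos_divide_le_eq distrib_left)
    qed
    then have "\<tau> n * norm v \<le> \<rho> / (norm v + 1) * norm v" by (rule mult_right_mono) simp
    also have "\<dots> < \<rho>"
    proof -
      have "0 < norm v + 1" by (simp add: add_nonneg_pos)
      then show ?thesis using \<rho> by (simp add: field_simps)
    qed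
    finally show "norm (\<tau> n *\<^sub>R v) < \<rho>" using \<open>0 < \<tau> n\<close> by simp
  qed
  have \<tau>0: "\<tau> \<longlonglongrightarrow> 0"
    unfolding \<tau>_def using LIMSEQ_Suc[OF lim_const_over_n[of "\<rho> / (norm v + 1)"]] by simp
  let ?h = "\<lambda>x. H x * (W x \<bullet> v)"
  have iH2\<psi>: "integrable lborel (\<lambda>x. (H x)\<^sup>2 * k x)" if "k \<in> borel_measurable borel" "\<And>x. \<bar>k x\<bar> \<le> K" for k K
    using that by (intro integrable_bounded_mult[OF H2]) auto
  have ih\<psi>: "integrable lborel (\<lambda>x. ?h x * k x)" if "k \<in> borel_measurable borel" "\<And>x. \<bar>k x\<bar> \<le> K" for k K
    using that by (intro integrable_bounded_mult[OF integrable_HW]) auto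
  have eq: "(LINT x|lborel. (H x)\<^sup>2 * ((\<psi> (x - \<tau> n *\<^sub>R v) - \<psi> x) / \<tau> n))
    = 2 * (LINT s|lborel. (LINT x|lborel. ?h x * \<psi> (x - s *\<^sub>R \<tau> n *\<^sub>R v)) * indicator {0..1} s)" for n
  proof -
    let ?z = "\<tau> n *\<^sub>R v"
    have mem: "x + s *\<^sub>R ?z \<in> V" if "x \<in> V'" "0 \<le> s" "s \<le> 1" for x s
    proof -
      have "norm (s *\<^sub>R ?z) \<le> norm ?z"
        unfolding norm_scaleR[of s ?z] using that by (intro mult_left_le_one_le) auto
      then have "x + s *\<^sub>R ?z \<in> ball x \<rho>" using \<tau>(2)[of n] by (simp add: dist_norm)
      then show ?thesis using sub[OF that(1)] by blast
    qed
    have AEx: "AE x in lborel. ((H (x + ?z))\<^sup>2 - (H x)\<^sup>2) * \<psi> x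
      = (LINT s|lborel. 2 * (H (x + s *\<^sub>R ?z) * (W (x + s *\<^sub>R ?z) \<bullet> ?z)) * indicator {0..1} s) * \<psi> x"
    proof -
      have "AE x in lborel. x \<in> V' \<longrightarrow> (H (x + ?z))\<^sup>2 - (H x)\<^sup>2
        = (LINT s|lborel. 2 * (H (x + s *\<^sub>R ?z) * (W (x + s *\<^sub>R ?z) \<bullet> ?z)) * indicator {0..1} s)"
        by (rule square_segment_formula[OF V']) (rule mem)
      then show ?thesis by eventually_elim (use supp in auto)
    qed
    have i1: "integrable lborel (\<lambda>x. (H x)\<^sup>2 * \<psi> (x - ?z))" "integrable lborel (\<lambda>x. (H x)\<^sup>2 * \<psi> x)"
      by (auto intro!: iH2\<psi> \<psi>C)
    have i1': "integrable lborel (\<lambda>x. (H (?z + x))\<^sup>2 * \<psi> x)"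
      using integrable_lborel_shift[of "\<lambda>x. (H x)\<^sup>2 * \<psi> (x - ?z)" ?z] i1(1) by simp
    have i2: "integrable (lborel \<Otimes>\<^sub>M lborel) (\<lambda>(s::real, x). (2 * (H (x + s *\<^sub>R ?z) * (W (x + s *\<^sub>R ?z) \<bullet> ?z))) * indicator {0..1} s * \<psi> x)"
      using integrable_bounded_mult[OF integrable_segment[of "\<lambda>x. 2 * (H x * (W x \<bullet> ?z))" ?z], of "\<lambda>p. \<psi> (snd p)" C]
        \<psi>C integrable_HW[of ?z] by (simp add: case_prod_beta')
    have "(LINT x|lborel. (H x)\<^sup>2 * (\<psi> (x - ?z) - \<psi> x))
      = (LINT x|lborel. (H (?z + x))\<^sup>2 * \<psi> x) - (LINT x|lborel. (H x)\<^sup>2 * \<psi> x)"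
      using i1 integral_lborel_shift[of "\<lambda>x. (H x)\<^sup>2 * \<psi> (x - ?z)" ?z]
      by (simp add: right_diff_distrib)
    also have "\<dots> = (LINT x|lborel. ((H (x + ?z))\<^sup>2 - (H x)\<^sup>2) * \<psi> x)"
      using i1 i1' by (simp add: left_diff_distrib add.commute)
    also have "\<dots> = (LINT x|lborel. (LINT s|lborel. 2 * (H (x + s *\<^sub>R ?z) * (W (x + s *\<^sub>R ?z) \<bullet> ?z)) * indicator {0..1} s) * \<psi> x)"
      by (rule integral_cong_AE) (use AEx in auto)
    also have "\<dots> = (LINT x|lborel. (LINT s|lborel. 2 * (H (x + s *\<^sub>R ?z) * (W (x + s *\<^sub>R ?z) \<bullet> ?z)) * indicator {0..1} s * \<psi> x))"
      by simp
    also have "\<dots> = (LINT s|lborel. (LINT x|lborel. 2 * (H (x + s *\<^sub>R ?z) * (W (x + s *\<^sub>R ?z) \<bullet> ?z)) * indicator {0..1} s * \<psi> x))"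
      by (rule lborel_pair.Fubini_integral[OF i2])
    also have "\<dots> = (LINT s|lborel. 2 * \<tau> n * ((LINT x|lborel. ?h x * \<psi> (x - s *\<^sub>R ?z)) * indicator {0..1} s))"
    proof (rule Bochner_Integration.integral_cong[OF refl])
      fix s :: real
      have "(LINT x|lborel. 2 * (H (x + s *\<^sub>R ?z) * (W (x + s *\<^sub>R ?z) \<bullet> ?z)) * indicator {0..1} s * \<psi> x)
        = (LINT x|lborel. (2 * \<tau> n * indicator {0..1} s) * (?h (s *\<^sub>R ?z + x) * \<psi> ((s *\<^sub>R ?z + x) - s *\<^sub>R ?z)))"
        by (intro Bochner_Integration.integral_cong refl) (simp add: ac_simps)
      also have "\<dots> = (2 * \<tau> n * indicator {0..1} s) * (LINT x|lborel. ?h x * \<psi> (x - s *\<^sub>R ?z))"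
        by (subst integral_lborel_shift[of "\<lambda>x. ?h x * \<psi> (x - s *\<^sub>R ?z)" "s *\<^sub>R ?z", symmetric]) auto
      finally show "(LINT x|lborel. 2 * (H (x + s *\<^sub>R ?z) * (W (x + s *\<^sub>R ?z) \<bullet> ?z)) * indicator {0..1} s * \<psi> x)
        = 2 * \<tau> n * ((LINT x|lborel. ?h x * \<psi> (x - s *\<^sub>R ?z)) * indicator {0..1} s)" by simp
    qed
    also have "\<dots> = \<tau> n * (2 * (LINT s|lborel. (LINT x|lborel. ?h x * \<psi> (x - s *\<^sub>R ?z)) * indicator {0..1} s))"
      by simp
    finally show ?thesis using \<tau>(1)[of n]
      by (simp add: divide_eq_eq mult.commute)
  qed
  have lim1: "(\<lambda>n. LINT x|lborel. (H x)\<^sup>2 * ((\<psi> (x - \<tau> n *\<^sub>R v) - \<psi> x) / \<tau> n))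
    \<longlonglongrightarrow> (LINT x|lborel. (H x)\<^sup>2 * - (g x \<bullet> v))"
  proof (rule integral_dominated_convergence)
    show "integrable lborel (\<lambda>x. (H x)\<^sup>2 * (C * norm v))" using H2 by simp
    show "AE x in lborel. (\<lambda>n. (H x)\<^sup>2 * ((\<psi> (x - \<tau> n *\<^sub>R v) - \<psi> x) / \<tau> n)) \<longlonglongrightarrow> (H x)\<^sup>2 * - (g x \<bullet> v)"
    proof (intro AE_I2 tendsto_mult tendsto_const)
      fix x
      have "((\<lambda>t. \<psi> (x - t *\<^sub>R v)) has_derivative (\<lambda>h. g (x - 0 *\<^sub>R v) \<bullet> (- (h *\<^sub>R v)))) (at 0)"
        by (rule has_derivative_compose[OF _ D]) (auto intro!: derivative_eq_intros)
      moreover have "(\<lambda>h. g (x - 0 *\<^sub>R v) \<bullet> (- (h *\<^sub>R v))) = (*) (- (g x \<bullet> v))"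
        by (auto simp: fun_eq_iff)
      ultimately have "((\<lambda>t. \<psi> (x - t *\<^sub>R v)) has_real_derivative - (g x \<bullet> v)) (at 0)"
        by (simp add: has_field_derivative_def)
      then have "((\<lambda>t. (\<psi> (x - t *\<^sub>R v) - \<psi> x) / t) \<longlongrightarrow> - (g x \<bullet> v)) (at 0)"
        by (simp add: has_field_derivative_iff)
      then show "(\<lambda>n. (\<psi> (x - \<tau> n *\<^sub>R v) - \<psi> x) / \<tau> n) \<longlonglongrightarrow> - (g x \<bullet> v)"
        by (rule filterlim_compose) (use \<tau>0 \<tau>(1) in \<open>auto simp: filterlim_at less_imp_neq[THEN not_sym]\<close>)
    qed
    show "AE x in lborel. norm ((H x)\<^sup>2 * ((\<psi> (x - \<tau> n *\<^sub>R v) - \<psi> x) / \<tau> n)) \<le> (H x)\<^sup>2 * (C * norm v)" for n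
    proof (rule AE_I2)
      fix x
      have "\<bar>\<psi> (x - \<tau> n *\<^sub>R v) - \<psi> x\<bar> \<le> C * (\<tau> n * norm v)"
        using lip[of "x - \<tau> n *\<^sub>R v" x] \<tau>(1)[of n] by simp
      then have "\<bar>(\<psi> (x - \<tau> n *\<^sub>R v) - \<psi> x) / \<tau> n\<bar> \<le> C * norm v"
        using \<tau>(1)[of n] by (simp add: abs_divide divide_le_eq ac_simps)
      then show "norm ((H x)\<^sup>2 * ((\<psi> (x - \<tau> n *\<^sub>R v) - \<psi> x) / \<tau> n)) \<le> (H x)\<^sup>2 * (C * norm v)"
        unfolding real_norm_def abs_mult abs_power2 by (intro mult_left_mono) simp_all
    qed
  qed measurable
  have lim2: "(\<lambda>n. LINT s|lborel. (LINT x|lborel. ?h x * \<psi> (x - s *\<^sub>R \<tau> n *\<^sub>R v)) * indicator {0..1} s)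
    \<longlonglongrightarrow> (LINT s|lborel. (LINT x|lborel. ?h x * \<psi> x) * indicator {0..(1::real)} s)"
  proof (rule integral_dominated_convergence)
    have bd: "\<bar>LINT x|lborel. ?h x * k x\<bar> \<le> (LINT x|lborel. \<bar>?h x\<bar>) * K"
      if k[measurable]: "k \<in> borel_measurable borel" and K: "\<And>x. \<bar>k x\<bar> \<le> K" for k K
    proof -
      have "\<bar>LINT x|lborel. ?h x * k x\<bar> \<le> (LINT x|lborel. \<bar>?h x * k x\<bar>)" by (rule integral_abs_bound)
      also have "\<dots> \<le> (LINT x|lborel. \<bar>?h x\<bar> * K)"
      proof (rule integral_mono)
        show "integrable lborel (\<lambda>x. \<bar>?h x * k x\<bar>)" by (rule integrable_abs[OF ih\<psi>[OF k K]])
        show "integrable lborel (\<lambda>x. \<bar>?h x\<bar> * K)"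
          by (rule integrable_mult_left[OF integrable_abs[OF integrable_HW]])
        show "\<bar>?h x * k x\<bar> \<le> \<bar>?h x\<bar> * K" for x
          unfolding abs_mult[of "?h x"] using K by (intro mult_left_mono) auto
      qed
      finally show ?thesis by simp
    qed
    show "integrable lborel (\<lambda>s. (LINT x|lborel. \<bar>?h x\<bar>) * C * indicator {0..(1::real)} s)" by simp
    show "AE s in lborel. norm ((LINT x|lborel. ?h x * \<psi> (x - s *\<^sub>R \<tau> n *\<^sub>R v)) * indicator {0..1} s)
       \<le> (LINT x|lborel. \<bar>?h x\<bar>) * C * indicator {0..(1::real)} s" for n
      using bd[of "\<lambda>x. \<psi> (x - s *\<^sub>R \<tau> n *\<^sub>R v)" C for s] \<psi>C
      by (intro AE_I2) (simp add: indicator_def)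
    show "AE s in lborel. (\<lambda>n. (LINT x|lborel. ?h x * \<psi> (x - s *\<^sub>R \<tau> n *\<^sub>R v)) * indicator {0..1} s)
      \<longlonglongrightarrow> (LINT x|lborel. ?h x * \<psi> x) * indicator {0..(1::real)} s"
    proof (intro AE_I2 tendsto_mult tendsto_const)
      fix s :: real
      show "(\<lambda>n. LINT x|lborel. ?h x * \<psi> (x - s *\<^sub>R \<tau> n *\<^sub>R v)) \<longlonglongrightarrow> (LINT x|lborel. ?h x * \<psi> x)"
      proof (rule integral_dominated_convergence)
        show "integrable lborel (\<lambda>x. C * \<bar>?h x\<bar>)"
          by (rule integrable_mult_right[OF integrable_abs[OF integrable_HW]])
        show "AE x in lborel. (\<lambda>n. ?h x * \<psi> (x - s *\<^sub>R \<tau> n *\<^sub>R v)) \<longlonglongrightarrow> ?h x * \<psi> x"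
        proof (intro AE_I2 tendsto_mult tendsto_const)
          fix x
          have "(\<lambda>n. x - s *\<^sub>R \<tau> n *\<^sub>R v) \<longlonglongrightarrow> x - s *\<^sub>R 0 *\<^sub>R v"
            by (intro tendsto_intros \<tau>0)
          then have "(\<lambda>n. x - s *\<^sub>R \<tau> n *\<^sub>R v) \<longlonglongrightarrow> x" by simp
          then show "(\<lambda>n. \<psi> (x - s *\<^sub>R \<tau> n *\<^sub>R v)) \<longlonglongrightarrow> \<psi> x"
            using cont by (intro isCont_tendsto_compose[of x \<psi>]) (simp add: continuous_on_eq_continuous_at)
        qed
        show "AE x in lborel. norm (?h x * \<psi> (x - s *\<^sub>R \<tau> n *\<^sub>R v)) \<le> C * \<bar>?h x\<bar>" for n
        proof (rule AE_I2)
          fix x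
          have "\<bar>?h x\<bar> * \<bar>\<psi> (x - s *\<^sub>R \<tau> n *\<^sub>R v)\<bar> \<le> \<bar>?h x\<bar> * C"
            by (intro mult_left_mono \<psi>C) simp
          then show "norm (?h x * \<psi> (x - s *\<^sub>R \<tau> n *\<^sub>R v)) \<le> C * \<bar>?h x\<bar>"
            by (simp add: abs_mult mult.commute)
        qed
      qed measurable
    qed
  qed measurable
  have "(LINT x|lborel. (H x)\<^sup>2 * - (g x \<bullet> v)) = 2 * (LINT s|lborel. (LINT x|lborel. ?h x * \<psi> x) * indicator {0..(1::real)} s)"
    using LIMSEQ_unique[OF lim1[unfolded eq] tendsto_mult[OF tendsto_const lim2]] .
  then show ?thesis by simp
qed

end

section \<open>The metric on unordered tuples\<close>

lemma finite_Gdist_values: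
  "finite {sqrt (\<Sum>i<size u. (norm (xs ! i - ys ! \<sigma> i))\<^sup>2) | xs ys \<sigma>.
     mset xs = u \<and> mset ys = v \<and> \<sigma> permutes {..<size u}}"
proof -
  obtain xs0 where xs0: "mset xs0 = u" using ex_mset by blast
  obtain ys0 where ys0: "mset ys0 = v" using ex_mset by blast
  have "finite ((\<lambda>(xs, ys, \<sigma>). sqrt (\<Sum>i<size u. (norm (xs ! i - ys ! \<sigma> i))\<^sup>2)) `
    ({xs. mset xs = mset xs0} \<times> {ys. mset ys = mset ys0} \<times> {\<sigma>. \<sigma> permutes {..<size u}}))"
    by (intro finite_imageI finite_cartesian_product mset_eq_finite finite_permutations) auto
  then show ?thesis
  proof (rule finite_subset[rotated], intro subsetI)
    fix z assume "z \<in> {sqrt (\<Sum>i<size u. (norm (xs ! i - ys ! \<sigma> i))\<^sup>2) | xs ys \<sigma>.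
     mset xs = u \<and> mset ys = v \<and> \<sigma> permutes {..<size u}}"
    then obtain xs ys \<sigma> where "z = sqrt (\<Sum>i<size u. (norm (xs ! i - ys ! \<sigma> i))\<^sup>2)"
      "mset xs = u" "mset ys = v" "\<sigma> permutes {..<size u}" by blast
    then show "z \<in> (\<lambda>(xs, ys, \<sigma>). sqrt (\<Sum>i<size u. (norm (xs ! i - ys ! \<sigma> i))\<^sup>2)) `
      ({xs. mset xs = mset xs0} \<times> {ys. mset ys = mset ys0} \<times> {\<sigma>. \<sigma> permutes {..<size u}})"
      unfolding xs0 ys0 by (intro image_eqI[where x = "(xs, ys, \<sigma>)"]) auto
  qed
qed

lemma Gdist_nth_le:
  shows "Gdist (mset xs) (mset ys) \<le> L2_set (\<lambda>i. norm (xs ! i - ys ! i)) {..<length xs}"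
  unfolding Gdist_def L2_set_def
proof (rule Min_le[OF finite_Gdist_values])
  have "id permutes {..<size (mset xs)}" by (rule permutes_id)
  moreover have "sqrt (\<Sum>i<length xs. (norm (xs ! i - ys ! i))\<^sup>2)
    = sqrt (\<Sum>i<size (mset xs). (norm (xs ! i - ys ! id i))\<^sup>2)" by simp
  ultimately show "sqrt (\<Sum>i<length xs. (norm (xs ! i - ys ! i))\<^sup>2)
    \<in> {sqrt (\<Sum>i<size (mset xs). (norm (xs' ! i - ys' ! \<sigma> i))\<^sup>2) | xs' ys' \<sigma>.
     mset xs' = mset xs \<and> mset ys' = mset ys \<and> \<sigma> permutes {..<size (mset xs)}}" by blast
qed

text \<open>The permutation \<open>\<sigma>\<close> and the re-enumeration of \<open>mset xs\<close>
  are both absorbed into a reordering of \<open>v\<close>. Later arguments can thus fix one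
  enumeration and compare entries of equal index.\<close>

lemma Gdist_matching:
  assumes "size v = length xs"
  shows "\<exists>ys. length ys = length xs \<and> mset ys = v \<and>
    Gdist (mset xs) v = L2_set (\<lambda>i. norm (xs ! i - ys ! i)) {..<length xs}"
proof -
  let ?n = "length xs"
  let ?S = "{sqrt (\<Sum>i<size (mset xs). (norm (xs' ! i - ys ! \<sigma> i))\<^sup>2) | xs' ys \<sigma>.
     mset xs' = mset xs \<and> mset ys = v \<and> \<sigma> permutes {..<size (mset xs)}}"
  obtain ys0 where ys0: "mset ys0 = v" using ex_mset by blast
  have "?S \<noteq> {}" using ys0 permutes_id by blast
  then have "Gdist (mset xs) v \<in> ?S"
    unfolding Gdist_def using Min_in[OF finite_Gdist_values] by blast
  then obtain xs' ys' \<sigma> where *: "mset xs' = mset xs" "mset ys' = v" "\<sigma> permutes {..<?n}"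
    "Gdist (mset xs) v = sqrt (\<Sum>i<?n. (norm (xs' ! i - ys' ! \<sigma> i))\<^sup>2)" by auto
  have len: "length xs' = ?n" "length ys' = ?n"
    using *(1,2) assms by (metis size_mset)+
  obtain \<pi> where \<pi>: "\<pi> permutes {..<length xs'}" "permute_list \<pi> xs' = xs"
    using mset_eq_permutation[OF *(1)[symmetric]] by auto
  define ys where "ys = permute_list (\<sigma> \<circ> \<pi>) ys'"
  have p: "\<sigma> \<circ> \<pi> permutes {..<length ys'}"
    using *(3) \<pi>(1) len by (simp add: permutes_compose)
  have "(\<Sum>i<?n. (norm (xs ! i - ys ! i))\<^sup>2) = (\<Sum>i<?n. (norm (xs' ! \<pi> i - ys' ! \<sigma> (\<pi> i)))\<^sup>2)"
  proof (rule sum.cong[OF refl])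
    fix i assume "i \<in> {..<?n}"
    then have "xs ! i = xs' ! \<pi> i" "ys ! i = ys' ! \<sigma> (\<pi> i)"
      using permute_list_nth[OF \<pi>(1), of i] permute_list_nth[OF p, of i] len \<pi>(2)
      by (auto simp: ys_def)
    then show "(norm (xs ! i - ys ! i))\<^sup>2 = (norm (xs' ! \<pi> i - ys' ! \<sigma> (\<pi> i)))\<^sup>2" by simp
  qed
  also have "\<dots> = (\<Sum>i<?n. (norm (xs' ! i - ys' ! \<sigma> i))\<^sup>2)"
    using sum.permute[OF \<pi>(1)[unfolded len], of "\<lambda>i. (norm (xs' ! i - ys' ! \<sigma> i))\<^sup>2"] by simp
  finally have "Gdist (mset xs) v = L2_set (\<lambda>i. norm (xs ! i - ys ! i)) {..<?n}"
    using *(4) by (simp add: L2_set_def)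
  moreover have "mset ys = v" "length ys = ?n"
    using *(2) len mset_permute_list[OF p] by (auto simp: ys_def)
  ultimately show ?thesis by blast
qed

lemma Gdist_matchingE:
  assumes "mset xs = u" "size v = size u"
  obtains ys where "length ys = length xs" "mset ys = v"
    "Gdist u v = L2_set (\<lambda>i. norm (xs ! i - ys ! i)) {..<length xs}"
proof -
  have "size v = length xs" using assms by (simp flip: size_mset)
  from Gdist_matching[OF this] that assms(1) show thesis by blast
qed

lemma Gdist_nonneg:
  assumes "size u = size v"
  shows "0 \<le> Gdist u v"
proof -
  obtain xs where xs: "mset xs = u" using ex_mset by blast
  obtain ys where "Gdist u v = L2_set (\<lambda>i. norm (xs ! i - ys ! i)) {..<length xs}"
    using Gdist_matchingE[OF xs assms[symmetric]] by blast
  then show ?thesis by (simp add: L2_set_nonneg)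
qed

lemma Gdist_commute_le:
  assumes "size u = size v"
  shows "Gdist v u \<le> Gdist u v"
proof -
  obtain xs where xs: "mset xs = u" using ex_mset by blast
  obtain ys where ys: "length ys = length xs" "mset ys = v"
    "Gdist u v = L2_set (\<lambda>i. norm (xs ! i - ys ! i)) {..<length xs}"
    using Gdist_matchingE[OF xs assms[symmetric]] by blast
  have "Gdist v u \<le> L2_set (\<lambda>i. norm (ys ! i - xs ! i)) {..<length xs}"
    using Gdist_nth_le[of ys xs] xs ys(1,2) by simp
  then show ?thesis using ys(3) by (simp only: norm_minus_commute)
qed

lemma Gdist_commute: "size u = size v \<Longrightarrow> Gdist u v = Gdist v u"
  using Gdist_commute_le[of u v] Gdist_commute_le[of v u] by linarith

lemma Gdist_triangle:
  assumes "size u = size v" "size v = size w"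
  shows "Gdist u w \<le> Gdist u v + Gdist v w"
proof -
  obtain xs where xs: "mset xs = u" using ex_mset by blast
  obtain ys where ys: "length ys = length xs" "mset ys = v"
    "Gdist u v = L2_set (\<lambda>i. norm (xs ! i - ys ! i)) {..<length xs}"
    using Gdist_matchingE[OF xs assms(1)[symmetric]] by blast
  obtain zs where zs: "length zs = length ys" "mset zs = w"
    "Gdist v w = L2_set (\<lambda>i. norm (ys ! i - zs ! i)) {..<length ys}"
    using Gdist_matchingE[OF ys(2) assms(2)[symmetric]] by blast
  have "Gdist u w \<le> L2_set (\<lambda>i. norm (xs ! i - zs ! i)) {..<length xs}"
    using Gdist_nth_le[of xs zs] xs zs by auto
  also have "\<dots> \<le> L2_set (\<lambda>i. norm (xs ! i - ys ! i) + norm (ys ! i - zs ! i)) {..<length xs}"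
  proof (rule L2_set_mono)
    fix i
    show "norm (xs ! i - zs ! i) \<le> norm (xs ! i - ys ! i) + norm (ys ! i - zs ! i)"
      using norm_triangle_ineq[of "xs ! i - ys ! i" "ys ! i - zs ! i"] by simp
  qed simp
  also have "\<dots> \<le> Gdist u v + Gdist v w"
    using L2_set_triangle_ineq ys zs by auto
  finally show ?thesis .
qed

text \<open>Every matching that respects the clusters of \<open>ps\<close> has the same cost as the identity.\<close>

lemma Gdist_eq_L2_set:
  fixes ps qs ts :: "'h::real_normed_vector list"
  assumes len: "length ps = Q" "length qs = Q" "length ts = Q"
    and sep: "\<And>i j. i < Q \<Longrightarrow> j < Q \<Longrightarrow> ps ! i \<noteq> ps ! j \<Longrightarrow> 4 * \<delta> \<le> norm (ps ! i - ps ! j)"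
    and coh: "\<And>i j. i < Q \<Longrightarrow> j < Q \<Longrightarrow> ps ! i = ps ! j \<Longrightarrow> qs ! i = qs ! j"
    and q: "L2_set (\<lambda>i. norm (qs ! i - ps ! i)) {..<Q} < \<delta>"
    and t: "L2_set (\<lambda>i. norm (ts ! i - ps ! i)) {..<Q} < \<delta>"
  shows "Gdist (mset qs) (mset ts) = L2_set (\<lambda>i. norm (qs ! i - ts ! i)) {..<Q}"
proof (rule antisym)
  show "Gdist (mset qs) (mset ts) \<le> L2_set (\<lambda>i. norm (qs ! i - ts ! i)) {..<Q}"
    using Gdist_nth_le[of qs ts] len by simp
  obtain ts' where ts': "length ts' = Q" "mset ts' = mset ts"
    "Gdist (mset qs) (mset ts) = L2_set (\<lambda>i. norm (qs ! i - ts' ! i)) {..<Q}"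
    using Gdist_matching[of "mset ts" qs] len by auto
  obtain \<sigma> where \<sigma>: "\<sigma> permutes {..<Q}" "permute_list \<sigma> ts = ts'"
    using mset_eq_permutation[OF ts'(2)] len by auto
  have nth: "ts' ! i = ts ! \<sigma> i" if "i < Q" for i
    using permute_list_nth[of \<sigma> ts i] \<sigma> len that by auto
  have \<sigma>Q: "\<sigma> i < Q" if "i < Q" for i using permutes_in_image[OF \<sigma>(1), of i] that by simp
  have qi: "norm (qs ! i - ps ! i) < \<delta>" if "i < Q" for i
    using member_le_L2_set[of "{..<Q}" i "\<lambda>i. norm (qs ! i - ps ! i)"] q that by simp
  have ti: "norm (ts ! i - ps ! i) < \<delta>" if "i < Q" for i
    using member_le_L2_set[of "{..<Q}" i "\<lambda>i. norm (ts ! i - ps ! i)"] t that by simp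
  show "L2_set (\<lambda>i. norm (qs ! i - ts ! i)) {..<Q} \<le> Gdist (mset qs) (mset ts)"
  proof (cases "\<exists>i<Q. ps ! i \<noteq> ps ! \<sigma> i")
    \<comment> \<open>Matching across two clusters costs at least \<open>2 * \<delta>\<close>,
      whereas the identity costs at most the sum of the distances of \<open>qs\<close> and
      \<open>ts\<close> to \<open>ps\<close>.\<close>
    case True
    then obtain i where i: "i < Q" "ps ! i \<noteq> ps ! \<sigma> i" by blast
    have "4 * \<delta> \<le> norm (ps ! i - ps ! \<sigma> i)" using sep i \<sigma>Q by blast
    also have "\<dots> \<le> norm (ps ! i - qs ! i) + norm (qs ! i - ts ! \<sigma> i) + norm (ts ! \<sigma> i - ps ! \<sigma> i)"
      using norm_triangle_ineq[of "ps ! i - qs ! i" "qs ! i - ts ! \<sigma> i"]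
        norm_triangle_ineq[of "ps ! i - ts ! \<sigma> i" "ts ! \<sigma> i - ps ! \<sigma> i"] by simp
    also have "\<dots> < 2 * \<delta> + norm (qs ! i - ts ! \<sigma> i)"
      using qi[OF i(1)] ti[OF \<sigma>Q[OF i(1)]] by (simp add: norm_minus_commute)
    finally have "2 * \<delta> \<le> norm (qs ! i - ts' ! i)" using nth[OF i(1)] by simp
    also have "\<dots> \<le> Gdist (mset qs) (mset ts)"
      unfolding ts'(3) using i(1) by (intro member_le_L2_set[of "{..<Q}" i "\<lambda>i. norm (qs ! i - ts' ! i)"]) auto
    finally have big: "2 * \<delta> \<le> Gdist (mset qs) (mset ts)" .
    have "L2_set (\<lambda>i. norm (qs ! i - ts ! i)) {..<Q}
      \<le> L2_set (\<lambda>i. norm (qs ! i - ps ! i) + norm (ts ! i - ps ! i)) {..<Q}"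
    proof (rule L2_set_mono)
      fix i
      show "norm (qs ! i - ts ! i) \<le> norm (qs ! i - ps ! i) + norm (ts ! i - ps ! i)"
        using norm_triangle_ineq4[of "qs ! i - ps ! i" "ts ! i - ps ! i"] by simp
    qed simp
    also have "\<dots> \<le> L2_set (\<lambda>i. norm (qs ! i - ps ! i)) {..<Q} + L2_set (\<lambda>i. norm (ts ! i - ps ! i)) {..<Q}"
      by (rule L2_set_triangle_ineq)
    finally show ?thesis using q t big by linarith
  next
    case False
    have "L2_set (\<lambda>i. norm (qs ! i - ts' ! i)) {..<Q} = L2_set (\<lambda>i. norm (qs ! \<sigma> i - ts ! \<sigma> i)) {..<Q}"
    proof (rule L2_set_cong[OF refl])
      fix i assume "i \<in> {..<Q}"
      then have i: "i < Q" by simp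
      then have "qs ! i = qs ! \<sigma> i" using False coh[OF i \<sigma>Q[OF i]] by blast
      then show "norm (qs ! i - ts' ! i) = norm (qs ! \<sigma> i - ts ! \<sigma> i)" using nth[OF i] by simp
    qed
    also have "\<dots> = L2_set (\<lambda>i. norm (qs ! i - ts ! i)) {..<Q}"
      using sum.permute[OF \<sigma>(1), of "\<lambda>i. (norm (qs ! i - ts ! i))\<^sup>2"] by (simp add: L2_set_def)
    finally show ?thesis using ts'(3) by simp
  qed
qed

section \<open>Approximate little-o calculus\<close>

text \<open>The approximate version of \<open>e x = o(norm (x - a))\<close>, written without a
  quotient so that \<open>x = a\<close> needs no special treatment.\<close>

definition ap_o :: "'a::euclidean_space \<Rightarrow> ('a \<Rightarrow> real) \<Rightarrow> bool" where
  "ap_o a e \<longleftrightarrow> (\<forall>\<epsilon>>0. \<forall>\<^sub>F x in ap_at a. \<bar>e x\<bar> \<le> \<epsilon> * norm (x - a))"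

lemma ap_oD: "ap_o a e \<Longrightarrow> 0 < \<epsilon> \<Longrightarrow> \<forall>\<^sub>F x in ap_at a. \<bar>e x\<bar> \<le> \<epsilon> * norm (x - a)"
  by (simp add: ap_o_def)

lemma ap_o_mono:
  assumes "ap_o a e'" "\<forall>\<^sub>F x in ap_at a. \<bar>e x\<bar> \<le> \<bar>e' x\<bar>"
  shows "ap_o a e"
  unfolding ap_o_def
proof (intro allI impI)
  fix \<epsilon> :: real assume "0 < \<epsilon>"
  from ap_oD[OF assms(1) this] assms(2) show "\<forall>\<^sub>F x in ap_at a. \<bar>e x\<bar> \<le> \<epsilon> * norm (x - a)"
    by eventually_elim simp
qed

lemma ap_o_add:
  assumes "ap_o a e" "ap_o a e'"
  shows "ap_o a (\<lambda>x. e x + e' x)"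
  unfolding ap_o_def
proof (intro allI impI)
  fix \<epsilon> :: real assume "0 < \<epsilon>"
  then have "0 < \<epsilon> / 2" by simp
  from ap_oD[OF assms(1) this] ap_oD[OF assms(2) this]
  show "\<forall>\<^sub>F x in ap_at a. \<bar>e x + e' x\<bar> \<le> \<epsilon> * norm (x - a)"
    by eventually_elim simp
qed

lemma ap_o_cmult:
  assumes "ap_o a e"
  shows "ap_o a (\<lambda>x. c * e x)"
  unfolding ap_o_def
proof (intro allI impI)
  fix \<epsilon> :: real assume "0 < \<epsilon>"
  then have "0 < \<epsilon> / (\<bar>c\<bar> + 1)" by simp
  from ap_oD[OF assms(1) this] show "\<forall>\<^sub>F x in ap_at a. \<bar>c * e x\<bar> \<le> \<epsilon> * norm (x - a)"
  proof eventually_elim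
    case (elim x)
    have "\<bar>c * e x\<bar> \<le> (\<bar>c\<bar> + 1) * \<bar>e x\<bar>" by (simp add: abs_mult mult_right_mono)
    also have "\<dots> \<le> (\<bar>c\<bar> + 1) * (\<epsilon> / (\<bar>c\<bar> + 1) * norm (x - a))"
      using elim by (intro mult_left_mono) auto
    also have "\<dots> = \<epsilon> * norm (x - a)" by simp
    finally show ?case .
  qed
qed

lemma ap_o_diff: "ap_o a e \<Longrightarrow> ap_o a e' \<Longrightarrow> ap_o a (\<lambda>x. e x - e' x)"
  using ap_o_add[OF _ ap_o_cmult[of a e' "-1"], of e] by simp

lemma ap_o_zero: "ap_o a (\<lambda>x. 0)"
  by (simp add: ap_o_def)

lemma ap_o_sum: "(\<And>i. i \<in> I \<Longrightarrow> ap_o a (e i)) \<Longrightarrow> ap_o a (\<lambda>x. \<Sum>i\<in>I. e i x)"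
  by (induction I rule: infinite_finite_induct) (auto intro: ap_o_zero ap_o_add)

lemma ap_at_small_norm:
  assumes "0 < \<epsilon>"
  shows "\<forall>\<^sub>F x in ap_at a. norm (x - a) < \<epsilon>"
proof -
  have "\<forall>\<^sub>F x in at a. norm (x - a) < \<epsilon>"
    using assms unfolding eventually_at by (auto simp: dist_norm)
  then show ?thesis using ap_at_le_at[of a] by (simp add: le_filter_def)
qed

lemma ap_o_quadratic:
  assumes "\<forall>\<^sub>F x in ap_at a. \<bar>e x\<bar> \<le> C * (norm (x - a))\<^sup>2"
  shows "ap_o a e"
  unfolding ap_o_def
proof (intro allI impI)
  fix \<epsilon> :: real assume "0 < \<epsilon>"
  then have "0 < \<epsilon> / (\<bar>C\<bar> + 1)" by simp
  from ap_at_small_norm[OF this] assms show "\<forall>\<^sub>F x in ap_at a. \<bar>e x\<bar> \<le> \<epsilon> * norm (x - a)"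
  proof eventually_elim
    case (elim x)
    have "\<bar>e x\<bar> \<le> (\<bar>C\<bar> + 1) * norm (x - a) * norm (x - a)"
      using elim(2) by (simp add: power2_eq_square algebra_simps)
        (smt (verit) mult_right_mono abs_ge_self mult_nonneg_nonneg norm_ge_zero)
    also have "\<dots> \<le> (\<bar>C\<bar> + 1) * (\<epsilon> / (\<bar>C\<bar> + 1)) * norm (x - a)"
      using elim(1) by (intro mult_right_mono mult_left_mono) auto
    also have "\<dots> = \<epsilon> * norm (x - a)" by simp
    finally show ?case .
  qed
qed

lemma ap_o_inner_bound:
  assumes "\<forall>\<^sub>F x in ap_at a. \<bar>c \<bullet> (x - a)\<bar> \<le> K * norm (x - a)"
  shows "norm c \<le> K"
proof -
  have "linear (\<lambda>z. c \<bullet> z)" by (simp add: bounded_linear.linear bounded_linear_inner_right)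
  then have "norm (c \<bullet> c) \<le> K * norm c"
    by (rule linear_bound_ap_at[where a = a]) (use assms in simp)
  then have "norm c * norm c \<le> K * norm c" by (simp add: norm_eq_sqrt_inner)
  moreover have "0 \<le> K" if "norm c = 0"
  proof -
    from eventually_conj[OF assms ap_at_AE_neq[of a]] obtain x where
      "\<bar>c \<bullet> (x - a)\<bar> \<le> K * norm (x - a)" "x \<noteq> a"
      using eventually_happens'[OF ap_at_neq_bot] by blast
    then show ?thesis by (metis abs_ge_zero order_trans right_minus_eq zero_le_mult_iff zero_less_norm_iff linorder_not_le norm_ge_zero)
  qed
  ultimately show ?thesis by (cases "norm c = 0") auto
qed

lemma ap_o_inner_unique:
  assumes "ap_o a (\<lambda>x. c \<bullet> (x - a))"
  shows "c = 0"
proof -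
  have "norm c \<le> \<epsilon>" if "0 < \<epsilon>" for \<epsilon>
    using ap_o_inner_bound[OF ap_oD[OF assms that]] .
  then show ?thesis by (metis dense_le_bounded field_le_epsilon add_0 norm_le_zero_iff)
qed

text \<open>Two approximate gradients differ by at most the sum of their errors
  (\<open>ap_o_inner_bound\<close>), so a sequence of them with errors tending to 0 is Cauchy, and
  its limit has no error left. Hence tuples from a dense family are enough to find a
  gradient.\<close>

lemma ap_o_linear_limit:
  assumes "\<And>\<epsilon>. 0 < \<epsilon> \<Longrightarrow> \<exists>c. \<forall>\<^sub>F x in ap_at a. \<bar>\<phi> x - c \<bullet> (x - a)\<bar> \<le> \<epsilon> * norm (x - a)"
  shows "\<exists>c. ap_o a (\<lambda>x. \<phi> x - c \<bullet> (x - a))"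
proof -
  have "\<forall>n. \<exists>c. \<forall>\<^sub>F x in ap_at a. \<bar>\<phi> x - c \<bullet> (x - a)\<bar> \<le> inverse (real (Suc n)) * norm (x - a)"
    using assms by simp
  then obtain c where c: "\<And>n. \<forall>\<^sub>F x in ap_at a. \<bar>\<phi> x - c n \<bullet> (x - a)\<bar> \<le> inverse (real (Suc n)) * norm (x - a)"
    by metis
  have diff: "norm (c n - c m) \<le> inverse (real (Suc n)) + inverse (real (Suc m))" for n m
    by (rule ap_o_inner_bound[where a = a], use c[of n] c[of m] in eventually_elim)
       (simp add: inner_diff_left distrib_right abs_le_iff)
  have "Cauchy c"
  proof (rule CauchyI)
    fix e :: real assume e: "0 < e"
    obtain N where N: "inverse (real (Suc N)) < e / 2" using reals_Archimedean[of "e / 2"] e by auto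
    have "norm (c m - c n) < e" if "N \<le> m" "N \<le> n" for m n
    proof -
      have "inverse (real (Suc m)) \<le> inverse (real (Suc N))" "inverse (real (Suc n)) \<le> inverse (real (Suc N))"
        using that by (auto intro!: le_imp_inverse_le)
      then show ?thesis using diff[of m n] N by linarith
    qed
    then show "\<exists>M. \<forall>m\<ge>M. \<forall>n\<ge>M. norm (c m - c n) < e" by blast
  qed
  then obtain l where l: "c \<longlonglongrightarrow> l" using Cauchy_convergent convergent_def by blast
  have "ap_o a (\<lambda>x. \<phi> x - l \<bullet> (x - a))"
    unfolding ap_o_def
  proof (intro allI impI)
    fix \<epsilon> :: real assume \<epsilon>: "0 < \<epsilon>"
    have "\<forall>\<^sub>F n in sequentially. norm (c n - l) < \<epsilon> / 2"
      using tendstoD[OF l, of "\<epsilon> / 2"] \<epsilon> by (simp add: dist_norm)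
    moreover have "\<forall>\<^sub>F n in sequentially. inverse (real (Suc n)) < \<epsilon> / 2"
      using LIMSEQ_inverse_real_of_nat \<epsilon> by (intro order_tendstoD) auto
    ultimately obtain n where n: "norm (c n - l) < \<epsilon> / 2" "inverse (real (Suc n)) < \<epsilon> / 2"
      using eventually_happens'[OF sequentially_bot eventually_conj] by blast
    show "\<forall>\<^sub>F x in ap_at a. \<bar>\<phi> x - l \<bullet> (x - a)\<bar> \<le> \<epsilon> * norm (x - a)"
      using c[of n]
    proof eventually_elim
      case (elim x)
      have "\<bar>(c n - l) \<bullet> (x - a)\<bar> \<le> norm (c n - l) * norm (x - a)" by (rule Cauchy_Schwarz_ineq2)
      also have "\<dots> \<le> \<epsilon> / 2 * norm (x - a)" using n by (intro mult_right_mono) auto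
      finally have 1: "\<bar>(c n - l) \<bullet> (x - a)\<bar> \<le> \<epsilon> / 2 * norm (x - a)" .
      have "inverse (real (Suc n)) * norm (x - a) \<le> \<epsilon> / 2 * norm (x - a)"
        using n by (intro mult_right_mono) auto
      with elim have 2: "\<bar>\<phi> x - c n \<bullet> (x - a)\<bar> \<le> \<epsilon> / 2 * norm (x - a)" by linarith
      have "\<phi> x - l \<bullet> (x - a) = (\<phi> x - c n \<bullet> (x - a)) + (c n - l) \<bullet> (x - a)"
        by (simp add: inner_diff_left)
      then have "\<bar>\<phi> x - l \<bullet> (x - a)\<bar> \<le> \<epsilon> / 2 * norm (x - a) + \<epsilon> / 2 * norm (x - a)"
        using 1 2 by linarith
      then show ?case by (simp add: field_simps)
    qed
  qed
  then show ?thesis by blast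
qed

text \<open>The representing vector minimises \<open>(norm y)\<^sup>2 / 2 - c y\<close>: minimising
  sequences are Cauchy by the parallelogram identity, and the first variation at the minimiser is
  the claim.\<close>

lemma riesz_representation:
  fixes c :: "'h::{real_inner, complete_space} \<Rightarrow> real"
  assumes lin: "linear c" and bd: "\<And>e. \<bar>c e\<bar> \<le> K * norm e"
  shows "\<exists>l. \<forall>e. c e = l \<bullet> e"
proof -
  define J where "J y = (norm y)\<^sup>2 / 2 - c y" for y
  have Jlow: "- (K\<^sup>2 / 2) \<le> J y" for y
  proof -
    have "K * norm y \<le> (norm y)\<^sup>2 / 2 + K\<^sup>2 / 2"
      using sum_squares_bound[of K "norm y"] by (simp add: field_simps)
    then show ?thesis using bd[of y] by (simp add: J_def abs_le_iff)
  qed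
  define \<mu> where "\<mu> = (INF y. J y)"
  have bdd: "bdd_below (range J)" using Jlow by (intro bdd_belowI2) auto
  have \<mu>: "\<mu> \<le> J y" for y unfolding \<mu>_def by (rule cINF_lower[OF bdd]) simp
  have "\<exists>y. J y < \<mu> + inverse (real (Suc n))" for n
    using cINF_less_iff[OF _ bdd, of "\<mu> + inverse (real (Suc n))"] by (simp add: \<mu>_def)
  then obtain y where y: "\<And>n. J (y n) < \<mu> + inverse (real (Suc n))" by metis
  have par: "(norm (u - v))\<^sup>2 / 4 = J u + J v - 2 * J ((1/2) *\<^sub>R (u + v))" for u v
    using linear_add[OF lin] linear_cmul[OF lin]
    by (simp add: J_def power2_norm_eq_inner inner_add_left inner_add_right inner_diff_left
        inner_diff_right inner_commute field_simps)
  have diff: "(norm (y n - y m))\<^sup>2 \<le> 4 * (inverse (real (Suc n)) + inverse (real (Suc m)))" for n m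
  proof -
    define p q where "p = inverse (real (Suc n))" and "q = inverse (real (Suc m))"
    show ?thesis
      using par[of "y n" "y m"] y[of n] y[of m] \<mu>[of "(1/2) *\<^sub>R (y n + y m)"]
      unfolding p_def[symmetric] q_def[symmetric] by argo
  qed
  have "Cauchy y"
  proof (rule CauchyI)
    fix e :: real assume e: "0 < e"
    then obtain N where N: "inverse (real (Suc N)) < e\<^sup>2 / 8" using reals_Archimedean[of "e\<^sup>2 / 8"] by auto
    have "norm (y m - y n) < e" if "N \<le> m" "N \<le> n" for m n
    proof -
      have "inverse (real (Suc m)) \<le> inverse (real (Suc N))" "inverse (real (Suc n)) \<le> inverse (real (Suc N))"
        using that by (auto intro!: le_imp_inverse_le)
      then have "(norm (y m - y n))\<^sup>2 < e\<^sup>2" using diff[of m n] N by argo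
      then show ?thesis using e by (simp add: power_less_imp_less_base)
    qed
    then show "\<exists>M. \<forall>m\<ge>M. \<forall>n\<ge>M. norm (y m - y n) < e" by blast
  qed
  then obtain l where l: "y \<longlonglongrightarrow> l" using Cauchy_convergent convergent_def by blast
  have "bounded_linear c"
    using bd by (intro bounded_linear_intro[where K = K])
       (auto simp: linear_add[OF lin] linear_cmul[OF lin] mult.commute)
  then have "(\<lambda>n. J (y n)) \<longlonglongrightarrow> J l"
    unfolding J_def by (intro tendsto_intros l bounded_linear.tendsto[of c]) auto
  moreover have "(\<lambda>n. \<mu> + inverse (real (Suc n))) \<longlonglongrightarrow> \<mu> + 0"
    by (intro tendsto_intros LIMSEQ_inverse_real_of_nat)
  ultimately have Jl: "J l \<le> \<mu>"
    using y by (intro LIMSEQ_le[of "\<lambda>n. J (y n)" "J l" "\<lambda>n. \<mu> + inverse (real (Suc n))"]) (auto intro: less_imp_le)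
  have "c e = l \<bullet> e" for e
  proof (rule ccontr)
    assume "c e \<noteq> l \<bullet> e"
    define b where "b = l \<bullet> e - c e"
    have b: "b \<noteq> 0" using \<open>c e \<noteq> l \<bullet> e\<close> by (simp add: b_def)
    \<comment> \<open>Moving by \<open>- b / N\<close> along \<open>e\<close> would lower
      \<open>J\<close> strictly; the \<open>+ 1\<close> keeps \<open>N\<close> positive.\<close>
    define N where "N = (norm e)\<^sup>2 + 1"
    have N: "0 < N" by (simp add: N_def add_nonneg_pos)
    define t where "t = - b / N"
    have sq: "(norm (l + t *\<^sub>R e))\<^sup>2 = (norm l)\<^sup>2 + 2 * t * (l \<bullet> e) + t\<^sup>2 * (norm e)\<^sup>2"
      unfolding power2_norm_eq_inner
      by (simp add: inner_add_left inner_add_right inner_commute power2_eq_square)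
    have "J (l + t *\<^sub>R e) = J l + t * b + t\<^sup>2 * (norm e)\<^sup>2 / 2"
      using linear_add[OF lin] linear_cmul[OF lin]
      unfolding J_def sq b_def by (simp add: field_simps)
    moreover have "J l \<le> J (l + t *\<^sub>R e)" using Jl \<mu>[of "l + t *\<^sub>R e"] by linarith
    ultimately have "0 \<le> t * b + t\<^sup>2 * (norm e)\<^sup>2 / 2" by linarith
    also have "t\<^sup>2 * (norm e)\<^sup>2 \<le> t\<^sup>2 * N" by (intro mult_left_mono) (auto simp: N_def)
    finally have "0 \<le> t * b + t\<^sup>2 * N / 2" by simp
    also have "\<dots> = - (b\<^sup>2 / N) / 2" using N by (simp add: t_def field_simps power2_eq_square)
    also have "\<dots> < 0" using b N by simp
    finally show False by simp
  qed
  then show ?thesis by blast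
qed

section \<open>Approximate differentiability from scalar expansions\<close>

lemma divide_Suc_mult_le:
  fixes e n :: real
  assumes "0 < e" "0 \<le> n"
  shows "e / (n + 1) * n \<le> e"
proof -
  have "e * n \<le> e * (n + 1)" using assms by simp
  then show ?thesis using assms by (simp add: pos_divide_le_eq)
qed

text \<open>The data available at almost every \<open>a\<close>, with \<open>w k\<close> as
  approximate gradient of \<open>Gdist (f x) (T k)\<close>. The expansions \<open>expand\<close>
  need not be uniform in \<open>k\<close>; \<open>upper\<close> supplies uniformity in the one
  direction that is required, and \<open>stratum\<close> prevents branches that agree at
  \<open>a\<close> from separating.\<close>

locale scalar_expansions =
  fixes f :: "real ^ 'm \<Rightarrow> 'h::{real_inner, polish_space} multiset" and a :: "real ^ 'm"
    and Q :: nat and T :: "nat \<Rightarrow> 'h multiset" and w :: "nat \<Rightarrow> real ^ 'm" and \<gamma> :: real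
  assumes size_a: "size (f a) = Q" and size_T: "size (T k) = Q"
    and size_f: "\<forall>\<^sub>F x in ap_at a. size (f x) = Q"
    and expand: "ap_o a (\<lambda>x. Gdist (f x) (T k) - Gdist (f a) (T k) - w k \<bullet> (x - a))"
    and upper: "0 < \<epsilon> \<Longrightarrow> \<forall>\<^sub>F x in ap_at a. Gdist (f x) (f a) \<le> (SUP k. w k \<bullet> (x - a)) + \<epsilon> * norm (x - a)"
    and w_bound: "norm (w k) \<le> \<gamma>"
    and stratum: "\<forall>\<^sub>F x in ap_at a. card (set_mset (f x)) = card (set_mset (f a))"
    and dense: "length ts = Q \<Longrightarrow> 0 < \<epsilon> \<Longrightarrow> \<exists>k ts'. T k = mset ts' \<and> length ts' = Q \<and>
      L2_set (\<lambda>i. norm (ts' ! i - ts ! i)) {..<Q} < \<epsilon>"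
begin

lemma \<gamma>_nonneg: "0 \<le> \<gamma>"
  using w_bound norm_ge_zero order_trans by blast

lemma w_inner_le: "w k \<bullet> z \<le> \<gamma> * norm z"
proof -
  have "w k \<bullet> z \<le> norm (w k) * norm z" by (rule norm_cauchy_schwarz)
  also have "\<dots> \<le> \<gamma> * norm z" using w_bound by (rule mult_right_mono) simp
  finally show ?thesis .
qed

section \<open>Branches matched with the values at the base point\<close>

definition ps :: "'h list" where "ps = (SOME xs. mset xs = f a)"

lemma mset_ps: "mset ps = f a"
  unfolding ps_def by (rule someI_ex) (rule ex_mset)

lemma length_ps: "length ps = Q"
  using mset_ps size_a by (metis size_mset)

text \<open>An enumeration of \<open>f x\<close> matched optimally with \<open>ps\<close>. The
  choice may be arbitrary in \<open>x\<close>, since \<open>ap_at\<close> handles nonmeasurable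
  sets.\<close>

definition qs :: "real ^ 'm \<Rightarrow> 'h list" where
  "qs x = (SOME ys. length ys = Q \<and> mset ys = f x \<and>
     Gdist (f x) (f a) = L2_set (\<lambda>i. norm (ys ! i - ps ! i)) {..<Q})"

lemma qs:
  assumes "size (f x) = Q"
  shows "length (qs x) = Q" "mset (qs x) = f x"
    "Gdist (f x) (f a) = L2_set (\<lambda>i. norm (qs x ! i - ps ! i)) {..<Q}"
proof -
  have "\<exists>ys. length ys = Q \<and> mset ys = f x \<and>
     Gdist (f x) (f a) = L2_set (\<lambda>i. norm (ys ! i - ps ! i)) {..<Q}"
  proof -
    have s: "size (f x) = size (f a)" using assms size_a by simp
    obtain ys where ys: "length ys = length ps" "mset ys = f x"
      "Gdist (f a) (f x) = L2_set (\<lambda>i. norm (ps ! i - ys ! i)) {..<length ps}"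
      using Gdist_matchingE[OF mset_ps s] by blast
    then show ?thesis
      using Gdist_commute[OF s] length_ps by (intro exI[of _ ys]) (simp add: norm_minus_commute)
  qed
  from someI_ex[OF this] show "length (qs x) = Q" "mset (qs x) = f x"
    "Gdist (f x) (f a) = L2_set (\<lambda>i. norm (qs x ! i - ps ! i)) {..<Q}"
    unfolding qs_def by blast+
qed

definition disp :: "real ^ 'm \<Rightarrow> real" where
  "disp x = L2_set (\<lambda>i. norm (qs x ! i - ps ! i)) {..<Q}"

lemma disp_nonneg: "0 \<le> disp x"
  by (simp add: disp_def L2_set_nonneg)

lemma norm_le_disp: "i < Q \<Longrightarrow> norm (qs x ! i - ps ! i) \<le> disp x"
  unfolding disp_def by (intro member_le_L2_set[of "{..<Q}" i "\<lambda>i. norm (qs x ! i - ps ! i)"]) auto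

lemma disp_squared: "(disp x)\<^sup>2 = (\<Sum>i<Q. (norm (qs x ! i - ps ! i))\<^sup>2)"
  by (simp add: disp_def L2_set_def sum_nonneg)

lemma disp_upper:
  assumes "0 < \<epsilon>"
  shows "\<forall>\<^sub>F x in ap_at a. disp x \<le> (SUP k. w k \<bullet> (x - a)) + \<epsilon> * norm (x - a)"
  using upper[OF assms] size_f by eventually_elim (simp add: qs(3) disp_def)

lemma disp_linear: "\<forall>\<^sub>F x in ap_at a. disp x \<le> (\<gamma> + 1) * norm (x - a)"
  using disp_upper[OF zero_less_one]
proof eventually_elim
  case (elim x)
  have "(SUP k. w k \<bullet> (x - a)) \<le> \<gamma> * norm (x - a)"
    by (rule cSUP_least) (auto intro: w_inner_le)
  with elim show ?case by (simp add: algebra_simps)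
qed

lemma disp_small: "0 < \<delta> \<Longrightarrow> \<forall>\<^sub>F x in ap_at a. disp x < \<delta>"
proof -
  assume \<delta>: "0 < \<delta>"
  then have "0 < \<delta> / (\<gamma> + 1)" using \<gamma>_nonneg by simp
  from ap_at_small_norm[OF this] disp_linear show ?thesis
  proof eventually_elim
    case (elim x)
    have "(\<gamma> + 1) * norm (x - a) < \<delta>"
      using elim(1) \<gamma>_nonneg by (simp add: pos_less_divide_eq mult.commute)
    with elim(2) show ?case by simp
  qed
qed

definition gap :: real where
  "gap = (SOME \<delta>. 0 < \<delta> \<and> (\<forall>i<Q. \<forall>j<Q. ps ! i \<noteq> ps ! j \<longrightarrow> 4 * \<delta> \<le> norm (ps ! i - ps ! j)))"

lemma gap: "0 < gap" "\<And>i j. i < Q \<Longrightarrow> j < Q \<Longrightarrow> ps ! i \<noteq> ps ! j \<Longrightarrow> 4 * gap \<le> norm (ps ! i - ps ! j)"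
proof -
  have "\<exists>\<delta>>0. \<forall>i<Q. \<forall>j<Q. ps ! i \<noteq> ps ! j \<longrightarrow> 4 * \<delta> \<le> norm (ps ! i - ps ! j)"
  proof -
    define N where "N = insert 1 ((\<lambda>(i, j). norm (ps ! i - ps ! j)) ` {(i, j). i < Q \<and> j < Q \<and> ps ! i \<noteq> ps ! j})"
    have "{(i, j). i < Q \<and> j < Q \<and> ps ! i \<noteq> ps ! j} \<subseteq> {..<Q} \<times> {..<Q}" by auto
    then have "finite {(i, j). i < Q \<and> j < Q \<and> ps ! i \<noteq> ps ! j}" by (rule finite_subset) simp
    then have fin: "finite N" unfolding N_def by (intro finite.insertI finite_imageI)
    have pos: "0 < Min N" using fin by (subst Min_gr_iff) (auto simp: N_def)
    have "Min N \<le> norm (ps ! i - ps ! j)" if "i < Q" "j < Q" "ps ! i \<noteq> ps ! j" for i j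
      using fin that by (intro Min_le) (auto simp: N_def)
    then show ?thesis using pos by (intro exI[of _ "Min N / 4"]) auto
  qed
  from someI_ex[OF this] show "0 < gap" "\<And>i j. i < Q \<Longrightarrow> j < Q \<Longrightarrow> ps ! i \<noteq> ps ! j \<Longrightarrow> 4 * gap \<le> norm (ps ! i - ps ! j)"
    unfolding gap_def by blast+
qed

text \<open>For \<open>x\<close> near \<open>a\<close>, equal values of \<open>f x\<close> are
  matched with equal values of \<open>f a\<close>, so the matching induces a surjection of the
  distinct values of \<open>f x\<close> onto those of \<open>f a\<close>. By \<open>stratum\<close>
  there are equally many, hence it is injective.\<close>

lemma coherent: "\<forall>\<^sub>F x in ap_at a. \<forall>i<Q. \<forall>j<Q. ps ! i = ps ! j \<longrightarrow> qs x ! i = qs x ! j"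
  using size_f stratum disp_small[OF gap(1)]
proof eventually_elim
  case (elim x)
  note q = qs[OF elim(1)]
  have close: "norm (qs x ! i - ps ! i) < gap" if "i < Q" for i
    using norm_le_disp[OF that, of x] elim(3) by linarith
  have inj1: "ps ! i = ps ! j" if "i < Q" "j < Q" "qs x ! i = qs x ! j" for i j
  proof (rule ccontr)
    assume "ps ! i \<noteq> ps ! j"
    then have "4 * gap \<le> norm (ps ! i - ps ! j)" using gap(2) that by blast
    also have "\<dots> \<le> norm (ps ! i - qs x ! i) + norm (qs x ! j - ps ! j)"
      using norm_triangle_ineq[of "ps ! i - qs x ! i" "qs x ! j - ps ! j"] that(3) by simp
    also have "\<dots> < gap + gap"
      using close[OF that(1)] close[OF that(2)] by (subst norm_minus_commute) linarith
    finally show False using gap(1) by simp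
  qed
  have setq: "set_mset (f x) = (\<lambda>i. qs x ! i) ` {..<Q}"
    using q(1) by (auto simp: q(2)[symmetric] set_conv_nth)
  have setp: "set_mset (f a) = (\<lambda>i. ps ! i) ` {..<Q}"
    using length_ps by (auto simp: mset_ps[symmetric] set_conv_nth)
  define g where "g v = ps ! (SOME i. i < Q \<and> qs x ! i = v)" for v
  have g: "g (qs x ! i) = ps ! i" if "i < Q" for i
  proof -
    have "\<exists>j. j < Q \<and> qs x ! j = qs x ! i" using that by blast
    from someI_ex[OF this] show ?thesis unfolding g_def using inj1 that by blast
  qed
  have "g ` set_mset (f x) = set_mset (f a)"
    unfolding setq setp image_image using g by (auto intro!: image_cong)
  then have "inj_on g (set_mset (f x))"
    using elim(2) by (intro eq_card_imp_inj_on) auto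
  then have "qs x ! i = qs x ! j" if "i < Q" "j < Q" "ps ! i = ps ! j" for i j
    using that g[OF that(1)] g[OF that(2)] unfolding setq by - (rule inj_onD[of g], auto)
  then show ?case by blast
qed

definition good :: "real ^ 'm \<Rightarrow> bool" where
  "good x \<longleftrightarrow> size (f x) = Q \<and> disp x \<le> (\<gamma> + 1) * norm (x - a) \<and> disp x < gap \<and>
     (\<forall>i<Q. \<forall>j<Q. ps ! i = ps ! j \<longrightarrow> qs x ! i = qs x ! j)"

lemma eventually_good: "\<forall>\<^sub>F x in ap_at a. good x"
  unfolding good_def using size_f disp_linear disp_small[OF gap(1)] coherent
  by eventually_elim blast

lemma sum_inner_bound:
  "\<bar>\<Sum>i<Q. (u i :: 'h) \<bullet> v i\<bar> \<le> L2_set (\<lambda>i. norm (u i)) {..<Q} * L2_set (\<lambda>i. norm (v i)) {..<Q}"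
proof -
  have "\<bar>\<Sum>i<Q. u i \<bullet> v i\<bar> \<le> (\<Sum>i<Q. \<bar>norm (u i)\<bar> * \<bar>norm (v i)\<bar>)"
    by (rule order_trans[OF sum_abs sum_mono]) (simp add: Cauchy_Schwarz_ineq2)
  also have "\<dots> \<le> L2_set (\<lambda>i. norm (u i)) {..<Q} * L2_set (\<lambda>i. norm (v i)) {..<Q}"
    by (rule L2_set_mult_ineq)
  finally show ?thesis .
qed

lemma ap_o_disp_squared: "ap_o a (\<lambda>x. (disp x)\<^sup>2)"
proof (rule ap_o_quadratic[where C = "(\<gamma> + 1)\<^sup>2"])
  show "\<forall>\<^sub>F x in ap_at a. \<bar>(disp x)\<^sup>2\<bar> \<le> (\<gamma> + 1)\<^sup>2 * (norm (x - a))\<^sup>2"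
    using disp_linear
    by eventually_elim (use disp_nonneg in \<open>simp add: power_mult_distrib[symmetric] power_mono\<close>)
qed

lemma L2_diff_squared:
  "(L2_set (\<lambda>i. norm (qs x ! i - t i)) {..<Q})\<^sup>2 - (L2_set (\<lambda>i. norm (ps ! i - t i)) {..<Q})\<^sup>2
    = (disp x)\<^sup>2 + 2 * (\<Sum>i<Q. (qs x ! i - ps ! i) \<bullet> (ps ! i - t i))"
proof -
  have "(L2_set (\<lambda>i. norm (qs x ! i - t i)) {..<Q})\<^sup>2 - (L2_set (\<lambda>i. norm (ps ! i - t i)) {..<Q})\<^sup>2
    = (\<Sum>i<Q. (norm (qs x ! i - t i))\<^sup>2 - (norm (ps ! i - t i))\<^sup>2)"
    by (simp add: L2_set_def sum_nonneg sum_subtractf)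
  also have "\<dots> = (\<Sum>i<Q. (norm (qs x ! i - ps ! i))\<^sup>2 + 2 * ((qs x ! i - ps ! i) \<bullet> (ps ! i - t i)))"
    by (intro sum.cong refl)
       (simp add: power2_norm_eq_inner inner_diff_left inner_diff_right inner_commute)
  also have "\<dots> = (disp x)\<^sup>2 + 2 * (\<Sum>i<Q. (qs x ! i - ps ! i) \<bullet> (ps ! i - t i))"
    by (simp add: disp_squared sum.distrib sum_distrib_left)
  finally show ?thesis .
qed

lemma expand_squared:
  "ap_o a (\<lambda>x. (Gdist (f x) (T k))\<^sup>2 - (Gdist (f a) (T k))\<^sup>2 - (2 * Gdist (f a) (T k)) * (w k \<bullet> (x - a)))"
proof -
  let ?u = "\<lambda>x. Gdist (f x) (T k)"
  let ?e = "\<lambda>x. ?u x - ?u a - w k \<bullet> (x - a)"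
  have "ap_o a (\<lambda>x. (?u x - ?u a)\<^sup>2)"
  proof (rule ap_o_quadratic[where C = "(\<gamma> + 1)\<^sup>2"])
    show "\<forall>\<^sub>F x in ap_at a. \<bar>(?u x - ?u a)\<^sup>2\<bar> \<le> (\<gamma> + 1)\<^sup>2 * (norm (x - a))\<^sup>2"
      using ap_oD[OF expand[of k] zero_less_one]
    proof eventually_elim
      case (elim x)
      have "\<bar>w k \<bullet> (x - a)\<bar> \<le> norm (w k) * norm (x - a)" by (rule Cauchy_Schwarz_ineq2)
      also have "\<dots> \<le> \<gamma> * norm (x - a)" using w_bound by (rule mult_right_mono) simp
      finally have "\<bar>?u x - ?u a\<bar> \<le> (\<gamma> + 1) * norm (x - a)"
        using elim by (simp add: algebra_simps)
      then have "\<bar>?u x - ?u a\<bar>\<^sup>2 \<le> ((\<gamma> + 1) * norm (x - a))\<^sup>2" by (intro power_mono) auto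
      then show ?case by (simp add: power_mult_distrib)
    qed
  qed
  from ap_o_add[OF this ap_o_cmult[OF expand[of k], of "2 * ?u a"]]
  show ?thesis
    by (rule ap_o_mono) (intro always_eventually allI, simp add: power2_eq_square algebra_simps)
qed

text \<open>Polarisation: for the tuple with entries \<open>ps ! i - \<tau> *\<^sub>R d i\<close>,
  the squared distance changes to first order by \<open>2 * \<tau>\<close> times the sum in
  question, and its linear part is known from \<open>expand_squared\<close>. The tuple has to be
  replaced by some \<open>T k\<close>, so each \<open>\<epsilon>\<close> yields its own covector and
  \<open>ap_o_linear_limit\<close> concludes.\<close>

lemma inner_expansion:
  "\<exists>c. ap_o a (\<lambda>x. (\<Sum>i<Q. (qs x ! i - ps ! i) \<bullet> d i) - c \<bullet> (x - a))"
proof (rule ap_o_linear_limit)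
  fix \<epsilon> :: real assume \<epsilon>: "0 < \<epsilon>"
  define N where "N = L2_set (\<lambda>i. norm (d i)) {..<Q}"
  have N: "0 \<le> N" by (simp add: N_def L2_set_nonneg)
  \<comment> \<open>So small that the displaced tuple stays within \<open>gap / 2\<close> of
    \<open>ps\<close>, in the region where the identity matching is optimal.\<close>
  define \<tau> where "\<tau> = gap / (2 * (N + 1))"
  have \<tau>: "0 < \<tau>" "\<tau> * N < gap / 2"
  proof -
    show "0 < \<tau>" using gap(1) N by (simp add: \<tau>_def)
    have "gap * N < gap * (N + 1)" using gap(1) by simp
    then show "\<tau> * N < gap / 2" using N by (simp add: \<tau>_def divide_less_eq distrib_left)
  qed
  \<comment> \<open>The first bound keeps the replacing tuple within \<open>gap\<close> of
    \<open>ps\<close>; the second limits the replacement error to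
    \<open>\<tau> * \<epsilon> / 2 * norm (x - a)\<close>, half of what is allowed.\<close>
  define \<eta> where "\<eta> = min (gap / 2) (\<tau> * \<epsilon> / (2 * (\<gamma> + 1)))"
  have \<eta>: "0 < \<eta>" using gap(1) \<tau>(1) \<epsilon> \<gamma>_nonneg by (simp add: \<eta>_def)
  define ts where "ts = map (\<lambda>i. ps ! i - \<tau> *\<^sub>R d i) [0..<Q]"
  obtain k ts' where k: "T k = mset ts'" "length ts' = Q"
    "L2_set (\<lambda>i. norm (ts' ! i - ts ! i)) {..<Q} < \<eta>"
    using dense[of ts \<eta>] \<eta> by (auto simp: ts_def)
  have tsi: "ts ! i = ps ! i - \<tau> *\<^sub>R d i" if "i < Q" for i using that by (simp add: ts_def)
  have "L2_set (\<lambda>i. norm (ts' ! i - ps ! i)) {..<Q}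
    \<le> L2_set (\<lambda>i. norm (ts' ! i - ts ! i) + \<tau> * norm (d i)) {..<Q}"
  proof (rule L2_set_mono)
    fix i assume "i \<in> {..<Q}"
    then show "norm (ts' ! i - ps ! i) \<le> norm (ts' ! i - ts ! i) + \<tau> * norm (d i)"
      using norm_triangle_ineq[of "ts' ! i - ts ! i" "ts ! i - ps ! i"] tsi[of i] \<tau>(1) by simp
  qed simp
  also have "\<dots> \<le> L2_set (\<lambda>i. norm (ts' ! i - ts ! i)) {..<Q} + L2_set (\<lambda>i. \<tau> * norm (d i)) {..<Q}"
    by (rule L2_set_triangle_ineq)
  also have "L2_set (\<lambda>i. \<tau> * norm (d i)) {..<Q} = \<tau> * N"
    unfolding N_def using \<tau>(1) by (subst L2_set_right_distrib) auto
  finally have near: "L2_set (\<lambda>i. norm (ts' ! i - ps ! i)) {..<Q} < gap"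
    using k(3) \<tau>(2) by (simp add: \<eta>_def)
  let ?S = "\<lambda>x. \<Sum>i<Q. (qs x ! i - ps ! i) \<bullet> (ps ! i - ts' ! i)"
  let ?u = "\<lambda>x. Gdist (f x) (T k)"
  have u0: "?u a = L2_set (\<lambda>i. norm (ps ! i - ts' ! i)) {..<Q}"
    unfolding k(1) mset_ps[symmetric]
    by (rule Gdist_eq_L2_set[OF length_ps length_ps k(2) gap(2) _ _ near]) (simp_all add: L2_set_def gap(1))
  have small: "ap_o a (\<lambda>x. ?S x - ?u a * (w k \<bullet> (x - a)))"
  proof (rule ap_o_mono[OF ap_o_cmult[OF ap_o_diff[OF expand_squared[of k] ap_o_disp_squared], of "1/2"]])
    show "\<forall>\<^sub>F x in ap_at a. \<bar>?S x - ?u a * (w k \<bullet> (x - a))\<bar>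
      \<le> \<bar>1/2 * ((?u x)\<^sup>2 - (?u a)\<^sup>2 - 2 * ?u a * (w k \<bullet> (x - a)) - (disp x)\<^sup>2)\<bar>"
      using eventually_good
    proof eventually_elim
      case (elim x)
      then have x: "size (f x) = Q" and dx: "disp x < gap"
        and coh: "\<And>i j. i < Q \<Longrightarrow> j < Q \<Longrightarrow> ps ! i = ps ! j \<Longrightarrow> qs x ! i = qs x ! j"
        unfolding good_def by blast+
      have "Gdist (mset (qs x)) (mset ts') = L2_set (\<lambda>i. norm (qs x ! i - ts' ! i)) {..<Q}"
        by (rule Gdist_eq_L2_set[OF length_ps qs(1)[OF x] k(2) gap(2) coh dx[unfolded disp_def] near])
      then have "?u x = L2_set (\<lambda>i. norm (qs x ! i - ts' ! i)) {..<Q}"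
        unfolding qs(2)[OF x] k(1) .
      then have "(?u x)\<^sup>2 - (?u a)\<^sup>2 = (disp x)\<^sup>2 + 2 * ?S x"
        using L2_diff_squared[of x "\<lambda>i. ts' ! i"] u0 by simp
      then have "1/2 * ((?u x)\<^sup>2 - (?u a)\<^sup>2 - 2 * ?u a * (w k \<bullet> (x - a)) - (disp x)\<^sup>2)
        = ?S x - ?u a * (w k \<bullet> (x - a))"
        by (simp add: field_simps)
      then show ?case by (simp only: order_refl)
    qed
  qed
  have "0 < \<tau> * \<epsilon> / 2" using \<tau> \<epsilon> by simp
  from ap_oD[OF small this] eventually_good
  have "\<forall>\<^sub>F x in ap_at a. \<bar>(\<Sum>i<Q. (qs x ! i - ps ! i) \<bullet> d i) - ((?u a / \<tau>) *\<^sub>R w k) \<bullet> (x - a)\<bar> \<le> \<epsilon> * norm (x - a)"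
  proof eventually_elim
    case (elim x)
    have "\<tau> * (\<Sum>i<Q. (qs x ! i - ps ! i) \<bullet> d i) = ?S x + (\<Sum>i<Q. (qs x ! i - ps ! i) \<bullet> (ts' ! i - ts ! i))"
      unfolding sum_distrib_left sum.distrib[symmetric]
    proof (rule sum.cong[OF refl])
      fix i assume "i \<in> {..<Q}"
      then have "\<tau> *\<^sub>R d i = (ps ! i - ts' ! i) + (ts' ! i - ts ! i)" using tsi by simp
      then show "\<tau> * ((qs x ! i - ps ! i) \<bullet> d i) = (qs x ! i - ps ! i) \<bullet> (ps ! i - ts' ! i) + (qs x ! i - ps ! i) \<bullet> (ts' ! i - ts ! i)"
        by (metis inner_add_right inner_scaleR_right)
    qed
    then have "\<tau> * ((\<Sum>i<Q. (qs x ! i - ps ! i) \<bullet> d i) - ((?u a / \<tau>) *\<^sub>R w k) \<bullet> (x - a))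
      = (?S x - ?u a * (w k \<bullet> (x - a))) + (\<Sum>i<Q. (qs x ! i - ps ! i) \<bullet> (ts' ! i - ts ! i))"
      using \<tau>(1) by (simp add: right_diff_distrib)
    note eq = this
    have bd: "\<bar>\<Sum>i<Q. (qs x ! i - ps ! i) \<bullet> (ts' ! i - ts ! i)\<bar> \<le> \<tau> * \<epsilon> / 2 * norm (x - a)"
    proof -
      have "\<bar>\<Sum>i<Q. (qs x ! i - ps ! i) \<bullet> (ts' ! i - ts ! i)\<bar>
        \<le> disp x * L2_set (\<lambda>i. norm (ts' ! i - ts ! i)) {..<Q}"
        unfolding disp_def by (rule sum_inner_bound)
      also have "\<dots> \<le> ((\<gamma> + 1) * norm (x - a)) * \<eta>"
        using elim(2) k(3) \<gamma>_nonneg unfolding good_def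
        by (intro mult_mono) (auto simp: L2_set_nonneg)
      also have "\<dots> \<le> ((\<gamma> + 1) * norm (x - a)) * (\<tau> * \<epsilon> / (2 * (\<gamma> + 1)))"
        using \<gamma>_nonneg by (intro mult_left_mono) (auto simp: \<eta>_def)
      also have "\<dots> = \<tau> * \<epsilon> / 2 * norm (x - a)" using \<gamma>_nonneg by (simp add: field_simps)
      finally show ?thesis .
    qed
    have "\<bar>\<tau> * ((\<Sum>i<Q. (qs x ! i - ps ! i) \<bullet> d i) - ((?u a / \<tau>) *\<^sub>R w k) \<bullet> (x - a))\<bar>
      \<le> \<tau> * \<epsilon> / 2 * norm (x - a) + \<tau> * \<epsilon> / 2 * norm (x - a)"
      unfolding eq using elim(1) bd by linarith
    also have "\<dots> = \<tau> * (\<epsilon> * norm (x - a))" by simp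
    finally have "\<bar>\<tau> * ((\<Sum>i<Q. (qs x ! i - ps ! i) \<bullet> d i) - ((?u a / \<tau>) *\<^sub>R w k) \<bullet> (x - a))\<bar>
      \<le> \<tau> * (\<epsilon> * norm (x - a))" .
    then show ?case using \<tau>(1) by (simp add: abs_mult)
  qed
  then show "\<exists>c. \<forall>\<^sub>F x in ap_at a. \<bar>(\<Sum>i<Q. (qs x ! i - ps ! i) \<bullet> d i) - c \<bullet> (x - a)\<bar> \<le> \<epsilon> * norm (x - a)"
    by blast
qed

text \<open>The approximate gradient at \<open>a\<close> of the \<open>e\<close>-component of branch
  \<open>i\<close>.\<close>

definition coef :: "nat \<Rightarrow> 'h \<Rightarrow> real ^ 'm" where
  "coef i e = (SOME c. ap_o a (\<lambda>x. (qs x ! i - ps ! i) \<bullet> e - c \<bullet> (x - a)))"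

lemma coef:
  assumes "i < Q"
  shows "ap_o a (\<lambda>x. (qs x ! i - ps ! i) \<bullet> e - coef i e \<bullet> (x - a))"
proof -
  have "(\<Sum>j<Q. (qs x ! j - ps ! j) \<bullet> (if j = i then e else 0)) = (qs x ! i - ps ! i) \<bullet> e" for x
    using assms by (simp add: if_distrib cong: if_cong)
  with inner_expansion[of "\<lambda>j. if j = i then e else 0"]
  have "\<exists>c. ap_o a (\<lambda>x. (qs x ! i - ps ! i) \<bullet> e - c \<bullet> (x - a))" by simp
  from someI_ex[OF this] show ?thesis unfolding coef_def .
qed

lemma coef_unique:
  assumes "i < Q" "ap_o a (\<lambda>x. (qs x ! i - ps ! i) \<bullet> e - c \<bullet> (x - a))"
  shows "coef i e = c"
proof -
  have "ap_o a (\<lambda>x. (c - coef i e) \<bullet> (x - a))"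
    using ap_o_diff[OF coef[OF assms(1), of e] assms(2)]
    by (rule ap_o_mono) (simp add: inner_diff_left)
  from ap_o_inner_unique[OF this] show ?thesis by simp
qed

lemma linear_coef: "i < Q \<Longrightarrow> linear (coef i)"
proof (rule linearI)
  assume i: "i < Q"
  show "coef i (e + e') = coef i e + coef i e'" for e e'
    by (rule coef_unique[OF i], rule ap_o_mono[OF ap_o_add[OF coef[OF i, of e] coef[OF i, of e']]])
       (simp add: inner_add_left inner_add_right algebra_simps)
  show "coef i (r *\<^sub>R e) = r *\<^sub>R coef i e" for r e
    by (rule coef_unique[OF i], rule ap_o_mono[OF ap_o_cmult[OF coef[OF i, of e], of r]])
       (simp add: algebra_simps)
qed

lemma norm_coef:
  assumes "i < Q"
  shows "norm (coef i e) \<le> (\<gamma> + 1) * norm e"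
proof (rule field_le_epsilon)
  fix \<epsilon> :: real assume \<epsilon>: "0 < \<epsilon>"
  show "norm (coef i e) \<le> (\<gamma> + 1) * norm e + \<epsilon>"
  proof (rule ap_o_inner_bound[where a = a])
    show "\<forall>\<^sub>F x in ap_at a. \<bar>coef i e \<bullet> (x - a)\<bar> \<le> ((\<gamma> + 1) * norm e + \<epsilon>) * norm (x - a)"
      using ap_oD[OF coef[OF assms, of e] \<epsilon>] disp_linear
    proof eventually_elim
      case (elim x)
      have "\<bar>(qs x ! i - ps ! i) \<bullet> e\<bar> \<le> norm (qs x ! i - ps ! i) * norm e" by (rule Cauchy_Schwarz_ineq2)
      also have "\<dots> \<le> ((\<gamma> + 1) * norm (x - a)) * norm e"
        using norm_le_disp[OF assms, of x] elim(2) by (intro mult_right_mono) auto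
      finally have "\<bar>(qs x ! i - ps ! i) \<bullet> e\<bar> \<le> (\<gamma> + 1) * norm e * norm (x - a)" by (simp add: ac_simps)
      with elim(1) show ?case by (simp add: distrib_right)
    qed
  qed
qed

text \<open>The transpose of \<open>coef i\<close>: the derivative of branch \<open>i\<close> in
  direction \<open>b\<close>, a vector of the Hilbert space by
  \<open>riesz_representation\<close>.\<close>

definition repr :: "nat \<Rightarrow> real ^ 'm \<Rightarrow> 'h" where
  "repr i b = (SOME l. \<forall>e. coef i e \<bullet> b = l \<bullet> e)"

lemma repr:
  assumes "i < Q"
  shows "repr i b \<bullet> e = coef i e \<bullet> b"
proof -
  have "\<exists>l. \<forall>e. coef i e \<bullet> b = l \<bullet> e"
  proof (rule riesz_representation[where K = "(\<gamma> + 1) * norm b"])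
    show "linear (\<lambda>e. coef i e \<bullet> b)"
      using linear_coef[OF assms] by (auto intro!: linearI simp: linear_add linear_cmul inner_add_left)
    fix e
    have "\<bar>coef i e \<bullet> b\<bar> \<le> norm (coef i e) * norm b" by (rule Cauchy_Schwarz_ineq2)
    also have "\<dots> \<le> ((\<gamma> + 1) * norm e) * norm b" using norm_coef[OF assms] by (intro mult_right_mono) auto
    finally show "\<bar>coef i e \<bullet> b\<bar> \<le> (\<gamma> + 1) * norm b * norm e" by (simp add: ac_simps)
  qed
  then have "\<forall>e. coef i e \<bullet> b = repr i b \<bullet> e" unfolding repr_def by (rule someI_ex)
  then show ?thesis by metis
qed

lemma linear_repr:
  assumes "i < Q"
  shows "linear (repr i)"
proof (rule linearI)
  show "repr i (b + b') = repr i b + repr i b'" for b b'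
  proof -
    have "repr i (b + b') \<bullet> e = (repr i b + repr i b') \<bullet> e" for e
      by (simp add: repr[OF assms] inner_add_left inner_add_right)
    then show ?thesis by (metis vector_eq_ldot inner_commute)
  qed
  show "repr i (r *\<^sub>R b) = r *\<^sub>R repr i b" for r b
  proof -
    have "repr i (r *\<^sub>R b) \<bullet> e = (r *\<^sub>R repr i b) \<bullet> e" for e
      by (simp add: repr[OF assms])
    then show ?thesis by (metis vector_eq_ldot inner_commute)
  qed
qed

lemma weak_expansion:
  "i < Q \<Longrightarrow> ap_o a (\<lambda>x. (qs x ! i - ps ! i) \<bullet> e - repr i (x - a) \<bullet> e)"
  using coef[of i e] by (simp add: repr)

lemma repr_coherent:
  assumes "i < Q" "j < Q" "ps ! i = ps ! j"
  shows "repr i = repr j"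
proof
  fix b
  have "coef i e = coef j e" for e
  proof (rule coef_unique[OF assms(1)], rule ap_o_mono[OF coef[OF assms(2), of e]])
    show "\<forall>\<^sub>F x in ap_at a. \<bar>(qs x ! i - ps ! i) \<bullet> e - coef j e \<bullet> (x - a)\<bar>
      \<le> \<bar>(qs x ! j - ps ! j) \<bullet> e - coef j e \<bullet> (x - a)\<bar>"
      using coherent
    proof eventually_elim
      case (elim x)
      then have "qs x ! i = qs x ! j" using assms by blast
      then show ?case using assms(3) by simp
    qed
  qed
  then have "repr i b \<bullet> e = repr j b \<bullet> e" for e using assms by (simp add: repr)
  then show "repr i b = repr j b" by (metis vector_eq_ldot inner_commute)
qed

text \<open>The norm of the tuple of all branch derivatives in direction \<open>z\<close>, against
  which the size \<open>disp x\<close> of the actual increment is measured.\<close>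

definition size_D :: "real ^ 'm \<Rightarrow> real" where
  "size_D z = L2_set (\<lambda>i. norm (repr i z)) {..<Q}"

lemma size_D_nonneg: "0 \<le> size_D z"
  by (simp add: size_D_def L2_set_nonneg)

lemma size_D_scale: "0 < t \<Longrightarrow> size_D (t *\<^sub>R z) = t * size_D z"
  unfolding size_D_def
  by (subst L2_set_right_distrib) (auto simp: linear_cmul[OF linear_repr] intro!: L2_set_cong)

lemma isCont_size_D: "isCont size_D z"
  unfolding size_D_def L2_set_def
  by (intro continuous_intros linear_continuous_at linear_conv_bounded_linear[THEN iffD1] linear_repr) auto

lemma size_D_bounded: "\<exists>K\<ge>0. \<forall>z. size_D z \<le> K * norm z"
proof -
  have "\<exists>B. \<forall>z. norm (repr i z) \<le> B * norm z" if "i < Q" for i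
    using linear_bounded_pos[OF linear_repr[OF that]] by blast
  then have "\<exists>K. \<forall>i<Q. \<forall>z. norm (repr i z) \<le> K i * norm z" by metis
  then obtain K where K: "\<And>i z. i < Q \<Longrightarrow> norm (repr i z) \<le> K i * norm z" by metis
  have "size_D z \<le> (\<Sum>i<Q. \<bar>K i\<bar>) * norm z" for z
  proof -
    have "size_D z \<le> (\<Sum>i<Q. norm (repr i z))"
      unfolding size_D_def by (rule L2_set_le_sum) simp
    also have "\<dots> \<le> (\<Sum>i<Q. \<bar>K i\<bar> * norm z)"
      using K by (intro sum_mono) (meson abs_ge_self mult_right_mono norm_ge_zero order_trans lessThan_iff)
    finally show ?thesis by (simp add: sum_distrib_right)
  qed
  then show ?thesis by (intro exI[of _ "\<Sum>i<Q. \<bar>K i\<bar>"]) (simp add: sum_nonneg)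
qed

lemma sum_weak_expansion:
  "ap_o a (\<lambda>x. (\<Sum>i<Q. (qs x ! i - ps ! i) \<bullet> d i) - (\<Sum>i<Q. repr i (x - a) \<bullet> d i))"
  using ap_o_sum[of "{..<Q}" a "\<lambda>i x. (qs x ! i - ps ! i) \<bullet> d i - repr i (x - a) \<bullet> d i"] weak_expansion
  by (simp add: sum_subtractf)

text \<open>Matching \<open>qs x\<close> with the enumeration of \<open>T k\<close> that is optimal
  for \<open>ps\<close> bounds \<open>Gdist (f x) (T k)\<close> from above, for every
  \<open>T k\<close>, near or far. The weak expansion gives the first-order part of this bound and
  Cauchy-Schwarz estimates it. If the distance vanishes at \<open>a\<close>, it has a minimum there
  and \<open>w k = 0\<close>.\<close>

lemma w_le_size_D: "w k \<bullet> z \<le> size_D z"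
proof (rule field_le_epsilon)
  fix e :: real assume e: "0 < e"
  define \<epsilon> where "\<epsilon> = e / (norm z + 1)"
  have \<epsilon>: "0 < \<epsilon>" using e by (auto simp: \<epsilon>_def intro!: divide_pos_pos add_nonneg_pos)
  have "\<forall>\<^sub>F x in ap_at a. (w k \<bullet> (x - a) - size_D (x - a)) - \<epsilon> * norm (x - a) \<le> 0"
  proof -
    let ?u = "\<lambda>x. Gdist (f x) (T k)"
    obtain ts where ts: "length ts = Q" "mset ts = T k"
      "?u a = L2_set (\<lambda>i. norm (ps ! i - ts ! i)) {..<Q}"
      using Gdist_matchingE[OF mset_ps, of "T k"] size_T size_a length_ps by metis
    have u0: "0 \<le> ?u a" unfolding ts(3) by (simp add: L2_set_nonneg)
    show ?thesis
    proof (cases "?u a = 0")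
      case True
      have "(- w k) \<bullet> v \<le> 0" for v
      proof (rule field_le_epsilon)
        fix e' :: real assume e': "0 < e'"
        define \<epsilon>' where "\<epsilon>' = e' / (norm v + 1)"
        have \<epsilon>': "0 < \<epsilon>'" using e' by (auto simp: \<epsilon>'_def intro!: divide_pos_pos add_nonneg_pos)
        have "(- w k) \<bullet> v - \<epsilon>' * norm v \<le> 0"
        proof (rule homogeneous_ap_at_le_0[where F = "\<lambda>v. (- w k) \<bullet> v - \<epsilon>' * norm v" and a = a])
          show "\<forall>\<^sub>F x in ap_at a. - w k \<bullet> (x - a) - \<epsilon>' * norm (x - a) \<le> 0"
            using ap_oD[OF expand[of k] \<epsilon>'] size_f
          proof eventually_elim
            case (elim x)
            have "0 \<le> ?u x" using elim(2) size_T by (intro Gdist_nonneg) simp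
            with elim(1) True show ?case by (simp add: abs_le_iff)
          qed
        qed (auto simp: algebra_simps intro!: continuous_intros)
        moreover have "\<epsilon>' * norm v \<le> e'"
          unfolding \<epsilon>'_def using e' by (rule divide_Suc_mult_le) simp
        ultimately show "(- w k) \<bullet> v \<le> 0 + e'" by simp
      qed
      from this[of "- w k"] have "w k \<bullet> w k \<le> 0" by simp
      then have "w k = 0" using inner_ge_zero[of "w k"] inner_eq_zero_iff[of "w k"] by linarith
      then have "(w k \<bullet> (x - a) - size_D (x - a)) - \<epsilon> * norm (x - a) \<le> 0" for x
        using size_D_nonneg[of "x - a"] mult_nonneg_nonneg[OF less_imp_le[OF \<epsilon>] norm_ge_zero[of "x - a"]]
        by (simp only: inner_zero_left)
      then show ?thesis by simp
    next
      case False
      then have pos: "0 < ?u a" using u0 by simp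
      let ?S = "\<lambda>x. \<Sum>i<Q. (qs x ! i - ps ! i) \<bullet> (ps ! i - ts ! i)"
      let ?R = "\<lambda>x. \<Sum>i<Q. repr i (x - a) \<bullet> (ps ! i - ts ! i)"
      have "ap_o a (\<lambda>x. ((disp x)\<^sup>2 + 2 * (?S x - ?R x))
        - ((?u x)\<^sup>2 - (?u a)\<^sup>2 - (2 * ?u a) * (w k \<bullet> (x - a))))"
        by (rule ap_o_diff[OF ap_o_add[OF ap_o_disp_squared ap_o_cmult[OF sum_weak_expansion]] expand_squared])
      from ap_oD[OF this, of "2 * ?u a * \<epsilon>"] pos \<epsilon>
      have "\<forall>\<^sub>F x in ap_at a. \<bar>((disp x)\<^sup>2 + 2 * (?S x - ?R x))
        - ((?u x)\<^sup>2 - (?u a)\<^sup>2 - (2 * ?u a) * (w k \<bullet> (x - a)))\<bar> \<le> 2 * ?u a * \<epsilon> * norm (x - a)" by simp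
      then show ?thesis using size_f
      proof eventually_elim
        case (elim x)
        have "?u x \<le> L2_set (\<lambda>i. norm (qs x ! i - ts ! i)) {..<Q}"
          using Gdist_nth_le[of "qs x" ts] qs(1,2)[OF elim(2)] ts by simp
        moreover have "0 \<le> ?u x" using elim(2) size_T by (intro Gdist_nonneg) simp
        ultimately have "(?u x)\<^sup>2 \<le> (L2_set (\<lambda>i. norm (qs x ! i - ts ! i)) {..<Q})\<^sup>2"
          by (intro power_mono)
        then have "(?u x)\<^sup>2 - (?u a)\<^sup>2 \<le> (disp x)\<^sup>2 + 2 * ?S x"
          using L2_diff_squared[of x "\<lambda>i. ts ! i"] ts(3) by simp
        with elim(1) have "(2 * ?u a) * (w k \<bullet> (x - a)) \<le> 2 * ?R x + 2 * ?u a * \<epsilon> * norm (x - a)"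
          by (simp add: abs_le_iff)
        also have "?R x \<le> size_D (x - a) * ?u a"
          unfolding size_D_def ts(3) using sum_inner_bound[of "\<lambda>i. repr i (x - a)" "\<lambda>i. ps ! i - ts ! i"] by simp
        finally have "(2 * ?u a) * (w k \<bullet> (x - a)) \<le> (2 * ?u a) * (size_D (x - a) + \<epsilon> * norm (x - a))"
          by (simp add: algebra_simps)
        then show ?case using pos by simp
      qed
    qed
  qed
  then have "(w k \<bullet> z - size_D z) - \<epsilon> * norm z \<le> 0"
    by (intro homogeneous_ap_at_le_0[where F = "\<lambda>z. (w k \<bullet> z - size_D z) - \<epsilon> * norm z" and a = a])
       (auto simp: size_D_scale algebra_simps intro!: continuous_intros isCont_size_D)
  moreover have "\<epsilon> * norm z \<le> e"
    unfolding \<epsilon>_def using e by (rule divide_Suc_mult_le) simp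
  ultimately show "w k \<bullet> z \<le> size_D z + e" by simp
qed

lemma disp_le_size_D:
  assumes "0 < \<epsilon>"
  shows "\<forall>\<^sub>F x in ap_at a. disp x \<le> size_D (x - a) + \<epsilon> * norm (x - a)"
  using disp_upper[OF assms]
proof eventually_elim
  case (elim x)
  have "(SUP k. w k \<bullet> (x - a)) \<le> size_D (x - a)"
    by (rule cSUP_least) (auto intro: w_le_size_D)
  with elim show ?case by simp
qed

section \<open>Strong expansion of the branches\<close>

definition err :: "real ^ 'm \<Rightarrow> real" where
  "err x = L2_set (\<lambda>i. norm (qs x ! i - (ps ! i + repr i (x - a)))) {..<Q}"

lemma err_squared:
  "(err x)\<^sup>2 = (disp x)\<^sup>2 - 2 * (\<Sum>i<Q. (qs x ! i - ps ! i) \<bullet> repr i (x - a)) + (size_D (x - a))\<^sup>2"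
proof -
  have "(err x)\<^sup>2 = (\<Sum>i<Q. (norm (qs x ! i - ps ! i))\<^sup>2 - 2 * ((qs x ! i - ps ! i) \<bullet> repr i (x - a)) + (norm (repr i (x - a)))\<^sup>2)"
    unfolding err_def L2_set_def
    by (simp add: sum_nonneg, intro sum.cong refl)
       (simp add: power2_norm_eq_inner inner_diff_left inner_diff_right inner_add_left inner_add_right inner_commute)
  also have "\<dots> = (disp x)\<^sup>2 - 2 * (\<Sum>i<Q. (qs x ! i - ps ! i) \<bullet> repr i (x - a)) + (size_D (x - a))\<^sup>2"
    by (simp add: disp_squared size_D_def L2_set_def sum_nonneg sum.distrib sum_subtractf sum_distrib_left)
  finally show ?thesis .
qed

text \<open>Weak convergence of the difference quotients together with the upper bound on their norms
  gives strong convergence.\<close>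

lemma ap_o_err: "ap_o a err"
  unfolding ap_o_def
proof (intro allI impI)
  fix \<eta> :: real assume \<eta>: "0 < \<eta>"
  obtain K where K: "0 \<le> K" "\<And>z. size_D z \<le> K * norm z" using size_D_bounded by blast
  \<comment> \<open>\<open>2 * K + 1\<close> collects the excess in the square of
    \<open>size_D z + \<epsilon> * norm z\<close>; the other summand is twice the error of the mixed
    term, expanded over the branches and the basis vectors.\<close>
  define C where "C = 2 * K + 1 + 2 * (real Q * real DIM(real ^ 'm))"
  have C: "0 < C" using K by (simp add: C_def add_pos_nonneg)
  define \<epsilon> where "\<epsilon> = min 1 (\<eta>\<^sup>2 / C)"
  have \<epsilon>: "0 < \<epsilon>" "\<epsilon> \<le> 1" "C * \<epsilon> \<le> \<eta>\<^sup>2"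
    using \<eta> C by (auto simp: \<epsilon>_def min_def field_simps)
  have "\<forall>\<^sub>F x in ap_at a. \<forall>i\<in>{..<Q}. \<forall>b\<in>Basis.
     \<bar>(qs x ! i - ps ! i) \<bullet> repr i b - repr i (x - a) \<bullet> repr i b\<bar> \<le> \<epsilon> * norm (x - a)"
    by (intro eventually_ball_finite finite_Basis ballI ap_oD[OF weak_expansion] \<epsilon>) auto
  then show "\<forall>\<^sub>F x in ap_at a. \<bar>err x\<bar> \<le> \<eta> * norm (x - a)"
    using disp_le_size_D[OF \<epsilon>(1)]
  proof eventually_elim
    case (elim x)
    let ?z = "x - a" and ?n = "norm (x - a)"
    have inner: "\<bar>(qs x ! i - ps ! i) \<bullet> repr i ?z - (norm (repr i ?z))\<^sup>2\<bar> \<le> real DIM(real ^ 'm) * (\<epsilon> * ?n\<^sup>2)" if i: "i < Q" for i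
    proof -
      let ?v = "(qs x ! i - ps ! i) - repr i ?z"
      have rz: "repr i ?z = (\<Sum>b\<in>Basis. (?z \<bullet> b) *\<^sub>R repr i b)"
      proof -
        have "repr i ?z = repr i (\<Sum>b\<in>Basis. (?z \<bullet> b) *\<^sub>R b)" by (simp add: euclidean_representation)
        also have "\<dots> = (\<Sum>b\<in>Basis. (?z \<bullet> b) *\<^sub>R repr i b)"
          by (simp add: linear_sum[OF linear_repr[OF i]] linear_cmul[OF linear_repr[OF i]])
        finally show ?thesis .
      qed
      have "(qs x ! i - ps ! i) \<bullet> repr i ?z - (norm (repr i ?z))\<^sup>2 = ?v \<bullet> repr i ?z"
        by (simp add: power2_norm_eq_inner inner_diff_left)
      also have "\<dots> = (\<Sum>b\<in>Basis. (?z \<bullet> b) * (?v \<bullet> repr i b))"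
        by (subst (2) rz) (simp add: inner_sum_right)
      also have "\<bar>\<dots>\<bar> \<le> (\<Sum>b\<in>(Basis::(real^'m) set). \<epsilon> * ?n\<^sup>2)"
      proof (rule order_trans[OF sum_abs sum_mono])
        fix b :: "real ^ 'm" assume b: "b \<in> Basis"
        have "\<bar>?z \<bullet> b\<bar> \<le> ?n" using Basis_le_norm[OF b] .
        moreover have "\<bar>?v \<bullet> repr i b\<bar> \<le> \<epsilon> * ?n" using elim(1) i b by (simp add: inner_diff_left)
        ultimately have "\<bar>?z \<bullet> b\<bar> * \<bar>?v \<bullet> repr i b\<bar> \<le> ?n * (\<epsilon> * ?n)" by (intro mult_mono) auto
        then show "\<bar>(?z \<bullet> b) * (?v \<bullet> repr i b)\<bar> \<le> \<epsilon> * ?n\<^sup>2"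
          by (simp add: abs_mult power2_eq_square ac_simps)
      qed
      finally show ?thesis by simp
    qed
    have sumin: "\<bar>(\<Sum>i<Q. (qs x ! i - ps ! i) \<bullet> repr i ?z) - (size_D ?z)\<^sup>2\<bar> \<le> real Q * (real DIM(real ^ 'm) * (\<epsilon> * ?n\<^sup>2))"
    proof -
      have "(\<Sum>i<Q. (qs x ! i - ps ! i) \<bullet> repr i ?z) - (size_D ?z)\<^sup>2
        = (\<Sum>i<Q. (qs x ! i - ps ! i) \<bullet> repr i ?z - (norm (repr i ?z))\<^sup>2)"
        by (simp add: size_D_def L2_set_def sum_nonneg sum_subtractf)
      also have "\<bar>\<dots>\<bar> \<le> (\<Sum>i<Q. real DIM(real ^ 'm) * (\<epsilon> * ?n\<^sup>2))"
        using inner by (intro order_trans[OF sum_abs sum_mono]) auto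
      finally show ?thesis by simp
    qed
    have "(disp x)\<^sup>2 \<le> (size_D ?z + \<epsilon> * ?n)\<^sup>2" using elim(2) disp_nonneg by (intro power_mono)
    also have "\<dots> = (size_D ?z)\<^sup>2 + 2 * \<epsilon> * (size_D ?z * ?n) + \<epsilon> * (\<epsilon> * ?n\<^sup>2)"
      by (simp add: power2_eq_square algebra_simps)
    also have "\<dots> \<le> (size_D ?z)\<^sup>2 + 2 * \<epsilon> * (K * ?n * ?n) + 1 * (\<epsilon> * ?n\<^sup>2)"
      using \<epsilon> K by (intro add_mono mult_left_mono mult_right_mono order_refl) auto
    finally have d: "(disp x)\<^sup>2 \<le> (size_D ?z)\<^sup>2 + (2 * K + 1) * (\<epsilon> * ?n\<^sup>2)"
      by (simp add: power2_eq_square algebra_simps)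
    have "(err x)\<^sup>2 \<le> (2 * K + 1) * (\<epsilon> * ?n\<^sup>2) + 2 * (real Q * (real DIM(real ^ 'm) * (\<epsilon> * ?n\<^sup>2)))"
      unfolding err_squared using d sumin by (simp only: abs_le_iff) linarith
    also have "\<dots> = C * \<epsilon> * ?n\<^sup>2" by (simp add: C_def algebra_simps)
    also have "\<dots> \<le> \<eta>\<^sup>2 * ?n\<^sup>2" using \<epsilon>(3) by (rule mult_right_mono) simp
    finally have "(err x)\<^sup>2 \<le> (\<eta> * ?n)\<^sup>2" by (simp add: power_mult_distrib)
    then show ?case using \<eta>
      by (metis abs_le_square_iff abs_of_nonneg less_imp_le mult_nonneg_nonneg norm_ge_zero)
  qed
qed

definition differential :: "('h \<times> ((real ^ 'm) \<Rightarrow>\<^sub>L 'h)) multiset" where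
  "differential = mset (map (\<lambda>i. (ps ! i, Blinfun (repr i))) [0..<Q])"

lemma blinfun_repr: "i < Q \<Longrightarrow> blinfun_apply (Blinfun (repr i)) = repr i"
  using linear_repr linear_conv_bounded_linear bounded_linear_Blinfun_apply by blast

theorem has_ap_differential: "has_ap_differential f a differential"
  unfolding has_ap_differential_def
proof (intro conjI ballI impI)
  have "map (\<lambda>i. ps ! i) [0..<Q] = ps" using length_ps map_nth by blast
  then show "image_mset fst differential = f a"
    unfolding differential_def mset_map[symmetric] map_map o_def by (simp add: mset_ps del: mset_map)
next
  fix p q assume "p \<in># differential" "q \<in># differential" "fst p = fst q"
  then obtain i j where "i < Q" "j < Q" "p = (ps ! i, Blinfun (repr i))" "q = (ps ! j, Blinfun (repr j))"
    by (auto simp: differential_def)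
  with \<open>fst p = fst q\<close> show "snd p = snd q" using repr_coherent[of i j] by simp
next
  have img: "image_mset (\<lambda>(v, L). v + blinfun_apply L (x - a)) differential
    = mset (map (\<lambda>i. ps ! i + repr i (x - a)) [0..<Q])" for x
    unfolding differential_def mset_map[symmetric] map_map o_def
    by (intro arg_cong[of _ _ mset] map_cong) (auto simp: blinfun_repr)
  show "ap_lim (\<lambda>x. Gdist (f x) (image_mset (\<lambda>(v, L). v + blinfun_apply L (x - a)) differential) / norm (x - a)) a 0"
    unfolding ap_lim_iff tendsto_iff
  proof (intro allI impI)
    fix e :: real assume e: "0 < e"
    then have "0 < e / 2" by simp
    from ap_oD[OF ap_o_err this] size_f ap_at_AE_neq[of a]
    show "\<forall>\<^sub>F x in ap_at a. dist (Gdist (f x) (image_mset (\<lambda>(v, L). v + blinfun_apply L (x - a)) differential) / norm (x - a)) 0 < e"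
    proof eventually_elim
      case (elim x)
      let ?G = "Gdist (f x) (mset (map (\<lambda>i. ps ! i + repr i (x - a)) [0..<Q]))"
      have "?G \<le> L2_set (\<lambda>i. norm (qs x ! i - (map (\<lambda>i. ps ! i + repr i (x - a)) [0..<Q]) ! i)) {..<Q}"
        using Gdist_nth_le[of "qs x" "map (\<lambda>i. ps ! i + repr i (x - a)) [0..<Q]"] qs(1,2)[OF elim(2)] by simp
      also have "\<dots> = err x" unfolding err_def by (intro L2_set_cong) auto
      also have "\<dots> \<le> e / 2 * norm (x - a)" using elim(1) by simp
      also have "\<dots> < e * norm (x - a)" using elim(3) e by simp
      finally have "?G < e * norm (x - a)" .
      moreover have "0 \<le> ?G" using elim(2) by (intro Gdist_nonneg) simp
      ultimately show ?case
        unfolding img using elim(3) by (simp add: dist_real_def pos_divide_less_eq)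
    qed
  qed
qed

text \<open>The squared distance to \<open>Q\<close> copies of 0 is the sum of the squared norms of
  the branches whatever the matching, so it can be differentiated branch by branch. Uniqueness of
  approximate gradients identifies the result with the one from
  \<open>expand_squared\<close>.\<close>

theorem Gdist_zero_gradient:
  assumes "T k = replicate_mset Q 0"
  shows "Gdist (f a) (T k) * (w k \<bullet> z) = (\<Sum>(v, L)\<in>#differential. v \<bullet> blinfun_apply L z)"
proof -
  let ?u = "\<lambda>x. Gdist (f x) (T k)"
  have L2: "Gdist (mset xs) (T k) = L2_set (\<lambda>i. norm (xs ! i - 0)) {..<Q}" if len: "length xs = Q" for xs
  proof -
    obtain ts where ts: "length ts = length xs" "mset ts = T k"
      "Gdist (mset xs) (T k) = L2_set (\<lambda>i. norm (xs ! i - ts ! i)) {..<length xs}"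
      using Gdist_matching[of "T k" xs] size_T len by metis
    have "ts ! i = 0" if "i < Q" for i
    proof -
      have "ts ! i \<in># T k" using ts len that by (metis nth_mem set_mset_mset)
      then show ?thesis using assms by (simp split: if_splits)
    qed
    then show ?thesis using ts(3) len by (simp cong: L2_set_cong_simp)
  qed
  let ?S = "\<lambda>x. \<Sum>i<Q. (qs x ! i - ps ! i) \<bullet> (ps ! i - 0)"
  let ?R = "\<lambda>z. \<Sum>i<Q. repr i z \<bullet> ps ! i"
  define c :: "real ^ 'm" where "c = (\<Sum>b\<in>Basis. ?R b *\<^sub>R b)"
  have c: "c \<bullet> z = ?R z" for z
  proof -
    have "?R z = (\<Sum>i<Q. (\<Sum>b\<in>Basis. (z \<bullet> b) *\<^sub>R repr i b) \<bullet> ps ! i)"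
    proof (intro sum.cong refl)
      fix i assume "i \<in> {..<Q}"
      then have i: "i < Q" by simp
      have "repr i z = repr i (\<Sum>b\<in>Basis. (z \<bullet> b) *\<^sub>R b)" by (simp add: euclidean_representation)
      also have "\<dots> = (\<Sum>b\<in>Basis. (z \<bullet> b) *\<^sub>R repr i b)"
        by (simp add: linear_sum[OF linear_repr[OF i]] linear_cmul[OF linear_repr[OF i]])
      finally show "repr i z \<bullet> ps ! i = (\<Sum>b\<in>Basis. (z \<bullet> b) *\<^sub>R repr i b) \<bullet> ps ! i" by simp
    qed
    also have "\<dots> = (\<Sum>b\<in>Basis. (z \<bullet> b) * ?R b)"
      by (simp add: inner_sum_left sum_distrib_left sum.swap[of _ "{..<Q}"])
    also have "\<dots> = c \<bullet> z"
      unfolding c_def inner_sum_left inner_scaleR_left by (simp add: inner_commute mult.commute)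
    finally show ?thesis ..
  qed
  have "ap_o a (\<lambda>x. (disp x)\<^sup>2 + 2 * (?S x - (\<Sum>i<Q. repr i (x - a) \<bullet> (ps ! i - 0)))
    - ((?u x)\<^sup>2 - (?u a)\<^sup>2 - (2 * ?u a) * (w k \<bullet> (x - a))))"
    by (rule ap_o_diff[OF ap_o_add[OF ap_o_disp_squared ap_o_cmult[OF sum_weak_expansion]] expand_squared])
  then have "ap_o a (\<lambda>x. (2 *\<^sub>R (?u a *\<^sub>R w k - c)) \<bullet> (x - a))"
  proof (rule ap_o_mono)
    show "\<forall>\<^sub>F x in ap_at a. \<bar>(2 *\<^sub>R (?u a *\<^sub>R w k - c)) \<bullet> (x - a)\<bar>
      \<le> \<bar>(disp x)\<^sup>2 + 2 * (?S x - (\<Sum>i<Q. repr i (x - a) \<bullet> (ps ! i - 0)))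
        - ((?u x)\<^sup>2 - (?u a)\<^sup>2 - (2 * ?u a) * (w k \<bullet> (x - a)))\<bar>"
      using size_f
    proof eventually_elim
      case (elim x)
      have "(?u x)\<^sup>2 - (?u a)\<^sup>2 = (disp x)\<^sup>2 + 2 * ?S x"
        using L2_diff_squared[of x "\<lambda>i. 0"] L2[OF qs(1)[OF elim]] L2[OF length_ps] qs(2)[OF elim] mset_ps by simp
      then show ?case using c[of "x - a"] by (simp add: inner_diff_left right_diff_distrib)
    qed
  qed
  then have "2 *\<^sub>R (?u a *\<^sub>R w k - c) = 0" by (rule ap_o_inner_unique)
  then have "?u a *\<^sub>R w k = c" by simp
  then have "?u a * (w k \<bullet> z) = ?R z" using c[of z] by (metis inner_scaleR_left)
  also have "\<dots> = (\<Sum>(v, L)\<in>#differential. v \<bullet> blinfun_apply L z)"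
  proof -
    have "(\<Sum>(v, L)\<in>#differential. v \<bullet> blinfun_apply L z) = (\<Sum>i\<leftarrow>[0..<Q]. ps ! i \<bullet> blinfun_apply (Blinfun (repr i)) z)"
      unfolding differential_def mset_map[symmetric] map_map o_def sum_mset_sum_list by simp
    also have "\<dots> = (\<Sum>i<Q. ps ! i \<bullet> blinfun_apply (Blinfun (repr i)) z)"
      by (simp add: interv_sum_list_conv_sum_set_nat atLeast0LessThan)
    finally show ?thesis by (simp add: blinfun_repr inner_commute)
  qed
  finally show ?thesis .
qed

end

section \<open>Borel representatives\<close>

lemma AE_lborel_iff_lebesgue: "(AE x in lebesgue. P x) \<longleftrightarrow> (AE x in lborel. P x)"
  by (rule AE_completion_iff)

lemma lebesgue_measurable_on_open:
  fixes h :: "real ^ 'm \<Rightarrow> 'b::{banach, second_countable_topology}"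
  assumes "open U" "locally_integrable U h"
  shows "(\<lambda>x. indicator U x *\<^sub>R h x) \<in> borel_measurable lebesgue"
proof -
  obtain C where C: "\<And>n. compact (C n)" "\<And>n. C n \<subseteq> U" "\<And>n. C n \<subseteq> interior (C (Suc n))"
    "\<Union>(range C) = U" using open_Union_compact_subsets[OF assms(1)] by metis
  have mono: "C n \<subseteq> C m" if "n \<le> m" for n m
    using that by (rule lift_Suc_mono_le[of C, rotated]) (use C(3) interior_subset in blast)
  show ?thesis
  proof (rule borel_measurable_LIMSEQ_metric)
    show "(\<lambda>x. indicator (C n) x *\<^sub>R h x) \<in> borel_measurable lebesgue" for n
    proof (rule borel_measurable_integrable)
      show "integrable lebesgue (\<lambda>x. indicator (C n) x *\<^sub>R h x)"
        using assms(2) C(1)[of n] C(2)[of n] by (simp add: locally_integrable_def set_integrable_def)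
    qed
    fix x :: "real ^ 'm"
    show "(\<lambda>n. indicator (C n) x *\<^sub>R h x) \<longlonglongrightarrow> indicator U x *\<^sub>R h x"
    proof (cases "x \<in> U")
      case True
      then obtain N where N: "x \<in> C N" using C(4) by blast
      have "\<forall>n\<ge>N. indicator (C n) x *\<^sub>R h x = indicator U x *\<^sub>R h x"
        using N mono True by (auto simp: indicator_def)
      then show ?thesis by (intro tendsto_eventually) (auto simp: eventually_sequentially)
    next
      case False
      then have "indicator (C n) x *\<^sub>R h x = indicator U x *\<^sub>R h x" for n
        using C(2)[of n] by (auto simp: indicator_def)
      then show ?thesis by (simp only: tendsto_const)
    qed
  qed
qed

lemma borel_representative_real:
  fixes h :: "'a::euclidean_space \<Rightarrow> real"
  assumes "(\<lambda>x. indicator U x *\<^sub>R h x) \<in> borel_measurable lebesgue"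
  obtains H where "H \<in> borel_measurable borel" "AE x in lborel. H x = indicator U x *\<^sub>R h x"
proof -
  obtain H where "H \<in> borel_measurable lborel" "AE x in lborel. indicator U x *\<^sub>R h x = H x"
    using completion_ex_borel_measurable_real[OF assms] by blast
  then show thesis using that[of H] by (auto simp: eq_commute)
qed

lemma borel_representative_vec:
  fixes h :: "real ^ 'm \<Rightarrow> real ^ 'm"
  assumes "(\<lambda>x. indicator U x *\<^sub>R h x) \<in> borel_measurable lebesgue"
  obtains H where "H \<in> borel_measurable borel" "AE x in lborel. H x = indicator U x *\<^sub>R h x"
proof -
  have "\<exists>H'. H' \<in> borel_measurable borel \<and> (AE x in lborel. H' x = indicator U x *\<^sub>R h x $ i)" for i
  proof -
    have "(\<lambda>x. (indicator U x *\<^sub>R h x) \<bullet> axis i 1) \<in> borel_measurable lebesgue"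
      using assms by (intro borel_measurable_inner) auto
    then have "(\<lambda>x. indicator U x *\<^sub>R (h x $ i)) \<in> borel_measurable lebesgue"
      by (simp add: inner_axis)
    from borel_representative_real[OF this] show ?thesis by metis
  qed
  then obtain H' where H': "\<And>i. H' i \<in> borel_measurable borel"
    "\<And>i. AE x in lborel. H' i x = indicator U x *\<^sub>R h x $ i" by metis
  define H where "H x = (\<Sum>i\<in>UNIV. H' i x *\<^sub>R axis i (1::real))" for x
  have "H \<in> borel_measurable borel" unfolding H_def using H'(1) by measurable
  moreover have "AE x in lborel. \<forall>i\<in>UNIV. H' i x = indicator U x *\<^sub>R h x $ i"
    using H'(2) by (subst AE_ball_countable) (auto simp: countable_finite)
  then have "AE x in lborel. H x = indicator U x *\<^sub>R h x"
  proof eventually_elim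
    case (elim x)
    then show ?case
      by (simp add: H_def vec_eq_iff sum_component axis_def if_distrib cong: if_cong)
  qed
  ultimately show thesis using that by blast
qed

lemma AE_lborel_shift:
  fixes a :: "'a::euclidean_space"
  assumes "AE x in lborel. P x"
  shows "AE z in lborel. P (a + z)"
proof -
  obtain N where N: "{x. \<not> P x} \<subseteq> N" "N \<in> sets borel" "emeasure lborel N = 0"
    using assms unfolding eventually_ae_filter by (auto simp: null_sets_def)
  have "emeasure lborel N = emeasure (distr lborel borel ((+) a)) N" by (simp add: lborel_distr_plus)
  also have "\<dots> = emeasure lborel ((+) a -` N)" using N(2) by (subst emeasure_distr) auto
  finally have "emeasure lborel ((+) a -` N) = 0" using N(3) by simp
  moreover have "(+) a -` N \<in> sets borel" using measurable_sets[of "(+) a" borel borel N] N(2) by simp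
  ultimately show ?thesis
    using N(1) by (intro AE_I[of _ _ "(+) a -` N"]) auto
qed

lemma ap_at_AE_shift:
  fixes a :: "'a::euclidean_space"
  assumes "AE z in lborel. norm z < \<rho> \<longrightarrow> P (a + z)" "0 < \<rho>"
  shows "eventually P (ap_at a)"
proof (rule eventually_ap_at_AE[OF _ assms(2)])
  have "AE x in lborel. norm (- a + x) < \<rho> \<longrightarrow> P (a + (- a + x))"
    by (rule AE_lborel_shift[OF assms(1)])
  then have "AE x in lborel. x \<in> ball a \<rho> \<longrightarrow> P x"
    by eventually_elim (auto simp: dist_norm norm_minus_commute)
  then show "AE x in lebesgue. x \<in> ball a \<rho> \<longrightarrow> P x" by (simp add: AE_lborel_iff_lebesgue)
qed

text \<open>Cutting off outside the closed ball makes both functions integrable on the whole space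
  and is not seen by bumps supported inside. \<open>has_weak_gradient\<close> speaks of coordinate
  directions, so the identity for general \<open>v\<close> is assembled at the end.\<close>

lemma weak_gradient_restrict:
  fixes h :: "real ^ 'm \<Rightarrow> real" and w :: "real ^ 'm \<Rightarrow> real ^ 'm"
  assumes hw: "has_weak_gradient U h w" and K: "cball b R \<subseteq> U"
    and H[measurable]: "H \<in> borel_measurable borel" "AE x in lborel. H x = indicator U x *\<^sub>R h x"
    and W[measurable]: "W \<in> borel_measurable borel" "AE x in lborel. W x = indicator U x *\<^sub>R w x"
  shows "weak_gradient (ball b R) (\<lambda>x. indicator (cball b R) x * H x) (\<lambda>x. indicator (cball b R) x *\<^sub>R W x)"
proof
  let ?K = "cball b R"
  have [measurable]: "?K \<in> sets borel" by simp
  have i: "set_integrable lebesgue ?K h" "set_integrable lebesgue ?K w"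
    using hw K unfolding has_weak_gradient_def locally_integrable_def by auto
  have AEH: "AE x in lborel. indicator ?K x * H x = indicator ?K x *\<^sub>R h x"
    using H(2) by eventually_elim (use K in \<open>auto simp: indicator_def\<close>)
  have AEW: "AE x in lborel. indicator ?K x *\<^sub>R W x = indicator ?K x *\<^sub>R w x"
    using W(2) by eventually_elim (use K in \<open>auto simp: indicator_def\<close>)
  have mH: "(\<lambda>x. indicator ?K x * H x) \<in> borel_measurable lborel"
    and mW: "(\<lambda>x. indicator ?K x *\<^sub>R W x) \<in> borel_measurable lborel" by measurable
  have "integrable lebesgue (\<lambda>x. indicator ?K x * H x)"
  proof (subst integrable_cong_AE)
    show "integrable lebesgue (\<lambda>x. indicator ?K x *\<^sub>R h x)" using i(1) unfolding set_integrable_def .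
    then show "(\<lambda>x. indicator ?K x *\<^sub>R h x) \<in> borel_measurable lebesgue" by (rule borel_measurable_integrable)
  qed (use AEH in \<open>auto simp only: AE_lborel_iff_lebesgue intro!: measurable_completion[OF mH]\<close>)
  then show "integrable lborel (\<lambda>x. indicator ?K x * H x)"
    by (subst (asm) integrable_completion) auto
  have "integrable lebesgue (\<lambda>x. indicator ?K x *\<^sub>R W x)"
  proof (subst integrable_cong_AE)
    show "integrable lebesgue (\<lambda>x. indicator ?K x *\<^sub>R w x)" using i(2) unfolding set_integrable_def .
    then show "(\<lambda>x. indicator ?K x *\<^sub>R w x) \<in> borel_measurable lebesgue" by (rule borel_measurable_integrable)
  qed (use AEW in \<open>auto simp only: AE_lborel_iff_lebesgue intro!: measurable_completion[OF mW]\<close>)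
  then show iW: "integrable lborel (\<lambda>x. indicator ?K x *\<^sub>R W x)"
    by (subst (asm) integrable_completion) auto
  show "weak_test (ball b R) (\<lambda>x. indicator ?K x * H x) (\<lambda>x. indicator ?K x *\<^sub>R W x)"
    unfolding weak_test_def
  proof (intro allI impI)
    fix a :: "real ^ 'm" and r :: real and v :: "real ^ 'm"
    assume r: "0 < r" and ar: "cball a r \<subseteq> ball b R"
    have arK: "ball a r \<subseteq> ?K" using ar ball_subset_cball[of a r] ball_subset_cball[of b R] by blast
    then have "cball a r \<subseteq> U" using ar K ball_subset_cball[of b R] by blast
    then have bt: "bump a r \<in> test_functions U" using r by (intro bump_test_function)
    have comp: "(LINT x|lborel. (indicator ?K x * H x) * (grad_bump a r x \<bullet> axis i 1))
      = - (LINT x|lborel. ((indicator ?K x *\<^sub>R W x) \<bullet> axis i 1) * bump a r x)" for i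
    proof -
      have "(LINT x|lborel. (indicator ?K x * H x) * (grad_bump a r x \<bullet> axis i 1))
        = (LINT x|lebesgue. (indicator ?K x * H x) * (grad_bump a r x \<bullet> axis i 1))"
        by (subst integral_completion) auto
      also have "\<dots> = (LINT x:U|lebesgue. h x * frechet_derivative (bump a r) (at x) (axis i 1))"
        unfolding set_lebesgue_integral_def frechet_derivative_bump
      proof (rule integral_cong_AE)
        have "locally_integrable U h" using hw by (simp add: has_weak_gradient_def)
        have m: "(\<lambda>x. indicator ?K x *\<^sub>R h x) \<in> borel_measurable lebesgue"
          using i(1) by (simp add: set_integrable_def borel_measurable_integrable)
        have "(\<lambda>x. (indicator ?K x *\<^sub>R h x) * (grad_bump a r x \<bullet> axis i 1)) \<in> borel_measurable lebesgue"
          by (rule borel_measurable_times[OF m measurable_completion]) measurable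
        also have "(\<lambda>x. (indicator ?K x *\<^sub>R h x) * (grad_bump a r x \<bullet> axis i 1)) = (\<lambda>x. indicator U x *\<^sub>R (h x * (grad_bump a r x \<bullet> axis i 1)))"
          using arK K grad_bump_eq_0[OF r] by (fastforce simp: indicator_def)
        finally show "(\<lambda>x. indicator U x *\<^sub>R (h x * (grad_bump a r x \<bullet> axis i 1))) \<in> borel_measurable lebesgue" .
        show "AE x in lebesgue. (indicator ?K x * H x) * (grad_bump a r x \<bullet> axis i 1) = indicator U x *\<^sub>R (h x * (grad_bump a r x \<bullet> axis i 1))"
          unfolding AE_lborel_iff_lebesgue using H(2)
        proof eventually_elim
          case (elim x)
          then show ?case using arK K grad_bump_eq_0[OF r, of x a]
            by (cases "x \<in> ball a r") (auto simp: indicator_def)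
        qed
      qed (rule measurable_completion, measurable)
      also have "\<dots> = - (LINT x:U|lebesgue. w x $ i * bump a r x)"
        using hw bt by (simp add: has_weak_gradient_def)
      also have "(LINT x:U|lebesgue. w x $ i * bump a r x) = (LINT x|lebesgue. ((indicator ?K x *\<^sub>R W x) \<bullet> axis i 1) * bump a r x)"
        unfolding set_lebesgue_integral_def
      proof (rule integral_cong_AE)
        have m: "(\<lambda>x. indicator ?K x *\<^sub>R w x) \<in> borel_measurable lebesgue"
          using i(2) by (simp add: set_integrable_def borel_measurable_integrable)
        have "(\<lambda>x. ((indicator ?K x *\<^sub>R w x) \<bullet> axis i 1) * bump a r x) \<in> borel_measurable lebesgue"
          by (rule borel_measurable_times[OF borel_measurable_inner[OF m borel_measurable_const] measurable_completion])
             measurable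
        also have "(\<lambda>x. ((indicator ?K x *\<^sub>R w x) \<bullet> axis i 1) * bump a r x) = (\<lambda>x. indicator U x *\<^sub>R (w x $ i * bump a r x))"
          using arK K bump_eq_0[OF r] by (fastforce simp: indicator_def inner_axis)
        finally show "(\<lambda>x. indicator U x *\<^sub>R (w x $ i * bump a r x)) \<in> borel_measurable lebesgue" .
        show "AE x in lebesgue. indicator U x *\<^sub>R (w x $ i * bump a r x) = ((indicator ?K x *\<^sub>R W x) \<bullet> axis i 1) * bump a r x"
          unfolding AE_lborel_iff_lebesgue using W(2)
        proof eventually_elim
          case (elim x)
          then show ?case using arK K bump_eq_0[OF r, of x a]
            by (cases "x \<in> ball a r") (auto simp: indicator_def inner_axis)
        qed
      qed (rule measurable_completion, measurable)
      also have "\<dots> = (LINT x|lborel. ((indicator ?K x *\<^sub>R W x) \<bullet> axis i 1) * bump a r x)"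
        by (subst integral_completion) auto
      finally show ?thesis .
    qed
    have v: "y \<bullet> v = (\<Sum>i\<in>UNIV. v $ i * (y \<bullet> axis i 1))" for y
      by (simp add: inner_axis) (simp add: inner_vec_def mult.commute)
    have iH1: "integrable lborel (\<lambda>x. (indicator ?K x * H x) * (grad_bump a r x \<bullet> axis i 1))" for i
    proof (rule integrable_bounded_mult[OF \<open>integrable lborel (\<lambda>x. indicator ?K x * H x)\<close>, where C = "4 / r"])
      fix x
      have "\<bar>grad_bump a r x \<bullet> axis i 1\<bar> \<le> norm (grad_bump a r x) * norm (axis i (1::real))" by (rule Cauchy_Schwarz_ineq2)
      then show "\<bar>grad_bump a r x \<bullet> axis i 1\<bar> \<le> 4 / r" using norm_grad_bump_le[OF r, of a x] by simp
    qed measurable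
    have iW1: "integrable lborel (\<lambda>x. ((indicator ?K x *\<^sub>R W x) \<bullet> axis i 1) * bump a r x)" for i
    proof (rule integrable_bounded_mult[where C = 1])
      show "integrable lborel (\<lambda>x. (indicator ?K x *\<^sub>R W x) \<bullet> axis i 1)"
        using iW by (rule integrable_inner_left)
    qed (auto simp: bump_le_1)
    have "(LINT x|lborel. (indicator ?K x * H x) * (grad_bump a r x \<bullet> v))
      = (LINT x|lborel. (\<Sum>i\<in>UNIV. v $ i * ((indicator ?K x * H x) * (grad_bump a r x \<bullet> axis i 1))))"
      unfolding v by (simp add: sum_distrib_left ac_simps)
    also have "\<dots> = (\<Sum>i\<in>UNIV. v $ i * (LINT x|lborel. (indicator ?K x * H x) * (grad_bump a r x \<bullet> axis i 1)))"
      using iH1 by (subst Bochner_Integration.integral_sum) auto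
    also have "\<dots> = - (\<Sum>i\<in>UNIV. v $ i * (LINT x|lborel. ((indicator ?K x *\<^sub>R W x) \<bullet> axis i 1) * bump a r x))"
      unfolding comp by (simp add: sum_negf)
    also have "(\<Sum>i\<in>UNIV. v $ i * (LINT x|lborel. ((indicator ?K x *\<^sub>R W x) \<bullet> axis i 1) * bump a r x))
      = (LINT x|lborel. (\<Sum>i\<in>UNIV. v $ i * (((indicator ?K x *\<^sub>R W x) \<bullet> axis i 1) * bump a r x)))"
      using iW1 by (subst Bochner_Integration.integral_sum) auto
    also have "\<dots> = (LINT x|lborel. ((indicator ?K x *\<^sub>R W x) \<bullet> v) * bump a r x)"
      unfolding v by (simp add: sum_distrib_right sum_distrib_left ac_simps)
    finally show "(LINT x|lborel. (indicator ?K x * H x) * (grad_bump a r x \<bullet> v))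
      = - (LINT x|lborel. ((indicator ?K x *\<^sub>R W x) \<bullet> v) * bump a r x)" .
  qed
qed

section \<open>Sobolev maps are approximately differentiable almost everywhere\<close>

text \<open>Index 0 is reserved for \<open>Q\<close> copies of the origin, because the distance to
  that tuple is the function in the energy identities.\<close>

lemma dense_tuples:
  "\<exists>T :: nat \<Rightarrow> 'h::{real_normed_vector, second_countable_topology} multiset.
    (\<forall>k. size (T k) = Q) \<and> T 0 = replicate_mset Q 0 \<and>
    (\<forall>ts \<epsilon>. length ts = Q \<longrightarrow> 0 < \<epsilon> \<longrightarrow> (\<exists>k ts'. T k = mset ts' \<and> length ts' = Q \<and>
      L2_set (\<lambda>i. norm (ts' ! i - ts ! i)) {..<Q} < \<epsilon>))"
proof -
  obtain D :: "'h set" where D: "countable D" "\<And>X. open X \<Longrightarrow> X \<noteq> {} \<Longrightarrow> \<exists>d\<in>D. d \<in> X"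
    using countable_dense_exists[where ?'a='h] by metis
  define TT where "TT = insert (replicate_mset Q 0) (mset ` {ts \<in> lists D. length ts = Q})"
  have cTT: "countable TT" unfolding TT_def
    by (intro countable_insert countable_image countable_subset[OF _ countable_lists[OF D(1)]]) auto
  define T where "T k = (case k of 0 \<Rightarrow> replicate_mset Q (0::'h) | Suc n \<Rightarrow> from_nat_into TT n)" for k
  have "size (T k) = Q" for k
  proof (cases k)
    case (Suc n)
    have "from_nat_into TT n \<in> TT" by (rule from_nat_into) (simp add: TT_def)
    then show ?thesis by (auto simp: T_def Suc TT_def)
  qed (simp add: T_def)
  moreover have "\<exists>k ts'. T k = mset ts' \<and> length ts' = Q \<and> L2_set (\<lambda>i. norm (ts' ! i - ts ! i)) {..<Q} < \<epsilon>"
    if ts: "length ts = Q" and \<epsilon>: "0 < \<epsilon>" for ts \<epsilon>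
  proof -
    define \<eta> where "\<eta> = \<epsilon> / (real Q + 1)"
    have \<eta>: "0 < \<eta>" using \<epsilon> by (simp add: \<eta>_def)
    have "\<forall>i. \<exists>d\<in>D. norm (d - ts ! i) < \<eta>"
    proof
      fix i
      obtain d where "d \<in> D" "d \<in> ball (ts ! i) \<eta>" using D(2)[of "ball (ts ! i) \<eta>"] \<eta> by auto
      then show "\<exists>d\<in>D. norm (d - ts ! i) < \<eta>" by (auto simp: dist_norm norm_minus_commute)
    qed
    then obtain d where d: "\<And>i. d i \<in> D" "\<And>i. norm (d i - ts ! i) < \<eta>" by metis
    define ts' where "ts' = map d [0..<Q]"
    have "ts' \<in> {ts \<in> lists D. length ts = Q}" using d(1) by (auto simp: ts'_def in_lists_conv_set)
    then have "mset ts' \<in> TT" unfolding TT_def by (intro insertI2 imageI)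
    then obtain n where "from_nat_into TT n = mset ts'"
      using cTT by (metis from_nat_into_surj)
    then have "T (Suc n) = mset ts'" by (simp add: T_def)
    moreover have "length ts' = Q" by (simp add: ts'_def)
    moreover have "L2_set (\<lambda>i. norm (ts' ! i - ts ! i)) {..<Q} < \<epsilon>"
    proof -
      have "L2_set (\<lambda>i. norm (ts' ! i - ts ! i)) {..<Q} \<le> (\<Sum>i<Q. norm (ts' ! i - ts ! i))"
        by (rule L2_set_le_sum) simp
      also have "\<dots> \<le> (\<Sum>i<Q. \<eta>)"
        using d(2) by (intro sum_mono) (auto simp: ts'_def intro: less_imp_le)
      also have "\<dots> < \<epsilon>" using \<epsilon> by (simp add: \<eta>_def pos_divide_less_eq)
      finally show ?thesis .
    qed
    ultimately show ?thesis by blast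
  qed
  ultimately show ?thesis by (intro exI[of _ T]) (auto simp: T_def)
qed

text \<open>If \<open>u\<close> is close to \<open>v\<close>, each value of \<open>u\<close> is
  matched with one value of \<open>v\<close> only, which gives a surjection of distinct values. It
  makes the sets with at least \<open>J\<close> distinct values open, and thereby the strata
  measurable.\<close>

lemma card_support_lower_semicontinuous:
  fixes v :: "'h::real_normed_vector multiset"
  shows "\<exists>\<delta>>0. \<forall>u. size u = size v \<longrightarrow> Gdist u v < \<delta> \<longrightarrow> card (set_mset v) \<le> card (set_mset u)"
proof -
  define N where "N = insert 1 ((\<lambda>(p, q). norm (p - q)) ` {(p, q). p \<in># v \<and> q \<in># v \<and> p \<noteq> q})"
  have "finite {(p, q). p \<in># v \<and> q \<in># v \<and> p \<noteq> q}"
    by (rule finite_subset[of _ "set_mset v \<times> set_mset v"]) auto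
  then have fin: "finite N" unfolding N_def by (intro finite.insertI finite_imageI)
  have pos: "0 < Min N" using fin by (subst Min_gr_iff) (auto simp: N_def)
  have sep: "Min N \<le> norm (p - q)" if "p \<in># v" "q \<in># v" "p \<noteq> q" for p q
    using fin that by (intro Min_le) (auto simp: N_def)
  have "card (set_mset v) \<le> card (set_mset u)" if s: "size u = size v" and d: "Gdist u v < Min N / 2" for u
  proof -
    obtain us where us: "mset us = u" using ex_mset by blast
    obtain vs where vs: "length vs = length us" "mset vs = v"
      "Gdist u v = L2_set (\<lambda>i. norm (us ! i - vs ! i)) {..<length us}"
      using Gdist_matchingE[OF us s[symmetric]] by blast
    have close: "norm (us ! i - vs ! i) < Min N / 2" if "i < length us" for i
      using member_le_L2_set[of "{..<length us}" i "\<lambda>i. norm (us ! i - vs ! i)"] that d vs(3) by simp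
    have eq: "vs ! i = vs ! j" if "i < length us" "j < length us" "us ! i = us ! j" for i j
    proof (rule ccontr)
      assume "vs ! i \<noteq> vs ! j"
      then have "Min N \<le> norm (vs ! i - vs ! j)"
        using vs(1,2) that by (intro sep) (auto simp flip: vs(2))
      also have "\<dots> \<le> norm (vs ! i - us ! i) + norm (us ! j - vs ! j)"
        using norm_triangle_ineq[of "vs ! i - us ! i" "us ! j - vs ! j"] that(3) by simp
      also have "\<dots> < Min N / 2 + Min N / 2"
        using close[OF that(1)] close[OF that(2)] by (subst norm_minus_commute) linarith
      finally show False by simp
    qed
    define g where "g p = vs ! (SOME i. i < length us \<and> us ! i = p)" for p
    have g: "g (us ! i) = vs ! i" if "i < length us" for i
    proof -
      have "\<exists>j. j < length us \<and> us ! j = us ! i" using that by blast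
      from someI_ex[OF this] show ?thesis unfolding g_def using eq that by blast
    qed
    have "set_mset v \<subseteq> g ` set_mset u"
    proof
      fix p assume "p \<in># v"
      then obtain i where "i < length us" "p = vs ! i"
        using vs(1) by (auto simp: vs(2)[symmetric] set_conv_nth)
      then show "p \<in> g ` set_mset u"
        using g[of i] by (intro image_eqI[of _ _ "us ! i"]) (auto simp: us[symmetric])
    qed
    then show ?thesis by (intro surj_card_le) auto
  qed
  then show ?thesis using pos by (intro exI[of _ "Min N / 2"]) auto
qed

lemma segment_deviation:
  fixes \<phi> :: "real \<Rightarrow> 'a::euclidean_space"
  assumes [measurable]: "\<phi> \<in> borel_measurable borel"
    and le: "(\<integral>\<^sup>+s. ennreal (norm (\<phi> s - c)) * indicator {0..1} s \<partial>lborel) \<le> ennreal \<epsilon>" and \<epsilon>: "0 \<le> \<epsilon>"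
  shows "integrable lborel (\<lambda>s. norm (\<phi> s - c) * indicator {0..1} s)"
    and "(LINT s|lborel. norm (\<phi> s - c) * indicator {0..1} s) \<le> \<epsilon>"
    and "\<bar>(LINT s|lborel. (\<phi> s \<bullet> z) * indicator {0..1} s) - c \<bullet> z\<bar> \<le> \<epsilon> * norm z"
proof -
  have eq: "(\<integral>\<^sup>+s. ennreal (norm (\<phi> s - c) * indicator {0..1} s) \<partial>lborel)
    = (\<integral>\<^sup>+s. ennreal (norm (\<phi> s - c)) * indicator {0..1} s \<partial>lborel)"
    by (intro nn_integral_cong) (auto simp: indicator_def)
  show i: "integrable lborel (\<lambda>s. norm (\<phi> s - c) * indicator {0..1} s)"
  proof (rule integrableI_bounded)
    have "(\<integral>\<^sup>+s. ennreal (norm (norm (\<phi> s - c) * indicator {0..1} s)) \<partial>lborel) \<le> ennreal \<epsilon>"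
      using le eq by simp
    then show "(\<integral>\<^sup>+s. ennreal (norm (norm (\<phi> s - c) * indicator {0..1} s)) \<partial>lborel) < \<infinity>"
      by (rule le_less_trans) simp
  qed measurable
  have "ennreal (LINT s|lborel. norm (\<phi> s - c) * indicator {0..1} s) \<le> ennreal \<epsilon>"
    using nn_integral_eq_integral[OF i] le eq by simp
  then show b: "(LINT s|lborel. norm (\<phi> s - c) * indicator {0..1} s) \<le> \<epsilon>"
    using \<epsilon> by simp
  have i2: "integrable lborel (\<lambda>s. ((\<phi> s - c) \<bullet> z) * indicator {0..1} s)"
  proof (rule Bochner_Integration.integrable_bound)
    show "integrable lborel (\<lambda>s. norm z * (norm (\<phi> s - c) * indicator {0..1} s))" using i by simp
    show "AE s in lborel. norm (((\<phi> s - c) \<bullet> z) * indicator {0..1} s)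
       \<le> norm (norm z * (norm (\<phi> s - c) * indicator {0..1} s))"
      using Cauchy_Schwarz_ineq2[of "\<phi> s - c" z for s]
      by (intro AE_I2) (simp add: abs_mult indicator_def mult.commute)
  qed measurable
  have i3: "integrable lborel (\<lambda>s. (c \<bullet> z) * indicator {0..(1::real)} s)" by simp
  have "(LINT s|lborel. (\<phi> s \<bullet> z) * indicator {0..1} s)
    = (LINT s|lborel. ((\<phi> s - c) \<bullet> z) * indicator {0..1} s + (c \<bullet> z) * indicator {0..1} s)"
    by (intro Bochner_Integration.integral_cong refl) (auto simp: indicator_def inner_diff_left)
  also have "\<dots> = (LINT s|lborel. ((\<phi> s - c) \<bullet> z) * indicator {0..1} s) + c \<bullet> z"
    using i2 i3 by simp
  finally have "\<bar>(LINT s|lborel. (\<phi> s \<bullet> z) * indicator {0..1} s) - c \<bullet> z\<bar>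
    = \<bar>LINT s|lborel. ((\<phi> s - c) \<bullet> z) * indicator {0..1} s\<bar>" by simp
  also have "\<dots> \<le> (LINT s|lborel. \<bar>((\<phi> s - c) \<bullet> z) * indicator {0..1} s\<bar>)"
    by (rule integral_abs_bound)
  also have "\<dots> \<le> (LINT s|lborel. norm z * (norm (\<phi> s - c) * indicator {0..1} s))"
  proof (rule integral_mono[OF integrable_abs[OF i2]])
    show "integrable lborel (\<lambda>s. norm z * (norm (\<phi> s - c) * indicator {0..1} s))" using i by simp
    show "\<bar>((\<phi> s - c) \<bullet> z) * indicator {0..1} s\<bar> \<le> norm z * (norm (\<phi> s - c) * indicator {0..1} s)" for s
      using Cauchy_Schwarz_ineq2[of "\<phi> s - c" z] by (auto simp: abs_mult indicator_def mult.commute)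
  qed
  also have "\<dots> = norm z * (LINT s|lborel. norm (\<phi> s - c) * indicator {0..1} s)"
    by (rule integral_mult_right_zero)
  also have "\<dots> \<le> norm z * \<epsilon>"
    using b by (rule mult_left_mono) simp
  also have "\<dots> = \<epsilon> * norm z" by (rule mult.commute)
  finally show "\<bar>(LINT s|lborel. (\<phi> s \<bullet> z) * indicator {0..1} s) - c \<bullet> z\<bar> \<le> \<epsilon> * norm z" .
qed

text \<open>
  \<open>T\<close> runs through a dense set of tuples, and \<open>H k\<close>, \<open>W k\<close> are Borel versions on the whole space of
  \<open>Gdist (f x) (T k)\<close> and of its weak gradient.
\<close>

locale sobolev_map =
  fixes f :: "real ^ 'm \<Rightarrow> 'h::{real_inner, polish_space} multiset" and U :: "(real ^ 'm) set"
    and Q :: nat and T :: "nat \<Rightarrow> 'h multiset" and H :: "nat \<Rightarrow> real ^ 'm \<Rightarrow> real"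
    and W :: "nat \<Rightarrow> real ^ 'm \<Rightarrow> real ^ 'm" and G :: "real ^ 'm \<Rightarrow> real"
  assumes U: "open U" and size_f: "x \<in> U \<Longrightarrow> size (f x) = Q"
    and size_T: "size (T k) = Q" and T_0: "T 0 = replicate_mset Q 0"
    and dense: "length ts = Q \<Longrightarrow> 0 < \<epsilon> \<Longrightarrow> \<exists>k ts'. T k = mset ts' \<and> length ts' = Q \<and>
      L2_set (\<lambda>i. norm (ts' ! i - ts ! i)) {..<Q} < \<epsilon>"
    and H_meas[measurable]: "H k \<in> borel_measurable borel"
    and W_meas[measurable]: "W k \<in> borel_measurable borel"
    and G_meas[measurable]: "G \<in> borel_measurable borel"
    and H_eq: "AE x in lborel. H k x = indicator U x * Gdist (f x) (T k)"
    and G_nonneg: "0 \<le> G x" and G2: "integrable lborel (\<lambda>x. (G x)\<^sup>2)"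
    and W_le: "norm (W k x) \<le> G x"
    and H0: "integrable lborel (\<lambda>x. (H 0 x)\<^sup>2)"
    and grad: "cball b R \<subseteq> U \<Longrightarrow>
      weak_gradient (ball b R) (\<lambda>x. indicator (cball b R) x * H k x) (\<lambda>x. indicator (cball b R) x *\<^sub>R W k x)"

lemma W12_sobolev_map:
  fixes f :: "real ^ 'm \<Rightarrow> 'h::{real_inner, polish_space} multiset"
  assumes U: "open U" and f: "f \<in> W12 U Q"
  shows "\<exists>T H W G. sobolev_map f U Q T H W G"
proof -
  have [measurable]: "U \<in> sets borel" using U by simp
  have Ul: "U \<in> sets lebesgue" using U by auto
  have fQ: "f x \<in> QQ Q" if "x \<in> U" for x
  proof -
    have "f \<in> measurable (lebesgue_on U) (sigma (QQ Q) {V. Metric_space.mopen (QQ Q) Gdist V})"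
      using f by (simp add: W12_def)
    from measurable_space[OF this] that show ?thesis by (simp add: space_measure_of_conv)
  qed
  obtain T :: "nat \<Rightarrow> 'h multiset" where T: "\<And>k. size (T k) = Q" "T 0 = replicate_mset Q 0"
    "\<And>ts \<epsilon>. length ts = Q \<Longrightarrow> 0 < \<epsilon> \<Longrightarrow> \<exists>k ts'. T k = mset ts' \<and> length ts' = Q \<and>
      L2_set (\<lambda>i. norm (ts' ! i - ts ! i)) {..<Q} < \<epsilon>"
  proof -
    from dense_tuples[of Q] obtain T :: "nat \<Rightarrow> 'h multiset" where
      "\<forall>k. size (T k) = Q" "T 0 = replicate_mset Q 0"
      "\<forall>ts \<epsilon>. length ts = Q \<longrightarrow> 0 < \<epsilon> \<longrightarrow> (\<exists>k ts'. T k = mset ts' \<and> length ts' = Q \<and>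
        L2_set (\<lambda>i. norm (ts' ! i - ts ! i)) {..<Q} < \<epsilon>)" by (elim exE conjE)
    then show thesis by (intro that[of T]) blast+
  qed
  obtain g :: "real ^ 'm \<Rightarrow> real" where g: "set_borel_measurable lebesgue U g"
    "set_integrable lebesgue U (\<lambda>x. (g x)\<^sup>2)"
    "\<And>S. S \<in> QQ Q \<Longrightarrow> \<exists>w. has_weak_gradient U (\<lambda>x. Gdist (f x) S) w \<and> (AE x in lebesgue_on U. norm (w x) \<le> g x)"
    using f unfolding W12_def by blast
  have "\<forall>k. \<exists>w. has_weak_gradient U (\<lambda>x. Gdist (f x) (T k)) w \<and> (AE x in lebesgue_on U. norm (w x) \<le> g x)"
    using g(3) T(1) by (simp add: QQ_def)
  then obtain w where w: "\<And>k. has_weak_gradient U (\<lambda>x. Gdist (f x) (T k)) (w k)"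
    "\<And>k. AE x in lebesgue_on U. norm (w k x) \<le> g x" by metis
  obtain G0 where G0[measurable]: "G0 \<in> borel_measurable borel" "AE x in lborel. G0 x = indicator U x *\<^sub>R g x"
    using borel_representative_real[of U g] g(1) unfolding set_borel_measurable_def by blast
  define G where "G x = \<bar>G0 x\<bar>" for x
  have Gm[measurable]: "G \<in> borel_measurable borel" unfolding G_def by measurable
  have "\<exists>H. H \<in> borel_measurable borel \<and> (AE x in lborel. H x = indicator U x *\<^sub>R Gdist (f x) (T k))" for k
    using borel_representative_real[OF lebesgue_measurable_on_open[OF U]] w(1)[of k]
    unfolding has_weak_gradient_def by metis
  then obtain H where H: "\<And>k. H k \<in> borel_measurable borel"
    "\<And>k. AE x in lborel. H k x = indicator U x *\<^sub>R Gdist (f x) (T k)" by metis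
  have "\<exists>H. H \<in> borel_measurable borel \<and> (AE x in lborel. H x = indicator U x *\<^sub>R w k x)" for k
    using borel_representative_vec[OF lebesgue_measurable_on_open[OF U]] w(1)[of k]
    unfolding has_weak_gradient_def by metis
  then obtain W0 where W0: "\<And>k. W0 k \<in> borel_measurable borel"
    "\<And>k. AE x in lborel. W0 k x = indicator U x *\<^sub>R w k x" by metis
  \<comment> \<open>Replacing the gradient by 0 on the null set where its bound fails makes
    \<open>norm (W k x) \<le> G x\<close> true everywhere, so that suprema over \<open>k\<close> are
    finite at each point.\<close>
  define W where "W k x = (if norm (W0 k x) \<le> G x then W0 k x else 0)" for k x
  have Wm: "W k \<in> borel_measurable borel" for k
    unfolding W_def using W0(1)[of k] by measurable
  have W_eq: "AE x in lborel. W k x = indicator U x *\<^sub>R w k x" for k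
  proof -
    have "AE x in lebesgue. x \<in> U \<longrightarrow> norm (w k x) \<le> g x"
      using w(2)[of k] Ul by (subst (asm) AE_restrict_space_iff) auto
    then have "AE x in lborel. x \<in> U \<longrightarrow> norm (w k x) \<le> g x" by (simp add: AE_lborel_iff_lebesgue)
    with W0(2)[of k] G0(2) show ?thesis
      by eventually_elim (auto simp: W_def G_def indicator_def)
  qed
  have "sobolev_map f U Q T H W G"
  proof (rule sobolev_map.intro)
    show "open U" by fact
    show "size (f x) = Q" if "x \<in> U" for x using fQ[OF that] by (simp add: QQ_def)
    show "size (T k) = Q" "T 0 = replicate_mset Q 0" for k by (fact T)+
    show "\<exists>k ts'. T k = mset ts' \<and> length ts' = Q \<and> L2_set (\<lambda>i. norm (ts' ! i - ts ! i)) {..<Q} < \<epsilon>"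
      if "length ts = Q" "0 < \<epsilon>" for ts \<epsilon> using T(3) that .
    show "H k \<in> borel_measurable borel" "W k \<in> borel_measurable borel" "G \<in> borel_measurable borel" for k
      by (fact H(1) Wm Gm)+
    show "AE x in lborel. H k x = indicator U x * Gdist (f x) (T k)" for k using H(2) by simp
    show "0 \<le> G x" for x by (simp add: G_def)
    show "norm (W k x) \<le> G x" for k x by (simp add: W_def G_def)
    show "integrable lborel (\<lambda>x. (G x)\<^sup>2)"
    proof -
      have "integrable lebesgue (\<lambda>x. (G x)\<^sup>2)"
      proof (subst integrable_cong_AE)
        show i: "integrable lebesgue (\<lambda>x. indicator U x *\<^sub>R (g x)\<^sup>2)"
          using g(2) unfolding set_integrable_def .
        then show "(\<lambda>x. indicator U x *\<^sub>R (g x)\<^sup>2) \<in> borel_measurable lebesgue" by (rule borel_measurable_integrable)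
        show "(\<lambda>x. (G x)\<^sup>2) \<in> borel_measurable lebesgue" by (rule measurable_completion) measurable
        show "AE x in lebesgue. (G x)\<^sup>2 = indicator U x *\<^sub>R (g x)\<^sup>2"
          unfolding AE_lborel_iff_lebesgue using G0(2)
          by eventually_elim (auto simp: G_def indicator_def)
      qed
      then show ?thesis by (subst (asm) integrable_completion) auto
    qed
    show "integrable lborel (\<lambda>x. (H 0 x)\<^sup>2)"
    proof -
      have [measurable]: "H 0 \<in> borel_measurable borel" by (rule H(1))
      have "integrable lebesgue (\<lambda>x. (H 0 x)\<^sup>2)"
      proof (subst integrable_cong_AE)
        show i: "integrable lebesgue (\<lambda>x. indicator U x *\<^sub>R (Gdist (f x) (replicate_mset Q 0))\<^sup>2)"
          using f unfolding W12_def set_integrable_def by blast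
        then show "(\<lambda>x. indicator U x *\<^sub>R (Gdist (f x) (replicate_mset Q 0))\<^sup>2) \<in> borel_measurable lebesgue" by (rule borel_measurable_integrable)
        show "(\<lambda>x. (H 0 x)\<^sup>2) \<in> borel_measurable lebesgue" by (rule measurable_completion) measurable
        show "AE x in lebesgue. (H 0 x)\<^sup>2 = indicator U x *\<^sub>R (Gdist (f x) (replicate_mset Q 0))\<^sup>2"
          unfolding AE_lborel_iff_lebesgue using H(2)[of 0]
          by eventually_elim (auto simp: T(2) indicator_def)
      qed
      then show ?thesis by (subst (asm) integrable_completion) auto
    qed
    show "weak_gradient (ball b R) (\<lambda>x. indicator (cball b R) x * H k x) (\<lambda>x. indicator (cball b R) x *\<^sub>R W k x)"
      if "cball b R \<subseteq> U" for b R k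
      by (rule weak_gradient_restrict[OF w(1) that H Wm W_eq])
  qed
  then show ?thesis by blast
qed

context sobolev_map
begin

lemma G_locally_integrable:
  "(\<integral>\<^sup>+x. ennreal (G x) * indicator (ball a r) x \<partial>lborel) < \<infinity>"
proof -
  have "(\<integral>\<^sup>+x. ennreal (G x) * indicator (ball a r) x \<partial>lborel)
    \<le> (\<integral>\<^sup>+x. indicator (ball a r) x + ennreal ((G x)\<^sup>2) \<partial>lborel)"
  proof (rule nn_integral_mono)
    fix x
    have "G x \<le> 1 + (G x)\<^sup>2" using sum_squares_bound[of 1 "G x"] G_nonneg[of x] by simp
    then have "ennreal (G x) \<le> 1 + ennreal ((G x)\<^sup>2)"
      by (metis ennreal_1 ennreal_leI ennreal_plus zero_le_one zero_le_power2)
    then show "ennreal (G x) * indicator (ball a r) x \<le> indicator (ball a r) x + ennreal ((G x)\<^sup>2)"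
      by (auto simp: indicator_def)
  qed
  also have "\<dots> = emeasure lborel (ball a r) + (\<integral>\<^sup>+x. ennreal ((G x)\<^sup>2) \<partial>lborel)"
    by (subst nn_integral_add) auto
  also have "\<dots> < \<infinity>"
    using emeasure_lborel_ball_finite[of a r] G2 unfolding integrable_iff_bounded by simp
  finally show ?thesis .
qed

lemma AE_lebesgue_point_dominated:
  fixes h :: "real ^ 'm \<Rightarrow> 'b::{real_normed_vector, second_countable_topology}"
  assumes "h \<in> borel_measurable borel" and le: "\<And>x. norm (h x) \<le> G x * c"
  shows "AE a in lborel. lebesgue_point h a"
proof -
  have "AE a in lborel. a \<in> UNIV \<longrightarrow> lebesgue_point h a"
  proof (rule AE_lebesgue_point[OF assms(1)])
    fix a :: "real ^ 'm"
    have "(\<integral>\<^sup>+x. ennreal (norm (h x)) * indicator (ball a 1) x \<partial>lborel)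
      \<le> (\<integral>\<^sup>+x. ennreal \<bar>c\<bar> * (ennreal (G x) * indicator (ball a 1) x) \<partial>lborel)"
    proof (rule nn_integral_mono)
      fix x
      have "norm (h x) \<le> \<bar>c\<bar> * G x"
        using le[of x] G_nonneg[of x] by (metis abs_ge_self mult.commute mult_left_mono order_trans)
      then have "ennreal (norm (h x)) \<le> ennreal \<bar>c\<bar> * ennreal (G x)"
        by (simp add: ennreal_leI ennreal_mult''[OF G_nonneg, symmetric])
      then show "ennreal (norm (h x)) * indicator (ball a 1) x \<le> ennreal \<bar>c\<bar> * (ennreal (G x) * indicator (ball a 1) x)"
        by (auto simp: indicator_def)
    qed
    also have "\<dots> = ennreal \<bar>c\<bar> * (\<integral>\<^sup>+x. ennreal (G x) * indicator (ball a 1) x \<partial>lborel)"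
      by (rule nn_integral_cmult) measurable
    also have "\<dots> < \<infinity>" using G_locally_integrable[of a 1] by (simp add: ennreal_mult_less_top)
    finally show "\<exists>r>0. (\<integral>\<^sup>+x. ennreal (norm (h x)) * indicator (ball a r) x \<partial>lborel) < \<infinity>"
      by (intro exI[of _ 1]) simp
  qed
  then show ?thesis by simp
qed

text \<open>An upper bound for the growth in direction \<open>v\<close> of all functions
  \<open>Gdist (f x) (T k)\<close>. As one Borel function dominated by a multiple of
  \<open>G\<close>, it has Lebesgue points almost everywhere, which gives control uniform in
  \<open>k\<close>.\<close>

definition slope :: "real ^ 'm \<Rightarrow> real ^ 'm \<Rightarrow> real" where
  "slope v x = (SUP k. W k x \<bullet> v)"

lemma W_inner_bound: "\<bar>W k x \<bullet> v\<bar> \<le> G x * norm v"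
proof -
  have "\<bar>W k x \<bullet> v\<bar> \<le> norm (W k x) * norm v" by (rule Cauchy_Schwarz_ineq2)
  also have "\<dots> \<le> G x * norm v" using W_le by (rule mult_right_mono) simp
  finally show ?thesis .
qed

lemma bdd_above_W: "bdd_above (range (\<lambda>k. W k x \<bullet> v))"
  using W_inner_bound[of _ x v] by (intro bdd_aboveI2[where M = "G x * norm v"]) (auto simp: abs_le_iff)

lemma W_le_slope: "W k x \<bullet> v \<le> slope v x"
  unfolding slope_def by (rule cSUP_upper[OF _ bdd_above_W]) simp

lemma slope_measurable [measurable]: "slope v \<in> borel_measurable borel"
  unfolding slope_def by (intro borel_measurable_cSUP bdd_above_W) measurable

lemma slope_bound: "norm (slope v x) \<le> G x * norm v"
proof -
  have "slope v x \<le> G x * norm v"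
    unfolding slope_def using W_inner_bound[of _ x v] by (intro cSUP_least) (auto simp: abs_le_iff)
  moreover have "- (G x * norm v) \<le> slope v x"
    using W_le_slope[of 0 x v] W_inner_bound[of 0 x v] by (simp add: abs_le_iff)
  ultimately show ?thesis by simp
qed

text \<open>At almost every base point the null set of exceptional increments \<open>z\<close>
  serves all \<open>k\<close> together, so that the point of differentiability can be fixed before
  \<open>x\<close> and \<open>k\<close>.\<close>

lemma AE_segments:
  "AE a in lborel. a \<in> U \<longrightarrow> (\<exists>\<rho>>0. AE z in lborel. norm z < \<rho> \<longrightarrow> a + z \<in> U \<and> (\<forall>k.
     Gdist (f (a + z)) (T k) - Gdist (f a) (T k) = (LINT s|lborel. (W k (a + s *\<^sub>R z) \<bullet> z) * indicator {0..1} s)))"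
proof (rule AE_lborel_locallyI)
  fix b assume "b \<in> U"
  then obtain R where R: "0 < R" "cball b (2 * R) \<subseteq> U"
    using U open_contains_cball[of U] by (metis dual_order.refl half_gt_zero mult.commute nonzero_divide_eq_eq zero_less_numeral less_imp_neq)
  let ?K = "cball b (2 * R)"
  have "AE x in lborel. AE z in lborel. x \<in> ball b R \<longrightarrow> norm z < R \<longrightarrow>
    indicator ?K (x + z) * H k (x + z) - indicator ?K x * H k x
     = (LINT s|lborel. ((indicator ?K (x + s *\<^sub>R z) *\<^sub>R W k (x + s *\<^sub>R z)) \<bullet> z) * indicator {0..1} s)" for k
  proof (rule weak_gradient.segment_formula_pairs[OF grad[OF R(2)]])
    fix x assume "x \<in> ball b R"
    show "ball x R \<subseteq> ball b (2 * R)"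
    proof
      fix y assume "y \<in> ball x R"
      then show "y \<in> ball b (2 * R)"
        using \<open>x \<in> ball b R\<close> dist_triangle[of b y x] by simp
    qed
  qed simp
  then have "AE x in lborel. \<forall>k. AE z in lborel. x \<in> ball b R \<longrightarrow> norm z < R \<longrightarrow>
    indicator ?K (x + z) * H k (x + z) - indicator ?K x * H k x
     = (LINT s|lborel. ((indicator ?K (x + s *\<^sub>R z) *\<^sub>R W k (x + s *\<^sub>R z)) \<bullet> z) * indicator {0..1} s)"
    by (subst AE_all_countable) blast
  moreover have He: "AE x in lborel. \<forall>k. H k x = indicator U x * Gdist (f x) (T k)"
    using H_eq by (subst AE_all_countable) blast
  ultimately have "AE x in lborel. x \<in> ball b R \<longrightarrow> (\<exists>\<rho>>0. AE z in lborel. norm z < \<rho> \<longrightarrow> x + z \<in> U \<and> (\<forall>k.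
     Gdist (f (x + z)) (T k) - Gdist (f x) (T k) = (LINT s|lborel. (W k (x + s *\<^sub>R z) \<bullet> z) * indicator {0..1} s)))"
  proof eventually_elim
    case (elim x)
    show ?case
    proof
      assume x: "x \<in> ball b R"
      have inK: "x + s *\<^sub>R z \<in> ?K" if "norm z < R" "0 \<le> s" "s \<le> 1" for s z
      proof -
        have "norm (s *\<^sub>R z) \<le> norm z" using that by (simp add: mult_left_le_one_le)
        moreover have "dist b (x + s *\<^sub>R z) \<le> dist b x + norm (s *\<^sub>R z)"
          using norm_triangle_ineq4[of "b - x" "s *\<^sub>R z"] by (simp add: dist_norm algebra_simps)
        ultimately show ?thesis using x that(1) by simp
      qed
      have "AE z in lborel. \<forall>k. x \<in> ball b R \<longrightarrow> norm z < R \<longrightarrow>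
        indicator ?K (x + z) * H k (x + z) - indicator ?K x * H k x
         = (LINT s|lborel. ((indicator ?K (x + s *\<^sub>R z) *\<^sub>R W k (x + s *\<^sub>R z)) \<bullet> z) * indicator {0..1} s)"
        using elim(1) by (subst AE_all_countable) blast
      moreover have "AE z in lborel. \<forall>k. H k (x + z) = indicator U (x + z) * Gdist (f (x + z)) (T k)"
        by (rule AE_lborel_shift[OF He])
      ultimately have "AE z in lborel. norm z < R \<longrightarrow> x + z \<in> U \<and> (\<forall>k.
        Gdist (f (x + z)) (T k) - Gdist (f x) (T k) = (LINT s|lborel. (W k (x + s *\<^sub>R z) \<bullet> z) * indicator {0..1} s))"
      proof eventually_elim
        case z: (elim z)
        show ?case
        proof (intro impI conjI allI)
          assume n: "norm z < R"
          have xzK: "x + z \<in> ?K" "x \<in> ?K" using inK[OF n, of 1] inK[OF n, of 0] by auto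
          then show xzU: "x + z \<in> U" using R(2) by blast
          fix k
          have "Gdist (f (x + z)) (T k) - Gdist (f x) (T k)
            = indicator ?K (x + z) * H k (x + z) - indicator ?K x * H k x"
            using z(2) elim(2) xzK xzU R(2) by (auto simp: indicator_def)
          also have "\<dots> = (LINT s|lborel. ((indicator ?K (x + s *\<^sub>R z) *\<^sub>R W k (x + s *\<^sub>R z)) \<bullet> z) * indicator {0..1} s)"
            using z(1) x n by blast
          also have "\<dots> = (LINT s|lborel. (W k (x + s *\<^sub>R z) \<bullet> z) * indicator {0..1} s)"
            using inK[OF n] by (intro Bochner_Integration.integral_cong refl) (auto simp: indicator_def)
          finally show "Gdist (f (x + z)) (T k) - Gdist (f x) (T k)
            = (LINT s|lborel. (W k (x + s *\<^sub>R z) \<bullet> z) * indicator {0..1} s)" .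
        qed
      qed
      then show "\<exists>\<rho>>0. AE z in lborel. norm z < \<rho> \<longrightarrow> x + z \<in> U \<and> (\<forall>k.
        Gdist (f (x + z)) (T k) - Gdist (f x) (T k) = (LINT s|lborel. (W k (x + s *\<^sub>R z) \<bullet> z) * indicator {0..1} s))"
        using R(1) by blast
    qed
  qed
  then show "\<exists>r>0. AE x in lborel. x \<in> ball b r \<longrightarrow> (\<exists>\<rho>>0. AE z in lborel. norm z < \<rho> \<longrightarrow> x + z \<in> U \<and> (\<forall>k.
     Gdist (f (x + z)) (T k) - Gdist (f x) (T k) = (LINT s|lborel. (W k (x + s *\<^sub>R z) \<bullet> z) * indicator {0..1} s)))"
    using R(1) by blast
qed

end

lemma lebesgue_point_ap_continuous:
  fixes f :: "'a::euclidean_space \<Rightarrow> 'b::{real_normed_vector, second_countable_topology}"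
  assumes f[measurable]: "f \<in> borel_measurable borel" and a: "lebesgue_point f a"
  shows "(f \<longlongrightarrow> f a) (ap_at a)"
  unfolding tendsto_iff
proof (intro allI impI)
  fix \<epsilon> :: real assume \<epsilon>: "0 < \<epsilon>"
  show "\<forall>\<^sub>F x in ap_at a. dist (f x) (f a) < \<epsilon>"
  proof (rule eventually_ap_atI)
    fix \<delta> :: real assume \<delta>: "0 < \<delta>"
    have "\<forall>\<^sub>F r in at_right 0. (\<integral>\<^sup>+x. ennreal (norm (f x - f a)) * indicator (ball a r) x \<partial>lborel)
       \<le> ennreal (\<epsilon> * \<delta>) * emeasure lborel (ball a r)"
      using a \<epsilon> \<delta> unfolding lebesgue_point_def by (meson mult_pos_pos)
    then show "\<forall>\<^sub>F r in at_right 0. \<exists>E\<in>sets lebesgue. {x \<in> ball a r. \<not> dist (f x) (f a) < \<epsilon>} \<subseteq> E \<and>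
      emeasure lebesgue E \<le> ennreal \<delta> * emeasure lebesgue (ball a r)"
    proof eventually_elim
      case (elim r)
      define E where "E = {x \<in> ball a r. \<epsilon> \<le> norm (f x - f a)}"
      have E[measurable]: "E \<in> sets borel" unfolding E_def by measurable
      have "ennreal \<epsilon> * emeasure lborel E = (\<integral>\<^sup>+x. ennreal \<epsilon> * indicator E x \<partial>lborel)"
        by (simp add: nn_integral_cmult_indicator)
      also have "\<dots> \<le> (\<integral>\<^sup>+x. ennreal (norm (f x - f a)) * indicator (ball a r) x \<partial>lborel)"
        by (intro nn_integral_mono) (auto simp: E_def indicator_def ennreal_leI)
      also have "\<dots> \<le> ennreal \<epsilon> * (ennreal \<delta> * emeasure lborel (ball a r))"
        using elim \<epsilon> \<delta> by (simp add: ennreal_mult mult.assoc)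
      finally have "emeasure lborel E \<le> ennreal \<delta> * emeasure lborel (ball a r)"
        using \<epsilon> by (subst (asm) ennreal_mult_le_mult_iff) auto
      moreover have "{x \<in> ball a r. \<not> dist (f x) (f a) < \<epsilon>} \<subseteq> E"
        by (auto simp: E_def dist_norm not_less)
      ultimately show ?case by (intro bexI[of _ E]) auto
    qed
  qed
qed

context sobolev_map
begin

section \<open>Strata by the number of distinct values\<close>

lemma Gdist_to_T_lt:
  assumes "size u = Q" "0 < \<epsilon>"
  shows "\<exists>k. Gdist u (T k) < \<epsilon>"
proof -
  obtain us where us: "mset us = u" using ex_mset by blast
  then have len: "length us = Q" using assms(1) by auto
  obtain k ts where k: "T k = mset ts" "length ts = Q" "L2_set (\<lambda>i. norm (ts ! i - us ! i)) {..<Q} < \<epsilon>"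
    using dense[OF len assms(2)] by blast
  have "Gdist u (T k) \<le> L2_set (\<lambda>i. norm (us ! i - ts ! i)) {..<Q}"
    using Gdist_nth_le[of us ts] us len k(1) by simp
  also have "\<dots> < \<epsilon>" using k(3) by (simp only: norm_minus_commute)
  finally show ?thesis by blast
qed

text \<open>Indices of balls all of whose tuples have at least \<open>J\<close> distinct values. By
  semicontinuity these countably many balls exhaust such tuples, so \<open>stratum_set\<close>
  describes the condition through the Borel functions \<open>H k\<close>.\<close>

definition stratum_basis :: "nat \<Rightarrow> (nat \<times> nat) set" where
  "stratum_basis J = {(k, n). \<forall>u :: 'h multiset. size u = Q \<longrightarrow> Gdist u (T k) < 1 / real (Suc n) \<longrightarrow> J \<le> card (set_mset u)}"

definition stratum_set :: "nat \<Rightarrow> (real ^ 'm) set" where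
  "stratum_set J = U \<inter> (\<Union>(k, n)\<in>stratum_basis J. {x. H k x < 1 / real (Suc n)})"

lemma stratum_set_borel [measurable]: "stratum_set J \<in> sets borel"
proof -
  have "{x. H k x < 1 / real (Suc n)} \<in> sets borel" for k n by measurable
  then show ?thesis unfolding stratum_set_def using U
    by (intro sets.Int sets.countable_UN') (auto simp: countableI_type)
qed

lemma stratum_basis_ex:
  assumes s: "size u = Q" and J: "J \<le> card (set_mset u)"
  shows "\<exists>(k, n)\<in>stratum_basis J. Gdist u (T k) < 1 / real (Suc n)"
proof -
  obtain \<delta> where \<delta>: "0 < \<delta>" "\<And>v. size v = Q \<Longrightarrow> Gdist v u < \<delta> \<Longrightarrow> card (set_mset u) \<le> card (set_mset v)"
    using card_support_lower_semicontinuous[of u] s by auto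
  obtain n where n: "1 / real (Suc n) < \<delta> / 2"
    using reals_Archimedean[of "\<delta> / 2"] \<delta>(1) by (auto simp: inverse_eq_divide)
  obtain k where k: "Gdist u (T k) < 1 / real (Suc n)" using Gdist_to_T_lt[OF s, of "1 / real (Suc n)"] by auto
  have "J \<le> card (set_mset v)" if v: "size v = Q" "Gdist v (T k) < 1 / real (Suc n)" for v
  proof -
    have "Gdist v u \<le> Gdist v (T k) + Gdist (T k) u"
      using v(1) s size_T by (intro Gdist_triangle) auto
    also have "Gdist (T k) u = Gdist u (T k)" using s size_T by (intro Gdist_commute) auto
    finally have "Gdist v u < \<delta>" using v(2) k n by argo
    then show "J \<le> card (set_mset v)" using \<delta>(2)[OF v(1)] J by simp
  qed
  then have "(k, n) \<in> stratum_basis J" by (simp add: stratum_basis_def)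
  then show ?thesis using k by blast
qed

lemma AE_H_eq: "AE x in lborel. \<forall>k. H k x = indicator U x * Gdist (f x) (T k)"
  using H_eq by (subst AE_all_countable) blast

lemma AE_stratum: "AE x in lborel. x \<in> U \<longrightarrow> (\<forall>J. x \<in> stratum_set J \<longleftrightarrow> J \<le> card (set_mset (f x)))"
  using AE_H_eq
proof eventually_elim
  case (elim x)
  show ?case
  proof (intro impI allI iffI)
    fix J assume x: "x \<in> U"
    have He: "H k x = Gdist (f x) (T k)" for k using elim x by simp
    show "J \<le> card (set_mset (f x))" if mem: "x \<in> stratum_set J"
    proof -
      obtain k n where "(k, n) \<in> stratum_basis J" "H k x < 1 / real (Suc n)"
        using mem by (auto simp: stratum_set_def)
      then show ?thesis using size_f[OF x] He[of k] unfolding stratum_basis_def by auto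
    qed
    show "x \<in> stratum_set J" if le: "J \<le> card (set_mset (f x))"
    proof -
      obtain k n where "(k, n) \<in> stratum_basis J" "Gdist (f x) (T k) < 1 / real (Suc n)"
        using stratum_basis_ex[OF size_f[OF x] le] by blast
      then show ?thesis
        using x He[of k] unfolding stratum_set_def by (intro IntI UN_I[of "(k, n)"]) auto
    qed
  qed
qed

text \<open>At a Lebesgue point of all indicators, membership in each \<open>stratum_set J\<close>
  is approximately constant. Using this for the number of distinct values at \<open>a\<close> and
  for its successor pins that number down.\<close>

lemma AE_stratum_density:
  "AE a in lborel. a \<in> U \<longrightarrow> (\<forall>\<^sub>F x in ap_at a. card (set_mset (f x)) = card (set_mset (f a)))"
proof -
  have "AE a in lborel. \<forall>J. lebesgue_point (indicator (stratum_set J) :: _ \<Rightarrow> real) a"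
  proof (subst AE_all_countable, intro allI)
    fix J
    have "AE a in lborel. a \<in> UNIV \<longrightarrow> lebesgue_point (indicator (stratum_set J) :: _ \<Rightarrow> real) a"
    proof (rule AE_lebesgue_point)
      fix a :: "real ^ 'm"
      have "(\<integral>\<^sup>+x. ennreal (norm (indicator (stratum_set J) x :: real)) * indicator (ball a 1) x \<partial>lborel)
        \<le> (\<integral>\<^sup>+x. indicator (ball a 1) x \<partial>lborel)"
        by (intro nn_integral_mono) (auto simp: indicator_def)
      also have "\<dots> < \<infinity>" using emeasure_lborel_ball_finite[of a 1] by simp
      finally show "\<exists>r>0. (\<integral>\<^sup>+x. ennreal (norm (indicator (stratum_set J) x :: real)) * indicator (ball a r) x \<partial>lborel) < \<infinity>"
        by (intro exI[of _ 1]) simp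
    qed measurable
    then show "AE a in lborel. lebesgue_point (indicator (stratum_set J) :: _ \<Rightarrow> real) a" by simp
  qed
  with AE_stratum show ?thesis
  proof eventually_elim
    case (elim a)
    show ?case
    proof
      assume a: "a \<in> U"
      let ?J = "card (set_mset (f a))"
      have ev: "\<forall>\<^sub>F x in ap_at a. x \<in> stratum_set J \<longleftrightarrow> a \<in> stratum_set J" for J
      proof -
        have "((indicator (stratum_set J) :: _ \<Rightarrow> real) \<longlongrightarrow> indicator (stratum_set J) a) (ap_at a)"
          by (rule lebesgue_point_ap_continuous) (use elim(2) in auto)
        from tendstoD[OF this zero_less_one] show ?thesis
          by eventually_elim (auto simp: indicator_def dist_real_def split: if_splits)
      qed
      obtain d where d: "0 < d" "ball a d \<subseteq> U" using U a open_contains_ball by blast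
      have "\<forall>\<^sub>F x in ap_at a. x \<in> U \<longrightarrow> (\<forall>J. x \<in> stratum_set J \<longleftrightarrow> J \<le> card (set_mset (f x)))"
        using AE_stratum by (intro eventually_ap_at_AE[of a 1]) (auto simp: AE_lborel_iff_lebesgue elim: eventually_mono)
      moreover have "\<forall>\<^sub>F x in ap_at a. x \<in> U"
        by (rule eventually_ap_at_AE[OF AE_I2 d(1)]) (use d(2) in blast)
      ultimately show "\<forall>\<^sub>F x in ap_at a. card (set_mset (f x)) = ?J"
        using ev[of ?J] ev[of "Suc ?J"]
      proof eventually_elim
        case (elim x)
        have "?J \<le> card (set_mset (f x))" "\<not> Suc ?J \<le> card (set_mset (f x))"
          using elim a \<open>a \<in> U \<longrightarrow> (\<forall>J. a \<in> stratum_set J \<longleftrightarrow> J \<le> card (set_mset (f a)))\<close> by auto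
        then show ?case by simp
      qed
    qed
  qed
qed

text \<open>Since one function \<open>G\<close> dominates every \<open>W k\<close>, replacing the
  direction of \<open>z\<close> by a nearby \<open>v\<close> costs \<open>\<eta> * G y\<close>,
  independently of \<open>k\<close>.\<close>

lemma W_inner_le_slope:
  assumes z: "z \<noteq> 0" and v: "norm (z /\<^sub>R norm z - v) \<le> \<eta>"
  shows "W k y \<bullet> z \<le> norm z * (slope v y + \<eta> * G y)"
    and "norm z * slope v y \<le> slope z y + norm z * (\<eta> * G y)"
proof -
  define e where "e = z /\<^sub>R norm z - v"
  have ze: "z = norm z *\<^sub>R (v + e)" using z by (simp add: e_def)
  have We: "\<bar>W k y \<bullet> e\<bar> \<le> \<eta> * G y" for k
  proof -
    have "\<bar>W k y \<bullet> e\<bar> \<le> G y * norm e" by (rule W_inner_bound)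
    also have "\<dots> \<le> G y * \<eta>" using v G_nonneg unfolding e_def by (intro mult_left_mono) auto
    finally show ?thesis by (simp add: mult.commute)
  qed
  have Wz: "W k y \<bullet> z = norm z * (W k y \<bullet> v + W k y \<bullet> e)" for k
    by (subst ze) (simp add: inner_add_right)
  show "W k y \<bullet> z \<le> norm z * (slope v y + \<eta> * G y)"
    unfolding Wz using W_le_slope[of k y v] We[of k] by (intro mult_left_mono) (auto simp: abs_le_iff)
  have "slope v y \<le> slope z y / norm z + \<eta> * G y"
    unfolding slope_def[of v]
  proof (rule cSUP_least)
    fix k
    have "W k y \<bullet> v = W k y \<bullet> z / norm z - W k y \<bullet> e" unfolding Wz using z by simp
    also have "\<dots> \<le> slope z y / norm z + \<eta> * G y"
      using divide_right_mono[OF W_le_slope[of k y z], of "norm z"] We[of k] by (simp add: abs_le_iff)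
    finally show "W k y \<bullet> v \<le> slope z y / norm z + \<eta> * G y" .
  qed simp
  from mult_left_mono[OF this, of "norm z"] show "norm z * slope v y \<le> slope z y + norm z * (\<eta> * G y)"
    using z by (simp add: distrib_left)
qed

text \<open>The estimate is the same for all \<open>k\<close>, because the smallness assumptions
  along the segment concern \<open>G\<close> and \<open>slope v\<close> and not the individual
  gradients.\<close>

lemma segment_upper_bound:
  assumes lG: "(\<integral>\<^sup>+s. ennreal (norm (G (a + s *\<^sub>R z) - G a)) * indicator {0..1} s \<partial>lborel) \<le> ennreal \<epsilon>"
    and lN: "(\<integral>\<^sup>+s. ennreal (norm (slope v (a + s *\<^sub>R z) - slope v a)) * indicator {0..1} s \<partial>lborel) \<le> ennreal \<epsilon>"
    and z: "z \<noteq> 0" and v: "norm (z /\<^sub>R norm z - v) \<le> \<eta>" and \<epsilon>: "0 \<le> \<epsilon>" and \<eta>: "0 \<le> \<eta>"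
  shows "(LINT s|lborel. (W k (a + s *\<^sub>R z) \<bullet> z) * indicator {0..1} s)
    \<le> slope z a + norm z * (2 * \<eta> * G a + \<epsilon> + \<eta> * \<epsilon>)"
proof -
  let ?y = "\<lambda>s. a + s *\<^sub>R z"
  let ?I = "indicator {0..(1::real)}"
  let ?DG = "\<lambda>s. norm (G (?y s) - G a) * ?I s" and ?DN = "\<lambda>s. norm (slope v (?y s) - slope v a) * ?I s"
  have mG: "(\<lambda>s. G (?y s)) \<in> borel_measurable borel" and mN: "(\<lambda>s. slope v (?y s)) \<in> borel_measurable borel"
    by measurable
  note dG = segment_deviation(1,2)[OF mG lG \<epsilon>] and dN = segment_deviation(1,2)[OF mN lN \<epsilon>]
  define R where "R s = norm z * ((slope v a + \<eta> * G a) * ?I s + ?DN s + \<eta> * ?DG s)" for s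
  have iR: "integrable lborel R"
    unfolding R_def using dG(1) dN(1) by (intro integrable_mult_right Bochner_Integration.integrable_add) auto
  have le: "(W k (?y s) \<bullet> z) * ?I s \<le> R s" for s
  proof (cases "s \<in> {0..1}")
    case True
    have "W k (?y s) \<bullet> z \<le> norm z * (slope v (?y s) + \<eta> * G (?y s))"
      by (rule W_inner_le_slope(1)[OF z v])
    also have "\<dots> \<le> norm z * ((slope v a + \<eta> * G a) + norm (slope v (?y s) - slope v a) + \<eta> * norm (G (?y s) - G a))"
    proof (intro mult_left_mono norm_ge_zero)
      have "\<eta> * G (?y s) \<le> \<eta> * (G a + norm (G (?y s) - G a))" using \<eta> by (intro mult_left_mono) auto
      then show "slope v (?y s) + \<eta> * G (?y s)
        \<le> (slope v a + \<eta> * G a) + norm (slope v (?y s) - slope v a) + \<eta> * norm (G (?y s) - G a)"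
        by (simp add: distrib_left)
    qed
    finally show ?thesis using True by (simp add: R_def)
  qed (simp add: R_def)
  have iW: "integrable lborel (\<lambda>s. (W k (?y s) \<bullet> z) * ?I s)"
  proof (rule Bochner_Integration.integrable_bound)
    show "integrable lborel (\<lambda>s. norm z * (G a * ?I s + ?DG s))"
      using dG(1) by (intro integrable_mult_right Bochner_Integration.integrable_add) auto
    show "AE s in lborel. norm ((W k (?y s) \<bullet> z) * ?I s) \<le> norm (norm z * (G a * ?I s + ?DG s))"
    proof (rule AE_I2)
      fix s
      have "\<bar>W k (?y s) \<bullet> z\<bar> \<le> G (?y s) * norm z" by (rule W_inner_bound)
      also have "\<dots> \<le> (G a + norm (G (?y s) - G a)) * norm z" by (intro mult_right_mono) auto
      finally show "norm ((W k (?y s) \<bullet> z) * ?I s) \<le> norm (norm z * (G a * ?I s + ?DG s))"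
        using G_nonneg[of a] by (auto simp: indicator_def abs_mult mult.commute)
    qed
  qed measurable
  have "(LINT s|lborel. (W k (?y s) \<bullet> z) * ?I s) \<le> (LINT s|lborel. R s)"
    by (rule integral_mono[OF iW iR le])
  also have "\<dots> = norm z * ((slope v a + \<eta> * G a) + (LINT s|lborel. ?DN s) + \<eta> * (LINT s|lborel. ?DG s))"
    unfolding R_def using dG(1) dN(1) by simp
  also have "\<dots> \<le> norm z * ((slope v a + \<eta> * G a) + \<epsilon> + \<eta> * \<epsilon>)"
    using dG(2) dN(2) \<eta> by (intro mult_left_mono add_mono order_refl norm_ge_zero)
  also have "\<dots> = norm z * slope v a + norm z * (\<eta> * G a) + norm z * (\<epsilon> + \<eta> * \<epsilon>)"
    by (simp add: distrib_left)
  also have "norm z * slope v a \<le> slope z a + norm z * (\<eta> * G a)"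
    by (rule W_inner_le_slope(2)[OF z v])
  finally show ?thesis by (simp add: algebra_simps)
qed

theorem AE_scalar_expansions:
  "AE a in lborel. a \<in> U \<longrightarrow> scalar_expansions f a Q T (\<lambda>k. W k a) (G a)"
proof -
  obtain D :: "(real ^ 'm) set" where D: "countable D" "\<And>X. open X \<Longrightarrow> X \<noteq> {} \<Longrightarrow> \<exists>d\<in>D. d \<in> X"
    using countable_dense_exists[where ?'a="real ^ 'm"] by metis
  have LN: "AE a in lborel. \<forall>v\<in>D. lebesgue_point (slope v) a"
    using D(1) by (subst AE_ball_countable) (auto intro!: AE_lebesgue_point_dominated slope_bound)
  have LW: "AE a in lborel. \<forall>k. lebesgue_point (W k) a"
    by (subst AE_all_countable, intro allI, rule AE_lebesgue_point_dominated[where c = 1]) (auto simp: W_le)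
  have LG: "AE a in lborel. lebesgue_point G a"
    by (rule AE_lebesgue_point_dominated[where c = 1]) (auto simp: G_nonneg)
  show ?thesis
    using AE_segments AE_stratum_density LN LW LG
  proof eventually_elim
    case (elim a)
    show ?case
    proof
      assume aU: "a \<in> U"
      obtain \<rho> where \<rho>: "0 < \<rho>" "AE z in lborel. norm z < \<rho> \<longrightarrow> a + z \<in> U \<and> (\<forall>k.
        Gdist (f (a + z)) (T k) - Gdist (f a) (T k) = (LINT s|lborel. (W k (a + s *\<^sub>R z) \<bullet> z) * indicator {0..1} s))"
        using elim(1) aU by blast
      have seg: "\<forall>\<^sub>F x in ap_at a. x \<in> U \<and> (\<forall>k. Gdist (f x) (T k) - Gdist (f a) (T k)
         = (LINT s|lborel. (W k (a + s *\<^sub>R (x - a)) \<bullet> (x - a)) * indicator {0..1} s))"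
        by (rule ap_at_AE_shift[OF _ \<rho>(1)]) (use \<rho>(2) in simp)
      show "scalar_expansions f a Q T (\<lambda>k. W k a) (G a)"
      proof (rule scalar_expansions.intro)
        show "size (f a) = Q" by (rule size_f[OF aU])
        show "size (T k) = Q" for k by (rule size_T)
        show "\<forall>\<^sub>F x in ap_at a. size (f x) = Q"
          using seg by eventually_elim (auto simp: size_f)
        show "norm (W k a) \<le> G a" for k by (rule W_le)
        show "\<forall>\<^sub>F x in ap_at a. card (set_mset (f x)) = card (set_mset (f a))" using elim(2) aU by blast
        show "\<exists>k ts'. T k = mset ts' \<and> length ts' = Q \<and> L2_set (\<lambda>i. norm (ts' ! i - ts ! i)) {..<Q} < \<epsilon>"
          if "length ts = Q" "0 < \<epsilon>" for ts \<epsilon> using dense that .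
        show "ap_o a (\<lambda>x. Gdist (f x) (T k) - Gdist (f a) (T k) - W k a \<bullet> (x - a))" for k
          unfolding ap_o_def
        proof (intro allI impI)
          fix \<epsilon> :: real assume \<epsilon>: "0 < \<epsilon>"
          have "lebesgue_point (W k) a" using elim(4) by blast
          from lebesgue_point_segment[OF W_meas this \<epsilon>] seg
          show "\<forall>\<^sub>F x in ap_at a. \<bar>Gdist (f x) (T k) - Gdist (f a) (T k) - W k a \<bullet> (x - a)\<bar> \<le> \<epsilon> * norm (x - a)"
          proof eventually_elim
            case (elim x)
            have m: "(\<lambda>s. W k (a + s *\<^sub>R (x - a))) \<in> borel_measurable borel" by measurable
            show ?case
              using segment_deviation(3)[OF m elim(1), of "x - a"] \<epsilon> elim(2) by simp
          qed
        qed
        show "\<forall>\<^sub>F x in ap_at a. Gdist (f x) (f a) \<le> (SUP k. W k a \<bullet> (x - a)) + \<epsilon> * norm (x - a)"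
          if \<epsilon>: "0 < \<epsilon>" for \<epsilon>
        proof -
          \<comment> \<open>With \<open>4 * (\<eta> * G a) \<le> \<epsilon>\<close>,
            \<open>\<eta> \<le> 1\<close> and segment deviations at most
            \<open>\<epsilon> / 4\<close>, the errors of \<open>segment_upper_bound\<close> add up
            to at most \<open>\<epsilon>\<close>.\<close>
          define \<eta> where "\<eta> = min 1 (\<epsilon> / (4 * (G a + 1)))"
          have \<eta>: "0 < \<eta>" "\<eta> \<le> 1" "4 * (\<eta> * G a) \<le> \<epsilon>"
          proof -
            show "0 < \<eta>" "\<eta> \<le> 1" using \<epsilon> G_nonneg[of a] by (auto simp: \<eta>_def)
            have "\<eta> * G a \<le> \<epsilon> / (4 * (G a + 1)) * (G a + 1)"
              using \<epsilon> G_nonneg[of a] by (intro mult_mono) (auto simp: \<eta>_def)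
            also have "\<dots> = \<epsilon> / 4" using G_nonneg[of a] by (simp add: field_simps)
            finally show "4 * (\<eta> * G a) \<le> \<epsilon>" by simp
          qed
          \<comment> \<open>Compactness reduces the directions to finitely many, for which the
            Lebesgue point estimates can be imposed simultaneously.\<close>
          have "sphere 0 1 \<subseteq> (\<Union>v\<in>D. ball v \<eta>)"
          proof
            fix u :: "real ^ 'm"
            obtain d where "d \<in> D" "d \<in> ball u \<eta>" using D(2)[of "ball u \<eta>"] \<eta>(1) by auto
            then show "u \<in> (\<Union>v\<in>D. ball v \<eta>)" by (auto simp: dist_commute)
          qed
          then obtain F where F: "F \<subseteq> D" "finite F" "sphere (0 :: real ^ 'm) 1 \<subseteq> (\<Union>v\<in>F. ball v \<eta>)"
            using compactE_image[OF compact_sphere[of "0 :: real ^ 'm" 1], of D "\<lambda>v. ball v \<eta>"] by auto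
          have \<epsilon>4: "0 < \<epsilon> / 4" using \<epsilon> by simp
          have evN: "\<forall>\<^sub>F x in ap_at a. \<forall>v\<in>F.
            (\<integral>\<^sup>+s. ennreal (norm (slope v (a + s *\<^sub>R (x - a)) - slope v a)) * indicator {0..1} s \<partial>lborel) \<le> ennreal (\<epsilon> / 4)"
            using elim(3) F(1) by (intro eventually_ball_finite[OF F(2)] ballI lebesgue_point_segment \<epsilon>4 slope_measurable) auto
          show ?thesis
            using evN lebesgue_point_segment[OF G_meas elim(5) \<epsilon>4] seg ap_at_AE_neq[of a]
          proof eventually_elim
            case (elim x)
            let ?z = "x - a"
            have z: "?z \<noteq> 0" using elim(4) by simp
            then have "?z /\<^sub>R norm ?z \<in> sphere 0 1" by simp
            then obtain v where v: "v \<in> F" "?z /\<^sub>R norm ?z \<in> ball v \<eta>" using F(3) by blast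
            have vd: "norm (?z /\<^sub>R norm ?z - v) \<le> \<eta>" using v(2) by (simp add: dist_norm norm_minus_commute)
            have bound: "Gdist (f x) (T k) - Gdist (f a) (T k) \<le> slope ?z a + \<epsilon> * norm ?z" for k
            proof -
              have "Gdist (f x) (T k) - Gdist (f a) (T k) \<le> slope ?z a + norm ?z * (2 * \<eta> * G a + \<epsilon> / 4 + \<eta> * (\<epsilon> / 4))"
                using segment_upper_bound[OF elim(2) _ z vd, of k] elim(1) v(1) \<epsilon> \<eta>(1) elim(3) by auto
              also have "norm ?z * (2 * \<eta> * G a + \<epsilon> / 4 + \<eta> * (\<epsilon> / 4)) \<le> norm ?z * \<epsilon>"
              proof (rule mult_left_mono)
                have "\<eta> * (\<epsilon> / 4) \<le> 1 * (\<epsilon> / 4)" using \<eta>(2) \<epsilon> by (intro mult_right_mono) auto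
                then show "2 * \<eta> * G a + \<epsilon> / 4 + \<eta> * (\<epsilon> / 4) \<le> \<epsilon>" using \<eta>(3) by simp
              qed simp
              finally show ?thesis by (simp add: mult.commute)
            qed
            \<comment> \<open>Only now is \<open>T k\<close> chosen close to \<open>f a\<close>,
              after the bound is available for all \<open>k\<close> at the same \<open>x\<close>;
              the distance of \<open>T k\<close> to \<open>f a\<close> enters twice.\<close>
            have "Gdist (f x) (f a) \<le> (slope ?z a + \<epsilon> * norm ?z) + e" if e: "0 < e" for e
            proof -
              obtain k where k: "Gdist (f a) (T k) < e / 2" using Gdist_to_T_lt[OF size_f[OF aU], of "e / 2"] e by auto
              have "Gdist (f x) (f a) \<le> Gdist (f x) (T k) + Gdist (T k) (f a)"
                using elim(3) aU by (intro Gdist_triangle) (auto simp: size_f size_T)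
              also have "Gdist (T k) (f a) = Gdist (f a) (T k)" using aU by (intro Gdist_commute) (simp add: size_f size_T)
              finally show ?thesis using bound[of k] k by simp
            qed
            then have "Gdist (f x) (f a) \<le> slope ?z a + \<epsilon> * norm ?z" by (rule field_le_epsilon)
            then show ?case by (simp add: slope_def)
          qed
        qed
      qed
    qed
  qed
qed

end

section \<open>Calculus of approximate differentials\<close>

lemma ap_lim_divide_iff: "ap_lim (\<lambda>x. h x / norm (x - a)) a 0 \<longleftrightarrow> ap_o a h"
proof
  assume "ap_lim (\<lambda>x. h x / norm (x - a)) a 0"
  then have lim: "((\<lambda>x. h x / norm (x - a)) \<longlongrightarrow> 0) (ap_at a)" by (simp add: ap_lim_iff)
  show "ap_o a h" unfolding ap_o_def
  proof (intro allI impI)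
    fix \<epsilon> :: real assume "0 < \<epsilon>"
    from tendstoD[OF lim this] ap_at_AE_neq[of a] show "\<forall>\<^sub>F x in ap_at a. \<bar>h x\<bar> \<le> \<epsilon> * norm (x - a)"
      by eventually_elim (simp add: pos_divide_less_eq abs_divide)
  qed
next
  assume h: "ap_o a h"
  show "ap_lim (\<lambda>x. h x / norm (x - a)) a 0" unfolding ap_lim_iff tendsto_iff
  proof (intro allI impI)
    fix e :: real assume e: "0 < e"
    then have "0 < e / 2" by simp
    from ap_oD[OF h this] ap_at_AE_neq[of a] show "\<forall>\<^sub>F x in ap_at a. dist (h x / norm (x - a)) 0 < e"
    proof eventually_elim
      case (elim x)
      then have "0 < norm (x - a)" by simp
      then have "\<bar>h x\<bar> < e * norm (x - a)" using elim(1) e by (smt (verit) mult_strict_right_mono field_sum_of_halves)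
      then show ?case using elim(2) by (simp add: pos_divide_less_eq abs_divide)
    qed
  qed
qed

lemma has_ap_differential_mset:
  "has_ap_differential f a (mset xs) \<longleftrightarrow> mset (map fst xs) = f a \<and>
     (\<forall>p\<in>set xs. \<forall>q\<in>set xs. fst p = fst q \<longrightarrow> snd p = snd q) \<and>
     ap_o a (\<lambda>x. Gdist (f x) (mset (map (\<lambda>(v, L). v + blinfun_apply L (x - a)) xs)))"
  unfolding has_ap_differential_def ap_lim_divide_iff by simp

lemma L2_set_eq_ap_o:
  assumes "\<And>i. i < n \<Longrightarrow> ap_o a (\<lambda>x. norm (e i x))"
  shows "ap_o a (\<lambda>x. L2_set (\<lambda>i. norm (e i x)) {..<n})"
proof (rule ap_o_mono[OF ap_o_sum[of "{..<n}" a "\<lambda>i x. norm (e i x)"]])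
  show "\<forall>\<^sub>F x in ap_at a. \<bar>L2_set (\<lambda>i. norm (e i x)) {..<n}\<bar> \<le> \<bar>\<Sum>i<n. norm (e i x)\<bar>"
    by (intro always_eventually allI) (simp add: L2_set_nonneg sum_nonneg L2_set_le_sum)
qed (use assms in auto)

lemma Gdist_map_le:
  "Gdist (mset (map F xs)) (mset (map F' xs)) \<le> L2_set (\<lambda>i. norm (F (xs ! i) - F' (xs ! i))) {..<length xs}"
proof -
  have "Gdist (mset (map F xs)) (mset (map F' xs)) \<le> L2_set (\<lambda>i. norm (map F xs ! i - map F' xs ! i)) {..<length xs}"
    using Gdist_nth_le[of "map F xs" "map F' xs"] by simp
  also have "\<dots> = L2_set (\<lambda>i. norm (F (xs ! i) - F' (xs ! i))) {..<length xs}"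
    by (intro L2_set_cong) auto
  finally show ?thesis .
qed

lemma ap_o_Gdist_change:
  assumes size: "\<forall>\<^sub>F x in ap_at a. size (f x) = length xs"
    and o: "ap_o a (\<lambda>x. Gdist (f x) (mset (map (F x) xs)))"
    and e: "\<And>p. p \<in> set xs \<Longrightarrow> ap_o a (\<lambda>x. norm (F x p - F' x p))"
  shows "ap_o a (\<lambda>x. Gdist (f x) (mset (map (F' x) xs)))"
proof (rule ap_o_mono[OF ap_o_add[OF o L2_set_eq_ap_o[of "length xs" a "\<lambda>i x. F x (xs ! i) - F' x (xs ! i)"]]])
  show "\<forall>\<^sub>F x in ap_at a. \<bar>Gdist (f x) (mset (map (F' x) xs))\<bar>
    \<le> \<bar>Gdist (f x) (mset (map (F x) xs)) + L2_set (\<lambda>i. norm (F x (xs ! i) - F' x (xs ! i))) {..<length xs}\<bar>"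
    using size
  proof eventually_elim
    case (elim x)
    have "Gdist (f x) (mset (map (F' x) xs)) \<le> Gdist (f x) (mset (map (F x) xs)) + Gdist (mset (map (F x) xs)) (mset (map (F' x) xs))"
      using elim by (intro Gdist_triangle) auto
    moreover have "0 \<le> Gdist (f x) (mset (map (F' x) xs))" using elim by (intro Gdist_nonneg) auto
    ultimately show ?case using Gdist_map_le[of "F x" xs "F' x"] by linarith
  qed
qed (use e in auto)

text \<open>Near \<open>a\<close> both affine tuples stay close to the common base values, and one
  of them is coherent on clusters, so \<open>Gdist_eq_L2_set\<close> computes their distance entry
  by entry. The triangle inequality makes it \<open>o(norm (x - a))\<close>, which forces the linear
  parts to agree.\<close>

lemma ap_differential_unique_aux:
  fixes xs ys :: "('h::real_normed_vector \<times> ((real ^ 'm) \<Rightarrow>\<^sub>L 'h)) list"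
  assumes d: "has_ap_differential f a (mset xs)" "has_ap_differential f a (mset ys)"
    and fst: "map fst xs = map fst ys" and size: "\<forall>\<^sub>F x in ap_at a. size (f x) = length xs"
  shows "xs = ys"
proof -
  let ?n = "length xs"
  have len: "length ys = ?n" using fst by (metis length_map)
  define p where "p i = fst (xs ! i)" for i
  have py: "fst (ys ! i) = p i" if "i < ?n" for i
    using fst that len unfolding p_def by (metis nth_map)
  obtain \<delta> where \<delta>: "0 < \<delta>" "\<And>i j. i < ?n \<Longrightarrow> j < ?n \<Longrightarrow> p i \<noteq> p j \<Longrightarrow> 4 * \<delta> \<le> norm (p i - p j)"
  proof -
    define N where "N = insert 1 ((\<lambda>(i, j). norm (p i - p j)) ` {(i, j). i < ?n \<and> j < ?n \<and> p i \<noteq> p j})"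
    have "finite {(i, j). i < ?n \<and> j < ?n \<and> p i \<noteq> p j}"
      by (rule finite_subset[of _ "{..<?n} \<times> {..<?n}"]) auto
    then have fin: "finite N" unfolding N_def by (intro finite.insertI finite_imageI)
    have pos: "0 < Min N" using fin by (subst Min_gr_iff) (auto simp: N_def)
    have "Min N \<le> norm (p i - p j)" if "i < ?n" "j < ?n" "p i \<noteq> p j" for i j
      using fin that by (intro Min_le) (auto simp: N_def)
    then show thesis using pos by (intro that[of "Min N / 4"]) auto
  qed
  let ?aff = "\<lambda>zs x. map (\<lambda>(v, L). v + blinfun_apply L (x - a)) zs"
  have near: "\<forall>\<^sub>F x in ap_at a. L2_set (\<lambda>i. norm (blinfun_apply (snd (zs ! i)) (x - a))) {..<?n} < \<delta>"
    for zs :: "('h \<times> ((real ^ 'm) \<Rightarrow>\<^sub>L 'h)) list"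
  proof -
    let ?h = "\<lambda>x. \<Sum>i<?n. norm (blinfun_apply (snd (zs ! i)) (x - a))"
    have "isCont ?h a" by (intro continuous_intros)
    then have "(?h \<longlongrightarrow> ?h a) (at a)" by (simp add: isCont_def)
    moreover have "?h a = 0" by simp
    ultimately have "\<forall>\<^sub>F x in at a. ?h x < \<delta>" using \<delta>(1) by (intro order_tendstoD) auto
    then have "\<forall>\<^sub>F x in ap_at a. ?h x < \<delta>" using ap_at_le_at[of a] by (simp add: le_filter_def)
    then show ?thesis
    proof eventually_elim
      case (elim x)
      have "L2_set (\<lambda>i. norm (blinfun_apply (snd (zs ! i)) (x - a))) {..<?n} \<le> ?h x"
        by (rule L2_set_le_sum) simp
      with elim show ?case by simp
    qed
  qed
  have snd_eq: "snd (xs ! i) = snd (ys ! i)" if i: "i < ?n" for i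
  proof -
    let ?A = "\<lambda>z. blinfun_apply (snd (xs ! i)) z - blinfun_apply (snd (ys ! i)) z"
    have lin: "linear ?A"
      by (intro linear_compose_sub) (simp_all add: blinfun.bounded_linear_right bounded_linear.linear)
    have ev: "\<forall>\<^sub>F x in ap_at a. norm (?A (x - a)) \<le> \<epsilon> * norm (x - a)" if \<epsilon>: "0 < \<epsilon>" for \<epsilon>
    proof -
      have "ap_o a (\<lambda>x. Gdist (f x) (mset (?aff xs x)) + Gdist (f x) (mset (?aff ys x)))"
        using d unfolding has_ap_differential_mset by (intro ap_o_add) auto
      from ap_oD[OF this \<epsilon>] size near[of xs] near[of ys]
      show ?thesis
      proof eventually_elim
        case (elim x)
        have xi: "?aff xs x ! j = p j + blinfun_apply (snd (xs ! j)) (x - a)"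
          and yi: "?aff ys x ! j = p j + blinfun_apply (snd (ys ! j)) (x - a)" if "j < ?n" for j
          using that len py[OF that] by (auto simp: p_def split_beta)
        have "Gdist (mset (?aff xs x)) (mset (?aff ys x)) = L2_set (\<lambda>i. norm (?aff xs x ! i - ?aff ys x ! i)) {..<?n}"
        proof (rule Gdist_eq_L2_set[of "map fst xs" _ _ _ \<delta>])
          show "4 * \<delta> \<le> norm (map fst xs ! i - map fst xs ! j)"
            if "i < ?n" "j < ?n" "map fst xs ! i \<noteq> map fst xs ! j" for i j
            using \<delta>(2)[OF that(1,2)] that by (simp add: p_def)
          show "?aff xs x ! i = ?aff xs x ! j" if "i < ?n" "j < ?n" "map fst xs ! i = map fst xs ! j" for i j
          proof -
            have "xs ! i \<in> set xs" "xs ! j \<in> set xs" "fst (xs ! i) = fst (xs ! j)" using that by auto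
            then have "snd (xs ! i) = snd (xs ! j)"
              using d(1) unfolding has_ap_differential_mset by blast
            then show ?thesis using that xi by (simp add: p_def)
          qed
          have "L2_set (\<lambda>i. norm (?aff xs x ! i - map fst xs ! i)) {..<?n}
            = L2_set (\<lambda>i. norm (blinfun_apply (snd (xs ! i)) (x - a))) {..<?n}"
            by (intro L2_set_cong refl) (use xi in \<open>auto simp: p_def\<close>)
          then show "L2_set (\<lambda>i. norm (?aff xs x ! i - map fst xs ! i)) {..<?n} < \<delta>" using elim(3) by simp
          have "L2_set (\<lambda>i. norm (?aff ys x ! i - map fst xs ! i)) {..<?n}
            = L2_set (\<lambda>i. norm (blinfun_apply (snd (ys ! i)) (x - a))) {..<?n}"
            by (intro L2_set_cong refl) (use yi in \<open>auto simp: p_def\<close>)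
          then show "L2_set (\<lambda>i. norm (?aff ys x ! i - map fst xs ! i)) {..<?n} < \<delta>" using elim(4) by simp
        qed (use len in auto)
        moreover have "norm (?A (x - a)) \<le> L2_set (\<lambda>i. norm (?aff xs x ! i - ?aff ys x ! i)) {..<?n}"
          using member_le_L2_set[of "{..<?n}" i "\<lambda>i. norm (?aff xs x ! i - ?aff ys x ! i)"] i xi[OF i] yi[OF i] by simp
        moreover have "Gdist (mset (?aff xs x)) (mset (?aff ys x))
          \<le> Gdist (mset (?aff xs x)) (f x) + Gdist (f x) (mset (?aff ys x))"
          using elim(2) len by (intro Gdist_triangle) auto
        moreover have "Gdist (mset (?aff xs x)) (f x) = Gdist (f x) (mset (?aff xs x))"
          using elim(2) by (intro Gdist_commute) auto
        ultimately show ?case using elim(1) by linarith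
      qed
    qed
    have "?A v = 0" for v
    proof -
      have "norm (?A v) \<le> 0 + e" if e: "0 < e" for e
      proof -
        have "norm (?A v) \<le> e / (norm v + 1) * norm v"
          by (rule linear_bound_ap_at[OF lin ev]) (use e in \<open>auto intro!: divide_pos_pos add_nonneg_pos\<close>)
        also have "\<dots> \<le> e" using e by (rule divide_Suc_mult_le) simp
        finally show ?thesis by simp
      qed
      then have "norm (?A v) \<le> 0" by (rule field_le_epsilon)
      then show ?thesis by simp
    qed
    then show ?thesis by (intro blinfun_eqI) simp
  qed
  show ?thesis
    using len snd_eq py by (intro nth_equalityI prod_eqI) (auto simp: p_def)
qed

theorem ap_differential_unique:
  fixes M M' :: "('h::real_normed_vector \<times> ((real ^ 'm) \<Rightarrow>\<^sub>L 'h)) multiset"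
  assumes d: "has_ap_differential f a M" "has_ap_differential f a M'"
    and size: "\<forall>\<^sub>F x in ap_at a. size (f x) = size (f a)"
  shows "M = M'"
proof -
  obtain xs where xs: "mset xs = M" using ex_mset by blast
  obtain ys0 where ys0: "mset ys0 = M'" using ex_mset by blast
  have "mset (map fst xs) = mset (map fst ys0)"
    using d unfolding xs[symmetric] ys0[symmetric] has_ap_differential_mset by simp
  then obtain \<pi> where \<pi>: "\<pi> permutes {..<length (map fst ys0)}" "permute_list \<pi> (map fst ys0) = map fst xs"
    using mset_eq_permutation by metis
  have \<pi>': "\<pi> permutes {..<length ys0}" using \<pi>(1) by simp
  define ys where "ys = permute_list \<pi> ys0"
  have "mset ys = M'" using ys0 mset_permute_list[OF \<pi>'] by (simp add: ys_def)
  moreover have "map fst ys = map fst xs" using \<pi>(2) permute_list_map[OF \<pi>', of fst] by (simp add: ys_def)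
  moreover have "length xs = size (f a)"
    using d(1) unfolding xs[symmetric] has_ap_differential_mset by (metis size_mset length_map)
  ultimately have "xs = ys"
    using d size xs by (intro ap_differential_unique_aux[of f a]) auto
  then show ?thesis using xs \<open>mset ys = M'\<close> by simp
qed

text \<open>Evaluates the definite description. The condition on sizes is there because
  \<open>Gdist\<close> behaves as a metric only between tuples of equal size.\<close>

lemma ap_differential_eq:
  assumes "has_ap_differential f a M" "\<forall>\<^sub>F x in ap_at a. size (f x) = size (f a)"
  shows "ap_differential f a = M"
  unfolding ap_differential_def
  by (rule the_equality[where P = "has_ap_differential f a", OF assms(1)])
     (rule ap_differential_unique[OF _ assms])

lemma norm_D_squared:
  assumes "has_ap_differential f a (mset xs)" "\<forall>\<^sub>F x in ap_at a. size (f x) = size (f a)"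
  shows "(norm_D f a)\<^sup>2 = (\<Sum>p\<leftarrow>xs. (HS_norm (snd p))\<^sup>2)"
proof -
  have "(\<Sum>(v, L)\<in>#mset xs. (HS_norm L)\<^sup>2) = (\<Sum>p\<leftarrow>xs. (HS_norm (snd p))\<^sup>2)"
    by (simp add: case_prod_unfold flip: mset_map sum_mset_sum_list)
  moreover have "0 \<le> (\<Sum>p\<leftarrow>xs. (HS_norm (snd p))\<^sup>2)" by (intro sum_list_nonneg) auto
  ultimately show ?thesis unfolding norm_D_def ap_differential_eq[OF assms] by simp
qed

section \<open>The product rule for scaled maps\<close>

lemma Gdist_scale_le:
  fixes u v :: "'h::real_normed_vector multiset"
  assumes "size u = size v"
  shows "Gdist (image_mset (\<lambda>y. s *\<^sub>R y) u) (image_mset (\<lambda>y. s *\<^sub>R y) v) \<le> \<bar>s\<bar> * Gdist u v"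
proof -
  obtain us where us: "mset us = u" using ex_mset by blast
  obtain vs where vs: "length vs = length us" "mset vs = v"
    "Gdist u v = L2_set (\<lambda>i. norm (us ! i - vs ! i)) {..<length us}"
    using Gdist_matchingE[OF us assms[symmetric]] by blast
  have "Gdist (mset (map (\<lambda>y. s *\<^sub>R y) us)) (mset (map (\<lambda>y. s *\<^sub>R y) vs))
    \<le> L2_set (\<lambda>i. norm (map (\<lambda>y. s *\<^sub>R y) us ! i - map (\<lambda>y. s *\<^sub>R y) vs ! i)) {..<length us}"
    using Gdist_nth_le[of "map (\<lambda>y. s *\<^sub>R y) us" "map (\<lambda>y. s *\<^sub>R y) vs"] by simp
  also have "\<dots> = L2_set (\<lambda>i. \<bar>s\<bar> * norm (us ! i - vs ! i)) {..<length us}"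
    using vs(1) by (intro L2_set_cong refl) (auto simp flip: scaleR_diff_right)
  also have "\<dots> = \<bar>s\<bar> * Gdist u v" using vs(3) by (simp add: L2_set_right_distrib)
  finally show ?thesis using us vs(2) by simp
qed

lemma HS_norm_squared: "(HS_norm L)\<^sup>2 = (\<Sum>i\<in>UNIV. (norm (blinfun_apply L (axis i 1)))\<^sup>2)"
  by (simp add: HS_norm_def sum_nonneg)

lemma blinfun_axis_expansion: "blinfun_apply L z = (\<Sum>i\<in>UNIV. z $ i *\<^sub>R blinfun_apply L (axis i 1))"
proof -
  have "z = (\<Sum>i\<in>UNIV. z $ i *\<^sub>R axis i 1)"
    using basis_expansion[of z] by (simp add: scalar_mult_eq_scaleR)
  then have "blinfun_apply L z = blinfun_apply L (\<Sum>i\<in>UNIV. z $ i *\<^sub>R axis i 1)" by simp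
  then show ?thesis by (simp add: blinfun.sum_right blinfun.scaleR_right)
qed

text \<open>The product rule for \<open>s x *\<^sub>R y\<close> when \<open>s\<close> has value
  \<open>c\<close> and gradient \<open>t *\<^sub>R g\<close> at the base point.\<close>

definition scale_differential ::
    "real \<Rightarrow> real \<Rightarrow> real ^ 'm \<Rightarrow> 'h \<times> ((real ^ 'm) \<Rightarrow>\<^sub>L 'h) \<Rightarrow> 'h::real_inner \<times> ((real ^ 'm) \<Rightarrow>\<^sub>L 'h)" where
  "scale_differential c t g p =
     (c *\<^sub>R fst p, Blinfun (\<lambda>z. c *\<^sub>R blinfun_apply (snd p) z + (t * (g \<bullet> z)) *\<^sub>R fst p))"

lemma scale_differential_apply:
  "blinfun_apply (snd (scale_differential c t g p)) z = c *\<^sub>R blinfun_apply (snd p) z + (t * (g \<bullet> z)) *\<^sub>R fst p"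
proof -
  have "bounded_linear (\<lambda>z. c *\<^sub>R blinfun_apply (snd p) z + (t * (g \<bullet> z)) *\<^sub>R fst p)"
    by (intro bounded_linear_add bounded_linear_const_scaleR blinfun.bounded_linear_right
        bounded_linear_scaleR_const bounded_linear_const_mult bounded_linear_inner_right)
  then show ?thesis by (simp add: scale_differential_def bounded_linear_Blinfun_apply)
qed

text \<open>The mixed term pairs the value with the derivative in direction \<open>g\<close>. Summed
  over the branches it is known from \<open>Gdist_zero_gradient\<close>, so the varied energy
  involves only \<open>norm_D\<close> and scalar Sobolev functions.\<close>

lemma HS_norm_scale_differential:
  "(HS_norm (snd (scale_differential c t g p)))\<^sup>2
    = c\<^sup>2 * (HS_norm (snd p))\<^sup>2 + 2 * c * t * (fst p \<bullet> blinfun_apply (snd p) g) + t\<^sup>2 * (norm g)\<^sup>2 * (norm (fst p))\<^sup>2"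
proof -
  have "(HS_norm (snd (scale_differential c t g p)))\<^sup>2
    = (\<Sum>i\<in>UNIV. c\<^sup>2 * (norm (blinfun_apply (snd p) (axis i 1)))\<^sup>2
        + (2 * c * t) * (g $ i * (fst p \<bullet> blinfun_apply (snd p) (axis i 1))) + (t\<^sup>2 * (norm (fst p))\<^sup>2) * (g $ i)\<^sup>2)"
    unfolding HS_norm_squared scale_differential_apply power2_norm_eq_inner
    by (intro sum.cong refl)
       (simp add: inner_axis inner_add_left inner_add_right inner_commute power2_eq_square algebra_simps)
  also have "\<dots> = c\<^sup>2 * (HS_norm (snd p))\<^sup>2 + (2 * c * t) * (\<Sum>i\<in>UNIV. g $ i * (fst p \<bullet> blinfun_apply (snd p) (axis i 1)))
     + (t\<^sup>2 * (norm (fst p))\<^sup>2) * (\<Sum>i\<in>UNIV. (g $ i)\<^sup>2)"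
    unfolding HS_norm_squared by (simp add: sum.distrib sum_distrib_left)
  also have "(\<Sum>i\<in>UNIV. (g $ i)\<^sup>2) = (norm g)\<^sup>2"
    by (simp add: norm_vec_def L2_set_def sum_nonneg)
  also have "(\<Sum>i\<in>UNIV. g $ i * (fst p \<bullet> blinfun_apply (snd p) (axis i 1))) = fst p \<bullet> blinfun_apply (snd p) g"
    by (subst (2) blinfun_axis_expansion) (simp add: inner_sum_right)
  finally show ?thesis by (simp add: ac_simps)
qed

lemma ap_o_of_at:
  assumes "\<And>\<epsilon>. 0 < \<epsilon> \<Longrightarrow> \<forall>\<^sub>F x in at a. norm (e x) \<le> \<epsilon> * norm (x - a)"
  shows "ap_o a (\<lambda>x. norm (e x))"
  unfolding ap_o_def
proof (intro allI impI)
  fix \<epsilon> :: real assume "0 < \<epsilon>"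
  from assms[OF this] show "\<forall>\<^sub>F x in ap_at a. \<bar>norm (e x)\<bar> \<le> \<epsilon> * norm (x - a)"
    using ap_at_le_at[of a] by (simp add: le_filter_def)
qed

lemma ap_o_derivative:
  assumes "(\<phi> has_derivative \<phi>') (at a)"
  shows "ap_o a (\<lambda>x. norm (\<phi> x - \<phi> a - \<phi>' (x - a)))"
proof (rule ap_o_of_at)
  fix \<epsilon> :: real assume "0 < \<epsilon>"
  then show "\<forall>\<^sub>F x in at a. norm (\<phi> x - \<phi> a - \<phi>' (x - a)) \<le> \<epsilon> * norm (x - a)"
    using assms unfolding has_derivative_at_alt eventually_at
    by (metis dist_norm)
qed

theorem has_ap_differential_scale:
  fixes f :: "real ^ 'm \<Rightarrow> 'h::real_inner multiset"
  assumes d: "has_ap_differential f a (mset xs)" and size: "\<forall>\<^sub>F x in ap_at a. size (f x) = size (f a)"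
    and s: "(s has_derivative (\<lambda>v. t * (g \<bullet> v))) (at a)" and s0: "s a \<noteq> 0"
  shows "has_ap_differential (\<lambda>x. image_mset (\<lambda>y. s x *\<^sub>R y) (f x)) a
    (mset (map (scale_differential (s a) t g) xs))"
proof -
  let ?c = "s a"
  let ?aff = "\<lambda>x. \<lambda>(v, L). v + blinfun_apply L (x - a)"
  have D: "mset (map fst xs) = f a" "\<And>p q. p \<in> set xs \<Longrightarrow> q \<in> set xs \<Longrightarrow> fst p = fst q \<Longrightarrow> snd p = snd q"
    "ap_o a (\<lambda>x. Gdist (f x) (mset (map (?aff x) xs)))"
    using d unfolding has_ap_differential_mset by blast+
  have lenxs: "length xs = size (f a)" using D(1) by (metis size_mset length_map)
  have size': "\<forall>\<^sub>F x in ap_at a. size (image_mset (\<lambda>y. s x *\<^sub>R y) (f x)) = length xs"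
    using size lenxs by simp
  have "isCont s a" using s by (rule has_derivative_continuous)
  then have "(s \<longlongrightarrow> s a) (at a)" by (simp add: isCont_def)
  then have "\<forall>\<^sub>F x in at a. \<bar>s x\<bar> < \<bar>?c\<bar> + 1"
    using tendsto_rabs[of s ?c "at a"] by (intro order_tendstoD) auto
  then have sbd: "\<forall>\<^sub>F x in ap_at a. \<bar>s x\<bar> < \<bar>?c\<bar> + 1" using ap_at_le_at[of a] by (simp add: le_filter_def)
  have o1: "ap_o a (\<lambda>x. Gdist (image_mset (\<lambda>y. s x *\<^sub>R y) (f x)) (mset (map (\<lambda>p. s x *\<^sub>R ?aff x p) xs)))"
  proof (rule ap_o_mono[OF ap_o_cmult[OF D(3), of "\<bar>?c\<bar> + 1"]])
    show "\<forall>\<^sub>F x in ap_at a. \<bar>Gdist (image_mset (\<lambda>y. s x *\<^sub>R y) (f x)) (mset (map (\<lambda>p. s x *\<^sub>R ?aff x p) xs))\<bar>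
      \<le> \<bar>(\<bar>?c\<bar> + 1) * Gdist (f x) (mset (map (?aff x) xs))\<bar>"
      using sbd size
    proof eventually_elim
      case (elim x)
      have sz: "size (f x) = size (mset (map (?aff x) xs))" using elim(2) lenxs by simp
      have im: "mset (map (\<lambda>p. s x *\<^sub>R ?aff x p) xs) = image_mset (\<lambda>y. s x *\<^sub>R y) (mset (map (?aff x) xs))"
        by (simp add: image_mset.compositionality o_def)
      have G0: "0 \<le> Gdist (f x) (mset (map (?aff x) xs))" by (rule Gdist_nonneg[OF sz])
      have "Gdist (image_mset (\<lambda>y. s x *\<^sub>R y) (f x)) (mset (map (\<lambda>p. s x *\<^sub>R ?aff x p) xs))
        \<le> \<bar>s x\<bar> * Gdist (f x) (mset (map (?aff x) xs))"
        unfolding im by (rule Gdist_scale_le[OF sz])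
      also have "\<dots> \<le> (\<bar>?c\<bar> + 1) * Gdist (f x) (mset (map (?aff x) xs))"
        using elim(1) G0 by (intro mult_right_mono) auto
      finally show ?case
        using Gdist_nonneg[of "image_mset (\<lambda>y. s x *\<^sub>R y) (f x)" "mset (map (\<lambda>p. s x *\<^sub>R ?aff x p) xs)"] sz G0 by simp
    qed
  qed
  have "ap_o a (\<lambda>x. Gdist (image_mset (\<lambda>y. s x *\<^sub>R y) (f x))
    (mset (map (\<lambda>p. fst (scale_differential ?c t g p) + blinfun_apply (snd (scale_differential ?c t g p)) (x - a)) xs)))"
  proof (rule ap_o_Gdist_change[OF size' o1])
    fix p assume "p \<in> set xs"
    obtain v L where p: "p = (v, L)" by force
    have o_s: "ap_o a (\<lambda>x. norm (s x - ?c - t * (g \<bullet> (x - a))))" by (rule ap_o_derivative[OF s])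
    have o_L: "ap_o a (\<lambda>x. \<bar>s x - ?c\<bar> * norm (blinfun_apply L (x - a)))"
      unfolding ap_o_def
    proof (intro allI impI)
      fix \<epsilon> :: real assume \<epsilon>: "0 < \<epsilon>"
      then have pos: "0 < \<epsilon> / (norm L + 1)" by (auto intro!: divide_pos_pos add_nonneg_pos)
      have "\<forall>\<^sub>F x in at a. dist (s x) ?c < \<epsilon> / (norm L + 1)"
        using \<open>(s \<longlongrightarrow> s a) (at a)\<close> pos by (rule tendstoD)
      then have "\<forall>\<^sub>F x in ap_at a. dist (s x) ?c < \<epsilon> / (norm L + 1)" using ap_at_le_at[of a] by (simp add: le_filter_def)
      then show "\<forall>\<^sub>F x in ap_at a. \<bar>\<bar>s x - ?c\<bar> * norm (blinfun_apply L (x - a))\<bar> \<le> \<epsilon> * norm (x - a)"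
      proof eventually_elim
        case (elim x)
        have "\<bar>s x - ?c\<bar> * norm (blinfun_apply L (x - a)) \<le> \<epsilon> / (norm L + 1) * (norm L * norm (x - a))"
          using elim pos by (intro mult_mono norm_blinfun) (auto simp: dist_real_def)
        also have "\<dots> = (\<epsilon> / (norm L + 1) * norm L) * norm (x - a)" by simp
        also have "\<dots> \<le> \<epsilon> * norm (x - a)" using \<epsilon> by (intro mult_right_mono divide_Suc_mult_le) auto
        finally show ?case by (simp add: abs_mult)
      qed
    qed
    show "ap_o a (\<lambda>x. norm (s x *\<^sub>R ?aff x p - (fst (scale_differential ?c t g p) + blinfun_apply (snd (scale_differential ?c t g p)) (x - a))))"
    proof (rule ap_o_mono[OF ap_o_add[OF ap_o_cmult[OF o_s, of "norm v"] o_L]], intro always_eventually allI)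
      fix x
      have "s x *\<^sub>R ?aff x p - (fst (scale_differential ?c t g p) + blinfun_apply (snd (scale_differential ?c t g p)) (x - a))
        = (s x - ?c - t * (g \<bullet> (x - a))) *\<^sub>R v + (s x - ?c) *\<^sub>R blinfun_apply L (x - a)"
        unfolding scale_differential_apply by (simp add: p scale_differential_def algebra_simps)
      then have "norm (s x *\<^sub>R ?aff x p - (fst (scale_differential ?c t g p) + blinfun_apply (snd (scale_differential ?c t g p)) (x - a)))
        \<le> norm v * norm (s x - ?c - t * (g \<bullet> (x - a))) + \<bar>s x - ?c\<bar> * norm (blinfun_apply L (x - a))"
        using norm_triangle_ineq[of "(s x - ?c - t * (g \<bullet> (x - a))) *\<^sub>R v" "(s x - ?c) *\<^sub>R blinfun_apply L (x - a)"]
        by (simp add: mult.commute)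
      then show "\<bar>norm (s x *\<^sub>R ?aff x p - (fst (scale_differential ?c t g p) + blinfun_apply (snd (scale_differential ?c t g p)) (x - a)))\<bar>
        \<le> \<bar>norm v * norm (s x - ?c - t * (g \<bullet> (x - a))) + \<bar>s x - ?c\<bar> * norm (blinfun_apply L (x - a))\<bar>" by simp
    qed
  qed
  then have o: "ap_o a (\<lambda>x. Gdist (image_mset (\<lambda>y. s x *\<^sub>R y) (f x))
    (mset (map (?aff x) (map (scale_differential ?c t g) xs))))"
    by (simp add: o_def split_beta del: mset_map)
  show ?thesis
    unfolding has_ap_differential_mset
  proof (intro conjI ballI impI o)
    show "mset (map fst (map (scale_differential ?c t g) xs)) = image_mset (\<lambda>y. ?c *\<^sub>R y) (f a)"
      unfolding D(1)[symmetric] by (simp add: scale_differential_def image_mset.compositionality o_def)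
    fix p' q' assume "p' \<in> set (map (scale_differential ?c t g) xs)" "q' \<in> set (map (scale_differential ?c t g) xs)"
      and fst: "fst p' = fst q'"
    then obtain p q where pq: "p \<in> set xs" "q \<in> set xs"
      "p' = scale_differential ?c t g p" "q' = scale_differential ?c t g q" by auto
    \<comment> \<open>A vanishing factor \<open>s a\<close> would merge branches that have different
      derivatives.\<close>
    then have "fst p = fst q" using fst s0 by (simp add: scale_differential_def)
    with D(2)[OF pq(1,2)] have "p = q" by (simp add: prod_eq_iff)
    then show "snd p' = snd q'" using pq by simp
  qed
qed

section \<open>The squash variation\<close>

lemma Gdist_replicate_zero:
  "(Gdist (mset xs) (replicate_mset (length xs) 0))\<^sup>2 = (\<Sum>p\<leftarrow>xs. (norm p)\<^sup>2)"
proof -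
  obtain ts where ts: "length ts = length xs" "mset ts = replicate_mset (length xs) 0"
    "Gdist (mset xs) (replicate_mset (length xs) 0) = L2_set (\<lambda>i. norm (xs ! i - ts ! i)) {..<length xs}"
    using Gdist_matching[of "replicate_mset (length xs) 0" xs] by auto
  have "ts ! i = 0" if "i < length xs" for i
  proof -
    have "ts ! i \<in># replicate_mset (length xs) 0" using ts that by (metis nth_mem set_mset_mset)
    then show ?thesis by (simp split: if_splits)
  qed
  then have "(Gdist (mset xs) (replicate_mset (length xs) 0))\<^sup>2 = (\<Sum>i<length xs. (norm (xs ! i))\<^sup>2)"
    using ts(3) by (simp add: L2_set_def sum_nonneg)
  also have "\<dots> = (\<Sum>p\<leftarrow>xs. (norm p)\<^sup>2)"
    by (simp add: sum_list_sum_nth atLeast0LessThan)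
  finally show ?thesis .
qed

definition scaling_field :: "'a::real_inner \<Rightarrow> real \<Rightarrow> 'a \<times> 'h::real_normed_vector \<Rightarrow> 'h" where
  "scaling_field a r z = bump a r (fst z) *\<^sub>R snd z"

lemma C1_on_scaling_field: "C1_on S (scaling_field a r)"
proof -
  define Y' where "Y' z = bump a r (fst z) *\<^sub>R snd_blinfun +
    (blinfun_scaleR_left (snd z) o\<^sub>L (blinfun_inner_right (grad_bump a r (fst z)) o\<^sub>L fst_blinfun))" for z :: "'a \<times> 'b"
  have "(scaling_field a r has_derivative blinfun_apply (Y' z)) (at z)" for z :: "'a \<times> 'b"
  proof -
    have "((\<lambda>z. bump a r (fst z) *\<^sub>R snd z) has_derivative
      (\<lambda>h. bump a r (fst z) *\<^sub>R snd h + (grad_bump a r (fst z) \<bullet> fst h) *\<^sub>R snd z)) (at z)"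
      by (intro has_derivative_scaleR has_derivative_snd has_derivative_ident
          has_derivative_compose[OF has_derivative_fst[OF has_derivative_ident] has_derivative_bump])
    moreover have "(\<lambda>h. bump a r (fst z) *\<^sub>R snd h + (grad_bump a r (fst z) \<bullet> fst h) *\<^sub>R snd z) = blinfun_apply (Y' z)"
      by (simp add: fun_eq_iff Y'_def blinfun.add_left blinfun.scaleR_left)
    ultimately show ?thesis unfolding scaling_field_def[abs_def] by simp
  qed
  moreover have "continuous_on S Y'"
    unfolding Y'_def
    by (intro continuous_intros continuous_on_compose2[OF continuous_on_bump[of UNIV]]
        continuous_on_compose2[OF continuous_on_grad_bump[of UNIV]]
        bounded_linear.continuous_on[OF bounded_linear_blinfun_scaleR_left]
        bounded_linear.continuous_on[OF bounded_linear_blinfun_inner_right]) auto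
  ultimately show ?thesis unfolding C1_on_def by blast
qed

lemma squash_critical:
  fixes f :: "real ^ 'm \<Rightarrow> 'h::real_normed_vector multiset"
  assumes "squash_stationary U f" "0 < r" "cball a r \<subseteq> U"
  shows "critical_family U (\<lambda>t x. image_mset (\<lambda>y. (1 + t * bump a r x) *\<^sub>R y) (f x))"
proof -
  have "closure {x \<in> U. \<exists>y::'h. scaling_field a r (x, y) \<noteq> 0} \<subseteq> cball a r"
  proof (rule closure_minimal)
    show "{x \<in> U. \<exists>y::'h. scaling_field a r (x, y) \<noteq> 0} \<subseteq> cball a r"
    proof
      fix x assume "x \<in> {x \<in> U. \<exists>y::'h. scaling_field a r (x, y) \<noteq> 0}"
      then have "bump a r x \<noteq> 0" by (auto simp: scaling_field_def)
      then have "x \<in> ball a r" using bump_eq_0[OF assms(2)] by blast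
      then show "x \<in> cball a r" using ball_subset_cball by blast
    qed
  qed simp
  then have "compact (closure {x \<in> U. \<exists>y::'h. scaling_field a r (x, y) \<noteq> 0})"
    "closure {x \<in> U. \<exists>y::'h. scaling_field a r (x, y) \<noteq> 0} \<subseteq> U"
    using assms(3) by (auto simp: compact_eq_bounded_closed intro: bounded_subset)
  then have "critical_family U (\<lambda>t x. image_mset (\<lambda>y. y + t *\<^sub>R scaling_field a r (x, y)) (f x))"
    using assms(1) C1_on_scaling_field unfolding squash_stationary_def by blast
  then show ?thesis by (simp add: scaling_field_def scaleR_add_left)
qed

context sobolev_map
begin

text \<open>Extended by 0 outside \<open>U\<close>, so that bumps reaching beyond \<open>U\<close>
  may be integrated against it.\<close>

definition dens :: "real ^ 'm \<Rightarrow> real" where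
  "dens x = indicator U x * (norm_D f x)\<^sup>2"

lemma dens_nonneg [simp]: "0 \<le> dens x"
  by (simp add: dens_def)

lemma AE_differential:
  "AE a in lborel. a \<in> U \<longrightarrow> (\<exists>xs. has_ap_differential f a (mset xs) \<and>
     (\<forall>\<^sub>F x in ap_at a. size (f x) = size (f a)) \<and>
     (\<forall>z. (\<Sum>p\<leftarrow>xs. fst p \<bullet> blinfun_apply (snd p) z) = H 0 a * (W 0 a \<bullet> z)) \<and>
     (\<Sum>p\<leftarrow>xs. (norm (fst p))\<^sup>2) = (H 0 a)\<^sup>2)"
  using AE_scalar_expansions AE_H_eq
proof eventually_elim
  case (elim a)
  show ?case
  proof
    assume a: "a \<in> U"
    interpret E: scalar_expansions f a Q T "\<lambda>k. W k a" "G a" using elim(1) a by blast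
    obtain xs where xs: "mset xs = E.differential" using ex_mset by blast
    have d: "has_ap_differential f a (mset xs)" unfolding xs by (rule E.has_ap_differential)
    have Ha: "H 0 a = Gdist (f a) (T 0)" using elim(2) a by simp
    have "(\<Sum>p\<leftarrow>xs. fst p \<bullet> blinfun_apply (snd p) z) = H 0 a * (W 0 a \<bullet> z)" for z
    proof -
      have "(\<Sum>p\<leftarrow>xs. fst p \<bullet> blinfun_apply (snd p) z) = (\<Sum>(v, L)\<in>#mset xs. v \<bullet> blinfun_apply L z)"
        by (simp add: case_prod_unfold flip: mset_map sum_mset_sum_list)
      also have "\<dots> = Gdist (f a) (T 0) * (W 0 a \<bullet> z)" unfolding xs by (rule E.Gdist_zero_gradient[OF T_0, symmetric])
      finally show ?thesis by (simp add: Ha)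
    qed
    moreover have "(\<Sum>p\<leftarrow>xs. (norm (fst p))\<^sup>2) = (H 0 a)\<^sup>2"
    proof -
      have fa: "mset (map fst xs) = f a" using d unfolding has_ap_differential_mset by blast
      then have "length (map fst xs) = Q" using size_f[OF a] by (metis size_mset)
      then show ?thesis using Gdist_replicate_zero[of "map fst xs"] unfolding Ha T_0 fa by (simp add: o_def)
    qed
    moreover have "\<forall>\<^sub>F x in ap_at a. size (f x) = size (f a)" using E.size_f E.size_a by simp
    ultimately show "\<exists>xs. has_ap_differential f a (mset xs) \<and>
     (\<forall>\<^sub>F x in ap_at a. size (f x) = size (f a)) \<and>
     (\<forall>z. (\<Sum>p\<leftarrow>xs. fst p \<bullet> blinfun_apply (snd p) z) = H 0 a * (W 0 a \<bullet> z)) \<and>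
     (\<Sum>p\<leftarrow>xs. (norm (fst p))\<^sup>2) = (H 0 a)\<^sup>2" using d by blast
  qed
qed

lemma AE_norm_D_scale:
  assumes t: "\<bar>t\<bar> < 1"
  shows "AE x in lborel. x \<in> U \<longrightarrow> (norm_D (\<lambda>x. image_mset (\<lambda>y. (1 + t * bump a r x) *\<^sub>R y) (f x)) x)\<^sup>2
    = (1 + t * bump a r x)\<^sup>2 * (norm_D f x)\<^sup>2
      + 2 * (1 + t * bump a r x) * t * (H 0 x * (W 0 x \<bullet> grad_bump a r x))
      + t\<^sup>2 * (norm (grad_bump a r x))\<^sup>2 * (H 0 x)\<^sup>2"
  using AE_differential
proof eventually_elim
  case (elim x)
  show ?case
  proof
    assume "x \<in> U"
    then obtain xs where xs: "has_ap_differential f x (mset xs)" "\<forall>\<^sub>F y in ap_at x. size (f y) = size (f x)"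
      "\<And>z. (\<Sum>p\<leftarrow>xs. fst p \<bullet> blinfun_apply (snd p) z) = H 0 x * (W 0 x \<bullet> z)"
      "(\<Sum>p\<leftarrow>xs. (norm (fst p))\<^sup>2) = (H 0 x)\<^sup>2" using elim by blast
    let ?s = "\<lambda>x. 1 + t * bump a r x" and ?g = "grad_bump a r x"
    have s0: "?s x \<noteq> 0"
    proof -
      have "\<bar>t * bump a r x\<bar> \<le> \<bar>t\<bar> * 1" unfolding abs_mult using bump_le_1[of a r x] by (intro mult_left_mono) auto
      then show ?thesis using t by linarith
    qed
    have D: "(?s has_derivative (\<lambda>v. t * (?g \<bullet> v))) (at x)"
      using has_derivative_add[OF has_derivative_const has_derivative_mult_right[OF has_derivative_bump]] by fastforce
    have d: "has_ap_differential (\<lambda>x. image_mset (\<lambda>y. ?s x *\<^sub>R y) (f x)) x (mset (map (scale_differential (?s x) t ?g) xs))"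
      by (rule has_ap_differential_scale[OF xs(1,2) D s0])
    have "(norm_D (\<lambda>x. image_mset (\<lambda>y. ?s x *\<^sub>R y) (f x)) x)\<^sup>2
      = (\<Sum>p\<leftarrow>xs. (HS_norm (snd (scale_differential (?s x) t ?g p)))\<^sup>2)"
      using norm_D_squared[OF d] xs(2) by (simp add: o_def)
    also have "\<dots> = (\<Sum>p\<leftarrow>xs. (?s x)\<^sup>2 * (HS_norm (snd p))\<^sup>2
       + (2 * ?s x * t) * (fst p \<bullet> blinfun_apply (snd p) ?g) + (t\<^sup>2 * (norm ?g)\<^sup>2) * (norm (fst p))\<^sup>2)"
      unfolding HS_norm_scale_differential by simp
    also have "\<dots> = (?s x)\<^sup>2 * (\<Sum>p\<leftarrow>xs. (HS_norm (snd p))\<^sup>2)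
       + (2 * ?s x * t) * (\<Sum>p\<leftarrow>xs. fst p \<bullet> blinfun_apply (snd p) ?g) + (t\<^sup>2 * (norm ?g)\<^sup>2) * (\<Sum>p\<leftarrow>xs. (norm (fst p))\<^sup>2)"
      by (simp add: sum_list_addf sum_list_const_mult)
    also have "(\<Sum>p\<leftarrow>xs. (HS_norm (snd p))\<^sup>2) = (norm_D f x)\<^sup>2" using norm_D_squared[OF xs(1,2)] by simp
    finally show "(norm_D (\<lambda>x. image_mset (\<lambda>y. ?s x *\<^sub>R y) (f x)) x)\<^sup>2
      = (?s x)\<^sup>2 * (norm_D f x)\<^sup>2 + 2 * ?s x * t * (H 0 x * (W 0 x \<bullet> ?g)) + t\<^sup>2 * (norm ?g)\<^sup>2 * (H 0 x)\<^sup>2"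
      unfolding xs(3,4) .
  qed
qed

lemma integrable_HW_mult:
  assumes [measurable]: "g \<in> borel_measurable borel" and "\<And>x. norm (g x) \<le> C"
  shows "integrable lborel (\<lambda>x. H 0 x * (W 0 x \<bullet> g x))"
proof (rule Bochner_Integration.integrable_bound)
  show "integrable lborel (\<lambda>x. C * ((H 0 x)\<^sup>2 + (G x)\<^sup>2))" using H0 G2 by simp
  have C: "0 \<le> C" using assms(2) norm_ge_zero order_trans by blast
  show "AE x in lborel. norm (H 0 x * (W 0 x \<bullet> g x)) \<le> norm (C * ((H 0 x)\<^sup>2 + (G x)\<^sup>2))"
  proof (rule AE_I2)
    fix x
    have "\<bar>W 0 x \<bullet> g x\<bar> \<le> G x * norm (g x)" by (rule W_inner_bound)
    also have "\<dots> \<le> G x * C" using assms(2) G_nonneg by (intro mult_left_mono) auto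
    finally have "\<bar>H 0 x\<bar> * \<bar>W 0 x \<bullet> g x\<bar> \<le> \<bar>H 0 x\<bar> * (G x * C)" by (intro mult_left_mono) auto
    also have "\<dots> = C * (\<bar>H 0 x\<bar> * G x)" by simp
    also have "\<dots> \<le> C * ((H 0 x)\<^sup>2 + (G x)\<^sup>2)"
    proof (rule mult_left_mono[OF _ C])
      have "0 \<le> \<bar>H 0 x\<bar> * G x" using G_nonneg by simp
      then show "\<bar>H 0 x\<bar> * G x \<le> (H 0 x)\<^sup>2 + (G x)\<^sup>2"
        using sum_squares_bound[of "\<bar>H 0 x\<bar>" "G x"] by simp
    qed
    finally show "norm (H 0 x * (W 0 x \<bullet> g x)) \<le> norm (C * ((H 0 x)\<^sup>2 + (G x)\<^sup>2))"
      using C by (simp add: abs_mult)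
  qed
qed measurable

text \<open>Stationarity with respect to the zero field contains the integrability of the unvaried
  density, which \<open>W12\<close> itself does not express through \<open>norm_D\<close>.\<close>

lemma dens_integrable:
  assumes "squeeze_stationary U f"
  shows "integrable lebesgue dens"
proof -
  have "(\<lambda>x. 0) \<in> test_functions U"
    by (auto simp: test_functions_def Ck_on_const)
  then have "critical_family U (\<lambda>t x. f (x + t *\<^sub>R 0))"
    using assms unfolding squeeze_stationary_def by blast
  then have "\<forall>\<^sub>F t::real in nhds 0. set_integrable lebesgue U (\<lambda>x. (norm_D f x)\<^sup>2)"
    by (simp add: critical_family_def)
  then have "set_integrable lebesgue U (\<lambda>x. (norm_D f x)\<^sup>2)"
    by (rule eventually_nhds_x_imp_x)
  then show ?thesis unfolding set_integrable_def dens_def by simp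
qed

text \<open>For small \<open>t\<close> the varied energy is exactly a quadratic polynomial in
  \<open>t\<close>, whose linear coefficient must vanish. Since \<open>H 0 x *\<^sub>R W 0 x\<close>
  is half the gradient of the square of \<open>H 0\<close>, this is the weak Laplace
  identity.\<close>

theorem squash_identity:
  assumes crit: "critical_family U (\<lambda>t x. image_mset (\<lambda>y. (1 + t * bump a r x) *\<^sub>R y) (f x))"
    and dens: "integrable lebesgue dens" and r: "0 < r" and ar: "cball a r \<subseteq> U"
  shows "(LINT x|lebesgue. dens x * bump a r x) = - (LINT x|lborel. H 0 x * (W 0 x \<bullet> grad_bump a r x))"
proof -
  let ?\<phi> = "bump a r" and ?g = "grad_bump a r"
  let ?F = "\<lambda>t x. image_mset (\<lambda>y. (1 + t * ?\<phi> x) *\<^sub>R y) (f x)"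
  define P where "P x = H 0 x * (W 0 x \<bullet> ?g x)" for x
  have P0: "?g x = 0" "?\<phi> x = 0" "P x = 0" if "x \<notin> U" for x
  proof -
    have "x \<notin> ball a r" using that ar ball_subset_cball[of a r] by blast
    then show g0: "?g x = 0" and "?\<phi> x = 0" by (simp_all add: grad_bump_eq_0[OF r] bump_eq_0[OF r])
    show "P x = 0" unfolding P_def g0 by simp
  qed
  have iPl: "integrable lborel P" unfolding P_def
    using norm_grad_bump_le[OF r, of a] by (intro integrable_HW_mult) auto
  then have iP: "integrable lebesgue P" by (subst integrable_completion) auto
  have bm: "?\<phi> \<in> borel_measurable lebesgue" by (rule measurable_completion) simp
  have iD\<phi>: "integrable lebesgue (\<lambda>x. dens x * ?\<phi> x)"
    using dens bm by (rule integrable_bounded_mult[where C = 1]) (simp add: bump_le_1)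
  define A2 where "A2 x = dens x * (?\<phi> x)\<^sup>2 + 2 * (P x * ?\<phi> x) + (norm (?g x))\<^sup>2 * (H 0 x)\<^sup>2" for x
  have iA2: "integrable lebesgue A2"
  proof -
    have "integrable lebesgue (\<lambda>x. (dens x * ?\<phi> x) * ?\<phi> x)"
      using iD\<phi> bm by (rule integrable_bounded_mult[where C = 1]) (simp add: bump_le_1)
    moreover have "integrable lebesgue (\<lambda>x. P x * ?\<phi> x)"
      using iP bm by (rule integrable_bounded_mult[where C = 1]) (simp add: bump_le_1)
    moreover have "integrable lebesgue (\<lambda>x. (norm (?g x))\<^sup>2 * (H 0 x)\<^sup>2)"
    proof -
      have "integrable lborel (\<lambda>x. (H 0 x)\<^sup>2 * (norm (?g x))\<^sup>2)"
      proof (rule integrable_bounded_mult[OF H0, where C = "(4 / r)\<^sup>2"])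
        show "\<bar>(norm (?g x))\<^sup>2\<bar> \<le> (4 / r)\<^sup>2" for x
          using norm_grad_bump_le[OF r, of a x] by (simp add: power_mono)
      qed measurable
      then show ?thesis by (subst integrable_completion) (auto simp: mult.commute)
    qed
    ultimately show ?thesis unfolding A2_def by (simp add: power2_eq_square mult.assoc)
  qed
  have E: "energy U (?F t) = (LINT x|lebesgue. dens x) + t * (2 * (LINT x|lebesgue. dens x * ?\<phi> x) + 2 * (LINT x|lebesgue. P x))
      + t\<^sup>2 * (LINT x|lebesgue. A2 x)" if t: "\<bar>t\<bar> < 1" and i: "set_integrable lebesgue U (\<lambda>x. (norm_D (?F t) x)\<^sup>2)" for t
  proof -
    have "energy U (?F t) = (LINT x|lebesgue. dens x + t * (2 * (dens x * ?\<phi> x) + 2 * P x) + t\<^sup>2 * A2 x)"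
      unfolding energy_def set_lebesgue_integral_def
    proof (rule integral_cong_AE)
      show "(\<lambda>x. indicator U x *\<^sub>R (norm_D (?F t) x)\<^sup>2) \<in> borel_measurable lebesgue"
        using i unfolding set_integrable_def by (rule borel_measurable_integrable)
      show "(\<lambda>x. dens x + t * (2 * (dens x * ?\<phi> x) + 2 * P x) + t\<^sup>2 * A2 x) \<in> borel_measurable lebesgue"
        using dens iD\<phi> iP iA2 by (intro borel_measurable_add borel_measurable_times borel_measurable_const borel_measurable_integrable)
      show "AE x in lebesgue. indicator U x *\<^sub>R (norm_D (?F t) x)\<^sup>2 = dens x + t * (2 * (dens x * ?\<phi> x) + 2 * P x) + t\<^sup>2 * A2 x"
        unfolding AE_lborel_iff_lebesgue using AE_norm_D_scale[OF t, of a r]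
      proof eventually_elim
        case (elim x)
        show ?case
        proof (cases "x \<in> U")
          case True
          then have "(norm_D (?F t) x)\<^sup>2 = (1 + t * ?\<phi> x)\<^sup>2 * (norm_D f x)\<^sup>2 + 2 * (1 + t * ?\<phi> x) * t * P x
            + t\<^sup>2 * (norm (?g x))\<^sup>2 * (H 0 x)\<^sup>2" using elim by (simp add: P_def)
          also have "\<dots> = dens x + t * (2 * (dens x * ?\<phi> x) + 2 * P x) + t\<^sup>2 * A2 x"
            using True by (simp add: dens_def A2_def power2_eq_square algebra_simps)
          finally show ?thesis using True by simp
        next
          case False
          then show ?thesis using P0[OF False] by (simp add: dens_def A2_def)
        qed
      qed
    qed
    also have "\<dots> = (LINT x|lebesgue. dens x) + t * (2 * (LINT x|lebesgue. dens x * ?\<phi> x) + 2 * (LINT x|lebesgue. P x))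
      + t\<^sup>2 * (LINT x|lebesgue. A2 x)"
      using dens iD\<phi> iP iA2 by simp
    finally show ?thesis .
  qed
  have "((\<lambda>t. energy U (?F t)) has_real_derivative 0) (at 0)"
    using crit by (simp add: critical_family_def)
  moreover have "\<forall>\<^sub>F t in nhds 0. energy U (?F t) = (LINT x|lebesgue. dens x)
      + t * (2 * (LINT x|lebesgue. dens x * ?\<phi> x) + 2 * (LINT x|lebesgue. P x)) + t\<^sup>2 * (LINT x|lebesgue. A2 x)"
  proof -
    have "\<forall>\<^sub>F t in nhds 0. \<bar>t\<bar> < (1::real)"
      using eventually_nhds_in_open[of "{-1<..<1::real}" 0] by (auto elim: eventually_mono)
    moreover have "\<forall>\<^sub>F t in nhds 0. set_integrable lebesgue U (\<lambda>x. (norm_D (?F t) x)\<^sup>2)"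
      using crit by (simp add: critical_family_def)
    ultimately show ?thesis by eventually_elim (rule E)
  qed
  ultimately have "((\<lambda>t. (LINT x|lebesgue. dens x)
      + t * (2 * (LINT x|lebesgue. dens x * ?\<phi> x) + 2 * (LINT x|lebesgue. P x)) + t\<^sup>2 * (LINT x|lebesgue. A2 x)) has_real_derivative 0) (at 0)"
    by (subst (asm) DERIV_cong_ev[OF refl _ refl])
  moreover have "((\<lambda>t. (LINT x|lebesgue. dens x)
      + t * (2 * (LINT x|lebesgue. dens x * ?\<phi> x) + 2 * (LINT x|lebesgue. P x)) + t\<^sup>2 * (LINT x|lebesgue. A2 x)) has_real_derivative
      (2 * (LINT x|lebesgue. dens x * ?\<phi> x) + 2 * (LINT x|lebesgue. P x))) (at 0)"
    by (auto intro!: derivative_eq_intros)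
  ultimately have "2 * (LINT x|lebesgue. dens x * ?\<phi> x) + 2 * (LINT x|lebesgue. P x) = 0"
    using DERIV_unique by blast
  moreover have "(LINT x|lebesgue. P x) = (LINT x|lborel. P x)"
    using iPl by (intro integral_completion) auto
  ultimately show ?thesis by (simp add: P_def)
qed

end

section \<open>Decay of the scaled energy\<close>

lemma has_real_derivative_integral_mult:
  fixes v :: "'a \<Rightarrow> real" and k k' :: "real \<Rightarrow> 'a \<Rightarrow> real"
  assumes v: "integrable M v"
    and km[measurable]: "\<And>s. k s \<in> borel_measurable M" "k' r \<in> borel_measurable M"
    and kB: "\<And>s x. c < s \<Longrightarrow> s < d \<Longrightarrow> \<bar>k s x\<bar> \<le> B"
    and D: "\<And>s x. c < s \<Longrightarrow> s < d \<Longrightarrow> ((\<lambda>s. k s x) has_real_derivative k' s x) (at s)"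
    and k'C: "\<And>s x. c < s \<Longrightarrow> s < d \<Longrightarrow> \<bar>k' s x\<bar> \<le> C"
    and r: "c < r" "r < d"
  shows "((\<lambda>s. LINT x|M. v x * k s x) has_real_derivative (LINT x|M. v x * k' r x)) (at r)"
proof -
  have [measurable]: "v \<in> borel_measurable M" using v by simp
  have lip: "\<bar>k s x - k r x\<bar> \<le> C * \<bar>s - r\<bar>" if "c < s" "s < d" for s x
  proof -
    have "norm (k s x - k r x) \<le> C * norm (s - r)"
    proof (rule field_differentiable_bound[where S = "{c<..<d}" and f' = "\<lambda>s. k' s x"])
      show "((\<lambda>s. k s x) has_real_derivative k' s x) (at s within {c<..<d})" if "s \<in> {c<..<d}" for s
        using D[of s x] that by (simp add: has_field_derivative_at_within)
    qed (use k'C that r in auto)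
    then show ?thesis by simp
  qed
  have i: "integrable M (\<lambda>x. v x * k s x)" if "c < s" "s < d" for s
    using kB[OF that] by (intro integrable_bounded_mult[OF v]) auto
  have "((\<lambda>y. ((LINT x|M. v x * k y x) - (LINT x|M. v x * k r x)) / (y - r)) \<longlongrightarrow> (LINT x|M. v x * k' r x))
    (at r within {c<..<d})"
    unfolding tendsto_at_iff_sequentially
  proof (intro allI impI)
    fix X :: "nat \<Rightarrow> real" assume X: "\<forall>i. X i \<in> {c<..<d} - {r}" and lim: "X \<longlonglongrightarrow> r"
    have Xc: "c < X i" "X i < d" "X i \<noteq> r" for i using X by auto
    have "(\<lambda>i. LINT x|M. v x * ((k (X i) x - k r x) / (X i - r))) \<longlonglongrightarrow> (LINT x|M. v x * k' r x)"
    proof (rule integral_dominated_convergence)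
      show "integrable M (\<lambda>x. \<bar>v x\<bar> * C)" using v by simp
      show "AE x in M. norm (v x * ((k (X i) x - k r x) / (X i - r))) \<le> \<bar>v x\<bar> * C" for i
      proof (rule AE_I2)
        fix x
        have "\<bar>(k (X i) x - k r x) / (X i - r)\<bar> \<le> C"
          using lip[of "X i" x] Xc[of i] by (simp add: abs_divide pos_divide_le_eq)
        then show "norm (v x * ((k (X i) x - k r x) / (X i - r))) \<le> \<bar>v x\<bar> * C"
          unfolding real_norm_def abs_mult[of "v x"] by (intro mult_left_mono) auto
      qed
      show "AE x in M. (\<lambda>i. v x * ((k (X i) x - k r x) / (X i - r))) \<longlonglongrightarrow> v x * k' r x"
      proof (intro AE_I2 tendsto_mult tendsto_const)
        fix x
        have "((\<lambda>s. (k s x - k r x) / (s - r)) \<longlongrightarrow> k' r x) (at r)"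
          using D[OF r] by (simp add: has_field_derivative_iff)
        moreover have "filterlim X (at r) sequentially"
          using lim Xc by (simp add: filterlim_at)
        ultimately show "(\<lambda>i. (k (X i) x - k r x) / (X i - r)) \<longlonglongrightarrow> k' r x"
          by (rule filterlim_compose)
      qed
    qed measurable
    moreover have "(LINT x|M. v x * ((k (X n) x - k r x) / (X n - r)))
      = ((LINT x|M. v x * k (X n) x) - (LINT x|M. v x * k r x)) / (X n - r)" for n
    proof -
      have "(LINT x|M. v x * ((k (X n) x - k r x) / (X n - r))) = (LINT x|M. (v x * k (X n) x - v x * k r x) / (X n - r))"
        by (intro Bochner_Integration.integral_cong refl) (simp add: right_diff_distrib)
      also have "\<dots> = ((LINT x|M. v x * k (X n) x) - (LINT x|M. v x * k r x)) / (X n - r)"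
        using i[OF Xc(1,2)] i[OF r] by simp
      finally show ?thesis .
    qed
    ultimately show "((\<lambda>y. ((LINT x|M. v x * k y x) - (LINT x|M. v x * k r x)) / (y - r)) \<circ> X)
      \<longlonglongrightarrow> (LINT x|M. v x * k' r x)" unfolding o_def by (simp only:)
  qed
  moreover have "at r within {c<..<d} = at r" using r by (intro at_within_open) auto
  ultimately show ?thesis by (simp add: has_field_derivative_iff)
qed

section \<open>Radius derivatives and second derivatives of bumps\<close>

definition flat' :: "nat \<Rightarrow> real \<Rightarrow> real" where
  "flat' j s = flat (j + 2) s - real j * flat (j + 1) s"

lemma flat'_measurable [measurable]: "flat' j \<in> borel_measurable borel"
  unfolding flat'_def by measurable

lemma flat'_eq_0: "s \<le> 0 \<Longrightarrow> flat' j s = 0"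
  by (simp add: flat'_def flat_eq_0)

lemma abs_flat'_le: "\<bar>flat' j s\<bar> \<le> fact (j + 2) + real j * fact (j + 1)"
proof -
  have "\<bar>flat' j s\<bar> \<le> flat (j + 2) s + real j * flat (j + 1) s"
    unfolding flat'_def by (rule order_trans[OF abs_triangle_ineq4]) simp
  also have "\<dots> \<le> fact (j + 2) + real j * fact (j + 1)"
    by (intro add_mono mult_left_mono flat_le_fact) auto
  finally show ?thesis .
qed

lemma DERIV_flat_height_radius:
  assumes "0 < r"
  shows "((\<lambda>r. flat j (height a r x)) has_real_derivative flat' j (height a r x) * (2 * (norm (x - a))\<^sup>2 / r ^ 3)) (at r)"
proof -
  have "((\<lambda>r. height a r x) has_real_derivative (2 * (norm (x - a))\<^sup>2 / r ^ 3)) (at r)"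
    unfolding height_def using assms
    by (auto intro!: derivative_eq_intros simp: field_simps power2_eq_square power3_eq_cube)
  from DERIV_chain2[OF DERIV_flat this] show ?thesis by (simp add: flat'_def)
qed

lemma abs_flat'_height_radius_le:
  assumes "0 < c" "c < r"
  shows "\<bar>flat' j (height a r x) * (2 * (norm (x - a))\<^sup>2 / r ^ 3)\<bar> \<le> (fact (j + 2) + real j * fact (j + 1)) * (2 / c)"
proof (cases "x \<in> ball a r")
  case True
  have "(norm (x - a))\<^sup>2 \<le> r\<^sup>2"
    using True by (intro power_mono) (auto simp: dist_norm norm_minus_commute)
  then have "2 * (norm (x - a))\<^sup>2 / r ^ 3 \<le> 2 / r"
    using assms by (simp add: field_simps power2_eq_square power3_eq_cube)
  also have "\<dots> \<le> 2 / c" using assms by (simp add: frac_le)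
  finally have "2 * (norm (x - a))\<^sup>2 / r ^ 3 \<le> 2 / c" .
  then show ?thesis unfolding abs_mult using assms by (intro mult_mono abs_flat'_le) auto
next
  case False
  then have "height a r x \<le> 0" using height_pos_iff[of r a x] assms by force
  then show ?thesis using assms by (simp add: flat'_eq_0)
qed

lemma DERIV_integral_flat_height:
  fixes v :: "'a::euclidean_space \<Rightarrow> real"
  assumes v: "integrable M v" and M: "sets borel \<subseteq> sets M" "space M = UNIV" and r: "0 < r"
  shows "((\<lambda>r. LINT x|M. v x * flat j (height a r x)) has_real_derivative
    (LINT x|M. v x * (flat' j (height a r x) * (2 * (norm (x - a))\<^sup>2 / r ^ 3)))) (at r)"
\<comment> \<open>The radii are kept away from 0, because the radius derivative of the profile is
  bounded only by a multiple of the inverse radius.\<close>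
proof (rule has_real_derivative_integral_mult[OF v, where c = "r / 2" and d = "2 * r"])
  have mono: "g \<in> borel_measurable M" if "g \<in> borel_measurable borel" for g :: "'a \<Rightarrow> real"
    using that M unfolding measurable_def by auto
  show "(\<lambda>x. flat j (height a s x)) \<in> borel_measurable M" for s
    by (rule mono) measurable
  show "(\<lambda>x. flat' j (height a r x) * (2 * (norm (x - a))\<^sup>2 / r ^ 3)) \<in> borel_measurable M"
    by (rule mono) measurable
  show "\<bar>flat j (height a s x)\<bar> \<le> fact j" for s x using flat_le_fact[of j] by simp
  fix s x assume s: "r / 2 < s" "s < 2 * r"
  then show "((\<lambda>r. flat j (height a r x)) has_real_derivative flat' j (height a s x) * (2 * (norm (x - a))\<^sup>2 / s ^ 3)) (at s)"
    using r by (intro DERIV_flat_height_radius) simp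
  show "\<bar>flat' j (height a s x) * (2 * (norm (x - a))\<^sup>2 / s ^ 3)\<bar> \<le> (fact (j + 2) + real j * fact (j + 1)) * (2 / (r / 2))"
    using s r by (intro abs_flat'_height_radius_le) auto
qed (use r in auto)

lemma bump_mono_radius: "0 < r \<Longrightarrow> r \<le> s \<Longrightarrow> bump a r x \<le> bump a s x"
  unfolding bump_def height_def by (intro flat_0_mono diff_left_mono divide_left_mono power_mono) auto

text \<open>The Hessian of the bump applied to \<open>b\<close>; the sum of
  \<open>hess_bump a r x b \<bullet> b\<close> over the basis is the Laplacian.\<close>

definition hess_bump :: "'a::real_inner \<Rightarrow> real \<Rightarrow> 'a \<Rightarrow> 'a \<Rightarrow> 'a" where
  "hess_bump a r x b = (4 / r ^ 4 * flat' 2 (height a r x) * ((x - a) \<bullet> b)) *\<^sub>R (x - a) - (2 / r\<^sup>2 * flat 2 (height a r x)) *\<^sub>R b"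

lemma has_derivative_grad_bump_inner:
  "((\<lambda>x. grad_bump a r x \<bullet> b) has_derivative (\<lambda>v. hess_bump a r x b \<bullet> v)) (at x)"
proof -
  define c where "c = 2 / r\<^sup>2"
  have c: "4 / r ^ 4 = c * c" by (simp add: c_def power2_eq_square power4_eq_xxxx)
  have D1: "((\<lambda>x. flat 2 (height a r x)) has_derivative (\<lambda>v. flat' 2 (height a r x) * (- c * ((x - a) \<bullet> v)))) (at x)"
    using has_derivative_flat[OF has_derivative_height, of 2 a r x UNIV] by (simp add: flat'_def c_def)
  have D2: "((\<lambda>x. (x - a) \<bullet> b) has_derivative (\<lambda>v. v \<bullet> b)) (at x)"
    by (auto intro!: derivative_eq_intros)
  have "((\<lambda>x. - c * (flat 2 (height a r x) * ((x - a) \<bullet> b))) has_derivative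
    (\<lambda>v. - c * (flat 2 (height a r x) * (v \<bullet> b) + flat' 2 (height a r x) * (- c * ((x - a) \<bullet> v)) * ((x - a) \<bullet> b)))) (at x)"
    by (rule has_derivative_mult_right[OF has_derivative_mult[OF D1 D2]])
  moreover have "(\<lambda>v. - c * (flat 2 (height a r x) * (v \<bullet> b) + flat' 2 (height a r x) * (- c * ((x - a) \<bullet> v)) * ((x - a) \<bullet> b)))
    = (\<lambda>v. hess_bump a r x b \<bullet> v)"
    unfolding hess_bump_def c c_def[symmetric]
    by (simp only: fun_eq_iff inner_diff_left inner_scaleR_left inner_commute[of b]) (simp add: algebra_simps)
  moreover have "(\<lambda>x. - c * (flat 2 (height a r x) * ((x - a) \<bullet> b))) = (\<lambda>x. grad_bump a r x \<bullet> b)"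
    by (simp add: grad_bump_def c_def fun_eq_iff)
  ultimately show ?thesis by simp
qed

lemma hess_bump_eq_0: "0 < r \<Longrightarrow> x \<notin> ball a r \<Longrightarrow> hess_bump a r x b = 0"
  using height_pos_iff[of r a x] by (simp add: hess_bump_def flat_eq_0 flat'_eq_0)

lemma norm_hess_bump_le:
  fixes b :: "'a::euclidean_space"
  assumes "0 < r" "b \<in> Basis"
  shows "norm (hess_bump a r x b) \<le> 200 / r\<^sup>2"
proof (cases "x \<in> ball a r")
  case True
  have n: "norm (x - a) \<le> r" using True by (simp add: dist_norm norm_minus_commute)
  have "norm (hess_bump a r x b) \<le> norm ((4 / r ^ 4 * flat' 2 (height a r x) * ((x - a) \<bullet> b)) *\<^sub>R (x - a))
    + norm ((2 / r\<^sup>2 * flat 2 (height a r x)) *\<^sub>R b)"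
    unfolding hess_bump_def by (rule norm_triangle_ineq4)
  also have "norm ((4 / r ^ 4 * flat' 2 (height a r x) * ((x - a) \<bullet> b)) *\<^sub>R (x - a)) \<le> 4 / r ^ 4 * 36 * r * r"
  proof -
    \<comment> \<open>\<open>36\<close> is \<open>4! + 2 * 3!\<close>; together with the second term
      this gives \<open>4 * 36 + 4\<close>, rounded up to 200.\<close>
    have "\<bar>flat' 2 (height a r x)\<bar> \<le> 36" using abs_flat'_le[of 2 "height a r x"] by (simp add: fact_numeral)
    moreover have "\<bar>(x - a) \<bullet> b\<bar> \<le> r" using Basis_le_norm[OF assms(2), of "x - a"] n by linarith
    ultimately show ?thesis unfolding norm_scaleR abs_mult using n assms
      by (intro mult_mono) auto
  qed
  also have "norm ((2 / r\<^sup>2 * flat 2 (height a r x)) *\<^sub>R b) \<le> 2 / r\<^sup>2 * 2"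
    using flat_le_fact[of 2 "height a r x"] assms by (simp add: divide_right_mono)
  also have "4 / r ^ 4 * 36 * r * r + 2 / r\<^sup>2 * 2 \<le> 200 / r\<^sup>2"
    using assms by (simp add: field_simps power2_eq_square power4_eq_xxxx)
  finally show ?thesis by simp
next
  case False
  then show ?thesis using hess_bump_eq_0[OF assms(1) False] by simp
qed

lemma sum_hess_bump_inner:
  fixes a :: "'a::euclidean_space"
  shows "(\<Sum>b\<in>Basis. hess_bump a r x b \<bullet> b)
    = 4 / r ^ 4 * flat' 2 (height a r x) * (norm (x - a))\<^sup>2 - DIM('a) * (2 / r\<^sup>2 * flat 2 (height a r x))"
proof -
  have "(\<Sum>b\<in>Basis. hess_bump a r x b \<bullet> b)
    = (\<Sum>b\<in>Basis. (4 / r ^ 4 * flat' 2 (height a r x)) * (((x - a) \<bullet> b) * ((x - a) \<bullet> b)) - 2 / r\<^sup>2 * flat 2 (height a r x))"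
    by (intro sum.cong refl) (simp add: hess_bump_def inner_diff_left[of "_ *\<^sub>R _"] inner_Basis)
  also have "\<dots> = 4 / r ^ 4 * flat' 2 (height a r x) * (norm (x - a))\<^sup>2 - DIM('a) * (2 / r\<^sup>2 * flat 2 (height a r x))"
    unfolding sum_subtractf sum_distrib_left[symmetric] euclidean_inner[symmetric] power2_norm_eq_inner by simp
  finally show ?thesis .
qed


lemma DERIV_power_quotient:
  assumes "0 < r"
  shows "((\<lambda>r::real. r ^ j / r ^ k) has_real_derivative (real j - real k) * (r ^ j / r ^ k / r)) (at r)"
proof -
  have p: "((\<lambda>r. r ^ n) has_real_derivative real n * (r ^ n / r)) (at r)" for n
    using DERIV_pow[of n r UNIV] assms by (cases n) auto
  have "((\<lambda>r. r ^ j / r ^ k) has_real_derivative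
    (real j * (r ^ j / r) * r ^ k - r ^ j * (real k * (r ^ k / r))) / (r ^ k * r ^ k)) (at r)"
    using assms by (intro DERIV_divide p) auto
  moreover have "(real j * (r ^ j / r) * r ^ k - r ^ j * (real k * (r ^ k / r))) / (r ^ k * r ^ k)
    = (real j - real k) * (r ^ j / r ^ k / r)"
    using assms by (simp add: field_simps)
  ultimately show ?thesis by simp
qed

lemma abs_hess_bump_inner_le : "b \<in> Basis \<Longrightarrow> 0 < r \<Longrightarrow> \<bar>hess_bump a r x b \<bullet> b\<bar> \<le> 200 / r\<^sup>2" for b :: "'a::euclidean_space"
  using Basis_le_norm[of b "hess_bump a r x b"] norm_hess_bump_le[of r b a x] by linarith

lemma hess_bump_measurable [measurable]: "(\<lambda>x. hess_bump (a::'a::euclidean_space) r x b) \<in> borel_measurable borel"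
  unfolding hess_bump_def by measurable

context sobolev_map
begin

text \<open>A second integration by parts: \<open>weak_gradient_square\<close> is applied to each
  component of the gradient of the bump, and summation over the basis produces the Laplacian. The
  larger radius \<open>R\<close> leaves room for the translations.\<close>

lemma integral_HW_grad_bump:
  assumes r: "0 < r" "r < R" and sub: "cball a R \<subseteq> U"
  shows "(LINT x|lborel. H 0 x * (W 0 x \<bullet> grad_bump a r x))
    = - (1 / 2) * (LINT x|lborel. (H 0 x)\<^sup>2 * (\<Sum>b\<in>Basis. hess_bump a r x b \<bullet> b))"
proof -
  let ?K = "\<lambda>x. indicator (cball a R) x :: real"
  let ?g = "grad_bump a r"
  interpret L: weak_gradient_L2 "ball a R" "\<lambda>x. ?K x * H 0 x" "\<lambda>x. ?K x *\<^sub>R W 0 x"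
  proof (rule weak_gradient_L2.intro[OF grad[OF sub] weak_gradient_L2_axioms.intro])
    show "integrable lborel (\<lambda>x. (?K x * H 0 x)\<^sup>2)"
      by (rule Bochner_Integration.integrable_bound[OF H0]) (auto simp: indicator_def)
    show "integrable lborel (\<lambda>x. (norm (?K x *\<^sub>R W 0 x))\<^sup>2)"
    proof (rule Bochner_Integration.integrable_bound[OF G2])
      have "norm (?K x *\<^sub>R W 0 x) \<le> G x" for x using W_le[of 0 x] G_nonneg[of x] by (auto simp: indicator_def)
      then show "AE x in lborel. norm ((norm (?K x *\<^sub>R W 0 x))\<^sup>2) \<le> norm ((G x)\<^sup>2)"
        by (intro AE_I2) (simp add: power_mono)
      have [measurable]: "W 0 \<in> borel_measurable lborel" using W_meas by simp
      have [measurable]: "cball a R \<in> sets lborel" by simp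
      show "(\<lambda>x. (norm (?K x *\<^sub>R W 0 x))\<^sup>2) \<in> borel_measurable lborel" by measurable
    qed
  qed
  have K: "?K x = 1" if "x \<in> ball a r" for x using that r by (simp add: indicator_def)
  define C where "C = max (200 / r\<^sup>2) (4 / r)"
  have each: "(LINT x|lborel. (H 0 x)\<^sup>2 * (hess_bump a r x b \<bullet> b)) = - 2 * (LINT x|lborel. H 0 x * (W 0 x \<bullet> b) * (?g x \<bullet> b))"
    if b: "b \<in> Basis" for b
  proof -
    have "(LINT x|lborel. (?K x * H 0 x)\<^sup>2 * (hess_bump a r x b \<bullet> b))
      = - 2 * (LINT x|lborel. ?K x * H 0 x * (?K x *\<^sub>R W 0 x \<bullet> b) * (?g x \<bullet> b))"
    proof (rule L.weak_gradient_square[where V' = "ball a r" and \<rho> = "R - r" and C = C])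
      show "ball x (R - r) \<subseteq> ball a R" if "x \<in> ball a r" for x
      proof
        fix y assume "y \<in> ball x (R - r)"
        then show "y \<in> ball a R" using that dist_triangle[of a y x] by simp
      qed
      show "((\<lambda>x. ?g x \<bullet> b) has_derivative (\<lambda>v. hess_bump a r x b \<bullet> v)) (at x)" for x
        by (rule has_derivative_grad_bump_inner)
      show "norm (hess_bump a r x b) \<le> C" for x
        using norm_hess_bump_le[OF r(1) b, of a x] by (simp add: C_def)
      show "\<bar>?g x \<bullet> b\<bar> \<le> C" for x
        using Basis_le_norm[OF b, of "?g x"] norm_grad_bump_le[OF r(1), of a x] by (simp add: C_def)
      show "?g x \<bullet> b = 0" if "x \<notin> ball a r" for x using grad_bump_eq_0[OF r(1) that] by simp
    qed (use r in auto)
    moreover have "(?K x * H 0 x)\<^sup>2 * (hess_bump a r x b \<bullet> b) = (H 0 x)\<^sup>2 * (hess_bump a r x b \<bullet> b)" for x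
      using K[of x] hess_bump_eq_0[OF r(1), of x a b] by (cases "x \<in> ball a r") auto
    moreover have "?K x * H 0 x * (?K x *\<^sub>R W 0 x \<bullet> b) * (?g x \<bullet> b) = H 0 x * (W 0 x \<bullet> b) * (?g x \<bullet> b)" for x
      using K[of x] grad_bump_eq_0[OF r(1), of x a] by (cases "x \<in> ball a r") auto
    ultimately show ?thesis by (simp only:)
  qed
  have i1: "integrable lborel (\<lambda>x. H 0 x * (W 0 x \<bullet> b) * (?g x \<bullet> b))" if b: "b \<in> Basis" for b
  proof (rule integrable_bounded_mult)
    show "integrable lborel (\<lambda>x. H 0 x * (W 0 x \<bullet> b))" by (rule integrable_HW_mult[where C = "norm b"]) auto
    show "\<bar>?g x \<bullet> b\<bar> \<le> 4 / r" for x
      using Basis_le_norm[OF b, of "?g x"] norm_grad_bump_le[OF r(1), of a x] by simp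
  qed measurable
  have i2: "integrable lborel (\<lambda>x. (H 0 x)\<^sup>2 * (hess_bump a r x b \<bullet> b))" if b: "b \<in> Basis" for b
    using abs_hess_bump_inner_le[OF b r(1)] by (intro integrable_bounded_mult[OF H0]) auto
  have "(LINT x|lborel. H 0 x * (W 0 x \<bullet> ?g x)) = (LINT x|lborel. (\<Sum>b\<in>Basis. H 0 x * (W 0 x \<bullet> b) * (?g x \<bullet> b)))"
    by (subst euclidean_inner) (simp add: sum_distrib_left mult.assoc)
  also have "\<dots> = (\<Sum>b\<in>Basis. LINT x|lborel. H 0 x * (W 0 x \<bullet> b) * (?g x \<bullet> b))"
    by (rule Bochner_Integration.integral_sum[OF i1])
  also have "\<dots> = (\<Sum>b\<in>Basis. - (1 / 2) * (LINT x|lborel. (H 0 x)\<^sup>2 * (hess_bump a r x b \<bullet> b)))"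
    by (intro sum.cong refl) (simp add: each)
  also have "\<dots> = - (1 / 2) * (LINT x|lborel. (\<Sum>b\<in>Basis. (H 0 x)\<^sup>2 * (hess_bump a r x b \<bullet> b)))"
    by (subst Bochner_Integration.integral_sum[OF i2]) (simp_all add: sum_distrib_left)
  finally show ?thesis by (simp add: sum_distrib_left)
qed

definition smoothed_energy :: "real ^ 'm \<Rightarrow> real \<Rightarrow> real" where
  "smoothed_energy a r = (LINT x|lebesgue. dens x * bump a r x)"

lemma integrable_dens_bump: "integrable lebesgue dens \<Longrightarrow> integrable lebesgue (\<lambda>x. dens x * bump a r x)"
  by (rule integrable_bounded_mult[where C = 1]) (simp_all add: bump_le_1 measurable_completion)

lemma smoothed_energy_nonneg: "0 \<le> smoothed_energy a r"
  unfolding smoothed_energy_def by (intro integral_nonneg_AE AE_I2) simp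

lemma smoothed_energy_mono:
  "integrable lebesgue dens \<Longrightarrow> 0 < r \<Longrightarrow> r \<le> s \<Longrightarrow> smoothed_energy a r \<le> smoothed_energy a s"
  unfolding smoothed_energy_def
  by (intro integral_mono integrable_dens_bump mult_left_mono bump_mono_radius) auto

text \<open>The weight in the average \<open>A\<close> is \<open>flat 2 (height a r x)\<close>, the
  profile occurring in the gradient of the bump; with this choice the derivative of \<open>A\<close>
  is exactly \<open>r / r ^ CARD('m)\<close> times the smoothed energy. The mean value theorem
  between \<open>r\<close> and \<open>2 * r\<close> then bounds the scaled energy by the increment
  of \<open>A\<close>.\<close>

lemma smoothed_energy_decay:
  assumes dens: "integrable lebesgue dens" and squash: "squash_stationary U f"
    and R: "0 < R" and sub: "cball a R \<subseteq> U"
  shows "((\<lambda>r. r\<^sup>2 / r ^ CARD('m) * smoothed_energy a r) \<longlongrightarrow> 0) (at_right 0)"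
proof -
  let ?m = "CARD('m)" and ?e = "smoothed_energy a"
  define F where "F r = (LINT x|lborel. (H 0 x)\<^sup>2 * flat 2 (height a r x))" for r
  define F' where "F' r = (LINT x|lborel. (H 0 x)\<^sup>2 * (flat' 2 (height a r x) * (2 * (norm (x - a))\<^sup>2 / r ^ 3)))" for r
  define A where "A r = F r * (1 / r ^ ?m)" for r
  have DF: "(F has_real_derivative F' r) (at r)" if "0 < r" for r
    unfolding F_def F'_def by (rule DERIV_integral_flat_height[OF H0 _ _ that]) auto
  \<comment> \<open>The Laplacian of the bump is recognised as a radius derivative of the
    \<open>flat 2\<close> profile minus a multiple of that profile.\<close>
  have e: "?e r = F' r / r - real ?m / r\<^sup>2 * F r" if r: "0 < r" "r < R" for r
  proof -
    have "cball a r \<subseteq> U" using sub r by auto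
    then have "?e r = (1 / 2) * (LINT x|lborel. (H 0 x)\<^sup>2 * (\<Sum>b\<in>Basis. hess_bump a r x b \<bullet> b))"
      unfolding smoothed_energy_def using squash_identity[OF squash_critical[OF squash r(1)] dens r(1), of a]
        integral_HW_grad_bump[OF r sub] by simp
    also have "(LINT x|lborel. (H 0 x)\<^sup>2 * (\<Sum>b\<in>Basis. hess_bump a r x b \<bullet> b))
      = (LINT x|lborel. (2 / r) * ((H 0 x)\<^sup>2 * (flat' 2 (height a r x) * (2 * (norm (x - a))\<^sup>2 / r ^ 3)))
        - (2 * real ?m / r\<^sup>2) * ((H 0 x)\<^sup>2 * flat 2 (height a r x)))"
      using r by (intro Bochner_Integration.integral_cong refl)
        (simp add: sum_hess_bump_inner field_simps power2_eq_square power3_eq_cube power4_eq_xxxx)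
    also have "\<dots> = (2 / r) * F' r - (2 * real ?m / r\<^sup>2) * F r"
    proof -
      have "integrable lborel (\<lambda>x. (H 0 x)\<^sup>2 * flat 2 (height a r x))"
        using flat_le_fact[of 2] by (intro integrable_bounded_mult[OF H0, where C = "fact 2"]) auto
      moreover have "integrable lborel (\<lambda>x. (H 0 x)\<^sup>2 * (flat' 2 (height a r x) * (2 * (norm (x - a))\<^sup>2 / r ^ 3)))"
        by (rule integrable_bounded_mult[OF H0 _ abs_flat'_height_radius_le[of "r / 2"]]) (use r in auto)
      ultimately show ?thesis unfolding F_def F'_def
        by (simp only: Bochner_Integration.integral_diff integrable_mult_right integral_mult_right_zero)
    qed
    finally show ?thesis by (simp only: right_diff_distrib) simp
  qed
  have DA: "(A has_real_derivative (r / r ^ ?m * ?e r)) (at r)" if r: "0 < r" "r < R" for r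
  proof -
    have "((\<lambda>r. 1 / r ^ ?m) has_real_derivative - (real ?m / r ^ Suc ?m)) (at r)"
      using DERIV_power_quotient[OF r(1), of 0 ?m] r by (simp add: mult.commute)
    from DERIV_mult[OF DF[OF r(1)] this]
    have "(A has_real_derivative (F' r * (1 / r ^ ?m) + - (real ?m / r ^ Suc ?m) * F r)) (at r)"
      unfolding A_def .
    moreover have "F' r * (1 / r ^ ?m) + - (real ?m / r ^ Suc ?m) * F r = r / r ^ ?m * ?e r"
      unfolding e[OF r] using r by (simp add: field_simps power2_eq_square)
    ultimately show ?thesis by simp
  qed
  have A_nonneg: "0 \<le> A r" if "0 < r" for r
    unfolding A_def F_def using that by (intro mult_nonneg_nonneg integral_nonneg_AE AE_I2) auto
  have A_mono: "A r \<le> A s" if "0 < r" "r \<le> s" "s < R" for r s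
  proof (rule DERIV_nonneg_imp_nondecreasing[OF that(2)])
    fix x assume "r \<le> x" "x \<le> s"
    then have "0 < x" "x < R" using that by auto
    then show "\<exists>y. (A has_real_derivative y) (at x) \<and> 0 \<le> y"
      using DA smoothed_energy_nonneg[of a x] by (intro exI conjI[of _ "0 \<le> x / x ^ ?m * ?e x"]) auto
  qed
  have key: "r\<^sup>2 / r ^ ?m * ?e r \<le> 2 ^ ?m * (A (2 * r) - A r)" if r: "0 < r" "2 * r < R" for r
  proof -
    obtain z where z: "r < z" "z < 2 * r" "A (2 * r) - A r = (2 * r - r) * (z / z ^ ?m * ?e z)"
      using MVT2[of r "2 * r" A "\<lambda>r. r / r ^ ?m * ?e r"] DA r by auto
    then have z3: "A (2 * r) - A r = r * (z / z ^ ?m * ?e z)" by simp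
    \<comment> \<open>Numerator, denominator and energy are estimated separately through
      \<open>r < z < 2 * r\<close>; this works in every dimension at the price of the factor
      \<open>2 ^ ?m\<close>.\<close>
    have "r / (2 * r) ^ ?m * ?e r \<le> z / z ^ ?m * ?e z"
      using r z smoothed_energy_nonneg[of a r] smoothed_energy_mono[OF dens r(1), of z a]
      by (intro mult_mono frac_le power_mono) auto
    then have "r * (r / (2 * r) ^ ?m * ?e r) \<le> A (2 * r) - A r"
      unfolding z3 by (rule mult_left_mono) (use r in simp)
    then have "2 ^ ?m * (r * (r / (2 * r) ^ ?m * ?e r)) \<le> 2 ^ ?m * (A (2 * r) - A r)"
      by (intro mult_left_mono) auto
    moreover have "2 ^ ?m * (r * (r / (2 * r) ^ ?m * ?e r)) = r\<^sup>2 / r ^ ?m * ?e r"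
      by (simp add: power_mult_distrib power2_eq_square)
    ultimately show ?thesis by (simp only:)
  qed
  define L where "L = (INF r\<in>{0<..<R}. A r)"
  have bdd: "bdd_below (A ` {0<..<R})" using A_nonneg by (intro bdd_belowI2[where m = 0]) auto
  have ne: "A ` {0<..<R} \<noteq> {}" using R by simp
  show ?thesis
  proof (rule tendsto_0_le[where K = 1 and f = "\<lambda>r. 2 ^ ?m * (A (2 * r) - A r)"])
    have "((\<lambda>r. A (2 * r) - A r) \<longlongrightarrow> 0) (at_right 0)"
    proof (rule tendstoI)
      fix \<epsilon> :: real assume \<epsilon>: "0 < \<epsilon>"
      obtain r0 where r0: "r0 \<in> {0<..<R}" "A r0 < L + \<epsilon>"
        using cInf_lessD[OF ne, of "L + \<epsilon>"] \<epsilon> unfolding L_def by auto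
      have "dist (A (2 * r) - A r) 0 < \<epsilon>" if r: "0 < r" "r < r0 / 2" for r
      proof -
        have "A (2 * r) \<le> A r0" using r r0 by (intro A_mono) auto
        moreover have "L \<le> A r" unfolding L_def using r r0 by (intro cINF_lower[OF bdd]) auto
        moreover have "A r \<le> A (2 * r)" using r r0 by (intro A_mono) auto
        ultimately show ?thesis using r0 by (simp add: dist_real_def)
      qed
      moreover have "\<forall>\<^sub>F r in at_right 0. 0 < r \<and> r < r0 / 2"
        using r0 eventually_at_right_less[of "0::real"] by (auto simp: eventually_at_right intro!: exI[of _ "r0 / 2"])
      ultimately show "\<forall>\<^sub>F r in at_right 0. dist (A (2 * r) - A r) 0 < \<epsilon>"
        by (auto elim: eventually_mono)
    qed
    from tendsto_mult_left[OF this, of "2 ^ ?m"]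
    show "((\<lambda>r. 2 ^ ?m * (A (2 * r) - A r)) \<longlongrightarrow> 0) (at_right 0)" by simp
    have "\<forall>\<^sub>F r in at_right 0. 0 < r \<and> r < R / 2"
      using R by (auto simp: eventually_at_right intro!: exI[of _ "R / 2"])
    then show "\<forall>\<^sub>F r in at_right 0. norm (r\<^sup>2 / r ^ ?m * ?e r) \<le> norm (2 ^ ?m * (A (2 * r) - A r)) * 1"
    proof eventually_elim
      case (elim r)
      have "0 \<le> r\<^sup>2 / r ^ ?m * ?e r" using elim smoothed_energy_nonneg[of a r] by auto
      then show ?case using key[of r] elim by simp
    qed
  qed
qed

end

section \<open>Change of variables for radial maps\<close>

text \<open>
  The change of variables formula of the library requires the index type of \<open>real ^ 'n\<close> to be
  well-ordered. A finite index type is replaced by an isomorphic copy that carries such an order.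
\<close>

typedef 'a ordered_index = "UNIV :: 'a set" by simp

instance ordered_index :: (finite) finite
proof
  have "inj (Rep_ordered_index :: 'a ordered_index \<Rightarrow> 'a)" by (simp add: inj_def Rep_ordered_index_inject)
  then show "finite (UNIV :: 'a ordered_index set)" using finite_imageD[OF finite] by blast
qed

instantiation ordered_index :: (finite) wellorder
begin

definition index_rank :: "'a ordered_index \<Rightarrow> nat" where
  "index_rank = to_nat_on UNIV"

definition less_eq_ordered_index :: "'a ordered_index \<Rightarrow> 'a ordered_index \<Rightarrow> bool" where
  "i \<le> j \<longleftrightarrow> index_rank i \<le> index_rank j"

definition less_ordered_index :: "'a ordered_index \<Rightarrow> 'a ordered_index \<Rightarrow> bool" where
  "i < j \<longleftrightarrow> index_rank i < index_rank j"

instance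
proof
  have "inj (index_rank :: 'a ordered_index \<Rightarrow> nat)"
    unfolding index_rank_def by (intro inj_on_to_nat_on countable_finite) simp
  then show "i = j" if "i \<le> j" "j \<le> i" for i j :: "'a ordered_index"
    using that by (auto simp: less_eq_ordered_index_def inj_def)
  show "P i" if "\<And>i. (\<And>j. j < i \<Longrightarrow> P j) \<Longrightarrow> P i" for P and i :: "'a ordered_index"
    using measure_induct_rule[of index_rank P i] that unfolding less_ordered_index_def by blast
qed (auto simp: less_eq_ordered_index_def less_ordered_index_def)

end

definition reindex :: "real ^ 'm \<Rightarrow> real ^ 'm ordered_index" where
  "reindex x = (\<chi> i. x $ Rep_ordered_index i)"

lemma bij_Rep_ordered_index: "bij Rep_ordered_index"
  by (metis Abs_ordered_index_inverse Rep_ordered_index_inject UNIV_I bij_def inj_def surjI)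

lemma card_ordered_index: "CARD('m ordered_index) = CARD('m::finite)"
  by (rule bij_betw_same_card[OF bij_Rep_ordered_index])

lemma reindex_inner: "reindex x \<bullet> reindex y = x \<bullet> y"
  unfolding inner_vec_def reindex_def
  by simp (rule sum.reindex_bij_betw[OF bij_Rep_ordered_index, of "\<lambda>i. x $ i * y $ i"])

lemma reindex_linear: "linear reindex"
  by (intro linearI) (simp_all add: reindex_def vec_eq_iff)

lemma reindex_norm: "norm (reindex x) = norm x"
  by (simp add: norm_eq_sqrt_inner reindex_inner)

lemma reindex_measurable [measurable]: "reindex \<in> borel_measurable borel"
  by (intro borel_measurable_continuous_onI linear_continuous_on linear_conv_bounded_linear[THEN iffD1] reindex_linear)

lemma distr_reindex: "distr lborel borel reindex = (lborel :: (real ^ 'm::finite ordered_index) measure)"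
proof (rule lborel_eqI[symmetric])
  fix l u :: "real ^ 'm ordered_index"
  assume lu: "\<And>b. b \<in> Basis \<Longrightarrow> l \<bullet> b \<le> u \<bullet> b"
  have le: "l $ i \<le> u $ i" for i using lu[of "axis i 1"] by (simp add: inner_axis axis_in_Basis_iff)
  define l' u' :: "real ^ 'm" where "l' = (\<chi> i. l $ Abs_ordered_index i)" and "u' = (\<chi> i. u $ Abs_ordered_index i)"
  have "reindex -` box l u = box l' u'"
    by (auto simp: mem_box_cart reindex_def l'_def u'_def)
       (metis Abs_ordered_index_inverse UNIV_I, metis Abs_ordered_index_inverse UNIV_I,
         metis Rep_ordered_index_inverse, metis Rep_ordered_index_inverse)
  then have "emeasure (distr lborel borel reindex) (box l u) = emeasure lborel (box l' u')"
    by (simp add: emeasure_distr)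
  also have "\<dots> = ennreal (\<Prod>b\<in>Basis. (u' - l') \<bullet> b)"
    using le by (intro emeasure_lborel_box) (auto simp: Basis_vec_def inner_axis l'_def u'_def)
  also have "(\<Prod>b\<in>Basis. (u' - l') \<bullet> b) = (\<Prod>i\<in>UNIV. (u' - l') $ i)"
    unfolding Basis_vec_def by (simp add: UNION_singleton_eq_range prod.reindex inj_on_def axis_eq_axis inner_axis)
  also have "\<dots> = (\<Prod>i\<in>UNIV. (u - l) $ i)"
    using prod.reindex_bij_betw[OF bij_Rep_ordered_index, of "\<lambda>i. (u' - l') $ i"]
    by (simp add: l'_def u'_def Rep_ordered_index_inverse)
  also have "\<dots> = (\<Prod>b\<in>Basis. (u - l) \<bullet> b)"
    unfolding Basis_vec_def by (simp add: UNION_singleton_eq_range prod.reindex inj_on_def axis_eq_axis inner_axis)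
  finally show "emeasure (distr lborel borel reindex) (box l u) = ennreal (\<Prod>b\<in>Basis. (u - l) \<bullet> b)" .
qed simp

section \<open>Radial maps: determinant, bijectivity, change of variables\<close>

definition radial_map :: "'a::real_inner \<Rightarrow> real \<Rightarrow> real \<Rightarrow> 'a \<Rightarrow> 'a" where
  "radial_map a r t x = x + t *\<^sub>R (bump a r x *\<^sub>R (x - a))"

text \<open>The gradient of the bump is
  \<open>- radial_factor a r x *\<^sub>R (x - a)\<close>.\<close>

definition radial_factor :: "'a::real_inner \<Rightarrow> real \<Rightarrow> 'a \<Rightarrow> real" where
  "radial_factor a r x = 2 / r\<^sup>2 * flat 2 (height a r x)"

text \<open>The determinant of the derivative of \<open>radial_map\<close>: the power comes from the
  directions orthogonal to \<open>x - a\<close>, the last factor from the radial direction.\<close>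

definition radial_jacobian :: "'a::euclidean_space \<Rightarrow> real \<Rightarrow> real \<Rightarrow> 'a \<Rightarrow> real" where
  "radial_jacobian a r t x = (1 + t * bump a r x) ^ (DIM('a) - 1)
    * (1 + t * bump a r x - t * radial_factor a r x * (norm (x - a))\<^sup>2)"

lemma has_derivative_radial_map:
  "(radial_map a r t has_derivative
    (\<lambda>h. (1 + t * bump a r x) *\<^sub>R h - (t * radial_factor a r x * ((x - a) \<bullet> h)) *\<^sub>R (x - a))) (at x within S)"
proof -
  have "((\<lambda>x. x + t *\<^sub>R (bump a r x *\<^sub>R (x - a))) has_derivative
    (\<lambda>h. h + t *\<^sub>R (bump a r x *\<^sub>R h + (grad_bump a r x \<bullet> h) *\<^sub>R (x - a)))) (at x within S)"
    by (intro has_derivative_add has_derivative_ident has_derivative_scaleR_right has_derivative_scaleR has_derivative_bump)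
       (auto intro!: derivative_eq_intros)
  moreover have "(\<lambda>h. h + t *\<^sub>R (bump a r x *\<^sub>R h + (grad_bump a r x \<bullet> h) *\<^sub>R (x - a)))
    = (\<lambda>h. (1 + t * bump a r x) *\<^sub>R h - (t * radial_factor a r x * ((x - a) \<bullet> h)) *\<^sub>R (x - a))"
  proof
    fix h
    define v where "v = x - a"
    have "grad_bump a r x \<bullet> h = - (radial_factor a r x * (v \<bullet> h))"
      by (simp add: grad_bump_def radial_factor_def v_def)
    then show "h + t *\<^sub>R (bump a r x *\<^sub>R h + (grad_bump a r x \<bullet> h) *\<^sub>R (x - a))
      = (1 + t * bump a r x) *\<^sub>R h - (t * radial_factor a r x * ((x - a) \<bullet> h)) *\<^sub>R (x - a)"
      unfolding v_def[symmetric]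
      by (simp add: scaleR_add_left scaleR_add_right scaleR_right_diff_distrib mult.assoc)
  qed
  ultimately show ?thesis by (simp add: radial_map_def[abs_def])
qed

text \<open>An orthogonal transformation takes \<open>v\<close> to a multiple of a coordinate
  vector, where the matrix is diagonal; conjugation preserves the determinant.\<close>

lemma det_rank_one_perturbation:
  fixes v :: "real ^ 'n"
  shows "det (matrix (\<lambda>h. \<alpha> *\<^sub>R h - (\<beta> * (v \<bullet> h)) *\<^sub>R v)) = \<alpha> ^ (CARD('n) - 1) * (\<alpha> - \<beta> * (norm v)\<^sup>2)"
proof -
  obtain k :: 'n where True by simp
  have "axis k (norm v) = norm v *\<^sub>R (axis k 1 :: real ^ 'n)" by (simp add: vec_eq_iff axis_def)
  then have "norm v = norm (axis k (norm v) :: real ^ 'n)" by (simp add: norm_axis_1)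
  then obtain f where f: "orthogonal_transformation f" "f v = axis k (norm v)"
    by (metis orthogonal_transformation_exists)
  have lf: "linear f" using f(1) by (simp add: orthogonal_transformation_def)
  let ?A = "\<lambda>h. \<alpha> *\<^sub>R h - (\<beta> * (v \<bullet> h)) *\<^sub>R v"
  let ?D = "\<lambda>h. \<alpha> *\<^sub>R h - (\<beta> * (axis k (norm v) \<bullet> h)) *\<^sub>R axis k (norm v)"
  have lin: "linear (\<lambda>h. \<alpha> *\<^sub>R h - (\<beta> * (w \<bullet> h)) *\<^sub>R w)" for w :: "real ^ 'n"
    by (intro linearI) (simp_all add: algebra_simps inner_add_right)
  have entry: "matrix ?D $ i $ j = \<alpha> * axis j 1 $ i - \<beta> * axis k (norm v) $ j * axis k (norm v) $ i" for i j
    by (simp add: matrix_def inner_axis)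
  have "f \<circ> ?A = ?D \<circ> f"
  proof
    fix h
    have "v \<bullet> h = f v \<bullet> f h" using f(1) by (simp add: orthogonal_transformation_def)
    then show "(f \<circ> ?A) h = (?D \<circ> f) h"
      using f(2) by (simp add: linear_diff[OF lf] linear_cmul[OF lf])
  qed
  then have "det (matrix f ** matrix ?A) = det (matrix ?D ** matrix f)"
    using matrix_compose[OF lin[of v] lf] matrix_compose[OF lf lin[of "axis k (norm v)"]] by simp
  moreover have "det (matrix f) \<noteq> 0"
    using f(1) det_orthogonal_matrix[of "matrix f"] by (auto simp: orthogonal_transformation_matrix)
  ultimately have "det (matrix ?A) = det (matrix ?D)" by (simp add: det_mul)
  also have "\<dots> = (\<Prod>i\<in>UNIV. matrix ?D $ i $ i)"
    by (rule det_diagonal) (unfold entry, auto simp: axis_def)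
  also have "\<dots> = (\<Prod>i\<in>UNIV. if i = k then \<alpha> - \<beta> * (norm v)\<^sup>2 else \<alpha>)"
    unfolding entry by (intro prod.cong refl) (auto simp: axis_def power2_eq_square)
  also have "\<dots> = (\<alpha> - \<beta> * (norm v)\<^sup>2) * (\<Prod>i\<in>UNIV - {k}. \<alpha>)"
    by (subst prod.remove[of _ k]) auto
  also have "\<dots> = \<alpha> ^ (CARD('n) - 1) * (\<alpha> - \<beta> * (norm v)\<^sup>2)"
    by (simp add: card_Diff_singleton)
  finally show ?thesis .
qed

lemma det_radial_map:
  fixes a x :: "real ^ 'n"
  shows "det (matrix (\<lambda>h. (1 + t * bump a r x) *\<^sub>R h - (t * radial_factor a r x * ((x - a) \<bullet> h)) *\<^sub>R (x - a)))
    = radial_jacobian a r t x"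
  unfolding det_rank_one_perturbation radial_jacobian_def by simp

lemma radial_factor_bounds:
  assumes r: "0 < r"
  shows "0 \<le> radial_factor a r x" "radial_factor a r x * (norm (x - a))\<^sup>2 \<le> 4"
proof -
  show "0 \<le> radial_factor a r x" by (simp add: radial_factor_def)
  show "radial_factor a r x * (norm (x - a))\<^sup>2 \<le> 4"
  proof (cases "x \<in> ball a r")
    case True
    then have "(norm (x - a))\<^sup>2 \<le> r\<^sup>2" by (intro power_mono) (auto simp: dist_norm norm_minus_commute)
    then have "radial_factor a r x * (norm (x - a))\<^sup>2 \<le> (2 / r\<^sup>2 * 2) * r\<^sup>2"
      using flat_le_fact[of 2 "height a r x"] unfolding radial_factor_def by (intro mult_mono) auto
    then show ?thesis using r by simp
  next
    case False
    then show ?thesis using height_pos_iff[OF r, of a x] by (simp add: radial_factor_def flat_eq_0)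
  qed
qed

text \<open>The bound \<open>1 / 16\<close> serves all facts about radial maps: the radial term is
  at most \<open>4 * t \<le> 1 / 4\<close> here, and as the field has Lipschitz constant 5, the map
  differs from the identity by a \<open>5 / 16\<close>-Lipschitz map.\<close>

lemma radial_jacobian_lower:
  assumes r: "0 < r" and t: "0 \<le> t" "t \<le> 1 / 16"
  shows "1 / 2 \<le> radial_jacobian a r t x"
proof -
  have b: "0 \<le> t * bump a r x" using t by simp
  have "t * (radial_factor a r x * (norm (x - a))\<^sup>2) \<le> 1 / 16 * 4"
    using t radial_factor_bounds[OF r, of a x] by (intro mult_mono) auto
  then have "1 / 2 \<le> 1 + t * bump a r x - t * radial_factor a r x * (norm (x - a))\<^sup>2"
    using b by (simp add: mult.assoc)
  moreover have "1 \<le> (1 + t * bump a r x) ^ (DIM('a) - 1)" using b by (intro one_le_power) simp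
  ultimately show ?thesis unfolding radial_jacobian_def
    using mult_mono[of 1 "(1 + t * bump a r x) ^ (DIM('a) - 1)" "1 / 2"] by simp
qed

lemma lipschitz_of_bounded_derivative:
  fixes F :: "'a::euclidean_space \<Rightarrow> 'b::real_normed_vector"
  assumes D: "\<And>x. (F has_derivative F' x) (at x)" and bd: "\<And>x h. norm (F' x h) \<le> K * norm h"
  shows "norm (F x - F y) \<le> K * norm (x - y)"
  by (rule differentiable_bound[of UNIV F F']) (use D in \<open>auto intro: onorm_le bd\<close>)

lemma radial_field_lipschitz:
  fixes a :: "'a::euclidean_space"
  assumes r: "0 < r"
  shows "norm (bump a r x *\<^sub>R (x - a) - bump a r y *\<^sub>R (y - a)) \<le> 5 * norm (x - y)"
proof (rule lipschitz_of_bounded_derivative)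
  show "((\<lambda>x. bump a r x *\<^sub>R (x - a)) has_derivative (\<lambda>h. bump a r x *\<^sub>R h + (grad_bump a r x \<bullet> h) *\<^sub>R (x - a))) (at x)" for x
    by (intro has_derivative_scaleR has_derivative_bump) (auto intro!: derivative_eq_intros)
  show "norm (bump a r x *\<^sub>R h + (grad_bump a r x \<bullet> h) *\<^sub>R (x - a)) \<le> 5 * norm h" for x h
  proof (cases "x \<in> ball a r")
    case True
    have "norm (bump a r x *\<^sub>R h) \<le> 1 * norm h"
      unfolding norm_scaleR using bump_le_1[of a r x] by (intro mult_right_mono) auto
    moreover have "norm ((grad_bump a r x \<bullet> h) *\<^sub>R (x - a)) \<le> (4 / r * norm h) * r"
    proof -
      have "\<bar>grad_bump a r x \<bullet> h\<bar> \<le> norm (grad_bump a r x) * norm h" by (rule Cauchy_Schwarz_ineq2)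
      also have "\<dots> \<le> 4 / r * norm h" using norm_grad_bump_le[OF r, of a x] by (intro mult_right_mono) auto
      finally show ?thesis unfolding norm_scaleR using True r
        by (intro mult_mono) (auto simp: dist_norm norm_minus_commute)
    qed
    ultimately show ?thesis
      using norm_triangle_ineq[of "bump a r x *\<^sub>R h" "(grad_bump a r x \<bullet> h) *\<^sub>R (x - a)"] r by simp
  next
    case False
    then show ?thesis using bump_eq_0[OF r False] grad_bump_eq_0[OF r False] by simp
  qed
qed

lemma radial_map_bilipschitz:
  fixes a :: "'a::euclidean_space"
  assumes r: "0 < r" and t: "0 \<le> t" "t \<le> 1 / 16"
  shows "norm (radial_map a r t x - radial_map a r t y) \<le> 2 * norm (x - y)"
    "norm (x - y) \<le> 2 * norm (radial_map a r t x - radial_map a r t y)"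
proof -
  let ?e = "t *\<^sub>R (bump a r x *\<^sub>R (x - a) - bump a r y *\<^sub>R (y - a))"
  have e: "norm ?e \<le> 1 / 16 * (5 * norm (x - y))"
    unfolding norm_scaleR using radial_field_lipschitz[OF r, of a x y] t by (intro mult_mono) auto
  have d: "radial_map a r t x - radial_map a r t y = (x - y) + ?e"
    by (simp add: radial_map_def scaleR_right_diff_distrib)
  show "norm (radial_map a r t x - radial_map a r t y) \<le> 2 * norm (x - y)"
    unfolding d using norm_triangle_ineq[of "x - y" ?e] e norm_ge_zero[of "x - y"] by linarith
  show "norm (x - y) \<le> 2 * norm (radial_map a r t x - radial_map a r t y)"
    unfolding d using norm_diff_ineq[of "x - y" ?e] e norm_ge_zero[of "x - y"] by linarith
qed

lemma inj_radial_map: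
  fixes a :: "'a::euclidean_space"
  assumes "0 < r" "0 \<le> t" "t \<le> 1 / 16"
  shows "inj (radial_map a r t)"
proof (rule injI)
  fix x y assume "radial_map a r t x = radial_map a r t y"
  then show "x = y" using radial_map_bilipschitz(2)[OF assms, of x y a] by simp
qed

text \<open>A preimage of \<open>y\<close> is a fixed point of \<open>y\<close> minus the
  displacement, a contraction by \<open>radial_field_lipschitz\<close>.\<close>

lemma surj_radial_map:
  fixes a :: "'a::euclidean_space"
  assumes r: "0 < r" and t: "0 \<le> t" "t \<le> 1 / 16"
  shows "surj (radial_map a r t)"
proof -
  have "\<exists>x. radial_map a r t x = y" for y
  proof -
    have "\<exists>!x. y - t *\<^sub>R (bump a r x *\<^sub>R (x - a)) = x"
    proof (rule banach_fix_type[where c = "1 / 2"], simp, simp, intro allI)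
      fix x z
      have "dist (y - t *\<^sub>R (bump a r x *\<^sub>R (x - a))) (y - t *\<^sub>R (bump a r z *\<^sub>R (z - a)))
        = t * norm (bump a r x *\<^sub>R (x - a) - bump a r z *\<^sub>R (z - a))"
      proof -
        have "(y - t *\<^sub>R (bump a r x *\<^sub>R (x - a))) - (y - t *\<^sub>R (bump a r z *\<^sub>R (z - a)))
          = - (t *\<^sub>R (bump a r x *\<^sub>R (x - a) - bump a r z *\<^sub>R (z - a)))" by (simp add: algebra_simps)
        then show ?thesis using t unfolding dist_norm by (simp only: norm_minus_cancel norm_scaleR abs_of_nonneg)
      qed
      also have "\<dots> \<le> 1 / 16 * (5 * norm (x - z))"
        using radial_field_lipschitz[OF r, of a x z] t by (intro mult_mono) auto
      also have "\<dots> \<le> 1 / 2 * dist x z" by (simp add: dist_norm)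
      finally show "dist (y - t *\<^sub>R (bump a r x *\<^sub>R (x - a))) (y - t *\<^sub>R (bump a r z *\<^sub>R (z - a))) \<le> 1 / 2 * dist x z" .
    qed
    then obtain x where "y - t *\<^sub>R (bump a r x *\<^sub>R (x - a)) = x" by blast
    then have "radial_map a r t x = y" unfolding radial_map_def by (metis diff_add_cancel)
    then show ?thesis ..
  qed
  then show ?thesis by (metis surjI)
qed

lemma radial_map_measurable [measurable]: "radial_map (a::'a::euclidean_space) r t \<in> borel_measurable borel"
  by (intro borel_measurable_continuous_onI has_derivative_continuous_on[OF has_derivative_radial_map])

lemma radial_jacobian_measurable [measurable]: "radial_jacobian (a::'a::euclidean_space) r t \<in> borel_measurable borel"
  unfolding radial_jacobian_def radial_factor_def by measurable


lemma integral_radial_map_wellorder: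
  fixes D :: "real ^ 'n::{finite,wellorder} \<Rightarrow> real"
  assumes r: "0 < r" and t: "0 \<le> t" "t \<le> 1 / 16" and D: "integrable lborel D"
  shows "integrable lborel (\<lambda>x. radial_jacobian a r t x * D (radial_map a r t x))"
    "(LINT x|lborel. radial_jacobian a r t x * D (radial_map a r t x)) = (LINT x|lborel. D x)"
proof -
  have [measurable]: "D \<in> borel_measurable borel" using D by simp
  let ?\<Phi> = "radial_map a r t" and ?J = "radial_jacobian a r t"
  let ?\<Phi>' = "\<lambda>x h. (1 + t * bump a r x) *\<^sub>R h - (t * radial_factor a r x * ((x - a) \<bullet> h)) *\<^sub>R (x - a)"
  \<comment> \<open>Scalars are packed into \<open>real ^ 1\<close>, the form of integrand in which
    the change of variables theorem is stated.\<close>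
  let ?V = "\<lambda>c. (\<chi> i. c) :: real ^ 1"
  have V: "bounded_linear ?V" unfolding linear_conv_bounded_linear[symmetric] by (rule linearI) (simp_all add: vec_eq_iff)
  have DV: "(\<lambda>x. ?V (D x)) absolutely_integrable_on UNIV"
  proof -
    have "integrable lebesgue D" using D by (subst integrable_completion) auto
    from integrable_bounded_linear[OF V this] show ?thesis by (simp add: set_integrable_def)
  qed
  have abs: "\<bar>det (matrix (?\<Phi>' x))\<bar> = ?J x" for x
    using radial_jacobian_lower[OF r t, of a x] unfolding det_radial_map by simp
  have "(\<lambda>x. \<bar>det (matrix (?\<Phi>' x))\<bar> *\<^sub>R ?V (D (?\<Phi> x))) absolutely_integrable_on UNIV \<and>
    integral UNIV (\<lambda>x. \<bar>det (matrix (?\<Phi>' x))\<bar> *\<^sub>R ?V (D (?\<Phi> x))) = integral (range ?\<Phi>) (\<lambda>x. ?V (D x))"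
  proof (rule has_absolute_integral_change_of_variables[THEN iffD2])
    show "(?\<Phi> has_derivative ?\<Phi>' x) (at x within UNIV)" for x by (rule has_derivative_radial_map)
    show "inj ?\<Phi>" by (rule inj_radial_map[OF r t])
  qed (use DV surj_radial_map[OF r t, of a] in auto)
  then have J: "(\<lambda>x. ?V (?J x * D (?\<Phi> x))) absolutely_integrable_on UNIV"
    "integral UNIV (\<lambda>x. ?V (?J x * D (?\<Phi> x))) = integral UNIV (\<lambda>x. ?V (D x))"
    using surj_radial_map[OF r t, of a] unfolding abs by (simp_all add: scaleR_vec_def)
  have "integrable lebesgue (\<lambda>x. ?V (?J x * D (?\<Phi> x)) $ 1)"
    using integrable_bounded_linear[OF bounded_linear_vec_nth J(1)[unfolded set_integrable_def]] by simp
  then have i: "integrable lebesgue (\<lambda>x. ?J x * D (?\<Phi> x))" by simp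
  then show il: "integrable lborel (\<lambda>x. ?J x * D (?\<Phi> x))" by (subst (asm) integrable_completion) auto
  have V1: "(LINT x|lborel. F x) = integral UNIV (\<lambda>x. ?V (F x)) $ 1" if "integrable lborel F" for F :: "(real, 'n) vec \<Rightarrow> real"
  proof -
    have iF: "integrable lebesgue F" using that by (subst integrable_completion) auto
    then have "(\<lambda>x. ?V (F x)) absolutely_integrable_on UNIV"
      using integrable_bounded_linear[OF V iF] by (simp add: set_integrable_def)
    then have "integral UNIV (\<lambda>x. ?V (F x)) = (LINT x|lebesgue. ?V (F x))"
      using set_lebesgue_integral_eq_integral(2) by (fastforce simp: set_lebesgue_integral_def)
    also have "\<dots> = ?V (LINT x|lebesgue. F x)" by (rule integral_bounded_linear[OF V iF])
    finally show ?thesis using that by (simp add: integral_completion)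
  qed
  show "(LINT x|lborel. ?J x * D (?\<Phi> x)) = (LINT x|lborel. D x)"
    unfolding V1[OF il] V1[OF D] J(2) ..
qed


lemma radial_map_reindex:
  fixes a x :: "real ^ 'm"
  shows "radial_map (reindex a) r t (reindex x) = reindex (radial_map a r t x)"
    "radial_jacobian (reindex a) r t (reindex x) = radial_jacobian a r t x"
proof -
  have n: "norm (reindex x - reindex a) = norm (x - a)"
    by (simp add: linear_diff[OF reindex_linear, symmetric] reindex_norm)
  then have h: "height (reindex a) r (reindex x) = height a r x" by (simp add: height_def)
  show "radial_map (reindex a) r t (reindex x) = reindex (radial_map a r t x)"
    by (simp add: radial_map_def bump_def h linear_diff[OF reindex_linear] linear_add[OF reindex_linear]
        linear_cmul[OF reindex_linear])
  show "radial_jacobian (reindex a) r t (reindex x) = radial_jacobian a r t x"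
    by (simp add: radial_jacobian_def radial_factor_def bump_def h n card_ordered_index)
qed

lemma integral_radial_map:
  fixes D :: "real ^ 'm \<Rightarrow> real"
  assumes r: "0 < r" and t: "0 \<le> t" "t \<le> 1 / 16" and D: "integrable lborel D"
  shows "integrable lborel (\<lambda>x. radial_jacobian a r t x * D (radial_map a r t x))"
    "(LINT x|lborel. radial_jacobian a r t x * D (radial_map a r t x)) = (LINT x|lborel. D x)"
proof -
  have [measurable]: "D \<in> borel_measurable borel" using D by simp
  define unindex :: "real ^ 'm ordered_index \<Rightarrow> real ^ 'm" where "unindex y = (\<chi> i. y $ Abs_ordered_index i)" for y
  have unindex: "unindex (reindex x) = x" for x
    by (simp add: unindex_def reindex_def vec_eq_iff Abs_ordered_index_inverse)
  have "linear unindex" by (intro linearI) (simp_all add: unindex_def vec_eq_iff)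
  then have [measurable]: "unindex \<in> borel_measurable borel"
    by (intro borel_measurable_continuous_onI linear_continuous_on linear_conv_bounded_linear[THEN iffD1])
  let ?D = "\<lambda>y. D (unindex y)" and ?J = "\<lambda>y. radial_jacobian (reindex a) r t y * D (unindex (radial_map (reindex a) r t y))"
  have transfer: "integrable lborel F \<longleftrightarrow> integrable lborel (\<lambda>x. F (reindex x))"
    "(LINT y|lborel. F y) = (LINT x|lborel. F (reindex x))"
    if [measurable]: "F \<in> borel_measurable borel" for F :: "real ^ 'm ordered_index \<Rightarrow> real"
  proof -
    have [measurable]: "reindex \<in> lborel \<rightarrow>\<^sub>M (borel :: (real ^ 'm ordered_index) measure)" by simp
    show "integrable lborel F \<longleftrightarrow> integrable lborel (\<lambda>x. F (reindex x))"
      unfolding distr_reindex[symmetric] by (rule integrable_distr_eq) measurable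
    show "(LINT y|lborel. F y) = (LINT x|lborel. F (reindex x))"
      unfolding distr_reindex[symmetric] by (rule integral_distr) measurable
  qed
  have iD: "integrable lborel ?D" using transfer(1)[of ?D] D by (simp add: unindex)
  note w = integral_radial_map_wellorder[OF r t iD, of "reindex a"]
  show "integrable lborel (\<lambda>x. radial_jacobian a r t x * D (radial_map a r t x))"
    using w(1) transfer(1)[of ?J] by (simp add: radial_map_reindex unindex)
  show "(LINT x|lborel. radial_jacobian a r t x * D (radial_map a r t x)) = (LINT x|lborel. D x)"
    using w(2) transfer(2)[of ?J] transfer(2)[of ?D] by (simp add: radial_map_reindex unindex)
qed

text \<open>The Jacobian is at least \<open>1 / 2\<close>, so integrating the indicator of
  \<open>E\<close> bounds the preimage. Both null sets and sets of density 0 therefore pull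
  back.\<close>

lemma emeasure_radial_map_vimage:
  fixes a :: "real ^ 'm"
  assumes r: "0 < r" and t: "0 \<le> t" "t \<le> 1 / 16" and [measurable]: "E \<in> sets borel"
  shows "emeasure lborel (radial_map a r t -` E) \<le> 2 * emeasure lborel E"
proof (cases "emeasure lborel E = \<infinity>")
  case False
  have iE: "integrable lborel (indicator E :: real ^ 'm \<Rightarrow> real)"
    using False by (intro integrable_real_indicator) (auto simp: top.not_eq_extremum)
  note w = integral_radial_map[OF r t iE, of a]
  let ?V = "radial_map a r t -` E"
  have [measurable]: "?V \<in> sets borel" using measurable_sets_borel[OF radial_map_measurable[of a r t]] by simp
  have "(\<integral>\<^sup>+x. indicator ?V x \<partial>lborel) \<le> (\<integral>\<^sup>+x. ennreal (2 * (radial_jacobian a r t x * indicator E (radial_map a r t x))) \<partial>lborel)"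
  proof (rule nn_integral_mono)
    fix x
    show "indicator ?V x \<le> ennreal (2 * (radial_jacobian a r t x * indicator E (radial_map a r t x)))"
      using radial_jacobian_lower[OF r t, of a x] by (auto simp: indicator_def simp flip: ennreal_1 intro: ennreal_leI)
  qed
  also have "\<dots> = ennreal (LINT x|lborel. 2 * (radial_jacobian a r t x * indicator E (radial_map a r t x)))"
  proof (rule nn_integral_eq_integral)
    show "integrable lborel (\<lambda>x. 2 * (radial_jacobian a r t x * indicator E (radial_map a r t x)))"
      by (rule integrable_mult_right) (rule w(1))
    show "AE x in lborel. 0 \<le> 2 * (radial_jacobian a r t x * indicator E (radial_map a r t x))"
      using radial_jacobian_lower[OF r t, of a] by (intro AE_I2) (auto simp: indicator_def intro: order_trans[of 0 "1/2"])
  qed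
  also have "\<dots> = ennreal (2 * measure lborel E)" using w(2) by simp
  also have "\<dots> = 2 * emeasure lborel E"
    using False by (simp add: emeasure_eq_ennreal_measure top.not_eq_extremum ennreal_mult)
  finally show ?thesis by simp
qed simp

lemma AE_radial_map:
  fixes a :: "real ^ 'm"
  assumes r: "0 < r" and t: "0 \<le> t" "t \<le> 1 / 16" and P: "AE y in lborel. P y"
  shows "AE x in lborel. P (radial_map a r t x)"
proof -
  obtain N where N: "N \<in> null_sets lborel" "{y. \<not> P y} \<subseteq> N" using P by (auto simp: eventually_ae_filter)
  have "N \<in> sets borel" using N by auto
  then have "radial_map a r t -` N \<in> null_sets lborel"
    using emeasure_radial_map_vimage[OF r t, of N a] N measurable_sets_borel[OF radial_map_measurable[of a r t]] by (simp add: null_sets_def)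
  then show ?thesis by (rule AE_I') (use N in auto)
qed

lemma borel_superset:
  fixes E :: "'a::euclidean_space set"
  assumes "E \<in> sets lebesgue"
  obtains E' where "E' \<in> sets borel" "E \<subseteq> E'" "emeasure lebesgue E = emeasure lborel E'"
proof -
  obtain S N N' where E: "E = S \<union> N" "N \<subseteq> N'" "N' \<in> null_sets lborel" "S \<in> sets lborel"
    using sets_completionE[OF assms] by blast
  have B: "S \<union> N' \<in> sets borel" using E by auto
  have "emeasure lborel (S \<union> N') = emeasure lborel S" by (rule emeasure_Un_null_set) (use E in auto)
  moreover have "emeasure lborel S = emeasure lebesgue S" using E by simp
  moreover have "emeasure lebesgue S \<le> emeasure lebesgue E" using E assms by (intro emeasure_mono) auto
  moreover have "emeasure lebesgue E \<le> emeasure lebesgue (S \<union> N')" using E by (intro emeasure_mono) auto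
  moreover have "emeasure lebesgue (S \<union> N') = emeasure lborel (S \<union> N')" using B by simp
  ultimately have "emeasure lebesgue E = emeasure lborel (S \<union> N')" by (metis order_antisym)
  moreover have "E \<subseteq> S \<union> N'" using E(1,2) by blast
  ultimately show thesis using that B by blast
qed

text \<open>The map sends \<open>ball b \<rho>\<close> into the ball of radius
  \<open>2 * \<rho>\<close> about the image point, and taking preimages at most doubles the measure;
  \<open>\<delta>\<close> compensates for this and for the volume ratio
  \<open>2 ^ CARD('m)\<close>.\<close>

lemma eventually_ap_at_radial_map:
  fixes a b :: "real ^ 'm"
  assumes r: "0 < r" and t: "0 \<le> t" "t \<le> 1 / 16"
    and P: "eventually P (ap_at (radial_map a r t b))"
  shows "\<forall>\<^sub>F x in ap_at b. P (radial_map a r t x)"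
proof (rule eventually_ap_atI)
  let ?\<Phi> = "radial_map a r t"
  fix \<epsilon> :: real assume \<epsilon>: "0 < \<epsilon>"
  define \<delta> where "\<delta> = \<epsilon> / (2 * 2 ^ CARD('m))"
  have \<delta>: "0 < \<delta>" using \<epsilon> by (simp add: \<delta>_def)
  have "filterlim (\<lambda>\<rho>. 2 * \<rho>) (at_right 0) (at_right (0::real))"
    by (auto simp: filterlim_at eventually_at_right_less intro!: tendsto_eq_intros)
       (auto simp: eventually_at_filter)
  from eventually_compose_filterlim[OF eventually_ap_atE[OF P \<delta>] this] eventually_at_right_less[of "0::real"]
  show "\<forall>\<^sub>F \<rho> in at_right 0. \<exists>E\<in>sets lebesgue. {x \<in> ball b \<rho>. \<not> P (?\<Phi> x)} \<subseteq> E \<and>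
    emeasure lebesgue E \<le> ennreal \<epsilon> * emeasure lebesgue (ball b \<rho>)"
  proof eventually_elim
    case (elim \<rho>)
    then obtain E where E: "E \<in> sets lebesgue" "{y \<in> ball (?\<Phi> b) (2 * \<rho>). \<not> P y} \<subseteq> E"
      "emeasure lebesgue E \<le> ennreal \<delta> * emeasure lebesgue (ball (?\<Phi> b) (2 * \<rho>))" by blast
    obtain E' where E': "E' \<in> sets borel" "E \<subseteq> E'" "emeasure lebesgue E = emeasure lborel E'"
      using borel_superset[OF E(1)] .
    have V: "?\<Phi> -` E' \<in> sets borel" using measurable_sets_borel[OF radial_map_measurable E'(1)] by simp
    have "{x \<in> ball b \<rho>. \<not> P (?\<Phi> x)} \<subseteq> ?\<Phi> -` E'"
    proof
      fix x assume x: "x \<in> {x \<in> ball b \<rho>. \<not> P (?\<Phi> x)}"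
      then have "norm (?\<Phi> b - ?\<Phi> x) < 2 * \<rho>"
        using radial_map_bilipschitz(1)[OF r t, of a b x] by (simp add: dist_norm)
      then have "?\<Phi> x \<in> {y \<in> ball (?\<Phi> b) (2 * \<rho>). \<not> P y}" using x by (simp add: dist_norm)
      then show "x \<in> ?\<Phi> -` E'" using E(2) E'(2) by blast
    qed
    moreover have "emeasure lebesgue (?\<Phi> -` E') \<le> ennreal \<epsilon> * emeasure lebesgue (ball b \<rho>)"
    proof -
      have "emeasure lebesgue (?\<Phi> -` E') \<le> 2 * emeasure lebesgue E"
        using emeasure_radial_map_vimage[OF r t E'(1), of a] V unfolding E'(3) by simp
      also have "\<dots> \<le> 2 * (ennreal \<delta> * (ennreal (2 ^ CARD('m)) * emeasure lebesgue (ball b \<rho>)))"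
        using E(3) emeasure_lebesgue_ball_scale[of \<rho> 2 "?\<Phi> b" b] elim by (intro mult_left_mono) auto
      also have "\<dots> = ennreal (2 * (\<delta> * 2 ^ CARD('m))) * emeasure lebesgue (ball b \<rho>)"
        using \<delta> by (simp add: ennreal_mult mult.assoc)
      also have "2 * (\<delta> * 2 ^ CARD('m)) = \<epsilon>" by (simp add: \<delta>_def)
      finally show ?thesis .
    qed
    ultimately show ?case using V by (intro bexI[of _ "?\<Phi> -` E'"]) auto
  qed
qed

section \<open>The squeeze variation\<close>

definition compose_differential ::
    "((real ^ 'm) \<Rightarrow>\<^sub>L (real ^ 'm)) \<Rightarrow> 'h::real_normed_vector \<times> ((real ^ 'm) \<Rightarrow>\<^sub>L 'h) \<Rightarrow> 'h \<times> ((real ^ 'm) \<Rightarrow>\<^sub>L 'h)" where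
  "compose_differential A p = (fst p, snd p o\<^sub>L A)"

lemma has_ap_differential_radial_map:
  fixes f :: "real ^ 'm \<Rightarrow> 'h::real_inner multiset" and b :: "real ^ 'm"
  assumes r: "0 < r" and t: "0 \<le> t" "t \<le> 1 / 16"
    and d: "has_ap_differential f (radial_map a r t b) (mset xs)"
    and size: "\<forall>\<^sub>F y in ap_at (radial_map a r t b). size (f y) = size (f (radial_map a r t b))"
    and A: "(radial_map a r t has_derivative blinfun_apply A) (at b)"
  shows "has_ap_differential (\<lambda>x. f (radial_map a r t x)) b (mset (map (compose_differential A) xs))"
    "\<forall>\<^sub>F x in ap_at b. size (f (radial_map a r t x)) = size (f (radial_map a r t b))"
proof -
  let ?\<Phi> = "radial_map a r t"
  have D: "mset (map fst xs) = f (?\<Phi> b)" "\<And>p q. p \<in> set xs \<Longrightarrow> q \<in> set xs \<Longrightarrow> fst p = fst q \<Longrightarrow> snd p = snd q"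
    "ap_o (?\<Phi> b) (\<lambda>y. Gdist (f y) (mset (map (\<lambda>(v, L). v + blinfun_apply L (y - ?\<Phi> b)) xs)))"
    using d unfolding has_ap_differential_mset by blast+
  show size_b: "\<forall>\<^sub>F x in ap_at b. size (f (?\<Phi> x)) = size (f (?\<Phi> b))"
    by (rule eventually_ap_at_radial_map[OF r t size])
  have "length xs = size (f (?\<Phi> b))" using D(1) by (metis size_mset length_map)
  then have size': "\<forall>\<^sub>F x in ap_at b. size (f (?\<Phi> x)) = length xs" using size_b by simp
  have o1: "ap_o b (\<lambda>x. Gdist (f (?\<Phi> x)) (mset (map (\<lambda>p. fst p + blinfun_apply (snd p) (?\<Phi> x - ?\<Phi> b)) xs)))"
    unfolding ap_o_def
  proof (intro allI impI)
    fix \<epsilon> :: real assume \<epsilon>: "0 < \<epsilon>"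
    then have "0 < \<epsilon> / 2" by simp
    from eventually_ap_at_radial_map[OF r t ap_oD[OF D(3) this]]
    show "\<forall>\<^sub>F x in ap_at b. \<bar>Gdist (f (?\<Phi> x)) (mset (map (\<lambda>p. fst p + blinfun_apply (snd p) (?\<Phi> x - ?\<Phi> b)) xs))\<bar> \<le> \<epsilon> * norm (x - b)"
    proof eventually_elim
      case (elim x)
      have "\<epsilon> / 2 * norm (?\<Phi> x - ?\<Phi> b) \<le> \<epsilon> / 2 * (2 * norm (x - b))"
        using radial_map_bilipschitz(1)[OF r t, of a x b] \<epsilon> by (intro mult_left_mono) auto
      then show ?case using elim unfolding case_prod_unfold by linarith
    qed
  qed
  have o2: "ap_o b (\<lambda>x. Gdist (f (?\<Phi> x)) (mset (map (\<lambda>p. fst p + blinfun_apply (snd p) (blinfun_apply A (x - b))) xs)))"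
  proof (rule ap_o_Gdist_change[OF size' o1])
    fix p assume "p \<in> set xs"
    show "ap_o b (\<lambda>x. norm (fst p + blinfun_apply (snd p) (?\<Phi> x - ?\<Phi> b)
      - (fst p + blinfun_apply (snd p) (blinfun_apply A (x - b)))))"
    proof (rule ap_o_mono[OF ap_o_cmult[OF ap_o_derivative[OF A], of "norm (snd p)"]], intro always_eventually allI)
      fix x
      have "fst p + blinfun_apply (snd p) (?\<Phi> x - ?\<Phi> b) - (fst p + blinfun_apply (snd p) (blinfun_apply A (x - b)))
        = blinfun_apply (snd p) (?\<Phi> x - ?\<Phi> b - blinfun_apply A (x - b))"
        by (simp add: blinfun.diff_right)
      then show "\<bar>norm (fst p + blinfun_apply (snd p) (?\<Phi> x - ?\<Phi> b) - (fst p + blinfun_apply (snd p) (blinfun_apply A (x - b))))\<bar>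
        \<le> \<bar>norm (snd p) * norm (?\<Phi> x - ?\<Phi> b - blinfun_apply A (x - b))\<bar>"
        using norm_blinfun[of "snd p" "?\<Phi> x - ?\<Phi> b - blinfun_apply A (x - b)"] by simp
    qed
  qed
  then have o: "ap_o b (\<lambda>x. Gdist (f (?\<Phi> x)) (mset (map (\<lambda>(v, L). v + blinfun_apply L (x - b)) (map (compose_differential A) xs))))"
    by (simp add: o_def split_beta compose_differential_def del: mset_map)
  show "has_ap_differential (\<lambda>x. f (?\<Phi> x)) b (mset (map (compose_differential A) xs))"
    unfolding has_ap_differential_mset
  proof (intro conjI ballI impI o)
    show "mset (map fst (map (compose_differential A) xs)) = f (?\<Phi> b)"
      unfolding D(1)[symmetric] by (simp add: compose_differential_def o_def image_mset.compositionality)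
    fix p' q' assume "p' \<in> set (map (compose_differential A) xs)" "q' \<in> set (map (compose_differential A) xs)"
      and fst: "fst p' = fst q'"
    then obtain p q where pq: "p \<in> set xs" "q \<in> set xs" "p' = compose_differential A p" "q' = compose_differential A q" by auto
    with D(2)[OF pq(1,2)] fst show "snd p' = snd q'" by (simp add: compose_differential_def)
  qed
qed

text \<open>The exact difference of the two sides is
  \<open>\<beta> * (2 * \<alpha> - \<beta> * (norm v)\<^sup>2)\<close> times the squared norm of
  \<open>L\<close> applied to \<open>v\<close>, and it has a sign. Discarding it spares the integral
  of the radial derivative of \<open>f\<close>.\<close>

lemma HS_norm_compose_le:
  fixes L :: "(real ^ 'm) \<Rightarrow>\<^sub>L 'h::real_inner"
  assumes A: "\<And>h. blinfun_apply A h = \<alpha> *\<^sub>R h - (\<beta> * (v \<bullet> h)) *\<^sub>R v"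
    and \<beta>: "0 \<le> \<beta>" "\<beta> * (norm v)\<^sup>2 \<le> 2 * \<alpha>"
  shows "(HS_norm (L o\<^sub>L A))\<^sup>2 \<le> \<alpha>\<^sup>2 * (HS_norm L)\<^sup>2"
proof -
  let ?L = "blinfun_apply L"
  have n: "(\<Sum>i\<in>UNIV. (v $ i)\<^sup>2) = (norm v)\<^sup>2" by (simp add: norm_vec_def L2_set_def sum_nonneg)
  have e: "(\<Sum>i\<in>UNIV. v $ i * (?L v \<bullet> ?L (axis i 1))) = (norm (?L v))\<^sup>2"
    unfolding power2_norm_eq_inner by (subst (3) blinfun_axis_expansion) (simp add: inner_sum_right)
  have "(HS_norm (L o\<^sub>L A))\<^sup>2 = (\<Sum>i\<in>UNIV. \<alpha>\<^sup>2 * (norm (?L (axis i 1)))\<^sup>2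
      - (2 * \<alpha> * \<beta>) * (v $ i * (?L v \<bullet> ?L (axis i 1))) + (\<beta>\<^sup>2 * (norm (?L v))\<^sup>2) * (v $ i)\<^sup>2)"
    unfolding HS_norm_squared blinfun_apply_blinfun_compose A power2_norm_eq_inner
    by (intro sum.cong refl)
       (simp add: blinfun.diff_right blinfun.scaleR_right inner_axis inner_diff_left inner_diff_right inner_commute
         power2_eq_square algebra_simps)
  also have "\<dots> = \<alpha>\<^sup>2 * (HS_norm L)\<^sup>2 - (2 * \<alpha> * \<beta>) * (\<Sum>i\<in>UNIV. v $ i * (?L v \<bullet> ?L (axis i 1)))
      + (\<beta>\<^sup>2 * (norm (?L v))\<^sup>2) * (\<Sum>i\<in>UNIV. (v $ i)\<^sup>2)"
    unfolding HS_norm_squared by (simp add: sum.distrib sum_subtractf sum_distrib_left)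
  also have "\<dots> = \<alpha>\<^sup>2 * (HS_norm L)\<^sup>2 - \<beta> * (2 * \<alpha> - \<beta> * (norm v)\<^sup>2) * (norm (?L v))\<^sup>2"
    unfolding n e by (simp add: power2_eq_square algebra_simps)
  also have "\<dots> \<le> \<alpha>\<^sup>2 * (HS_norm L)\<^sup>2" using \<beta> by simp
  finally show ?thesis .
qed

text \<open>The derivative at \<open>t = 0\<close> of
  \<open>(1 + t * bump a r x)\<^sup>2 / radial_jacobian a r t x\<close>. Integrated against the
  energy density it gives \<open>2 - DIM('a)\<close> times the smoothed energy plus \<open>r\<close>
  times its radius derivative.\<close>

definition radial_weight :: "'a::euclidean_space \<Rightarrow> real \<Rightarrow> 'a \<Rightarrow> real" where
  "radial_weight a r x = (2 - real DIM('a)) * bump a r x + radial_factor a r x * (norm (x - a))\<^sup>2"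

lemma radial_weight_measurable [measurable]: "radial_weight a r \<in> borel_measurable borel"
  unfolding radial_weight_def radial_factor_def by measurable

lemma abs_radial_weight_le:
  assumes "0 < r"
  shows "\<bar>radial_weight (a::'a::euclidean_space) r x\<bar> \<le> DIM('a) + 6"
proof -
  have "\<bar>(2 - real DIM('a)) * bump a r x\<bar> \<le> (real DIM('a) + 2) * 1"
    unfolding abs_mult using bump_le_1[of a r x] by (intro mult_mono) auto
  then show ?thesis
    using radial_factor_bounds(2)[OF assms, of a x] mult_nonneg_nonneg[OF radial_factor_bounds(1)[OF assms, of a x], of "(norm (x - a))\<^sup>2"]
    unfolding radial_weight_def by simp
qed

lemma radial_weight_lipschitz:
  fixes a :: "'a::euclidean_space"
  assumes r: "0 < r"
  obtains K where "\<And>x y. \<bar>radial_weight a r x - radial_weight a r y\<bar> \<le> K * norm (x - y)"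
proof -
  define c where "c = 2 - real DIM('a)"
  define F' where "F' s = c * flat' 0 s + 2 * (flat' 2 s * (1 - s) - flat 2 s)" for s
  \<comment> \<open>Since \<open>(norm (x - a))\<^sup>2 / r\<^sup>2 = 1 - height a r x\<close>, the
    weight is a function of the height alone.\<close>
  have eq: "radial_weight a r x = c * flat 0 (height a r x) + 2 * (flat 2 (height a r x) * (1 - height a r x))" for x
    using r by (simp add: radial_weight_def radial_factor_def bump_def c_def) (simp add: height_def)
  have D: "((\<lambda>x. radial_weight a r x) has_derivative (\<lambda>h. F' (height a r x) * (- (2 / r\<^sup>2) * ((x - a) \<bullet> h)))) (at x)" for x
  proof -
    have "((\<lambda>s. c * flat 0 s + 2 * (flat 2 s * (1 - s))) has_real_derivative F' s) (at s)" for s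
      unfolding F'_def flat'_def by (auto intro!: derivative_eq_intros DERIV_flat simp: algebra_simps)
    from has_derivative_compose[OF has_derivative_height this[THEN has_field_derivative_imp_has_derivative]]
    show ?thesis unfolding eq by (simp add: mult.commute)
  qed
  define M where "M = \<bar>c\<bar> * 2 + 2 * (36 * 1 + 2)"
  show thesis
  proof (rule that)
    fix x y
    have "norm (radial_weight a r x - radial_weight a r y) \<le> (M * (2 / r\<^sup>2 * r)) * norm (x - y)"
    proof (rule lipschitz_of_bounded_derivative[OF D])
      fix x h
      show "norm (F' (height a r x) * (- (2 / r\<^sup>2) * ((x - a) \<bullet> h))) \<le> (M * (2 / r\<^sup>2 * r)) * norm h"
      proof (cases "x \<in> ball a r")
        case True
        let ?s = "height a r x"
        have s: "0 < ?s" "?s \<le> 1" using height_pos_iff[OF r, of a x] True r by (auto simp: height_def)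
        have "\<bar>F' ?s\<bar> \<le> \<bar>c * flat' 0 ?s\<bar> + \<bar>2 * (flat' 2 ?s * (1 - ?s) - flat 2 ?s)\<bar>"
          unfolding F'_def by (rule abs_triangle_ineq)
        also have "\<bar>c * flat' 0 ?s\<bar> \<le> \<bar>c\<bar> * 2"
          unfolding abs_mult using abs_flat'_le[of 0 ?s] by (intro mult_left_mono) (auto simp: fact_numeral)
        also have "\<bar>2 * (flat' 2 ?s * (1 - ?s) - flat 2 ?s)\<bar> \<le> 2 * (36 * 1 + 2)"
        proof -
          have "\<bar>flat' 2 ?s * (1 - ?s)\<bar> \<le> 36 * 1"
            unfolding abs_mult using abs_flat'_le[of 2 ?s] s by (intro mult_mono) (auto simp: fact_numeral)
          moreover have "\<bar>flat 2 ?s\<bar> \<le> 2" using flat_le_fact[of 2 ?s] by simp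
          ultimately have "\<bar>flat' 2 ?s * (1 - ?s) - flat 2 ?s\<bar> \<le> 36 * 1 + 2" by linarith
          then show ?thesis by simp
        qed
        finally have M: "\<bar>F' ?s\<bar> \<le> M" by (simp add: M_def)
        have "\<bar>(x - a) \<bullet> h\<bar> \<le> norm (x - a) * norm h" by (rule Cauchy_Schwarz_ineq2)
        also have "\<dots> \<le> r * norm h" using True by (intro mult_right_mono) (auto simp: dist_norm norm_minus_commute)
        finally have "\<bar>- (2 / r\<^sup>2) * ((x - a) \<bullet> h)\<bar> \<le> 2 / r\<^sup>2 * (r * norm h)"
          unfolding abs_mult by (intro mult_mono) auto
        then have "\<bar>F' ?s * (- (2 / r\<^sup>2) * ((x - a) \<bullet> h))\<bar> \<le> M * (2 / r\<^sup>2 * (r * norm h))"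
          unfolding abs_mult[of "F' ?s"] using M by (intro mult_mono) auto
        then show ?thesis by (simp add: mult.assoc)
      next
        case False
        then have "height a r x \<le> 0" using height_pos_iff[OF r, of a x] by simp
        then show ?thesis using r by (simp add: F'_def flat'_eq_0 flat_eq_0 M_def)
      qed
    qed
    then show "\<bar>radial_weight a r x - radial_weight a r y\<bar> \<le> (M * (2 / r\<^sup>2 * r)) * norm (x - y)" by simp
  qed
qed

section \<open>The stretch factor compared with the Jacobian\<close>

lemma exp_le_quadratic:
  fixes z :: real
  assumes "z \<le> 1"
  shows "exp z \<le> 1 + z + z\<^sup>2"
proof (cases "0 \<le> z")
  case True
  then show ?thesis using assms exp_bound by blast
next
  case False
  define w where "w = - z"
  have w: "0 < w" using False by (simp add: w_def)
  have "1 + w + w\<^sup>2 / 2 \<le> exp w" using w exp_lower_Taylor_quadratic[of w] by simp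
  \<comment> \<open>The claimed upper bound for \<open>exp (- w)\<close> times the Taylor lower
    bound for \<open>exp w\<close> is at least 1, which suffices after division by
    \<open>exp w\<close>.\<close>
  moreover have "1 \<le> (1 - w + w\<^sup>2) * (1 + w + w\<^sup>2 / 2)"
  proof -
    have "(1 - w + w\<^sup>2) * (1 + w + w\<^sup>2 / 2) = 1 + w\<^sup>2 / 2 + w ^ 3 / 2 + w ^ 4 / 2"
      by (simp add: power2_eq_square power3_eq_cube power4_eq_xxxx algebra_simps add_divide_distrib diff_divide_distrib)
    then show ?thesis using w by simp
  qed
  moreover have pos: "0 < 1 - w + w\<^sup>2"
  proof -
    have "1 - w + w\<^sup>2 = (w - 1 / 2)\<^sup>2 + 3 / 4" by (simp add: power2_eq_square algebra_simps)
    then show ?thesis using zero_le_power2[of "w - 1 / 2"] by linarith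
  qed
  ultimately have "1 \<le> (1 - w + w\<^sup>2) * exp w"
    using mult_left_mono[of "1 + w + w\<^sup>2 / 2" "exp w" "1 - w + w\<^sup>2"] by linarith
  then have "exp (- w) \<le> 1 - w + w\<^sup>2" by (simp add: exp_minus field_simps)
  then show ?thesis by (simp add: w_def)
qed

text \<open>Logarithms turn the quotient into a sum whose first-order part is
  \<open>t * radial_weight a r x\<close>. The remainders are \<open>DIM('a) * t\<^sup>2\<close> from
  the power of \<open>1 + s\<close>, and \<open>32 * t\<^sup>2\<close> from
  \<open>2 * u\<^sup>2\<close> with \<open>u \<le> 4 * t\<close>.\<close>

lemma stretch_le_jacobian_exp:
  fixes a :: "'a::euclidean_space"
  assumes r: "0 < r" and t: "0 \<le> t" "t \<le> 1 / 16"
  shows "(1 + t * bump a r x)\<^sup>2 \<le> radial_jacobian a r t x * exp (t * radial_weight a r x + t\<^sup>2 * (DIM('a) + 32))"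
proof -
  let ?m = "DIM('a)"
  define s where "s = t * bump a r x"
  define \<kappa> where "\<kappa> = radial_factor a r x * (norm (x - a))\<^sup>2"
  define u where "u = t * \<kappa> / (1 + s)"
  have s: "0 \<le> s" "s \<le> t" using t bump_le_1[of a r x] mult_left_le[of "bump a r x" t] by (auto simp: s_def)
  have \<kappa>: "0 \<le> \<kappa>" "\<kappa> \<le> 4" using radial_factor_bounds[OF r, of a x] by (auto simp: \<kappa>_def)
  have tk: "0 \<le> t * \<kappa>" "t * \<kappa> \<le> t * 4" using t \<kappa> by (auto intro: mult_left_mono)
  have u: "0 \<le> u" "u \<le> t * \<kappa>"
    using tk s by (auto simp: u_def divide_le_eq mult_le_cancel_left1)
  have J: "radial_jacobian a r t x = (1 + s) ^ ?m * (1 - u)"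
  proof -
    have "radial_jacobian a r t x = (1 + s) ^ (?m - 1) * (1 + s - t * \<kappa>)"
      by (simp add: radial_jacobian_def s_def \<kappa>_def mult.assoc)
    also have "1 + s - t * \<kappa> = (1 + s) * (1 - u)" using s by (simp add: u_def field_simps)
    also have "(1 + s) ^ (?m - 1) * ((1 + s) * (1 - u)) = ((1 + s) ^ (?m - 1) * (1 + s)) * (1 - u)" by simp
    also have "(1 + s) ^ (?m - 1) * (1 + s) = (1 + s) ^ ?m" by (metis DIM_positive power_minus_mult)
    finally show ?thesis .
  qed
  have l1: "ln (1 + s) \<le> s" using s by (simp add: ln_add_one_self_le_self)
  have l2: "s - s\<^sup>2 \<le> ln (1 + s)" using s t by (intro ln_one_plus_pos_lower_bound) auto
  have l3: "- u - 2 * u\<^sup>2 \<le> ln (1 - u)" using u tk t by (intro ln_one_minus_pos_lower_bound) auto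
  have u1: "u < 1" using u tk t by linarith
  have "2 * ln (1 + s) \<le> ?m * ln (1 + s) + ln (1 - u) + (t * radial_weight a r x + t\<^sup>2 * (?m + 32))"
  proof -
    have "real ?m * (s - s\<^sup>2) \<le> ?m * ln (1 + s)" using l2 by (intro mult_left_mono) auto
    then have "real ?m * s - ?m * s\<^sup>2 \<le> ?m * ln (1 + s)" by (simp add: right_diff_distrib)
    moreover have "real ?m * s\<^sup>2 \<le> ?m * t\<^sup>2" using s by (intro mult_left_mono power_mono) auto
    moreover have "u\<^sup>2 \<le> 16 * t\<^sup>2" using u tk power_mono[of u "t * 4" 2] by (simp add: power_mult_distrib)
    moreover have "t * radial_weight a r x = 2 * s - ?m * s + t * \<kappa>"
      by (simp add: radial_weight_def s_def \<kappa>_def algebra_simps)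
    moreover have "t\<^sup>2 * (?m + 32) = ?m * t\<^sup>2 + 32 * t\<^sup>2" by (simp add: algebra_simps)
    ultimately show ?thesis using l1 l3 u by linarith
  qed
  then have "exp (2 * ln (1 + s)) \<le> exp (?m * ln (1 + s) + ln (1 - u) + (t * radial_weight a r x + t\<^sup>2 * (?m + 32)))" by simp
  moreover have "exp (real n * ln (1 + s)) = (1 + s) ^ n" for n
    using s by (simp add: exp_of_nat_mult)
  from this[of 2] this[of ?m] have "exp (2 * ln (1 + s)) = (1 + s)\<^sup>2" "exp (?m * ln (1 + s)) = (1 + s) ^ ?m" by simp_all
  ultimately show ?thesis using u1 by (simp add: J exp_add s_def)
qed

text \<open>The weight is moved from \<open>x\<close> to its image, where the change of variables
  will evaluate it. Points move by at most \<open>t * r\<close>, so the Lipschitz bound on the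
  weight makes this cost quadratic in \<open>t\<close>, like the linearisation of the
  exponential.\<close>

lemma stretch_le_jacobian:
  fixes a :: "'a::euclidean_space"
  assumes r: "0 < r"
  obtains \<delta> C where "0 < \<delta>" "\<delta> \<le> 1 / 16"
    "\<forall>t x. 0 < t \<longrightarrow> t < \<delta> \<longrightarrow>
      (1 + t * bump a r x)\<^sup>2 \<le> radial_jacobian a r t x * (1 + t * radial_weight a r (radial_map a r t x) + C * t\<^sup>2)"
proof -
  let ?m = "real DIM('a)"
  obtain K where K: "\<And>x y. \<bar>radial_weight a r x - radial_weight a r y\<bar> \<le> K * norm (x - y)"
    using radial_weight_lipschitz[OF r] by blast
  \<comment> \<open>The exponent \<open>z\<close> below satisfies
    \<open>\<bar>z\<bar> \<le> t * N\<close>; the choice of \<open>\<delta>\<close> ensures both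
    \<open>t * N \<le> 1\<close>, as \<open>exp_le_quadratic\<close> requires, and
    \<open>t \<le> 1 / 16\<close>.\<close>
  define N where "N = (?m + 6) + (?m + 32)"
  define C where "C = (?m + 32) + N\<^sup>2 + \<bar>K\<bar> * r"
  define \<delta> where "\<delta> = 1 / (N + 16)"
  have N: "0 < N" by (simp add: N_def add_nonneg_pos)
  show thesis
  proof (rule that[of \<delta> C])
    show "0 < \<delta>" "\<delta> \<le> 1 / 16" using N by (auto simp: \<delta>_def field_simps)
    have "(1 + t * bump a r x)\<^sup>2 \<le> radial_jacobian a r t x * (1 + t * radial_weight a r (radial_map a r t x) + C * t\<^sup>2)"
      if t: "0 < t" "t < \<delta>" for t x
    proof -
    have t16: "t \<le> 1 / 16" using t \<open>\<delta> \<le> 1 / 16\<close> by linarith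
    let ?b = "radial_weight a r x"
    define z where "z = t * ?b + t\<^sup>2 * (?m + 32)"
    have "\<bar>z\<bar> \<le> t * N"
    proof -
      have "\<bar>t * ?b\<bar> \<le> t * (?m + 6)" unfolding abs_mult using abs_radial_weight_le[OF r, of a x] t by (intro mult_mono) auto
      moreover have "t\<^sup>2 * (?m + 32) \<le> t * (?m + 32)"
        using t t16 by (intro mult_right_mono) (auto simp: power2_eq_square mult_le_cancel_left1)
      moreover have "0 \<le> t\<^sup>2 * (?m + 32)" by simp
      ultimately show ?thesis unfolding z_def N_def distrib_left[of t] by linarith
    qed
    moreover have "t * N \<le> 1"
    proof -
      have "t * (N + 16) \<le> 1" using t N by (simp add: \<delta>_def pos_less_divide_eq less_imp_le)
      then show ?thesis using t by (simp add: distrib_left)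
    qed
    ultimately have z: "z \<le> 1" "z\<^sup>2 \<le> (t * N)\<^sup>2" using power_mono[of "\<bar>z\<bar>" "t * N" 2] by auto
    have d: "norm (x - radial_map a r t x) \<le> t * r"
    proof (cases "x \<in> ball a r")
      case True
      then have "norm (x - a) \<le> r" by (simp add: dist_norm norm_minus_commute)
      then have "bump a r x * norm (x - a) \<le> 1 * r" using bump_le_1[of a r x] r by (intro mult_mono) auto
      then show ?thesis using t by (simp add: radial_map_def)
    next
      case False
      then show ?thesis using bump_eq_0[OF r False] t r by (simp add: radial_map_def)
    qed
    have "?b \<le> radial_weight a r (radial_map a r t x) + \<bar>K\<bar> * (t * r)"
    proof -
      have "?b - radial_weight a r (radial_map a r t x) \<le> K * norm (x - radial_map a r t x)"
        using K[of x "radial_map a r t x"] by linarith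
      also have "\<dots> \<le> \<bar>K\<bar> * (t * r)" using d by (intro mult_mono) auto
      finally show ?thesis by simp
    qed
    then have "t * ?b \<le> t * (radial_weight a r (radial_map a r t x) + \<bar>K\<bar> * (t * r))"
      using t by (intro mult_left_mono) auto
    then have "1 + z + z\<^sup>2 \<le> 1 + t * radial_weight a r (radial_map a r t x) + C * t\<^sup>2"
      using z(2) unfolding z_def C_def by (simp add: power2_eq_square algebra_simps)
    then have "exp z \<le> 1 + t * radial_weight a r (radial_map a r t x) + C * t\<^sup>2"
      using exp_le_quadratic[OF z(1)] by linarith
    then have "radial_jacobian a r t x * exp z
      \<le> radial_jacobian a r t x * (1 + t * radial_weight a r (radial_map a r t x) + C * t\<^sup>2)"
      using radial_jacobian_lower[OF r _ t16, of a x] t by (intro mult_left_mono) auto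
    then show ?thesis
      using stretch_le_jacobian_exp[OF r _ t16, of a x] t unfolding z_def by simp
    qed
    then show "\<forall>t x. 0 < t \<longrightarrow> t < \<delta> \<longrightarrow>
      (1 + t * bump a r x)\<^sup>2 \<le> radial_jacobian a r t x * (1 + t * radial_weight a r (radial_map a r t x) + C * t\<^sup>2)" by blast
  qed
qed


text \<open>An image point outside the ball is fixed by the map, so by injectivity it equals
  \<open>x\<close>.\<close>

lemma radial_map_mem:
  fixes a :: "'a::euclidean_space"
  assumes r: "0 < r" and t: "0 \<le> t" "t \<le> 1 / 16" and sub: "cball a r \<subseteq> U" and x: "x \<in> U"
  shows "radial_map a r t x \<in> U"
proof (cases "radial_map a r t x \<in> ball a r")
  case True
  then show ?thesis using sub ball_subset_cball by blast
next
  case False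
  then have "radial_map a r t (radial_map a r t x) = radial_map a r t x"
    by (subst radial_map_def) (simp add: bump_eq_0[OF r])
  then have "radial_map a r t x = x" using inj_radial_map[OF r t, of a] by (simp add: inj_eq)
  then show ?thesis using x by simp
qed

context sobolev_map
begin

lemma AE_norm_D_radial_map_le:
  assumes r: "0 < r" and t: "0 \<le> t" "t \<le> 1 / 16" and sub: "cball a r \<subseteq> U"
  shows "AE x in lborel. indicator U x * (norm_D (\<lambda>x. f (radial_map a r t x)) x)\<^sup>2
    \<le> (1 + t * bump a r x)\<^sup>2 * dens (radial_map a r t x)"
  using AE_radial_map[OF r t AE_differential, of a]
proof eventually_elim
  case (elim x)
  let ?\<Phi> = "radial_map a r t"
  show ?case
  proof (cases "x \<in> U")
    case True
    then have \<Phi>: "?\<Phi> x \<in> U" by (rule radial_map_mem[OF r t sub])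
    then obtain xs where xs: "has_ap_differential f (?\<Phi> x) (mset xs)" "\<forall>\<^sub>F y in ap_at (?\<Phi> x). size (f y) = size (f (?\<Phi> x))"
      using elim by blast
    let ?A = "\<lambda>h. (1 + t * bump a r x) *\<^sub>R h - (t * radial_factor a r x * ((x - a) \<bullet> h)) *\<^sub>R (x - a)"
    have D: "(?\<Phi> has_derivative ?A) (at x)" by (rule has_derivative_radial_map)
    define A where "A = Blinfun ?A"
    have A: "blinfun_apply A = ?A"
      unfolding A_def by (rule bounded_linear_Blinfun_apply[OF has_derivative_bounded_linear[OF D]])
    have DA: "(?\<Phi> has_derivative blinfun_apply A) (at x)" using D unfolding A .
    note d = has_ap_differential_radial_map[OF r t xs DA]
    have HS: "(HS_norm (snd (compose_differential A p)))\<^sup>2 \<le> (1 + t * bump a r x)\<^sup>2 * (HS_norm (snd p))\<^sup>2"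
      for p :: "'h \<times> ((real ^ 'm) \<Rightarrow>\<^sub>L 'h)"
    proof -
      have "t * (radial_factor a r x * (norm (x - a))\<^sup>2) \<le> 1 / 16 * 4"
        using t radial_factor_bounds[OF r, of a x] by (intro mult_mono) auto
      moreover have "0 \<le> t * bump a r x" using t by simp
      ultimately have "t * radial_factor a r x * (norm (x - a))\<^sup>2 \<le> 2 * (1 + t * bump a r x)" by (simp add: mult.assoc)
      moreover have "0 \<le> t * radial_factor a r x" using t radial_factor_bounds(1)[OF r, of a x] by simp
      ultimately show ?thesis
        unfolding compose_differential_def snd_conv
        by (intro HS_norm_compose_le[where v = "x - a" and \<beta> = "t * radial_factor a r x"]) (simp_all add: A)
    qed
    have "(norm_D (\<lambda>x. f (?\<Phi> x)) x)\<^sup>2 = (\<Sum>p\<leftarrow>xs. (HS_norm (snd (compose_differential A p)))\<^sup>2)"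
      using norm_D_squared[OF d] by (simp add: o_def)
    also have "\<dots> \<le> (\<Sum>p\<leftarrow>xs. (1 + t * bump a r x)\<^sup>2 * (HS_norm (snd p))\<^sup>2)"
      by (rule sum_list_mono) (rule HS)
    also have "\<dots> = (1 + t * bump a r x)\<^sup>2 * (norm_D f (?\<Phi> x))\<^sup>2"
      unfolding norm_D_squared[OF xs] by (simp add: sum_list_const_mult)
    finally show ?thesis using True \<Phi> by (simp add: dens_def)
  qed simp
qed

text \<open>For small \<open>t > 0\<close> the change of variables bounds the varied energy by
  \<open>M + t * B + C * t\<^sup>2 * M\<close>. Its derivative at 0 is 0, so \<open>B\<close> cannot
  be negative. The Borel version \<open>D\<close> of the density keeps compositions with the radial
  map measurable.\<close>

theorem squeeze_inequality:
  assumes squeeze: "squeeze_stationary U f" and r: "0 < r" and sub: "cball a r \<subseteq> U"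
  shows "0 \<le> (LINT x|lebesgue. dens x * radial_weight a r x)"
proof -
  let ?\<Phi> = "radial_map a r" and ?b = "radial_weight a r" and ?J = "radial_jacobian a r"
  let ?F = "\<lambda>t x. f (?\<Phi> t x)"
  have dens: "integrable lebesgue dens" by (rule dens_integrable[OF squeeze])
  have crit: "critical_family U ?F"
    using squeeze radial_field_test_function[OF r sub] unfolding squeeze_stationary_def radial_map_def by blast
  obtain D where D[measurable]: "D \<in> borel_measurable borel" and AE_D: "AE x in lborel. dens x = D x"
    using completion_ex_borel_measurable_real[OF borel_measurable_integrable[OF dens]] by auto
  have AE_D': "AE x in lebesgue. dens x = D x" using AE_D by (simp add: AE_lborel_iff_lebesgue)
  have Dl: "D \<in> borel_measurable lebesgue" by (rule measurable_completion) simp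
  have iD: "integrable lborel D"
  proof -
    have "integrable lebesgue D"
      using dens AE_D' integrable_cong_AE[OF borel_measurable_integrable[OF dens] Dl] by blast
    then show ?thesis by (subst (asm) integrable_completion) auto
  qed
  have LD: "(LINT x|lebesgue. dens x * k x) = (LINT x|lborel. D x * k x)" if [measurable]: "k \<in> borel_measurable borel" for k
  proof -
    have k: "k \<in> borel_measurable lebesgue" by (rule measurable_completion) simp
    have "(LINT x|lebesgue. dens x * k x) = (LINT x|lebesgue. D x * k x)"
    proof (rule integral_cong_AE)
      show "AE x in lebesgue. dens x * k x = D x * k x" using AE_D' by eventually_elim simp
    qed (use k Dl borel_measurable_integrable[OF dens] in \<open>auto intro!: borel_measurable_times\<close>)
    then show ?thesis by (simp add: integral_completion)
  qed
  obtain \<delta> C where \<delta>: "0 < \<delta>" "\<delta> \<le> 1 / 16" and C: "\<forall>t x. 0 < t \<longrightarrow> t < \<delta> \<longrightarrow>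
      (1 + t * bump a r x)\<^sup>2 \<le> ?J t x * (1 + t * ?b (?\<Phi> t x) + C * t\<^sup>2)"
    using stretch_le_jacobian[OF r, of a] .
  have iDb: "integrable lborel (\<lambda>x. D x * ?b x)"
    using abs_radial_weight_le[OF r, of a] by (intro integrable_bounded_mult[OF iD]) auto
  define B where "B = (LINT x|lborel. D x * ?b x)"
  define M where "M = (LINT x|lborel. D x)"
  have E: "energy U (?F t) \<le> M + t * B + C * t\<^sup>2 * M"
    if t: "0 < t" "t < \<delta>" and i: "set_integrable lebesgue U (\<lambda>x. (norm_D (?F t) x)\<^sup>2)" for t
  proof -
    have t': "0 \<le> t" "t \<le> 1 / 16" using t \<delta> by auto
    define Dt where "Dt y = D y + t * (D y * ?b y) + C * t\<^sup>2 * D y" for y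
    have iDt: "integrable lborel Dt" using iD iDb unfolding Dt_def by simp
    note w = integral_radial_map[OF r t' iDt, of a]
    have wl: "integrable lebesgue (\<lambda>x. ?J t x * Dt (?\<Phi> t x))"
      using w(1) by (subst integrable_completion) auto
    have "energy U (?F t) \<le> (LINT x|lebesgue. ?J t x * Dt (?\<Phi> t x))"
      unfolding energy_def set_lebesgue_integral_def
    proof (rule integral_mono_AE[OF _ wl])
      show "integrable lebesgue (\<lambda>x. indicator U x *\<^sub>R (norm_D (?F t) x)\<^sup>2)" using i unfolding set_integrable_def .
      show "AE x in lebesgue. indicator U x *\<^sub>R (norm_D (?F t) x)\<^sup>2 \<le> ?J t x * Dt (?\<Phi> t x)"
        unfolding AE_lborel_iff_lebesgue
        using AE_norm_D_radial_map_le[OF r t' sub] AE_radial_map[OF r t' AE_D, of a]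
      proof eventually_elim
        case (elim x)
        have "indicator U x *\<^sub>R (norm_D (?F t) x)\<^sup>2 \<le> (1 + t * bump a r x)\<^sup>2 * dens (?\<Phi> t x)" using elim(1) by simp
        also have "\<dots> \<le> (?J t x * (1 + t * ?b (?\<Phi> t x) + C * t\<^sup>2)) * dens (?\<Phi> t x)"
          using C t by (intro mult_right_mono) auto
        also have "\<dots> = ?J t x * Dt (?\<Phi> t x)" unfolding elim(2) Dt_def by (simp add: algebra_simps)
        finally show ?case .
      qed
    qed
    also have "\<dots> = (LINT x|lborel. Dt x)" using w by (subst integral_completion) auto
    also have "\<dots> = M + t * B + C * t\<^sup>2 * M" using iD iDb unfolding Dt_def M_def B_def by simp
    finally show ?thesis .
  qed
  have E0: "energy U (?F 0) = M"
  proof -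
    have "energy U (?F 0) = (LINT x|lebesgue. dens x * 1)"
      by (simp add: energy_def set_lebesgue_integral_def dens_def radial_map_def)
    then show ?thesis using LD[of "\<lambda>_. 1"] by (simp add: M_def)
  qed
  have "((\<lambda>t. (energy U (?F t) - energy U (?F 0)) / (t - 0)) \<longlongrightarrow> 0) (at 0)"
    using crit unfolding critical_family_def has_field_derivative_iff by blast
  then have lim: "((\<lambda>t. (energy U (?F t) - M) / t) \<longlongrightarrow> 0) (at_right 0)"
    unfolding E0 by (simp add: filterlim_at_split)
  have "((\<lambda>t. B + C * t * M) \<longlongrightarrow> B + C * 0 * M) (at_right 0)" by (intro tendsto_intros)
  moreover have "\<forall>\<^sub>F t in at_right 0. (energy U (?F t) - M) / t \<le> B + C * t * M"
  proof -
    have "\<forall>\<^sub>F t in nhds 0. set_integrable lebesgue U (\<lambda>x. (norm_D (?F t) x)\<^sup>2)"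
      using crit by (simp add: critical_family_def)
    then have "\<forall>\<^sub>F t in at_right 0. set_integrable lebesgue U (\<lambda>x. (norm_D (?F t) x)\<^sup>2)"
      by (auto simp: eventually_at_filter elim: eventually_mono)
    moreover have "\<forall>\<^sub>F t in at_right 0. t \<in> {0<..<\<delta>}" using \<delta>(1) by (rule eventually_at_right_real)
    ultimately show ?thesis
    proof eventually_elim
      case (elim t)
      then have "energy U (?F t) - M \<le> (B + C * t * M) * t" using E[of t] by (simp add: power2_eq_square algebra_simps)
      then show ?case using elim(2) by (simp add: pos_divide_le_eq)
    qed
  qed
  ultimately have "0 \<le> B + C * 0 * M"
    by (intro tendsto_le[OF trivial_limit_at_right_real _ lim])
  then show ?thesis using LD[of ?b] by (simp add: B_def)
qed

text \<open>The derivative of the scaled energy is a nonnegative multiple of the integral in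
  \<open>squeeze_inequality\<close>: the radial part of \<open>radial_weight a x y\<close> is
  \<open>x\<close> times the radius derivative of the bump.\<close>

lemma scaled_energy_mono:
  assumes squeeze: "squeeze_stationary U f" and r: "0 < r" "r \<le> s" and sub: "cball a s \<subseteq> U"
  shows "r\<^sup>2 / r ^ CARD('m) * smoothed_energy a r \<le> s\<^sup>2 / s ^ CARD('m) * smoothed_energy a s"
proof (rule DERIV_nonneg_imp_nondecreasing[OF r(2)])
  fix x assume x: "r \<le> x" "x \<le> s"
  then have x0: "0 < x" using r by simp
  let ?m = "CARD('m)"
  define e' where "e' = (LINT y|lebesgue. dens y * (flat' 0 (height a x y) * (2 * (norm (y - a))\<^sup>2 / x ^ 3)))"
  have dens: "integrable lebesgue dens" by (rule dens_integrable[OF squeeze])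
  have De: "(smoothed_energy a has_real_derivative e') (at x)"
    unfolding smoothed_energy_def bump_def e'_def
    by (rule DERIV_integral_flat_height[OF dens _ _ x0]) auto
  have d1: "((\<lambda>r. r\<^sup>2 / r ^ ?m * smoothed_energy a r) has_real_derivative
    (real 2 - real ?m) * (x\<^sup>2 / x ^ ?m / x) * smoothed_energy a x + e' * (x\<^sup>2 / x ^ ?m)) (at x)"
    by (rule DERIV_mult[OF DERIV_power_quotient[OF x0] De])
  have d2: "(real 2 - real ?m) * (x\<^sup>2 / x ^ ?m / x) * smoothed_energy a x + e' * (x\<^sup>2 / x ^ ?m)
    = (x\<^sup>2 / x ^ ?m / x) * ((2 - real ?m) * smoothed_energy a x + x * e')"
    using x0 by (simp add: field_simps)
  have d3: "(2 - real ?m) * smoothed_energy a x + x * e' = (LINT y|lebesgue. dens y * radial_weight a x y)"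
  proof -
    have "integrable lebesgue (\<lambda>y. dens y * (flat' 0 (height a x y) * (2 * (norm (y - a))\<^sup>2 / x ^ 3)))"
    proof (rule integrable_bounded_mult[OF dens _ abs_flat'_height_radius_le[of "x / 2"]])
      show "(\<lambda>y. flat' 0 (height a x y) * (2 * (norm (y - a))\<^sup>2 / x ^ 3)) \<in> borel_measurable lebesgue"
        by (rule measurable_completion) measurable
    qed (use x0 in auto)
    then have "(LINT y|lebesgue. (2 - real ?m) * (dens y * bump a x y)
        + x * (dens y * (flat' 0 (height a x y) * (2 * (norm (y - a))\<^sup>2 / x ^ 3))))
      = (2 - real ?m) * smoothed_energy a x + x * e'"
      unfolding e'_def smoothed_energy_def using integrable_dens_bump[OF dens, of a x]
      by (simp only: Bochner_Integration.integral_add integrable_mult_right integral_mult_right_zero)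
    moreover have "(2 - real ?m) * (dens y * bump a x y) + x * (dens y * (flat' 0 (height a x y) * (2 * (norm (y - a))\<^sup>2 / x ^ 3)))
      = dens y * radial_weight a x y" for y
      using x0 by (simp add: radial_weight_def radial_factor_def flat'_def field_simps power2_eq_square power3_eq_cube numeral_2_eq_2)
    ultimately show ?thesis by simp
  qed
  have "0 \<le> (LINT y|lebesgue. dens y * radial_weight a x y)"
    using x sub by (intro squeeze_inequality[OF squeeze x0]) auto
  moreover have "0 \<le> x\<^sup>2 / x ^ ?m / x" using x0 by simp
  ultimately have "0 \<le> (real 2 - real ?m) * (x\<^sup>2 / x ^ ?m / x) * smoothed_energy a x + e' * (x\<^sup>2 / x ^ ?m)"
    unfolding d2 d3 by (intro mult_nonneg_nonneg)
  with d1 show "\<exists>y. ((\<lambda>r. r\<^sup>2 / r ^ ?m * smoothed_energy a r) has_real_derivative y) (at x) \<and> 0 \<le> y" by blast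
qed

end

section \<open>Vanishing mean oscillation\<close>

lemma bump_center_lipschitz:
  fixes a b x :: "'a::euclidean_space"
  assumes r: "0 < r"
  shows "\<bar>bump a r x - bump b r x\<bar> \<le> 4 / r * norm (a - b)"
proof -
  have "norm (bump a r x - bump a r (x - (b - a))) \<le> 4 / r * norm (x - (x - (b - a)))"
  proof (rule lipschitz_of_bounded_derivative)
    show "(bump a r has_derivative (\<lambda>v. grad_bump a r x \<bullet> v)) (at x)" for x by (rule has_derivative_bump)
    show "norm (grad_bump a r x \<bullet> h) \<le> 4 / r * norm h" for x h
    proof -
      have "norm (grad_bump a r x \<bullet> h) \<le> norm (grad_bump a r x) * norm h" by (simp add: Cauchy_Schwarz_ineq2)
      also have "\<dots> \<le> 4 / r * norm h" using norm_grad_bump_le[OF r, of a x] by (intro mult_right_mono) auto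
      finally show ?thesis .
    qed
  qed
  then show ?thesis by (simp add: bump_translate norm_minus_commute)
qed

text \<open>Continuity spreads smallness at one radius \<open>s\<close> to an open set of centres,
  and monotonicity carries it to all smaller radii; finitely many such open sets cover
  \<open>K\<close>.\<close>

lemma compact_uniform_smallness:
  fixes I :: "'a::topological_space \<Rightarrow> real \<Rightarrow> real"
  assumes K: "compact K" and R: "0 < R" and \<epsilon>: "0 < \<epsilon>"
    and cont: "\<And>r. 0 < r \<Longrightarrow> continuous_on UNIV (\<lambda>a. I a r)"
    and mono: "\<And>a r s. a \<in> K \<Longrightarrow> 0 < r \<Longrightarrow> r \<le> s \<Longrightarrow> s < R \<Longrightarrow> I a r \<le> I a s"
    and lim: "\<And>a. a \<in> K \<Longrightarrow> (I a \<longlongrightarrow> 0) (at_right 0)"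
  shows "\<exists>\<delta>>0. \<forall>a\<in>K. \<forall>r. 0 < r \<longrightarrow> r < \<delta> \<longrightarrow> I a r < \<epsilon>"
proof -
  define V where "V s = {a. I a s < \<epsilon>}" for s
  have "open (V s)" if "s \<in> {0<..<R}" for s
    unfolding V_def using cont[of s] that by (intro open_Collect_less) auto
  moreover have "K \<subseteq> (\<Union>s\<in>{0<..<R}. V s)"
  proof
    fix a assume a: "a \<in> K"
    have "\<forall>\<^sub>F s in at_right 0. I a s < \<epsilon>" using lim[OF a] \<epsilon> by (rule order_tendstoD)
    moreover have "\<forall>\<^sub>F s in at_right 0. s \<in> {0<..<R}" using R by (rule eventually_at_right_real)
    ultimately have "\<forall>\<^sub>F s in at_right 0. I a s < \<epsilon> \<and> s \<in> {0<..<R}" by (rule eventually_conj)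
    then obtain s where "I a s < \<epsilon>" "s \<in> {0<..<R}"
      using eventually_happens'[OF trivial_limit_at_right_real] by blast
    then show "a \<in> (\<Union>s\<in>{0<..<R}. V s)" by (auto simp: V_def)
  qed
  ultimately obtain S where S: "S \<subseteq> {0<..<R}" "finite S" "K \<subseteq> (\<Union>s\<in>S. V s)"
    by (rule compactE_image[OF K])
  define \<delta> where "\<delta> = Min (insert R S)"
  have \<delta>: "0 < \<delta>" unfolding \<delta>_def using S R by (subst Min_gr_iff) auto
  have "I a r < \<epsilon>" if a: "a \<in> K" and r: "0 < r" "r < \<delta>" for a r
  proof -
    obtain s where s: "s \<in> S" "a \<in> V s" using S(3) a by blast
    have "\<delta> \<le> s" unfolding \<delta>_def using S s by (intro Min_le) auto
    then have "I a r \<le> I a s" using s S(1) r by (intro mono[OF a]) auto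
    then show ?thesis using s by (simp add: V_def)
  qed
  with \<delta> show ?thesis by blast
qed

context sobolev_map
begin

lemma smoothed_energy_le: "integrable lebesgue dens \<Longrightarrow> smoothed_energy a r \<le> (LINT x|lebesgue. dens x)"
  unfolding smoothed_energy_def
  by (intro integral_mono integrable_dens_bump) (simp_all add: mult_left_le bump_le_1)

lemma smoothed_energy_continuous:
  assumes dens: "integrable lebesgue dens" and r: "0 < r"
  shows "continuous_on UNIV (\<lambda>a. smoothed_energy a r)"
proof -
  define M where "M = (LINT x|lebesgue. dens x)"
  have M: "0 \<le> M" unfolding M_def by (intro integral_nonneg_AE AE_I2) simp
  have "\<bar>smoothed_energy a r - smoothed_energy b r\<bar> \<le> 4 / r * M * norm (a - b)" for a b
  proof -
    have "smoothed_energy a r - smoothed_energy b r = (LINT x|lebesgue. dens x * (bump a r x - bump b r x))"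
      unfolding smoothed_energy_def right_diff_distrib
      by (rule Bochner_Integration.integral_diff[symmetric]) (intro integrable_dens_bump dens)+
    also have "\<bar>\<dots>\<bar> \<le> (LINT x|lebesgue. \<bar>dens x * (bump a r x - bump b r x)\<bar>)" by (rule integral_abs_bound)
    also have "\<dots> \<le> (LINT x|lebesgue. dens x * (4 / r * norm (a - b)))"
    proof (rule integral_mono)
      show "integrable lebesgue (\<lambda>x. \<bar>dens x * (bump a r x - bump b r x)\<bar>)"
        unfolding right_diff_distrib by (intro integrable_abs Bochner_Integration.integrable_diff integrable_dens_bump dens)
      show "\<bar>dens x * (bump a r x - bump b r x)\<bar> \<le> dens x * (4 / r * norm (a - b))" for x
        unfolding abs_mult abs_of_nonneg[OF dens_nonneg] by (rule mult_left_mono[OF bump_center_lipschitz[OF r]]) simp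
    qed (use dens in simp)
    also have "\<dots> = 4 / r * M * norm (a - b)" unfolding M_def by simp
    finally show ?thesis .
  qed
  then have "(4 / r * M)-lipschitz_on UNIV (\<lambda>a. smoothed_energy a r)"
    using M r by (intro lipschitz_onI) (auto simp: dist_real_def dist_norm)
  then show ?thesis by (rule lipschitz_on_continuous_on)
qed

text \<open>\<open>ball a r\<close> is the half-radius ball of the bump of radius
  \<open>2 * r\<close>. That bump may leave \<open>U\<close>, where \<open>dens\<close>
  vanishes.\<close>

lemma energy_ball_le:
  assumes dens: "integrable lebesgue dens" and r: "0 < r" and sub: "ball a r \<subseteq> U"
  shows "energy (ball a r) f \<le> smoothed_energy a (2 * r) / flat 0 (3 / 4)"
proof -
  have c: "0 < flat 0 (3 / 4)" by (simp add: flat_pos)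
  have "energy (ball a r) f = (LINT x|lebesgue. dens x * indicator (ball a r) x)"
    unfolding energy_def set_lebesgue_integral_def using sub
    by (intro Bochner_Integration.integral_cong refl) (auto simp: dens_def indicator_def)
  also have "\<dots> \<le> (LINT x|lebesgue. dens x * bump a (2 * r) x / flat 0 (3 / 4))"
  proof (rule integral_mono)
    show "integrable lebesgue (\<lambda>x. dens x * indicator (ball a r) x)"
    proof (rule integrable_bounded_mult[OF dens, where C = 1])
      show "indicator (ball a r) \<in> borel_measurable lebesgue" by (intro borel_measurable_indicator) simp
    qed (simp add: indicator_def)
    show "integrable lebesgue (\<lambda>x. dens x * bump a (2 * r) x / flat 0 (3 / 4))"
      using integrable_dens_bump[OF dens] by simp
    show "dens x * indicator (ball a r) x \<le> dens x * bump a (2 * r) x / flat 0 (3 / 4)" for x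
    proof -
      have "indicator (ball a r) x \<le> bump a (2 * r) x / flat 0 (3 / 4)"
        using bump_lower[of "2 * r" a x] r c by (simp add: pos_le_divide_eq mult.commute)
      then have "dens x * indicator (ball a r) x \<le> dens x * (bump a (2 * r) x / flat 0 (3 / 4))"
        by (intro mult_left_mono) auto
      then show ?thesis by simp
    qed
  qed
  finally show ?thesis by (simp add: smoothed_energy_def)
qed

theorem energy_density_vanishes:
  assumes squeeze: "squeeze_stationary U f" and squash: "squash_stationary U f" and a: "a \<in> U"
  shows "((\<lambda>r. 1 / r powi (int CARD('m) - 2) * energy (ball a r) f) \<longlongrightarrow> 0) (at_right 0)"
proof -
  let ?m = "CARD('m)" and ?c = "flat 0 (3 / 4)"
  have dens: "integrable lebesgue dens" by (rule dens_integrable[OF squeeze])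
  obtain R where R: "0 < R" "cball a R \<subseteq> U" using U a open_contains_cball by blast
  have "filterlim (\<lambda>r. 2 * r) (at_right 0) (at_right (0::real))"
    by (auto simp: filterlim_at eventually_at_filter intro!: tendsto_eq_intros)
  from filterlim_compose[OF smoothed_energy_decay[OF dens squash R] this]
  have "((\<lambda>r. (2 * r)\<^sup>2 / (2 * r) ^ ?m * smoothed_energy a (2 * r)) \<longlongrightarrow> 0) (at_right 0)" .
  from tendsto_mult_left[OF this, of "2 ^ ?m / 4 / ?c"]
  have lim: "((\<lambda>r. 2 ^ ?m / 4 / ?c * ((2 * r)\<^sup>2 / (2 * r) ^ ?m * smoothed_energy a (2 * r))) \<longlongrightarrow> 0) (at_right 0)" by simp
  have ev: "\<forall>\<^sub>F r in at_right 0. r \<in> {0<..<R}" using R(1) by (rule eventually_at_right_real)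
  \<comment> \<open>The exponent is negative when \<open>?m = 1\<close>; the quotient on the right
    covers all dimensions.\<close>
  have scale: "1 / r powi (int ?m - 2) = r\<^sup>2 / r ^ ?m" if "0 < r" for r :: real
    using that by (simp add: power_int_diff)
  show ?thesis
  proof (rule tendsto_sandwich[OF _ _ tendsto_const lim])
    show "\<forall>\<^sub>F r in at_right 0. 0 \<le> 1 / r powi (int ?m - 2) * energy (ball a r) f"
      using ev
    proof eventually_elim
      case (elim r)
      have "0 \<le> energy (ball a r) f"
        unfolding energy_def set_lebesgue_integral_def by (intro integral_nonneg_AE AE_I2) simp
      then show ?case using elim by simp
    qed
    show "\<forall>\<^sub>F r in at_right 0. 1 / r powi (int ?m - 2) * energy (ball a r) f
      \<le> 2 ^ ?m / 4 / ?c * ((2 * r)\<^sup>2 / (2 * r) ^ ?m * smoothed_energy a (2 * r))"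
      using ev
    proof eventually_elim
      case (elim r)
      then have "ball a r \<subseteq> U" using R(2) by auto
      then have "r\<^sup>2 / r ^ ?m * energy (ball a r) f \<le> r\<^sup>2 / r ^ ?m * (smoothed_energy a (2 * r) / ?c)"
        using elim energy_ball_le[OF dens, of r a] by (intro mult_left_mono) auto
      also have "\<dots> = 2 ^ ?m / 4 / ?c * ((2 * r)\<^sup>2 / (2 * r) ^ ?m * smoothed_energy a (2 * r))"
        using elim by (simp add: power_mult_distrib)
      finally show ?case using elim by (simp add: scale)
    qed
  qed
qed

text \<open>\<open>\<omega>\<close> is the bound from the mean inequality with the smoothed energy
  replaced by its supremum over the centres. That supremum is finite by the total energy even when
  the bumps leave \<open>U\<close>; uniform decay matters only for small radii.\<close>

theorem vanishing_mean_oscillation: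
  assumes squeeze: "squeeze_stationary U f" and squash: "squash_stationary U f" and UB: "U = ball 0 1"
  shows "\<exists>\<omega> :: real \<Rightarrow> real. (\<forall>r\<in>{0..1/2}. 0 \<le> \<omega> r) \<and> (\<omega> \<longlongrightarrow> 0) (at 0 within {0..1/2}) \<and>
    (\<forall>a\<in>ball 0 (1/2). \<forall>r\<in>{0<..1/2}. \<forall>P. is_mean C Q f a r P \<longrightarrow>
       1 / measure lebesgue (ball a r) * (LINT x:ball a r|lebesgue. (Gdist (f x) P)\<^sup>2) \<le> \<omega> r)"
proof -
  let ?m = "CARD('m)" and ?c = "flat 0 (3 / 4)" and ?e = smoothed_energy and ?\<alpha> = "unit_ball_vol CARD('m)"
  let ?B = "ball 0 (1/2) :: (real ^ 'm) set"
  have dens: "integrable lebesgue dens" by (rule dens_integrable[OF squeeze])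
  have c: "0 < ?c" by (simp add: flat_pos)
  have \<alpha>: "0 < ?\<alpha>" by simp
  define S where "S r = (SUP a\<in>?B. ?e a (2 * r))" for r
  have bdd: "bdd_above ((\<lambda>a. ?e a s) ` ?B)" for s
    using smoothed_energy_le[OF dens] by (intro bdd_aboveI2)
  have eS: "?e a (2 * r) \<le> S r" if "a \<in> ?B" for a r
    unfolding S_def by (rule cSUP_upper[OF that bdd])
  have S0: "0 \<le> S r" for r
    using eS[of 0 r] smoothed_energy_nonneg[of 0 "2 * r"] by simp
  \<comment> \<open>\<open>?\<alpha>\<close> comes from the volume of the ball and \<open>?c\<close>
    from \<open>energy_ball_le\<close>; the absolute value makes \<open>\<omega>\<close> nonnegative
    whatever the sign of \<open>C\<close>.\<close>
  define k where "k = \<bar>C\<bar> / (?\<alpha> * ?c)"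
  have k: "0 \<le> k" using c \<alpha> by (simp add: k_def)
  define \<omega> where "\<omega> r = k * (r\<^sup>2 / r ^ ?m * S r)" for r
  have small: "\<exists>\<delta>>0. \<forall>r. 0 < r \<longrightarrow> r < \<delta> \<longrightarrow> r\<^sup>2 / r ^ ?m * S r \<le> \<epsilon>" if \<epsilon>: "0 < \<epsilon>" for \<epsilon>
  proof -
    define I where "I a r = r\<^sup>2 / r ^ ?m * ?e a r" for a r
    have sub: "cball a s \<subseteq> U" if "a \<in> cball 0 (1/2)" "s < 1/2" for a s
    proof
      fix x assume "x \<in> cball a s"
      then show "x \<in> U" using that dist_triangle[of 0 x a] unfolding UB by simp
    qed
    \<comment> \<open>\<open>4 / 2 ^ ?m\<close> is the ratio of the prefactors
      \<open>r\<^sup>2 / r ^ ?m\<close> at the radii \<open>2 * r\<close> and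
      \<open>r\<close>.\<close>
    have "0 < 4 * \<epsilon> / 2 ^ ?m" using \<epsilon> by simp
    have "\<exists>\<delta>>0. \<forall>a\<in>cball 0 (1/2). \<forall>r. 0 < r \<longrightarrow> r < \<delta> \<longrightarrow> I a r < 4 * \<epsilon> / 2 ^ ?m"
    \<comment> \<open>Closed balls with centre in the closed half ball and radius below
      \<open>1/2\<close> stay inside the open unit ball.\<close>
    proof (rule compact_uniform_smallness[where R = "1/2"])
      show "continuous_on UNIV (\<lambda>a. I a r)" if "0 < r" for r
        unfolding I_def by (intro continuous_intros smoothed_energy_continuous[OF dens that])
      show "I a r \<le> I a s" if "a \<in> cball 0 (1/2)" "0 < r" "r \<le> s" "s < 1/2" for a r s
        unfolding I_def by (rule scaled_energy_mono[OF squeeze that(2,3) sub[OF that(1,4)]])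
      show "(I a \<longlongrightarrow> 0) (at_right 0)" if "a \<in> cball 0 (1/2)" for a
        unfolding I_def by (rule smoothed_energy_decay[OF dens squash _ sub[OF that, of "1/4"]]) simp_all
    qed (use \<epsilon> in auto)
    then obtain \<delta> where \<delta>: "0 < \<delta>" "\<And>a r. a \<in> cball 0 (1/2) \<Longrightarrow> 0 < r \<Longrightarrow> r < \<delta> \<Longrightarrow> I a r < 4 * \<epsilon> / 2 ^ ?m" by blast
    have "r\<^sup>2 / r ^ ?m * S r \<le> \<epsilon>" if r: "0 < r" "r < \<delta> / 2" for r
    proof -
      have "S r \<le> \<epsilon> * (r ^ ?m / r\<^sup>2)"
        unfolding S_def
      proof (rule cSUP_least)
        fix a :: "real ^ 'm" assume "a \<in> ?B"
        then have "I a (2 * r) < 4 * \<epsilon> / 2 ^ ?m" using \<delta>(2)[of a "2 * r"] r by simp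
        then have "r\<^sup>2 / r ^ ?m * ?e a (2 * r) \<le> \<epsilon>"
          unfolding I_def by (simp add: power_mult_distrib field_simps)
        then show "?e a (2 * r) \<le> \<epsilon> * (r ^ ?m / r\<^sup>2)" using r by (simp add: field_simps)
      qed simp
      then show ?thesis using r by (simp add: field_simps)
    qed
    then show ?thesis using \<delta>(1) by (intro exI[of _ "\<delta> / 2"]) auto
  qed
  have "(\<omega> \<longlongrightarrow> 0) (at 0 within {0..1/2})"
    unfolding tendsto_iff
  proof (intro allI impI)
    fix \<epsilon> :: real assume \<epsilon>: "0 < \<epsilon>"
    have k1: "0 < k + 1" using k by simp
    obtain \<delta> where \<delta>: "0 < \<delta>" "\<And>r. 0 < r \<Longrightarrow> r < \<delta> \<Longrightarrow> r\<^sup>2 / r ^ ?m * S r \<le> \<epsilon> / (k + 1)"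
      using small[of "\<epsilon> / (k + 1)"] \<epsilon> k1 by auto
    have "dist (\<omega> r) 0 < \<epsilon>" if r: "0 < r" "r < \<delta>" for r
    proof -
      have "0 \<le> \<omega> r" unfolding \<omega>_def using k S0[of r] r by (intro mult_nonneg_nonneg) auto
      moreover have "\<omega> r \<le> k * (\<epsilon> / (k + 1))" unfolding \<omega>_def using \<delta>(2)[OF r] k by (rule mult_left_mono)
      moreover have "k * (\<epsilon> / (k + 1)) < \<epsilon>" using \<epsilon> k1 by (simp add: pos_divide_less_eq algebra_simps)
      ultimately show ?thesis by (simp add: dist_real_def)
    qed
    then show "\<forall>\<^sub>F r in at 0 within {0..1/2}. dist (\<omega> r) 0 < \<epsilon>"
      unfolding eventually_at using \<delta>(1) by (intro exI[of _ \<delta>]) (auto simp: dist_real_def)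
  qed
  moreover have "1 / measure lebesgue (ball a r) * (LINT x:ball a r|lebesgue. (Gdist (f x) P)\<^sup>2) \<le> \<omega> r"
    if a: "a \<in> ?B" and r: "0 < r" "r \<le> 1/2" and P: "is_mean C Q f a r P" for a r P
  proof -
    have sub: "ball a r \<subseteq> U"
    proof
      fix x assume "x \<in> ball a r"
      then show "x \<in> U" using a r dist_triangle[of 0 x a] unfolding UB by simp
    qed
    have vol: "measure lebesgue (ball a r) = ?\<alpha> * r ^ ?m"
      using content_ball[of r a] r by simp
    have "(LINT x:ball a r|lebesgue. (Gdist (f x) P)\<^sup>2) \<le> C * r\<^sup>2 * energy (ball a r) f"
      using P by (simp add: is_mean_def)
    also have "\<dots> \<le> \<bar>C\<bar> * r\<^sup>2 * (S r / ?c)"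
    proof -
      have "0 \<le> energy (ball a r) f"
        unfolding energy_def set_lebesgue_integral_def by (intro integral_nonneg_AE AE_I2) simp
      moreover have "energy (ball a r) f \<le> S r / ?c"
        using energy_ball_le[OF dens r(1) sub] divide_right_mono[OF eS[OF a, of r], of ?c] c by simp
      ultimately show ?thesis by (intro mult_mono mult_right_mono) auto
    qed
    finally have "1 / measure lebesgue (ball a r) * (LINT x:ball a r|lebesgue. (Gdist (f x) P)\<^sup>2)
      \<le> 1 / measure lebesgue (ball a r) * (\<bar>C\<bar> * r\<^sup>2 * (S r / ?c))"
      by (rule mult_left_mono) simp
    also have "\<dots> = \<omega> r" unfolding vol \<omega>_def k_def by (simp add: mult_ac)
    finally show ?thesis .
  qed
  moreover have "0 \<le> \<omega> r" if "r \<in> {0..1/2}" for r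
    unfolding \<omega>_def using k S0[of r] that by (intro mult_nonneg_nonneg) auto
  ultimately show ?thesis by (intro exI[of _ \<omega>]) auto
qed

end

theorem proposition8p3:
  fixes f :: "real ^ 'm \<Rightarrow> 'h::{real_inner, polish_space} multiset"
    and U :: "(real ^ 'm) set"
    and Q :: nat
  assumes infinite_dimensional: "\<not> (\<exists>B :: 'h set. finite B \<and> span B = UNIV)"
    and "1 \<le> Q"
    and "open U"
    and "f \<in> W12 U Q"
    and "squeeze_stationary U f"
    and "squash_stationary U f"
  shows "(\<forall>a\<in>U. ((\<lambda>r. 1 / r powi (int CARD('m) - 2) * energy (ball a r) f) \<longlongrightarrow> 0) (at_right 0)) \<and>
    (U = ball 0 1 \<longrightarrow>
      (\<forall>C. poincare_constant TYPE(real ^ 'm \<Rightarrow> 'h multiset) Q C \<longrightarrow>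
        (\<exists>\<omega> :: real \<Rightarrow> real.
          (\<forall>r\<in>{0..1/2}. 0 \<le> \<omega> r) \<and>
          (\<omega> \<longlongrightarrow> 0) (at 0 within {0..1/2}) \<and>
          (\<forall>a\<in>ball 0 (1/2). \<forall>r\<in>{0<..1/2}. \<forall>P. is_mean C Q f a r P \<longrightarrow>
            1 / measure lebesgue (ball a r) * (LINT x:ball a r|lebesgue. (Gdist (f x) P)\<^sup>2) \<le> \<omega> r))))"
proof -
  obtain T H W G where "sobolev_map f U Q T H W G"
    using W12_sobolev_map[OF assms(3,4)] by blast
  then interpret sobolev_map f U Q T H W G .
  show ?thesis
    using energy_density_vanishes[OF assms(5,6)] vanishing_mean_oscillation[OF assms(5,6)] by blast
qed

end
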